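(* Let $g:Y\rightarrow X$ be a $\mathcal C^1$-smooth suspension over a compact Riemann surface $X$ of genus $g_X\geq 2$. Then $Y$ is projective, i.e. for some $N$ there is a $\mathcal C^1$-smooth embedding of $Y$ into the complex projective space $\mathbb P^N$ which is holomorphic along the leaves of $Y$.
   Context: Suspensions: Let $X$ be a compact Riemann surface of genus at least two, $f:\mathbb D\to X$ a universal covering map from the unit disc and $\Gamma$ the corresponding deck group. Let $\mathbb T$ be a compact smooth manifold and $\phi:\Gamma\to \mathrm{Diff}(\mathbb T)$ a homomorphism ($\mathcal C^1$-diffeomorphisms for a $\mathcal C^1$-smooth suspension). Let $\tilde\Gamma$ be the group of maps $(\varphi,\phi(\varphi))$, $\varphi\in\Gamma$, acting on $\mathbb D\times\mathbb T$ by $(\zeta,t)\mapsto(\varphi(\zeta),\phi(\varphi)(t))$, let $Y:=(\mathbb D\times\mathbb T)/\tilde\Gamma$, with quotient map $\pi:\mathbb D\times\mathbb T\to Y$, and let $g:Y\to X$ be the projection $[(\zeta,t)]\mapsto f(\zeta)$. $Y$ is a compact $\mathcal C^1$-smooth manifold laminated by Riemann surfaces, the leaves being $\pi(\mathbb D\times\{t\})$, and is called a suspension over $X$. *)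

theory Defs
  imports "HOL-Complex_Analysis.Complex_Analysis" "HOL-Homology.Homology" "HOL-Algebra.Bij"
begin

text \<open>The class \<open>euclidean_space\<close> requires a non-empty basis and so excludes dimension zero.
  The following class consists of the finite-dimensional real inner product spaces, dimension
  zero included; it is used for the model space of a manifold of arbitrary dimension.\<close>

class finite_dim_inner = real_inner +
  assumes ex_finite_spanning: "\<exists>B. finite B \<and> (\<forall>x. \<exists>a. x = (\<Sum>b\<in>B. a b *\<^sub>R b))"

subclass (in euclidean_space) finite_dim_inner
proof
  show "\<exists>B. finite B \<and> (\<forall>x. \<exists>a. x = (\<Sum>b\<in>B. a b *\<^sub>R b))"
    by (rule exI[of _ Basis]) (metis euclidean_representation finite_Basis)
qed

text \<open>For open \<open>S\<close> in a finite-dimensional space, continuity (or \<open>C\<^sup>k\<close>) of the derivative as a map into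
  the space of linear maps is the same as continuity (or \<open>C\<^sup>k\<close>) of all directional derivatives.\<close>

primrec Ck_on :: "nat \<Rightarrow> 'a::real_normed_vector set \<Rightarrow> ('a \<Rightarrow> 'b::real_normed_vector) \<Rightarrow> bool" where
  "Ck_on 0 S h \<longleftrightarrow> continuous_on S h"
| "Ck_on (Suc k) S h \<longleftrightarrow>
     (\<forall>x\<in>S. h differentiable (at x)) \<and> (\<forall>v. Ck_on k S (\<lambda>x. frechet_derivative h (at x) v))"

definition smooth_on :: "'a::real_normed_vector set \<Rightarrow> ('a \<Rightarrow> 'b::real_normed_vector) \<Rightarrow> bool" where
  "smooth_on S h \<longleftrightarrow> (\<forall>k. Ck_on k S h)"

text \<open>A chart is a pair of its domain and its coordinate map, whose values off the domain are
  irrelevant. Accordingly \<open>inv_into U c\<close> is the inverse of the chart \<open>(U, c)\<close>.\<close>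

type_synonym ('a, 'e) chart = "'a set \<times> ('a \<Rightarrow> 'e)"

definition topological_atlas :: "'a topology \<Rightarrow> ('a, 'e::topological_space) chart set \<Rightarrow> bool" where
  "topological_atlas M A \<longleftrightarrow>
     (\<Union>(U, c)\<in>A. U) = topspace M \<and>
     (\<forall>(U, c)\<in>A. openin M U \<and> open (c ` U) \<and>
        homeomorphic_map (subtopology M U) (top_of_set (c ` U)) c)"

definition smooth_manifold :: "'a topology \<Rightarrow> ('a, 'e::finite_dim_inner) chart set \<Rightarrow> bool" where
  "smooth_manifold M A \<longleftrightarrow>
     Hausdorff_space M \<and> second_countable M \<and> topological_atlas M A \<and>
     (\<forall>(U, c)\<in>A. \<forall>(V, d)\<in>A. smooth_on (c ` (U \<inter> V)) (d \<circ> inv_into U c))"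

definition riemann_surface :: "'a topology \<Rightarrow> ('a, complex) chart set \<Rightarrow> bool" where
  "riemann_surface M A \<longleftrightarrow>
     Hausdorff_space M \<and> connected_space M \<and> topological_atlas M A \<and>
     (\<forall>(U, c)\<in>A. \<forall>(V, d)\<in>A. (d \<circ> inv_into U c) holomorphic_on (c ` (U \<inter> V)))"

text \<open>The genus of a compact Riemann surface is half the rank of its first homology, which is free
  abelian.\<close>

definition has_genus :: "'a topology \<Rightarrow> nat \<Rightarrow> bool" where
  "has_genus M n \<longleftrightarrow> homology_group 1 M \<cong> free_Abelian_group {..<2 * n}"

definition Ck_map ::
  "nat \<Rightarrow> 'a topology \<Rightarrow> ('a, 'e::real_normed_vector) chart set \<Rightarrow>
   'b topology \<Rightarrow> ('b, 'f::real_normed_vector) chart set \<Rightarrow> ('a \<Rightarrow> 'b) \<Rightarrow> bool" where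
  "Ck_map k M A N B h \<longleftrightarrow>
     continuous_map M N h \<and>
     (\<forall>(U, c)\<in>A. \<forall>(V, d)\<in>B. Ck_on k (c ` (U \<inter> h -` V)) (d \<circ> h \<circ> inv_into U c))"

text \<open>The group of \<open>C\<^sup>1\<close>-diffeomorphisms. As in \<^const>\<open>BijGroup\<close>, a self-map of a set is represented
  by its extensional version, and the multiplication is composition.\<close>

definition diff1_group ::
  "'a topology \<Rightarrow> ('a, 'e::finite_dim_inner) chart set \<Rightarrow> ('a \<Rightarrow> 'a) monoid" where
  "diff1_group M A = BijGroup (topspace M)
     \<lparr>carrier := {h \<in> Bij (topspace M).
        Ck_map 1 M A M A h \<and> Ck_map 1 M A M A (inv_into (topspace M) h)}\<rparr>"

definition quotient_topology :: "'a topology \<Rightarrow> ('a \<Rightarrow> 'b) \<Rightarrow> 'b topology" where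
  "quotient_topology M q =
     topology (\<lambda>W. W \<subseteq> q ` topspace M \<and> openin M {x \<in> topspace M. q x \<in> W})"

lemma openin_quotient_topology:
  "openin (quotient_topology M q) W \<longleftrightarrow>
     W \<subseteq> q ` topspace M \<and> openin M {x \<in> topspace M. q x \<in> W}"
proof -
  have "istopology (\<lambda>W. W \<subseteq> q ` topspace M \<and> openin M {x \<in> topspace M. q x \<in> W})"
    unfolding istopology_def
  proof (intro conjI allI impI)
    fix S T
    assume S: "S \<subseteq> q ` topspace M \<and> openin M {x \<in> topspace M. q x \<in> S}"
      and T: "T \<subseteq> q ` topspace M \<and> openin M {x \<in> topspace M. q x \<in> T}"
    have "{x \<in> topspace M. q x \<in> S \<inter> T}
        = {x \<in> topspace M. q x \<in> S} \<inter> {x \<in> topspace M. q x \<in> T}" by auto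
    then show "openin M {x \<in> topspace M. q x \<in> S \<inter> T}" using S T by auto
    show "S \<inter> T \<subseteq> q ` topspace M" using S by auto
  next
    fix K
    assume K: "\<forall>S\<in>K. S \<subseteq> q ` topspace M \<and> openin M {x \<in> topspace M. q x \<in> S}"
    have "{x \<in> topspace M. q x \<in> \<Union>K} = (\<Union>S\<in>K. {x \<in> topspace M. q x \<in> S})" by auto
    then show "openin M {x \<in> topspace M. q x \<in> \<Union>K}" using K by auto
    show "\<Union>K \<subseteq> q ` topspace M" using K by auto
  qed
  then show ?thesis by (simp add: quotient_topology_def)
qed

lemma topspace_quotient_topology: "topspace (quotient_topology M q) = q ` topspace M"
proof
  show "topspace (quotient_topology M q) \<subseteq> q ` topspace M"
    by (meson openin_quotient_topology openin_topspace)
  have "{x \<in> topspace M. q x \<in> q ` topspace M} = topspace M" by auto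
  then have "openin (quotient_topology M q) (q ` topspace M)"
    by (simp add: openin_quotient_topology)
  then show "q ` topspace M \<subseteq> topspace (quotient_topology M q)" by (rule openin_subset)
qed

lemma quotient_map_quotient_topology: "quotient_map M (quotient_topology M q) q"
  by (simp add: quotient_map_def openin_quotient_topology topspace_quotient_topology)

abbreviation unit_disc :: "complex set" where
  "unit_disc \<equiv> ball 0 1"

text \<open>Since the disc is simply connected, every covering of \<open>X\<close> by the disc is universal. The charts
  of the second conjunct are those of \<open>X\<close>.\<close>

definition disc_universal_covering ::
  "'x::topological_space set \<Rightarrow> ('x, complex) chart set \<Rightarrow> (complex \<Rightarrow> 'x) \<Rightarrow> bool" where
  "disc_universal_covering X A f \<longleftrightarrow>
     covering_space unit_disc f X \<and>
     (\<forall>(U, c)\<in>A. (c \<circ> f) holomorphic_on (unit_disc \<inter> f -` U))"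

definition deck_group :: "(complex \<Rightarrow> 'x) \<Rightarrow> (complex \<Rightarrow> complex) monoid" where
  "deck_group f = BijGroup unit_disc
     \<lparr>carrier := {\<gamma> \<in> Bij unit_disc.
        homeomorphic_map (top_of_set unit_disc) (top_of_set unit_disc) \<gamma> \<and>
        (\<forall>\<zeta>\<in>unit_disc. f (\<gamma> \<zeta>) = f \<zeta>)}\<rparr>"

text \<open>The quotient map to the suspension sends a point of the product of the disc with \<open>T\<close> to its
  orbit under the maps \<open>(\<zeta>, t) \<mapsto> (\<gamma> \<zeta>, \<phi> \<gamma> t)\<close>.\<close>

definition susp_pi ::
  "(complex \<Rightarrow> 'x) \<Rightarrow> ((complex \<Rightarrow> complex) \<Rightarrow> ('t \<Rightarrow> 't)) \<Rightarrow> complex \<times> 't \<Rightarrow> (complex \<times> 't) set" where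
  "susp_pi f \<phi> p = (\<lambda>\<gamma>. (\<gamma> (fst p), \<phi> \<gamma> (snd p))) ` carrier (deck_group f)"

definition suspension ::
  "(complex \<Rightarrow> 'x) \<Rightarrow> 't topology \<Rightarrow> ((complex \<Rightarrow> complex) \<Rightarrow> ('t \<Rightarrow> 't)) \<Rightarrow>
   (complex \<times> 't) set topology" where
  "suspension f T \<phi> = quotient_topology (prod_topology (top_of_set unit_disc) T) (susp_pi f \<phi>)"

text \<open>The flow boxes of the suspension: local inverses of the quotient map on products \<open>U \<times> V\<close>,
  followed by a chart of \<open>T\<close> in the second factor. They define the \<open>C\<^sup>1\<close>-structure of the suspension,
  and its leaves are locally the sets with constant second coordinate.\<close>

definition suspension_atlas ::
  "(complex \<Rightarrow> 'x) \<Rightarrow> ('t, 'e::finite_dim_inner) chart set \<Rightarrow>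
   ((complex \<Rightarrow> complex) \<Rightarrow> ('t \<Rightarrow> 't)) \<Rightarrow> ((complex \<times> 't) set, complex \<times> 'e) chart set" where
  "suspension_atlas f A \<phi> =
     {(susp_pi f \<phi> ` (U \<times> V), \<lambda>y. map_prod id d (inv_into (U \<times> V) (susp_pi f \<phi>) y)) | U V d.
        open U \<and> U \<subseteq> unit_disc \<and> (V, d) \<in> A \<and> inj_on (susp_pi f \<phi>) (U \<times> V)}"

text \<open>Vectors of dimension \<open>N + 1\<close> are the extensional functions on \<open>{..N}\<close>; the point of projective
  space given by a nonzero vector is the set of its nonzero multiples.\<close>

definition nonzero_vectors :: "nat \<Rightarrow> (nat \<Rightarrow> complex) set" where
  "nonzero_vectors N = {z \<in> extensional {..N}. \<exists>i\<le>N. z i \<noteq> 0}"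

definition proj_class :: "nat \<Rightarrow> (nat \<Rightarrow> complex) \<Rightarrow> (nat \<Rightarrow> complex) set" where
  "proj_class N z = {(\<lambda>i\<in>{..N}. a * z i) | a. a \<noteq> 0}"

definition proj_space :: "nat \<Rightarrow> (nat \<Rightarrow> complex) set topology" where
  "proj_space N = quotient_topology
     (subtopology (product_topology (\<lambda>_. euclidean) {..N}) (nonzero_vectors N)) (proj_class N)"

text \<open>The \<open>j\<close>-th standard affine chart has the domain \<open>proj_dom N j\<close> and the coordinate functions
  \<open>proj_coord j i\<close>, that is \<open>[z] \<mapsto> z i / z j\<close>, for \<open>i \<le> N\<close>. The constant coordinate
  \<open>i = j\<close> is not removed, which makes no difference below.\<close>

definition proj_dom :: "nat \<Rightarrow> nat \<Rightarrow> (nat \<Rightarrow> complex) set set" where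
  "proj_dom N j = {L \<in> topspace (proj_space N). \<forall>z\<in>L. z j \<noteq> 0}"

definition proj_coord :: "nat \<Rightarrow> nat \<Rightarrow> (nat \<Rightarrow> complex) set \<Rightarrow> complex" where
  "proj_coord j i L = (THE w. \<forall>z\<in>L. w = z i / z j)"

text \<open>The dimension \<open>N\<close> is a number and not a type, so maps into an affine chart of projective space
  are treated through their coordinate functions. Thus an immersion is a \<open>C\<^sup>1\<close>-map such that the
  derivatives of the coordinate functions have no common nonzero vector in their kernels.\<close>

definition C1_proj_map ::
  "'y topology \<Rightarrow> ('y, 'e::real_normed_vector) chart set \<Rightarrow> nat \<Rightarrow>
   ('y \<Rightarrow> (nat \<Rightarrow> complex) set) \<Rightarrow> bool" where
  "C1_proj_map Y A N \<Psi> \<longleftrightarrow>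
     continuous_map Y (proj_space N) \<Psi> \<and>
     (\<forall>(U, c)\<in>A. \<forall>j\<le>N. \<forall>i\<le>N.
        Ck_on 1 (c ` (U \<inter> \<Psi> -` proj_dom N j)) (proj_coord j i \<circ> \<Psi> \<circ> inv_into U c))"

definition proj_immersion ::
  "'y topology \<Rightarrow> ('y, 'e::real_normed_vector) chart set \<Rightarrow> nat \<Rightarrow>
   ('y \<Rightarrow> (nat \<Rightarrow> complex) set) \<Rightarrow> bool" where
  "proj_immersion Y A N \<Psi> \<longleftrightarrow>
     C1_proj_map Y A N \<Psi> \<and>
     (\<forall>(U, c)\<in>A. \<forall>j\<le>N. \<forall>x \<in> c ` (U \<inter> \<Psi> -` proj_dom N j). \<forall>v.
        (\<forall>i\<le>N. frechet_derivative (proj_coord j i \<circ> \<Psi> \<circ> inv_into U c) (at x) v = 0) \<longrightarrow> v = 0)"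

definition C1_proj_embedding ::
  "'y topology \<Rightarrow> ('y, 'e::real_normed_vector) chart set \<Rightarrow> nat \<Rightarrow>
   ('y \<Rightarrow> (nat \<Rightarrow> complex) set) \<Rightarrow> bool" where
  "C1_proj_embedding Y A N \<Psi> \<longleftrightarrow>
     proj_immersion Y A N \<Psi> \<and> embedding_map Y (proj_space N) \<Psi>"

text \<open>Here \<open>A\<close> is an atlas of flow boxes, whose plaques are the sets with constant second
  coordinate.\<close>

definition leafwise_holomorphic ::
  "('y, complex \<times> 'e) chart set \<Rightarrow> nat \<Rightarrow> ('y \<Rightarrow> (nat \<Rightarrow> complex) set) \<Rightarrow> bool" where
  "leafwise_holomorphic A N \<Psi> \<longleftrightarrow>
     (\<forall>(U, c)\<in>A. \<forall>j\<le>N. \<forall>i\<le>N. \<forall>s.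
        (\<lambda>\<zeta>. proj_coord j i (\<Psi> (inv_into U c (\<zeta>, s))))
          holomorphic_on {\<zeta>. (\<zeta>, s) \<in> c ` (U \<inter> \<Psi> -` proj_dom N j)})"

definition projective_lamination ::
  "'y topology \<Rightarrow> ('y, complex \<times> 'e::real_normed_vector) chart set \<Rightarrow> bool" where
  "projective_lamination Y A \<longleftrightarrow>
     (\<exists>N \<Psi>. C1_proj_embedding Y A N \<Psi> \<and> leafwise_holomorphic A N \<Psi>)"

end

theory Submission
  imports Defs
begin

text \<open>A finite set of automorphic forms of a common weight without common zeros, that is, of functions
  \<open>F\<close> on the product of the disc with \<open>T\<close> with \<open>F (\<gamma> \<zeta>, \<phi> \<gamma> t) * \<gamma>' \<zeta> ^ m = F (\<zeta>, t)\<close>, defines a map of the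
  suspension into projective space. Forms holomorphic in \<open>\<zeta>\<close> and \<open>C\<^sup>1\<close> in the charts come from the Poincare
  series of \<open>h (\<gamma> \<zeta>) * \<gamma>' \<zeta> ^ m * k (\<phi> \<gamma> t)\<close>, where \<open>k\<close> is any \<open>C\<^sup>1\<close>-function on \<open>T\<close>. For large \<open>m\<close>
  the series converges in \<open>C\<^sup>1\<close> although the maps \<open>\<phi> \<gamma>\<close> are not bounded in \<open>C\<^sup>1\<close>: their
  differentials grow at most exponentially in the word length of \<open>\<gamma>\<close>, hence at most like a power of
  \<open>1 / \<bar>\<gamma>'\<bar>\<close>.

  If \<open>h\<close> is the \<open>m\<close>-th power of the kernel peaking at \<open>\<zeta>0\<close>, then as \<open>m\<close> grows only the terms with
  \<open>\<gamma> \<zeta> = \<zeta>0\<close> survive, so \<open>k\<close> prescribes the values of the form near the orbit of \<open>\<zeta>0\<close>. This separates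
  pairs of points and gives immersions locally. Powers of forms bring these to a common
  weight, and compactness leaves finitely many of them.\<close>

section \<open>Calculus on finite-dimensional inner product spaces\<close>

text \<open>The action on \<open>T\<close> has no invariant metric, so the size of the differential
  of \<open>\<phi> \<gamma>\<close> must be paid for by the decay of the derivative of \<gamma>.
  Cocompactness fixes the rate: the word length of \<gamma> is at most linear in the hyperbolic
  distance from 0 to \<open>\<gamma> 0\<close>, while 1 - |\<gamma> 0|^2 decays exponentially in
  that distance. The kernel at \<open>a\<close> is the derivative of the disc automorphism
  \<open>mob a\<close> moving \<open>a\<close> to 0. By Schwarz-Pick its term in the series,
  multiplied by (1 - |z|^2)^m, has as modulus the m-th power of 1 - |mob a (\<gamma> z)|^2, which is
  at most 1 with equality exactly if \<gamma> z = a. Discreteness gives a gap for the other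
  \<gamma>, and freeness leaves at most one peak term. Separation of inequivalent points is an open
  condition, but equivalent pairs are limits of inequivalent ones; there local injectivity has to
  take over. Powers of forms alone could destroy injectivity and differentials, so where these
  matter a form is multiplied by a power of a locally nonvanishing one, which preserves the
  quotients.\<close>

instance prod :: (finite_dim_inner, finite_dim_inner) finite_dim_inner
proof
  obtain A :: "'a set" where A: "finite A" "\<And>x. \<exists>a. x = (\<Sum>b\<in>A. a b *\<^sub>R b)"
    using ex_finite_spanning by metis
  obtain B :: "'b set" where B: "finite B" "\<And>x. \<exists>a. x = (\<Sum>b\<in>B. a b *\<^sub>R b)"
    using ex_finite_spanning by metis
  define C where "C = (\<lambda>a. (a, 0::'b)) ` A \<union> (\<lambda>b. (0::'a, b)) ` B"
  have C: "finite C" using A(1) B(1) by (simp add: C_def)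
  have "x \<in> span C" for x
  proof -
    obtain a where a: "fst x = (\<Sum>c\<in>A. a c *\<^sub>R c)" using A(2) by metis
    obtain b where b: "snd x = (\<Sum>c\<in>B. b c *\<^sub>R c)" using B(2) by metis
    have "x = (fst x, 0) + (0, snd x)" by simp
    also have "(fst x, 0) = (\<Sum>c\<in>A. a c *\<^sub>R (c, 0::'b))"
      unfolding a by (simp add: sum_prod)
    also have "(0, snd x) = (\<Sum>c\<in>B. b c *\<^sub>R (0::'a, c))"
      unfolding b by (simp add: sum_prod)
    also have "(\<Sum>c\<in>A. a c *\<^sub>R (c, 0::'b)) + (\<Sum>c\<in>B. b c *\<^sub>R (0::'a, c)) \<in> span C"
      by (intro span_add span_sum span_scale span_base) (auto simp: C_def)
    finally show ?thesis .
  qed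
  then have "\<forall>x. \<exists>a. x = (\<Sum>b\<in>C. a b *\<^sub>R b)"
    using span_finite[OF C] by (auto simp: set_eq_iff image_iff)
  with C show "\<exists>B::('a \<times> 'b) set. finite B \<and> (\<forall>x. \<exists>a. x = (\<Sum>b\<in>B. a b *\<^sub>R b))" by blast
qed

section \<open>Orthonormal bases in all finite dimensions, zero included\<close>

lemma ex_orthonormal_basis:
  "\<exists>B::'a::finite_dim_inner set. finite B \<and> (\<forall>b\<in>B. norm b = 1) \<and> (\<forall>x. x = (\<Sum>b\<in>B. (x \<bullet> b) *\<^sub>R b))"
proof -
  obtain A :: "'a set" where A: "finite A" "\<And>x. \<exists>a. x = (\<Sum>b\<in>A. a b *\<^sub>R b)"
    using ex_finite_spanning by metis
  have "span A = UNIV" using A by (auto simp: span_finite set_eq_iff image_iff)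
  then obtain C :: "'a set" where C: "finite C" "span C = UNIV" "pairwise orthogonal C"
    using basis_orthogonal[OF A(1)] by metis
  \<comment> \<open>An orthogonal spanning set may contain 0, which cannot be normalized.\<close>
  define B where "B = sgn ` (C - {0})"
  have fB: "finite B" using C by (simp add: B_def)
  have nB: "norm b = 1" if "b \<in> B" for b using that by (auto simp: B_def norm_sgn split: if_splits)
  have "c \<in> span B" if "c \<in> C" for c
  proof (cases "c = 0")
    case False
    have "c = norm c *\<^sub>R sgn c" using False by (simp add: sgn_div_norm)
    also have "\<dots> \<in> span B" using False that by (intro span_scale span_base) (auto simp: B_def)
    finally show ?thesis .
  qed (simp add: span_zero)
  then have sB: "span B = UNIV"
    using C(2) by (metis UNIV_I span_mono span_span subsetI subset_antisym top_greatest)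
  have oB: "b \<bullet> b' = 0" if bb: "b \<in> B" "b' \<in> B" "b \<noteq> b'" for b b'
  proof -
    obtain c c' where "c \<in> C" "c' \<in> C" "b = sgn c" "b' = sgn c'"
      using bb unfolding B_def by blast
    moreover from this have "c \<noteq> c'" using bb by auto
    ultimately show ?thesis using C(3) by (auto simp: pairwise_def orthogonal_def sgn_div_norm)
  qed
  have "x = (\<Sum>b\<in>B. (x \<bullet> b) *\<^sub>R b)" for x
  proof -
    define y where "y = x - (\<Sum>b\<in>B. (x \<bullet> b) *\<^sub>R b)"
    have "y \<bullet> b = 0" if "b \<in> B" for b
    proof -
      have "(\<Sum>b'\<in>B. (x \<bullet> b') * (b' \<bullet> b)) = (\<Sum>b'\<in>{b}. (x \<bullet> b') * (b' \<bullet> b))"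
        using fB that oB by (intro sum.mono_neutral_right) auto
      also have "\<dots> = x \<bullet> b" using nB[OF that] by (simp add: dot_square_norm)
      finally show ?thesis by (simp add: y_def inner_diff_left inner_sum_left)
    qed
    then have "\<forall>z\<in>span B. orthogonal y z"
      by (metis orthogonal_to_span orthogonal_def)
    then have "y = 0" using sB by (metis UNIV_I orthogonal_self)
    then show ?thesis by (simp add: y_def)
  qed
  with fB nB show ?thesis by blast
qed

definition onb :: "'a::finite_dim_inner set" where
  "onb = (SOME B. finite B \<and> (\<forall>b\<in>B. norm b = 1) \<and> (\<forall>x. x = (\<Sum>b\<in>B. (x \<bullet> b) *\<^sub>R b)))"

lemma finite_onb: "finite (onb :: 'a::finite_dim_inner set)"
  and norm_onb: "b \<in> onb \<Longrightarrow> norm (b :: 'a) = 1"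
  and onb_expansion: "(x :: 'a) = (\<Sum>b\<in>onb. (x \<bullet> b) *\<^sub>R b)"
proof -
  have "finite (onb :: 'a set) \<and> (\<forall>b\<in>onb :: 'a set. norm b = 1) \<and> (\<forall>x::'a. x = (\<Sum>b\<in>onb. (x \<bullet> b) *\<^sub>R b))"
    unfolding onb_def by (rule someI_ex[OF ex_orthonormal_basis])
  then show "finite (onb :: 'a set)" "b \<in> onb \<Longrightarrow> norm b = 1" "x = (\<Sum>b\<in>onb. (x \<bullet> b) *\<^sub>R b)"
    by blast+
qed

lemma norm_le_sum_onb: "norm (x :: 'a::finite_dim_inner) \<le> (\<Sum>b\<in>onb. \<bar>x \<bullet> b\<bar>)"
proof -
  have "norm x = norm (\<Sum>b\<in>onb. (x \<bullet> b) *\<^sub>R b)" by (rule arg_cong[OF onb_expansion])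
  also have "\<dots> \<le> (\<Sum>b\<in>onb. norm ((x \<bullet> b) *\<^sub>R b))" by (rule norm_sum)
  also have "\<dots> = (\<Sum>b\<in>onb. \<bar>x \<bullet> b\<bar>)" by (intro sum.cong) (auto simp: norm_onb)
  finally show ?thesis .
qed

text \<open>A separate constant shields \<open>Ck_on 1\<close> from the simplifier, which would
  unfold the recursion. Derivatives are taken in the whole space at every point of \<open>S\<close>,
  so that passing to an arbitrary subset is harmless.\<close>

definition C1 :: "'a::real_normed_vector set \<Rightarrow> ('a \<Rightarrow> 'b::real_normed_vector) \<Rightarrow> bool" where
  "C1 = Ck_on 1"

abbreviation "fder h x \<equiv> frechet_derivative h (at x)"

lemma C1_iff: "C1 S h \<longleftrightarrow> (\<forall>x\<in>S. h differentiable (at x)) \<and> (\<forall>v. continuous_on S (\<lambda>x. fder h x v))"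
  by (simp add: C1_def)

lemma C1_I:
  assumes "\<And>x. x \<in> S \<Longrightarrow> (h has_derivative h' x) (at x)" "\<And>v. continuous_on S (\<lambda>x. h' x v)"
  shows "C1 S h"
proof -
  have "fder h x = h' x" if "x \<in> S" for x
    using assms(1)[OF that] frechet_derivative_at by metis
  then have "continuous_on S (\<lambda>x. fder h x v)" for v
    using assms(2)[of v] by (simp cong: continuous_on_cong_simp)
  then show ?thesis unfolding C1_iff using assms(1) by (auto simp: differentiable_def)
qed

lemma fder_eq: "(h has_derivative h') (at x) \<Longrightarrow> fder h x = h'"
  by (metis frechet_derivative_at)

lemma C1_D: "C1 S h \<Longrightarrow> x \<in> S \<Longrightarrow> (h has_derivative fder h x) (at x)"
  using frechet_derivative_works by (auto simp: C1_iff)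

lemma C1_continuous_fder: "C1 S h \<Longrightarrow> continuous_on S (\<lambda>x. fder h x v)"
  by (simp add: C1_iff)

lemma C1_imp_continuous_on: "C1 S h \<Longrightarrow> continuous_on S h"
  by (meson C1_D continuous_at_imp_continuous_on has_derivative_continuous)

lemma C1_subset: "C1 S h \<Longrightarrow> R \<subseteq> S \<Longrightarrow> C1 R h"
  by (auto simp: C1_iff intro: continuous_on_subset)

lemma fder_cong:
  assumes "open S" "x \<in> S" "\<And>y. y \<in> S \<Longrightarrow> h y = g y"
  shows "fder h x = fder g x"
proof -
  have *: "(h has_derivative h') (at x) \<longleftrightarrow> (g has_derivative h') (at x)" for h'
    using has_derivative_transform_within_open[OF _ assms(1,2)] assms(3) by metis
  then show ?thesis unfolding frechet_derivative_def by simp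
qed

lemma C1_cong:
  assumes "open S" "\<And>x. x \<in> S \<Longrightarrow> h x = g x" "C1 S h"
  shows "C1 S g"
proof (rule C1_I)
  show "(g has_derivative fder h x) (at x)" if "x \<in> S" for x
    using has_derivative_transform_within_open[OF C1_D[OF assms(3) that] assms(1) that] assms(2) by auto
qed (rule C1_continuous_fder[OF assms(3)])

lemma C1_local:
  assumes "\<And>x. x \<in> S \<Longrightarrow> \<exists>N. open N \<and> x \<in> N \<and> C1 N h"
  shows "C1 S h"
proof -
  have "continuous (at x) (\<lambda>x. fder h x v)" if x: "x \<in> S" for x v
    using assms[OF x] C1_continuous_fder continuous_on_eq_continuous_at by metis
  moreover have "h differentiable (at x)" if x: "x \<in> S" for x
    using assms[OF x] by (auto simp: C1_iff)
  ultimately show ?thesis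
    by (auto simp: C1_iff intro: continuous_at_imp_continuous_on)
qed

lemma fder_linear: "C1 S h \<Longrightarrow> x \<in> S \<Longrightarrow> bounded_linear (fder h x)"
  using C1_D has_derivative_bounded_linear by blast

lemma fder_expansion:
  fixes h :: "'a::finite_dim_inner \<Rightarrow> 'b::real_normed_vector"
  assumes "C1 S h" "x \<in> S"
  shows "fder h x v = (\<Sum>b\<in>onb. (v \<bullet> b) *\<^sub>R fder h x b)"
proof -
  interpret bounded_linear "fder h x" by (rule fder_linear[OF assms])
  have "fder h x v = fder h x (\<Sum>b\<in>onb. (v \<bullet> b) *\<^sub>R b)" by (rule arg_cong[OF onb_expansion])
  then show ?thesis by (simp add: sum scaleR)
qed

text \<open>The sum over the basis replaces the operator norm: being a finite expression in
  directional derivatives it is continuous in \<open>x\<close>, which is what the compactness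
  arguments below require.\<close>

lemma norm_fder_le:
  fixes h :: "'a::finite_dim_inner \<Rightarrow> 'b::real_normed_vector"
  assumes "C1 S h" "x \<in> S"
  shows "norm (fder h x v) \<le> (\<Sum>b\<in>onb. norm (fder h x b)) * norm v"
proof -
  have "norm (fder h x v) \<le> (\<Sum>b\<in>onb. norm ((v \<bullet> b) *\<^sub>R fder h x b))"
    unfolding fder_expansion[OF assms, of v] by (rule norm_sum)
  also have "\<dots> \<le> (\<Sum>b\<in>onb. norm v * norm (fder h x b))"
  proof (rule sum_mono)
    fix b :: 'a assume "b \<in> onb"
    then have "\<bar>v \<bullet> b\<bar> \<le> norm v" using Cauchy_Schwarz_ineq2[of v b] by (simp add: norm_onb)
    then show "norm ((v \<bullet> b) *\<^sub>R fder h x b) \<le> norm v * norm (fder h x b)"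
      by (simp add: mult_right_mono)
  qed
  finally show ?thesis by (simp add: sum_distrib_left mult.commute)
qed

text \<open>\<open>C1\<close> controls one fixed direction at a time. Expanding a moving direction
  in a finite basis gives joint continuity, as the chain rule demands.\<close>

lemma continuous_on_fder_apply:
  fixes h :: "'a::finite_dim_inner \<Rightarrow> 'b::real_normed_vector"
  assumes h: "C1 S h" and y: "continuous_on A y" "y ` A \<subseteq> S" and w: "continuous_on A w"
  shows "continuous_on A (\<lambda>a. fder h (y a) (w a))"
proof -
  have "continuous_on A (\<lambda>a. fder h (y a) b)" for b
    using continuous_on_compose2[OF C1_continuous_fder[OF h] y] .
  then have "continuous_on A (\<lambda>a. \<Sum>b\<in>onb. (w a \<bullet> b) *\<^sub>R fder h (y a) b)"
    using w by (intro continuous_intros)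
  moreover have "(\<Sum>b\<in>onb. (w a \<bullet> b) *\<^sub>R fder h (y a) b) = fder h (y a) (w a)" if "a \<in> A" for a
    by (rule fder_expansion[OF h, symmetric]) (use y(2) that in blast)
  ultimately show ?thesis by (rule continuous_on_eq)
qed

lemma C1_bound_compact:
  fixes h :: "'a::finite_dim_inner \<Rightarrow> 'b::real_normed_vector"
  assumes h: "C1 S h" and K: "compact K" "K \<subseteq> S"
  obtains B where "0 \<le> B" "\<And>x v. x \<in> K \<Longrightarrow> norm (fder h x v) \<le> B * norm v"
proof -
  have "continuous_on K (\<lambda>x. \<Sum>b\<in>onb. norm (fder h x b))"
    using continuous_on_subset[OF C1_continuous_fder[OF h] K(2)] by (intro continuous_intros)
  from compact_imp_bounded[OF compact_continuous_image[OF this K(1)]]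
  obtain B where B: "\<And>x. x \<in> K \<Longrightarrow> (\<Sum>b\<in>onb. norm (fder h x b)) \<le> B"
    by (auto simp: bounded_iff abs_le_iff)
  show ?thesis
  proof (rule that[of "max B 0"])
    fix x v assume x: "x \<in> K"
    have "norm (fder h x v) \<le> (\<Sum>b\<in>onb. norm (fder h x b)) * norm v"
      using norm_fder_le[OF h] x K by blast
    also have "\<dots> \<le> max B 0 * norm v" using B[OF x] by (intro mult_right_mono) auto
    finally show "norm (fder h x v) \<le> max B 0 * norm v" .
  qed auto
qed

lemma C1_bound_local:
  fixes h :: "'a::finite_dim_inner \<Rightarrow> 'b::real_normed_vector"
  assumes h: "C1 S h" and "open S" "x \<in> S"
  obtains r B where "0 < r" "0 \<le> B" "ball x r \<subseteq> S" "\<And>y v. y \<in> ball x r \<Longrightarrow> norm (fder h y v) \<le> B * norm v"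
proof -
  let ?f = "\<lambda>y. \<Sum>b\<in>onb. norm (fder h y b)"
  have c: "continuous_on S ?f"
    using C1_continuous_fder[OF h] by (intro continuous_intros)
  then have "open (S \<inter> ?f -` {..<?f x + 1})"
    using assms(2) by (intro continuous_open_preimage) auto
  moreover have "x \<in> S \<inter> ?f -` {..<?f x + 1}" using assms(3) by auto
  ultimately obtain r where r: "0 < r" "ball x r \<subseteq> S \<inter> ?f -` {..<?f x + 1}"
    by (meson open_contains_ball)
  show ?thesis
  proof (rule that[of r "?f x + 1"])
    fix y v assume y: "y \<in> ball x r"
    have "norm (fder h y v) \<le> ?f y * norm v"
      using norm_fder_le[OF h] y r by blast
    also have "\<dots> \<le> (?f x + 1) * norm v" using y r by (intro mult_right_mono) auto
    finally show "norm (fder h y v) \<le> (?f x + 1) * norm v" .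
  qed (use r in \<open>auto intro!: add_nonneg_nonneg sum_nonneg\<close>)
qed

lemma
  fixes g :: "'a::finite_dim_inner \<Rightarrow> 'b::real_normed_vector"
  assumes g: "C1 T g" and h: "C1 S h" and hS: "h ` S \<subseteq> T"
  shows C1_compose: "C1 S (\<lambda>x. g (h x))"
    and fder_compose: "x \<in> S \<Longrightarrow> fder (\<lambda>x. g (h x)) x v = fder g (h x) (fder h x v)"
proof -
  have *: "((\<lambda>x. g (h x)) has_derivative (\<lambda>v. fder g (h x) (fder h x v))) (at x)" if "x \<in> S" for x
    using has_derivative_compose[OF C1_D[OF h that] C1_D[OF g]] hS that by blast
  show "C1 S (\<lambda>x. g (h x))"
  proof (rule C1_I[OF *])
    show "continuous_on S (\<lambda>x. fder g (h x) (fder h x v))" for v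
      by (rule continuous_on_fder_apply[OF g C1_imp_continuous_on[OF h] hS C1_continuous_fder[OF h]])
  qed
  show "fder (\<lambda>x. g (h x)) x v = fder g (h x) (fder h x v)" if "x \<in> S"
    using fder_eq[OF *[OF that]] by simp
qed

lemma C1_const: "C1 S (\<lambda>x. c)"
  by (rule C1_I[where h' = "\<lambda>x v. 0"]) auto

lemma C1_bounded_linear: "bounded_linear h \<Longrightarrow> C1 S h"
  by (rule C1_I[where h' = "\<lambda>x. h"]) (auto intro: bounded_linear_imp_has_derivative)

lemma
  fixes g h :: "_ \<Rightarrow> 'b::real_normed_algebra"
  assumes g: "C1 S g" and h: "C1 S h"
  shows C1_mult: "C1 S (\<lambda>x. g x * h x)"
    and fder_mult: "x \<in> S \<Longrightarrow> fder (\<lambda>x. g x * h x) x v = g x * fder h x v + fder g x v * h x"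
proof -
  have *: "((\<lambda>x. g x * h x) has_derivative (\<lambda>v. g x * fder h x v + fder g x v * h x)) (at x)"
    if "x \<in> S" for x
    using has_derivative_mult[OF C1_D[OF g that] C1_D[OF h that]] .
  show "C1 S (\<lambda>x. g x * h x)"
    by (rule C1_I[OF *])
      (auto intro!: continuous_intros C1_continuous_fder[OF g] C1_continuous_fder[OF h] C1_imp_continuous_on[OF g] C1_imp_continuous_on[OF h])
  show "fder (\<lambda>x. g x * h x) x v = g x * fder h x v + fder g x v * h x" if "x \<in> S"
    using fder_eq[OF *[OF that]] by simp
qed

lemma
  fixes g h :: "_ \<Rightarrow> 'b::real_normed_field"
  assumes g: "C1 S g" and h: "C1 S h" and h0: "\<And>x. x \<in> S \<Longrightarrow> h x \<noteq> 0"
  shows C1_divide: "C1 S (\<lambda>x. g x / h x)"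
    and fder_divide: "x \<in> S \<Longrightarrow>
      fder (\<lambda>x. g x / h x) x v = (fder g x v * h x - g x * fder h x v) / (h x * h x)"
proof -
  have *: "((\<lambda>x. g x / h x) has_derivative (\<lambda>v. (fder g x v * h x - g x * fder h x v) / (h x * h x))) (at x)"
    if "x \<in> S" for x
    using has_derivative_divide'[OF C1_D[OF g that] C1_D[OF h that] h0[OF that]] .
  show "C1 S (\<lambda>x. g x / h x)"
    by (rule C1_I[OF *])
      (auto intro!: continuous_intros C1_continuous_fder[OF g] C1_continuous_fder[OF h] C1_imp_continuous_on[OF g] C1_imp_continuous_on[OF h] simp: h0)
  show "fder (\<lambda>x. g x / h x) x v = (fder g x v * h x - g x * fder h x v) / (h x * h x)" if "x \<in> S"
    using fder_eq[OF *[OF that]] by simp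
qed

lemma
  fixes u :: "complex \<Rightarrow> complex"
  assumes u: "u holomorphic_on S" "open S"
  shows C1_holomorphic: "C1 S u"
    and fder_holomorphic: "x \<in> S \<Longrightarrow> fder u x v = deriv u x * v"
proof -
  have *: "(u has_derivative (\<lambda>v. deriv u x * v)) (at x)" if "x \<in> S" for x
    using holomorphic_derivI[OF u that] by (simp add: has_field_derivative_def)
  show "C1 S u"
    by (rule C1_I[OF *])
      (auto intro!: continuous_intros holomorphic_on_imp_continuous_on[OF holomorphic_deriv[OF u]])
  show "fder u x v = deriv u x * v" if "x \<in> S"
    using fder_eq[OF *[OF that]] by simp
qed

lemma C1_Lipschitz:
  assumes "convex S" "C1 S h" "\<And>x v. x \<in> S \<Longrightarrow> norm (fder h x v) \<le> B * norm v" "x \<in> S" "y \<in> S" "0 \<le> B"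
  shows "norm (h x - h y) \<le> B * norm (x - y)"
proof (rule differentiable_bound[where f' = "fder h", OF assms(1) _ _ assms(4,5)])
  show "(h has_derivative fder h x) (at x within S)" if "x \<in> S" for x
    by (rule has_derivative_at_withinI[OF C1_D[OF assms(2) that]])
  show "onorm (fder h x) \<le> B" if "x \<in> S" for x
    by (rule onorm_bound[OF assms(6) assms(3)[OF that]])
qed

section \<open>Dominated series of C1 maps\<close>

lemma has_sum_diff:
  fixes f g :: "'i \<Rightarrow> 'b::real_normed_vector"
  assumes "(f has_sum a) I" "(g has_sum b) I"
  shows "((\<lambda>i. f i - g i) has_sum (a - b)) I"
  using has_sum_add[OF assms(1), of "\<lambda>i. - g i" "- b"] assms(2) by (simp add: has_sum_uminus)

lemma
  fixes f :: "'i \<Rightarrow> 'b::banach"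
  assumes b: "b summable_on I" and le: "\<And>i. i \<in> I \<Longrightarrow> norm (f i) \<le> b i"
  shows dominated_norm_summable: "(\<lambda>i. norm (f i)) summable_on I"
    and dominated_summable: "f summable_on I"
    and norm_infsum_dominated: "norm (infsum f I) \<le> infsum b I"
proof -
  show *: "(\<lambda>i. norm (f i)) summable_on I"
    by (rule Infinite_Sum.abs_summable_on_comparison_test'[OF b le])
  then show s: "f summable_on I" by (rule Infinite_Sum.abs_summable_summable)
  show "norm (infsum f I) \<le> infsum b I"
    by (rule norm_infsum_le[OF has_sum_infsum[OF s] has_sum_infsum[OF b] le])
qed

text \<open>Termwise differentiation along unordered sums. All but e/3 of the majorant sits in a
  finite \<open>F\<close>; outside it the remainder of each term is at most
  \<open>2 * b i * norm (y - x)\<close>, one half by the mean value inequality (hence convexity),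
  the other by the bound on the derivative. A single \<open>b\<close> dominates values and
  derivatives.\<close>

lemma
  fixes f :: "'i \<Rightarrow> 'a::real_normed_vector \<Rightarrow> 'b::banach"
  assumes S: "open S" "convex S" and f: "\<And>i. i \<in> I \<Longrightarrow> C1 S (f i)"
    and bf: "\<And>i x. i \<in> I \<Longrightarrow> x \<in> S \<Longrightarrow> norm (f i x) \<le> b i"
    and bd: "\<And>i x v. i \<in> I \<Longrightarrow> x \<in> S \<Longrightarrow> norm (fder (f i) x v) \<le> b i * norm v"
    and b: "b summable_on I"
  shows C1_infsum: "C1 S (\<lambda>x. \<Sum>\<^sub>\<infinity>i\<in>I. f i x)"
    and norm_fder_infsum: "x \<in> S \<Longrightarrow> norm (fder (\<lambda>x. \<Sum>\<^sub>\<infinity>i\<in>I. f i x) x v) \<le> (\<Sum>\<^sub>\<infinity>i\<in>I. norm (fder (f i) x v))"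
proof -
  define G where "G = (\<lambda>x. \<Sum>\<^sub>\<infinity>i\<in>I. f i x)"
  define G' where "G' = (\<lambda>x v. \<Sum>\<^sub>\<infinity>i\<in>I. fder (f i) x v)"
  have sf: "(\<lambda>i. f i x) summable_on I" if "x \<in> S" for x
    using dominated_summable[OF b bf[OF _ that]] by auto
  have sa: "(\<lambda>i. norm (fder (f i) x v)) summable_on I" if "x \<in> S" for x v
    using dominated_norm_summable[OF summable_on_cmult_left[OF b] bd[OF _ that]] by auto
  have sd: "(\<lambda>i. fder (f i) x v) summable_on I" if "x \<in> S" for x v
    using dominated_summable[OF summable_on_cmult_left[OF b] bd[OF _ that]] by auto
  have lin: "bounded_linear (G' x)" if x: "x \<in> S" for x
  proof (rule bounded_linear_intro[where K = "infsum b I"])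
    show "G' x (v + w) = G' x v + G' x w" for v w
    proof -
      have "(\<Sum>\<^sub>\<infinity>i\<in>I. fder (f i) x (v + w)) = (\<Sum>\<^sub>\<infinity>i\<in>I. fder (f i) x v + fder (f i) x w)"
        using fder_linear[OF f x] by (intro infsum_cong) (simp add: bounded_linear.linear linear_add)
      then show ?thesis by (simp add: G'_def infsum_add sd[OF x])
    qed
    show "G' x (r *\<^sub>R v) = r *\<^sub>R G' x v" for r v
    proof -
      have "(\<Sum>\<^sub>\<infinity>i\<in>I. fder (f i) x (r *\<^sub>R v)) = (\<Sum>\<^sub>\<infinity>i\<in>I. r *\<^sub>R fder (f i) x v)"
        using fder_linear[OF f x] by (intro infsum_cong) (simp add: bounded_linear.linear linear_scale)
      then show ?thesis by (simp add: G'_def infsum_scaleR_right)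
    qed
    show "norm (G' x v) \<le> norm v * infsum b I" for v
    proof -
      have "norm (G' x v) \<le> (\<Sum>\<^sub>\<infinity>i\<in>I. norm (fder (f i) x v))"
        unfolding G'_def by (rule norm_infsum_bound[OF sa[OF x]])
      also have "\<dots> \<le> (\<Sum>\<^sub>\<infinity>i\<in>I. b i * norm v)"
        using bd[OF _ x] by (intro infsum_mono sa[OF x] summable_on_cmult_left b) auto
      also have "\<dots> = norm v * infsum b I" by (subst infsum_cmult_left) (use b in auto)
      finally show ?thesis .
    qed
  qed
  have der: "(G has_derivative G' x) (at x)" if x: "x \<in> S" for x
    unfolding has_derivative_within_alt2
  proof (intro conjI allI impI)
    show "bounded_linear (G' x)" by (rule lin[OF x])
    fix e :: real assume e: "0 < e"
    obtain F where F: "finite F" "F \<subseteq> I" "dist (sum b F) (infsum b I) \<le> e / 3"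
      using infsum_finite_approximation[OF b, of "e/3"] e by auto
    have sF: "b summable_on (I - F)"
      by (rule summable_on_subset_banach[OF b]) auto
    have "infsum b I = infsum b F + infsum b (I - F)"
      using infsum_Un_disjoint[of b F "I - F"] F sF by (simp add: Un_absorb1)
    then have tail: "infsum b (I - F) \<le> e / 3"
      using F by (simp add: dist_real_def)
    have "((\<lambda>y. \<Sum>i\<in>F. f i y) has_derivative (\<lambda>v. \<Sum>i\<in>F. fder (f i) x v)) (at x)"
      using F by (intro has_derivative_sum C1_D[OF f x]) auto
    then have ev: "\<forall>\<^sub>F y in at x. norm ((\<Sum>i\<in>F. f i y) - (\<Sum>i\<in>F. f i x) - (\<Sum>i\<in>F. fder (f i) x (y - x)))
        \<le> e / 3 * norm (y - x)"
      using e unfolding has_derivative_within_alt2 by (auto dest: spec[of _ "e/3"])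
    have "\<forall>\<^sub>F y in at x. y \<in> S"
      using S x by (simp add: eventually_at_in_open')
    with ev show "\<forall>\<^sub>F y in at x. norm (G y - G x - G' x (y - x)) \<le> e * norm (y - x)"
    proof eventually_elim
      case (elim y)
      let ?r = "\<lambda>i. f i y - f i x - fder (f i) x (y - x)"
      have "(?r has_sum (G y - G x - G' x (y - x))) I"
        unfolding G_def G'_def
        by (intro has_sum_diff has_sum_infsum sf sd elim x)
      then have sr: "?r summable_on I" and "G y - G x - G' x (y - x) = infsum ?r I"
        by (auto simp: has_sum_iff)
      note this(2)
      also have "\<dots> = infsum ?r F + infsum ?r (I - F)"
        using infsum_Un_disjoint[of ?r F "I - F"] F summable_on_subset_banach[OF sr, of "I - F"]
        by (simp add: Un_absorb1)
      finally have eq: "G y - G x - G' x (y - x) = sum ?r F + infsum ?r (I - F)"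
        using F by simp
      have r: "norm (?r i) \<le> b i * (2 * norm (y - x))" if i: "i \<in> I" for i
      proof -
        have "norm (f i y - f i x) \<le> b i * norm (y - x)"
          by (rule C1_Lipschitz[OF S(2) f[OF i]]) (use bd i elim x order.trans[OF norm_ge_zero bf[OF i x]] in auto)
        moreover have "norm (fder (f i) x (y - x)) \<le> b i * norm (y - x)"
          using bd i x by auto
        ultimately show ?thesis
          using norm_triangle_ineq4[of "f i y - f i x" "fder (f i) x (y - x)"] by linarith
      qed
      have sb: "(\<lambda>i. b i * (2 * norm (y - x))) summable_on (I - F)"
        by (rule summable_on_cmult_left[OF sF])
      have "norm (infsum ?r (I - F)) \<le> (\<Sum>\<^sub>\<infinity>i\<in>I - F. b i * (2 * norm (y - x)))"
      proof (rule norm_infsum_le[OF has_sum_infsum has_sum_infsum])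
        show "?r summable_on (I - F)" by (rule summable_on_subset_banach[OF sr]) auto
      qed (use sb r in auto)
      also have "\<dots> = infsum b (I - F) * (2 * norm (y - x))"
        by (rule infsum_cmult_left) (use sF in auto)
      also have "\<dots> \<le> e / 3 * (2 * norm (y - x))"
        using tail by (intro mult_right_mono) auto
      finally have t: "norm (infsum ?r (I - F)) \<le> e / 3 * (2 * norm (y - x))" .
      have "norm (sum ?r F) \<le> e / 3 * norm (y - x)"
        using elim(1) by (simp add: sum_subtractf)
      with t show ?case unfolding eq
        using norm_triangle_ineq[of "sum ?r F" "infsum ?r (I - F)"] by linarith
    qed
  qed
  have cont: "continuous_on S (\<lambda>x. G' x v)" for v
  proof (rule uniform_limit_theorem)
    show "uniform_limit S (\<lambda>F x. \<Sum>i\<in>F. fder (f i) x v) (\<lambda>x. G' x v) (finite_subsets_at_top I)"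
      unfolding G'_def
      by (rule Weierstrass_m_test_general[where M = "\<lambda>i. b i * norm v"])
        (use bd summable_on_cmult_left[OF b] in auto)
    show "\<forall>\<^sub>F F in finite_subsets_at_top I. continuous_on S (\<lambda>x. \<Sum>i\<in>F. fder (f i) x v)"
      unfolding eventually_finite_subsets_at_top
      by (intro exI[of _ "{}"]) (auto intro!: continuous_intros C1_continuous_fder f)
  qed auto
  show "C1 S (\<lambda>x. \<Sum>\<^sub>\<infinity>i\<in>I. f i x)"
    by (rule C1_I[OF der[unfolded G_def] cont])
  show "norm (fder (\<lambda>x. \<Sum>\<^sub>\<infinity>i\<in>I. f i x) x v) \<le> (\<Sum>\<^sub>\<infinity>i\<in>I. norm (fder (f i) x v))" if "x \<in> S"
    unfolding fder_eq[OF der[unfolded G_def, OF that]]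
    unfolding G'_def by (rule norm_infsum_bound[OF sa[OF that]])
qed

section \<open>Cocompact groups of disc automorphisms\<close>

definition mob :: "complex \<Rightarrow> complex \<Rightarrow> complex" where
  "mob a z = (z - a) / (1 - cnj a * z)"

lemma mob_denominator: "norm a < 1 \<Longrightarrow> norm z < 1 \<Longrightarrow> 1 - norm z \<le> norm (1 - cnj a * z)"
  and mob_denominator': "norm a < 1 \<Longrightarrow> norm z < 1 \<Longrightarrow> 1 - norm a \<le> norm (1 - cnj a * z)"
  and mob_denominator_nz: "norm a < 1 \<Longrightarrow> norm z < 1 \<Longrightarrow> 1 - cnj a * z \<noteq> 0"
proof -
  assume a: "norm a < 1" and z: "norm z < 1"
  have 1: "1 - norm a * norm z \<le> norm (1 - cnj a * z)"
    using norm_triangle_ineq2[of 1 "cnj a * z"] by (simp add: norm_mult)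
  have "norm a * norm z \<le> 1 * norm z" "norm a * norm z \<le> norm a * 1"
    using a z by (intro mult_right_mono mult_left_mono; simp)+
  with 1 show 2: "1 - norm z \<le> norm (1 - cnj a * z)" and "1 - norm a \<le> norm (1 - cnj a * z)"
    by linarith+
  show "1 - cnj a * z \<noteq> 0" using 2 z by (metis diff_gt_0_iff_gt norm_zero not_le)
qed

lemma norm_mob_less_1: "norm a < 1 \<Longrightarrow> norm z < 1 \<Longrightarrow> norm (mob a z) < 1"
  using Moebius_function_norm_lt_1[of a z 0] by (simp add: Moebius_function_simple mob_def)

lemma mob_minus: "norm a < 1 \<Longrightarrow> norm z < 1 \<Longrightarrow> mob (- a) (mob a z) = z"
  using Moebius_function_compose[of "-a" a z] by (simp add: Moebius_function_simple mob_def)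

lemma holomorphic_on_mob: "norm a < 1 \<Longrightarrow> mob a holomorphic_on unit_disc"
  using Moebius_function_holomorphic[of a 0]
  by (simp add: Moebius_function_simple[abs_def] mob_def[abs_def] cong: holomorphic_cong)

lemma mob_self [simp]: "mob a a = 0"
  by (simp add: mob_def)

lemma mob_derivative:
  assumes "norm a < 1" "norm z < 1"
  shows "(mob a has_field_derivative of_real (1 - (norm a)\<^sup>2) / (1 - cnj a * z)\<^sup>2) (at z)"
proof -
  have "1 - cnj a * z \<noteq> 0" by (rule mob_denominator_nz[OF assms])
  then have "((\<lambda>z. (z - a) / (1 - cnj a * z)) has_field_derivative
      (1 * (1 - cnj a * z) - (z - a) * (- cnj a)) / ((1 - cnj a * z) * (1 - cnj a * z))) (at z)"
    by (auto intro!: derivative_eq_intros)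
  also have "1 * (1 - cnj a * z) - (z - a) * (- cnj a) = of_real (1 - (norm a)\<^sup>2)"
    by (simp add: algebra_simps of_real_diff complex_norm_square[symmetric] flip: of_real_power)
  finally show ?thesis by (simp add: mob_def[abs_def] power2_eq_square)
qed

text \<open>Polarized Schwarz-Pick identity: the case \<open>a = w\<close> is the formula for 1 -
  |mob b w|^2, and the two together make the quotient \<open>hypQ\<close> invariant.\<close>

lemma mob_polarization:
  assumes "norm b < 1" "norm a < 1" "norm w < 1"
  shows "1 - cnj (mob b a) * mob b w
    = of_real (1 - (norm b)\<^sup>2) * (1 - cnj a * w) / (cnj (1 - cnj b * a) * (1 - cnj b * w))"
proof -
  have 1: "1 - cnj b * a \<noteq> 0" "1 - cnj b * w \<noteq> 0" using assms mob_denominator_nz by auto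
  then have 2: "cnj (1 - cnj b * a) \<noteq> 0" by (simp only: complex_cnj_zero_iff not_False_eq_True)
  have "1 - cnj (mob b a) * mob b w = 1 - cnj (a - b) * (w - b) / (cnj (1 - cnj b * a) * (1 - cnj b * w))"
    by (simp add: mob_def)
  also have "\<dots> = (cnj (1 - cnj b * a) * (1 - cnj b * w) - cnj (a - b) * (w - b)) / (cnj (1 - cnj b * a) * (1 - cnj b * w))"
    using 1 2 by (simp only: diff_divide_distrib) simp
  also have "cnj (1 - cnj b * a) * (1 - cnj b * w) - cnj (a - b) * (w - b) = (1 - b * cnj b) * (1 - cnj a * w)"
    by (simp add: algebra_simps)
  also have "1 - b * cnj b = of_real (1 - (norm b)\<^sup>2)"
    by (simp add: of_real_diff complex_norm_square[symmetric] flip: of_real_power)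
  finally show ?thesis .
qed

text \<open>The function \<open>hypQ a w\<close> is \<open>cosh\<^sup>2\<close> of half the hyperbolic distance of \<open>a\<close> and \<open>w\<close>.\<close>

definition hypQ :: "complex \<Rightarrow> complex \<Rightarrow> real" where
  "hypQ a w = (norm (1 - cnj a * w))\<^sup>2 / ((1 - (norm a)\<^sup>2) * (1 - (norm w)\<^sup>2))"

lemma one_minus_norm_sq_pos: "norm (a::complex) < 1 \<Longrightarrow> 0 < 1 - (norm a)\<^sup>2"
  by (simp add: abs_square_less_1)

lemma one_minus_norm_mob_sq:
  assumes "norm b < 1" "norm w < 1"
  shows "1 - (norm (mob b w))\<^sup>2 = (1 - (norm b)\<^sup>2) * (1 - (norm w)\<^sup>2) / (norm (1 - cnj b * w))\<^sup>2"
proof -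
  have "of_real (1 - (norm (mob b w))\<^sup>2) = 1 - cnj (mob b w) * mob b w"
    by (simp add: of_real_diff complex_norm_square mult.commute flip: of_real_power)
  also have "\<dots> = of_real (1 - (norm b)\<^sup>2) * (1 - cnj w * w) / (cnj (1 - cnj b * w) * (1 - cnj b * w))"
    by (rule mob_polarization[OF assms(1,2,2)])
  also have "1 - cnj w * w = of_real (1 - (norm w)\<^sup>2)"
    by (simp add: of_real_diff complex_norm_square mult.commute flip: of_real_power)
  also have "cnj (1 - cnj b * w) * (1 - cnj b * w) = of_real ((norm (1 - cnj b * w))\<^sup>2)"
    by (metis complex_norm_square mult.commute)
  finally show ?thesis
    by (simp only: of_real_mult[symmetric] of_real_divide[symmetric] of_real_eq_iff)
qed

lemma hypQ_mob:
  assumes "norm b < 1" "norm a < 1" "norm w < 1"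
  shows "hypQ (mob b a) (mob b w) = hypQ a w"
proof -
  let ?A = "norm (1 - cnj b * a)" and ?W = "norm (1 - cnj b * w)" and ?B = "1 - (norm b)\<^sup>2"
  have pos: "0 < ?A" "0 < ?W" "0 < ?B" using assms mob_denominator_nz one_minus_norm_sq_pos by auto
  have "norm (1 - cnj (mob b a) * mob b w) = ?B * norm (1 - cnj a * w) / (?A * ?W)"
    unfolding mob_polarization[OF assms] norm_divide norm_mult complex_mod_cnj norm_of_real
    using pos by simp
  then show ?thesis
    unfolding hypQ_def one_minus_norm_mob_sq[OF assms(1,2)] one_minus_norm_mob_sq[OF assms(1,3)]
    using pos by (simp add: power_divide power_mult_distrib power2_eq_square[of "?A * ?W"]
      power2_eq_square[of ?B] power2_eq_square[of ?A] power2_eq_square[of ?W])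
qed

section \<open>Discrete, free and cocompact groups of the disc\<close>

definition disc_id :: "complex \<Rightarrow> complex" where
  "disc_id = (\<lambda>z\<in>unit_disc. z)"

lemma disc_id_apply [simp]: "norm z < 1 \<Longrightarrow> disc_id z = z"
  by (simp add: disc_id_def)

text \<open>Elements are extensional, so that equality in the group is equality of functions and the
  product is \<open>compose unit_disc\<close>. Since \<open>discrete\<close> lets \<open>w\<close>
  vary near \<open>z\<close> together with its image, this one condition contains both freeness and
  proper discontinuity. The radius in \<open>cocompact\<close> stands for a compact set meeting all
  orbits.\<close>

locale disc_group =
  fixes \<Gamma> :: "(complex \<Rightarrow> complex) set"
  assumes ext: "\<gamma> \<in> \<Gamma> \<Longrightarrow> \<gamma> \<in> extensional unit_disc"
    and maps: "\<gamma> \<in> \<Gamma> \<Longrightarrow> norm z < 1 \<Longrightarrow> norm (\<gamma> z) < 1"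
    and hol: "\<gamma> \<in> \<Gamma> \<Longrightarrow> \<gamma> holomorphic_on unit_disc"
    and id_in: "disc_id \<in> \<Gamma>"
    and comp_in: "\<gamma> \<in> \<Gamma> \<Longrightarrow> \<delta> \<in> \<Gamma> \<Longrightarrow> compose unit_disc \<gamma> \<delta> \<in> \<Gamma>"
    and ex_inv: "\<gamma> \<in> \<Gamma> \<Longrightarrow> \<exists>\<delta>\<in>\<Gamma>. compose unit_disc \<delta> \<gamma> = disc_id \<and> compose unit_disc \<gamma> \<delta> = disc_id"
    and discrete: "norm z < 1 \<Longrightarrow> \<exists>r>0. \<forall>\<gamma>\<in>\<Gamma>. \<forall>w. norm w < 1 \<longrightarrow> dist z w < r \<longrightarrow> dist z (\<gamma> w) < r \<longrightarrow> \<gamma> = disc_id"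
    and cocompact: "\<exists>k<1. \<forall>z. norm z < 1 \<longrightarrow> (\<exists>\<gamma>\<in>\<Gamma>. norm (\<gamma> z) \<le> k)"
begin

lemma compose_apply [simp]: "norm z < 1 \<Longrightarrow> compose unit_disc \<gamma> \<delta> z = \<gamma> (\<delta> z)"
  by (simp add: compose_def)

definition ginv :: "(complex \<Rightarrow> complex) \<Rightarrow> complex \<Rightarrow> complex" where
  "ginv \<gamma> = (SOME \<delta>. \<delta> \<in> \<Gamma> \<and> compose unit_disc \<delta> \<gamma> = disc_id \<and> compose unit_disc \<gamma> \<delta> = disc_id)"

lemma
  assumes "\<gamma> \<in> \<Gamma>"
  shows ginv_in: "ginv \<gamma> \<in> \<Gamma>"
    and ginv_left: "compose unit_disc (ginv \<gamma>) \<gamma> = disc_id"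
    and ginv_right: "compose unit_disc \<gamma> (ginv \<gamma>) = disc_id"
proof -
  have "ginv \<gamma> \<in> \<Gamma> \<and> compose unit_disc (ginv \<gamma>) \<gamma> = disc_id \<and> compose unit_disc \<gamma> (ginv \<gamma>) = disc_id"
    unfolding ginv_def by (rule someI_ex[of "\<lambda>\<delta>. \<delta> \<in> \<Gamma> \<and> compose unit_disc \<delta> \<gamma> = disc_id \<and> compose unit_disc \<gamma> \<delta> = disc_id"])
      (use ex_inv[OF assms] in blast)
  then show "ginv \<gamma> \<in> \<Gamma>" "compose unit_disc (ginv \<gamma>) \<gamma> = disc_id" "compose unit_disc \<gamma> (ginv \<gamma>) = disc_id"
    by auto
qed

lemma ginv_left_apply: "\<gamma> \<in> \<Gamma> \<Longrightarrow> norm z < 1 \<Longrightarrow> ginv \<gamma> (\<gamma> z) = z"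
  using ginv_left[of \<gamma>] compose_apply[of z "ginv \<gamma>" \<gamma>] by simp

lemma ginv_right_apply: "\<gamma> \<in> \<Gamma> \<Longrightarrow> norm z < 1 \<Longrightarrow> \<gamma> (ginv \<gamma> z) = z"
  using ginv_right[of \<gamma>] compose_apply[of z \<gamma> "ginv \<gamma>"] by simp

lemma compose_assoc_group:
  assumes "\<gamma> \<in> \<Gamma>" "\<delta> \<in> \<Gamma>" "\<beta> \<in> \<Gamma>"
  shows "compose unit_disc \<gamma> (compose unit_disc \<delta> \<beta>) = compose unit_disc (compose unit_disc \<gamma> \<delta>) \<beta>"
  using maps[OF assms(3)] by (auto simp: fun_eq_iff compose_def)

lemma compose_disc_id: "\<gamma> \<in> \<Gamma> \<Longrightarrow> compose unit_disc disc_id \<gamma> = \<gamma>"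
  and compose_disc_id_right: "\<gamma> \<in> \<Gamma> \<Longrightarrow> compose unit_disc \<gamma> disc_id = \<gamma>"
  using maps[of \<gamma>] ext[of \<gamma>] by (auto simp: fun_eq_iff compose_def extensional_def)

lemma free:
  assumes "\<gamma> \<in> \<Gamma>" "norm z < 1" "\<gamma> z = z"
  shows "\<gamma> = disc_id"
  using discrete[OF assms(2)] assms by (metis dist_self)

lemma free2:
  assumes "\<gamma> \<in> \<Gamma>" "\<delta> \<in> \<Gamma>" "norm z < 1" "\<gamma> z = \<delta> z"
  shows "\<gamma> = \<delta>"
proof -
  have "compose unit_disc (ginv \<gamma>) \<delta> = disc_id"
    by (rule free[of _ z]) (use assms in \<open>auto intro: comp_in ginv_in simp: ginv_left_apply assms(4)[symmetric]\<close>)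
  then have "compose unit_disc \<gamma> (compose unit_disc (ginv \<gamma>) \<delta>) = \<gamma>"
    using assms by (simp add: compose_disc_id_right)
  then show ?thesis
    using assms ginv_in by (simp add: compose_assoc_group ginv_right compose_disc_id)
qed

text \<open>The change of index that makes Poincare series automorphic.\<close>

lemma bij_compose_right:
  assumes "\<delta> \<in> \<Gamma>"
  shows "bij_betw (\<lambda>\<gamma>. compose unit_disc \<gamma> \<delta>) \<Gamma> \<Gamma>"
  by (rule bij_betw_byWitness[where f' = "\<lambda>\<gamma>. compose unit_disc \<gamma> (ginv \<delta>)"])
    (use assms in \<open>auto simp: compose_assoc_group[symmetric] ginv_in ginv_left ginv_right compose_disc_id_right intro: comp_in\<close>)

text \<open>With \<open>a\<close> the preimage of 0, both \<open>u\<close>, which is \<gamma> after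
  \<open>mob (- a)\<close>, and its inverse \<open>v\<close> fix 0. The Schwarz lemma for the two
  maps forces equality of moduli at 1/2, so \<open>u\<close> is a rotation.\<close>

lemma moebius_form:
  assumes g: "\<gamma> \<in> \<Gamma>"
  obtains a c where "norm a < 1" "norm c = 1" "\<And>z. norm z < 1 \<Longrightarrow> \<gamma> z = c * mob a z"
proof -
  define a where "a = ginv \<gamma> 0"
  have a: "norm a < 1" using maps[OF ginv_in[OF g]] by (simp add: a_def)
  have ga: "\<gamma> a = 0" using ginv_right_apply[OF g] by (simp add: a_def)
  define u where "u = (\<lambda>z. \<gamma> (mob (- a) z))"
  define v where "v = (\<lambda>z. mob a (ginv \<gamma> z))"
  have na: "norm (- a) < 1" using a by simp
  have u: "norm (u z) < 1" "norm (v z) < 1" if "norm z < 1" for z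
    using that norm_mob_less_1[OF na] norm_mob_less_1[OF a] maps[OF g] maps[OF ginv_in[OF g]]
    by (auto simp: u_def v_def)
  have "(\<gamma> \<circ> mob (- a)) holomorphic_on unit_disc"
    by (rule holomorphic_on_compose_gen[OF holomorphic_on_mob[OF na] hol[OF g]])
      (use norm_mob_less_1[OF na] in auto)
  then have hu: "u holomorphic_on unit_disc" by (simp add: u_def comp_def)
  have "(mob a \<circ> ginv \<gamma>) holomorphic_on unit_disc"
    by (rule holomorphic_on_compose_gen[OF hol[OF ginv_in[OF g]] holomorphic_on_mob[OF a]])
      (use maps[OF ginv_in[OF g]] in auto)
  then have hv: "v holomorphic_on unit_disc" by (simp add: v_def comp_def)
  have u0: "u 0 = 0" by (simp add: u_def mob_def ga)
  have v0: "v 0 = 0" by (simp add: v_def a_def[symmetric])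
  have vu: "v (u z) = z" if "norm z < 1" for z
    using ginv_left_apply[OF g norm_mob_less_1[OF na that]] mob_minus[of "-a" z] that a
    by (simp add: u_def v_def)
  have h: "norm (1/2::complex) < 1" by simp
  have "norm (u (1/2)) \<le> norm (1/2::complex)"
    by (rule Schwarz_Lemma(1)[OF hu u0 u(1) h])
  moreover have "norm (v (u (1/2))) \<le> norm (u (1/2))"
    by (rule Schwarz_Lemma(1)[OF hv v0 u(2) u(1)[OF h]])
  ultimately have "norm (u (1/2)) = norm (1/2::complex)" using vu[OF h] by simp
  then have "\<exists>\<alpha>. (\<forall>z. norm z < 1 \<longrightarrow> u z = \<alpha> * z) \<and> norm \<alpha> = 1"
    by (intro Schwarz_Lemma(3)[OF hu u0 u(1) h]) (auto intro!: exI[of _ "1/2"])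
  then obtain c where c: "\<And>z. norm z < 1 \<Longrightarrow> u z = c * z" "norm c = 1" by blast
  show ?thesis
  proof (rule that[OF a c(2)])
    fix z :: complex assume z: "norm z < 1"
    have "\<gamma> z = u (mob a z)" using mob_minus[OF a z] by (simp add: u_def)
    then show "\<gamma> z = c * mob a z" using c(1)[OF norm_mob_less_1[OF a z]] by simp
  qed
qed

text \<open>The modulus of the derivative of \<gamma> at 0, and the reciprocal of
  \<open>hypQ 0 (\<gamma> 0)\<close>: the scale on which the size of \<gamma> is measured
  throughout.\<close>

definition eps :: "(complex \<Rightarrow> complex) \<Rightarrow> real" where
  "eps \<gamma> = 1 - (norm (\<gamma> 0))\<^sup>2"

lemma eps_pos: "\<gamma> \<in> \<Gamma> \<Longrightarrow> 0 < eps \<gamma>"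
  and eps_le_1: "eps \<gamma> \<le> 1"
  using maps[of \<gamma> 0] one_minus_norm_sq_pos by (auto simp: eps_def)

text \<open>Schwarz-Pick is an equality for automorphisms. Since the zero \<open>a\<close> of
  \<gamma> has the same modulus as \<open>\<gamma> 0\<close>, the estimate of the denominator by 1 -
  |z| compares the derivative at \<open>z\<close> with \<open>eps \<gamma>\<close>, uniformly on
  smaller discs.\<close>

lemma
  assumes g: "\<gamma> \<in> \<Gamma>" and z: "norm z < 1"
  shows schwarz_pick: "norm (deriv \<gamma> z) * (1 - (norm z)\<^sup>2) = 1 - (norm (\<gamma> z))\<^sup>2"
    and norm_deriv_le: "norm (deriv \<gamma> z) \<le> eps \<gamma> / (1 - norm z)\<^sup>2"
    and deriv_nz: "deriv \<gamma> z \<noteq> 0"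
proof -
  obtain a c where a: "norm a < 1" "norm c = 1" and eq: "\<And>z. norm z < 1 \<Longrightarrow> \<gamma> z = c * mob a z"
    using moebius_form[OF g] by metis
  have "((\<lambda>z. c * mob a z) has_field_derivative c * (of_real (1 - (norm a)\<^sup>2) / (1 - cnj a * z)\<^sup>2)) (at z)"
    by (rule DERIV_cmult[OF mob_derivative[OF a(1) z]])
  then have "(\<gamma> has_field_derivative c * (of_real (1 - (norm a)\<^sup>2) / (1 - cnj a * z)\<^sup>2)) (at z)"
    by (rule has_field_derivative_transform_within_open[of _ _ _ unit_disc]) (use z eq in auto)
  then have "deriv \<gamma> z = c * (of_real (1 - (norm a)\<^sup>2) / (1 - cnj a * z)\<^sup>2)"
    by (rule DERIV_imp_deriv)
  then have nd: "norm (deriv \<gamma> z) = (1 - (norm a)\<^sup>2) / (norm (1 - cnj a * z))\<^sup>2"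
    using a one_minus_norm_sq_pos[OF a(1)] by (simp add: norm_mult norm_divide norm_power del: of_real_diff)
  show "norm (deriv \<gamma> z) * (1 - (norm z)\<^sup>2) = 1 - (norm (\<gamma> z))\<^sup>2"
    using one_minus_norm_mob_sq[OF a(1) z] a(2) by (simp add: nd eq[OF z] norm_mult)
  have "eps \<gamma> = 1 - (norm a)\<^sup>2"
    using a(2) by (simp add: eps_def eq norm_mult mob_def)
  moreover have "(1 - norm z)\<^sup>2 \<le> (norm (1 - cnj a * z))\<^sup>2"
    using mob_denominator[OF a(1) z] z by (intro power_mono) auto
  ultimately show "norm (deriv \<gamma> z) \<le> eps \<gamma> / (1 - norm z)\<^sup>2"
    using z one_minus_norm_sq_pos[OF a(1)] unfolding nd by (intro frac_le) auto
  show "deriv \<gamma> z \<noteq> 0"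
    using nd one_minus_norm_sq_pos[OF a(1)] mob_denominator_nz[OF a(1) z] by auto
qed

lemma hypQ_invariant:
  assumes g: "\<gamma> \<in> \<Gamma>" and "norm a < 1" "norm w < 1"
  shows "hypQ (\<gamma> a) (\<gamma> w) = hypQ a w"
proof -
  obtain b c where b: "norm b < 1" "norm c = 1" and eq: "\<And>z. norm z < 1 \<Longrightarrow> \<gamma> z = c * mob b z"
    using moebius_form[OF g] by metis
  have "cnj c * c = 1" using b(2) by (simp add: complex_norm_square[symmetric] mult.commute)
  then have "(cnj c * c) * (cnj (mob b a) * mob b w) = cnj (mob b a) * mob b w" by simp
  then have e1: "cnj c * cnj (mob b a) * (c * mob b w) = cnj (mob b a) * mob b w"
    by (simp only: mult_ac)
  then show ?thesis using hypQ_mob[OF b(1) assms(2,3)]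
    unfolding hypQ_def eq[OF assms(2)] eq[OF assms(3)] complex_cnj_mult e1 norm_mult b(2)
    by simp
qed

lemma deriv_compose:
  assumes "\<gamma> \<in> \<Gamma>" "\<delta> \<in> \<Gamma>" "norm z < 1"
  shows "deriv (compose unit_disc \<gamma> \<delta>) z = deriv \<gamma> (\<delta> z) * deriv \<delta> z"
proof -
  have "(\<delta> has_field_derivative deriv \<delta> z) (at z)"
    by (rule holomorphic_derivI[OF hol[OF assms(2)]]) (use assms in auto)
  moreover have "(\<gamma> has_field_derivative deriv \<gamma> (\<delta> z)) (at (\<delta> z))"
    by (rule holomorphic_derivI[OF hol[OF assms(1)]]) (use assms maps in auto)
  ultimately have "(\<gamma> \<circ> \<delta> has_field_derivative deriv \<gamma> (\<delta> z) * deriv \<delta> z) (at z)"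
    by (intro DERIV_chain)
  then have "(compose unit_disc \<gamma> \<delta> has_field_derivative deriv \<gamma> (\<delta> z) * deriv \<delta> z) (at z)"
    by (rule has_field_derivative_transform_within_open[of _ _ _ unit_disc]) (use assms in auto)
  then show ?thesis by (rule DERIV_imp_deriv)
qed

lemma deriv_disc_id: "norm z < 1 \<Longrightarrow> deriv disc_id z = 1"
  by (rule DERIV_imp_deriv, rule has_field_derivative_transform_within_open[of "\<lambda>z. z" _ _ unit_disc])
    auto

text \<open>By freeness infinitely many such elements would give infinitely many orbit points of 0
  in a closed disc of radius below 1. Near an accumulation point two of them are joined by a group
  element that violates \<open>discrete\<close>.\<close>

lemma finite_eps_ge:
  assumes "0 < e"
  shows "finite {\<gamma>\<in>\<Gamma>. e \<le> eps \<gamma>}" (is "finite ?A")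
proof (rule ccontr)
  assume inf: "infinite ?A"
  have inj: "inj_on (\<lambda>\<gamma>. \<gamma> 0) ?A" by (rule inj_onI) (use free2[of _ _ 0] in auto)
  define R where "R = sqrt (1 - e)"
  have R: "norm (\<gamma> 0) \<le> R" if "\<gamma> \<in> ?A" for \<gamma>
    using that unfolding R_def by (intro real_le_rsqrt) (auto simp: eps_def)
  have R1: "R < 1" using assms by (simp add: R_def)
  let ?B = "(\<lambda>\<gamma>. \<gamma> 0) ` ?A"
  have "infinite ?B" using inf inj finite_image_iff by blast
  moreover have "?B \<subseteq> cball 0 R" using R by auto
  moreover have "\<forall>T. infinite T \<and> T \<subseteq> cball 0 R \<longrightarrow> (\<exists>x\<in>cball (0::complex) R. x islimpt T)"
    using compact_cball[of "0::complex" R] unfolding compact_eq_Bolzano_Weierstrass .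
  ultimately obtain z where z: "z \<in> cball 0 R" "z islimpt ?B" by blast
  have z1: "norm z < 1" using z(1) R1 by simp
  then obtain r where r: "r > 0" "\<And>\<gamma> w. \<gamma> \<in> \<Gamma> \<Longrightarrow> norm w < 1 \<Longrightarrow> dist z w < r \<Longrightarrow> dist z (\<gamma> w) < r \<Longrightarrow> \<gamma> = disc_id"
    using discrete by blast
  have inf2: "infinite (?B \<inter> ball z r)" using z(2) r(1) islimpt_eq_infinite_ball by blast
  then obtain p where p: "p \<in> ?B \<inter> ball z r" by (metis ex_in_conv finite.emptyI)
  have "infinite (?B \<inter> ball z r - {p})" using inf2 by simp
  then obtain q where "q \<in> ?B \<inter> ball z r - {p}" by (metis ex_in_conv finite.emptyI)
  then obtain \<gamma> \<delta> where gd: "\<gamma> \<in> \<Gamma>" "\<delta> \<in> \<Gamma>" "dist z (\<gamma> 0) < r" "dist z (\<delta> 0) < r" "\<gamma> 0 \<noteq> \<delta> 0"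
    using p by auto
  have "compose unit_disc \<delta> (ginv \<gamma>) = disc_id"
    by (rule r(2)[of _ "\<gamma> 0"]) (use gd maps ginv_in comp_in ginv_left_apply in auto)
  then have "compose unit_disc \<delta> (ginv \<gamma>) (\<gamma> 0) = \<gamma> 0" using maps[OF gd(1)] by simp
  then show False using gd maps[OF gd(1)] ginv_left_apply[OF gd(1)] by simp
qed

section \<open>Word length against hyperbolic distance\<close>

lemma eps_ginv:
  assumes "\<gamma> \<in> \<Gamma>"
  shows "eps (ginv \<gamma>) = eps \<gamma>"
proof -
  \<comment> \<open>Invariance under \<gamma> turns the distance from \<open>ginv \<gamma> 0\<close>
    to 0 into that from 0 to \<open>\<gamma> 0\<close>.\<close>
  have "hypQ (\<gamma> (ginv \<gamma> 0)) (\<gamma> 0) = hypQ (ginv \<gamma> 0) 0"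
    using maps[OF ginv_in[OF assms]] by (intro hypQ_invariant assms) auto
  then show ?thesis
    using assms eps_pos[OF assms] eps_pos[OF ginv_in[OF assms]]
    by (simp add: ginv_right_apply hypQ_def eps_def field_simps)
qed

text \<open>An orbit point of large modulus is moved closer to the origin by an element of a fixed finite set.
  So the greedy algorithm bounds the word length of \<open>\<gamma>\<close> by the hyperbolic distance of \<open>\<gamma> 0\<close> from the origin.\<close>

lemma descent:
  obtains e where "0 < e" "e < 1" 
    "\<And>w. norm w < 1 \<Longrightarrow> 1 - (norm w)\<^sup>2 < e \<Longrightarrow>
       \<exists>s\<in>\<Gamma>. e\<^sup>2 \<le> eps s \<and> 2 * (1 - (norm w)\<^sup>2) \<le> 1 - (norm (s w))\<^sup>2"
proof -
  obtain k0 where k0: "k0 < 1" "\<And>z. norm z < 1 \<Longrightarrow> \<exists>\<gamma>\<in>\<Gamma>. norm (\<gamma> z) \<le> k0"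
    using cocompact by blast
  define k where "k = max k0 0"
  have k: "k < 1" "0 \<le> k" "\<And>z. norm z < 1 \<Longrightarrow> \<exists>\<gamma>\<in>\<Gamma>. norm (\<gamma> z) \<le> k"
    using k0 by (auto simp: k_def le_max_iff_disj)
  define e where "e = (1 - k)\<^sup>2 / 2"
  have "(1 - k)\<^sup>2 \<le> 1" using k by (simp add: power_le_one)
  then have e: "0 < e" "e < 1" using k by (auto simp: e_def)
  define r where "r = sqrt (1 - e)"
  have r: "0 < r" "r < 1" "r\<^sup>2 = 1 - e" using e by (auto simp: r_def)
  show ?thesis
  proof (rule that[OF e])
    fix w :: complex assume w: "norm w < 1" "1 - (norm w)\<^sup>2 < e"
    have rw: "r < norm w"
      using w r e by (intro power2_less_imp_less[of r "norm w"]) auto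
    \<comment> \<open>The point of radius \<open>r\<close> on the segment from 0 to
      \<open>w\<close>, where 1 - r^2 = e. The element \<open>s\<close> is chosen for
      \<open>a\<close> and not for \<open>w\<close>, so that its displacement is bounded
      independently of \<open>w\<close>.\<close>
    define a where "a = of_real (r / norm w) * w"
    have w0: "w \<noteq> 0" using rw r by auto
    have na: "norm a = r" using w0 r by (simp add: a_def norm_mult norm_divide)
    then obtain s where s: "s \<in> \<Gamma>" "norm (s a) \<le> k" using k(3)[of a] r by auto
    have sw: "norm (s w) < 1" "norm (s 0) < 1" "norm (s a) < 1" "norm a < 1"
      using maps[OF s(1)] w na r by auto
    \<comment> \<open>Since \<open>s a\<close> lies within radius \<open>k\<close>, the numerator of
      \<open>hypQ (s a) (s v)\<close> is at least (1 - k)^2. The case \<open>v = 0\<close> bounds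
      the displacement of \<open>s\<close>, the case \<open>v = w\<close> shows the gain.\<close>
    have low: "(1 - k)\<^sup>2 / (1 - (norm (s v))\<^sup>2) \<le> hypQ a v" if v: "norm v < 1" for v
    proof -
      have sv: "norm (s v) < 1" using maps[OF s(1) v] .
      have "(1 - k)\<^sup>2 \<le> (norm (1 - cnj (s a) * s v))\<^sup>2"
        using mob_denominator'[OF sw(3) sv] s(2) k by (intro power_mono) auto
      then have "(1 - k)\<^sup>2 / (1 - (norm (s v))\<^sup>2) \<le> hypQ (s a) (s v)"
        unfolding hypQ_def using one_minus_norm_sq_pos[OF sv] one_minus_norm_sq_pos[OF sw(3)]
        by (intro frac_le) (auto simp: mult_le_cancel_right1)
      then show ?thesis using hypQ_invariant[OF s(1) sw(4) v] by simp
    qed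
    have "hypQ a 0 = 1 / e" using na r by (simp add: hypQ_def)
    then have "(1 - k)\<^sup>2 / eps s \<le> 1 / e" using low[of 0] by (simp add: eps_def)
    then have 1: "e * (1 - k)\<^sup>2 \<le> eps s" using eps_pos[OF s(1)] e by (simp add: field_simps)
    have "e\<^sup>2 \<le> e * (1 - k)\<^sup>2"
      unfolding power2_eq_square[of e] using e by (intro mult_left_mono) (auto simp: e_def)
    with 1 have 1: "e\<^sup>2 \<le> eps s" by linarith
    have wp: "0 < 1 - (norm w)\<^sup>2" "0 < 1 - (norm (s w))\<^sup>2" 
      using one_minus_norm_sq_pos[OF w(1)] one_minus_norm_sq_pos[OF sw(1)] by auto
    \<comment> \<open>On a common ray the product is real, so 1 - cnj a * w has modulus at most 1 -
      r^2 = e.\<close>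
    have "cnj a * w = of_real (r * norm w)"
    proof -
      have "cnj a * w = of_real (r / norm w) * (w * cnj w)" by (simp add: a_def)
      also have "\<dots> = of_real (r / norm w * (norm w)\<^sup>2)" by (simp add: complex_norm_square flip: of_real_power)
      also have "r / norm w * (norm w)\<^sup>2 = r * norm w" using rw r by (simp add: power2_eq_square)
      finally show ?thesis .
    qed
    then have "norm (1 - cnj a * w) = \<bar>1 - r * norm w\<bar>"
      by (metis norm_of_real of_real_1 of_real_diff)
    also have "\<dots> = 1 - r * norm w" using r w mult_mono[of r 1 "norm w" 1] by auto
    also have "\<dots> \<le> 1 - r * r" using rw r by simp
    finally have "norm (1 - cnj a * w) \<le> e" using r by (simp add: power2_eq_square)
    then have "(norm (1 - cnj a * w))\<^sup>2 \<le> e\<^sup>2" by (intro power_mono) auto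
    moreover have "hypQ a w = (norm (1 - cnj a * w))\<^sup>2 / (e * (1 - (norm w)\<^sup>2))"
      using na r by (simp add: hypQ_def)
    ultimately have "hypQ a w \<le> e\<^sup>2 / (e * (1 - (norm w)\<^sup>2))"
      using e wp by (simp add: divide_right_mono)
    also have "\<dots> = e / (1 - (norm w)\<^sup>2)" using e by (simp add: power2_eq_square)
    finally have "2 * e / (1 - (norm (s w))\<^sup>2) \<le> e / (1 - (norm w)\<^sup>2)"
      using low[OF w(1)] by (simp add: e_def)
    then have "2 * (1 - (norm w)\<^sup>2) \<le> 1 - (norm (s w))\<^sup>2"
      using wp e mult_le_cancel_left_pos[OF e(1), of "2 * (1 - (norm w)\<^sup>2)" "1 - (norm (s w))\<^sup>2"]
      by (simp add: divide_le_eq le_divide_eq mult_ac)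
    with 1 s(1) show "\<exists>s\<in>\<Gamma>. e\<^sup>2 \<le> eps s \<and> 2 * (1 - (norm w)\<^sup>2) \<le> 1 - (norm (s w))\<^sup>2"
      by blast
  qed
qed

text \<open>Products of \<open>Suc n\<close> letters rather than \<open>n\<close>, so the bounds on
  number and growth carry the exponent \<open>Suc n\<close>. The sets increase in \<open>n\<close>
  once \<open>S\<close> contains the identity.\<close>

primrec words :: "(complex \<Rightarrow> complex) set \<Rightarrow> nat \<Rightarrow> (complex \<Rightarrow> complex) set" where
  "words S 0 = S"
| "words S (Suc n) = (\<lambda>(s, w). compose unit_disc s w) ` (S \<times> words S n)"

lemma words_subset: "S \<subseteq> \<Gamma> \<Longrightarrow> words S n \<subseteq> \<Gamma>"
  by (induction n) (auto intro: comp_in)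

lemma words_card: "finite S \<Longrightarrow> finite (words S n) \<and> card (words S n) \<le> card S ^ Suc n"
proof (induction n)
  case (Suc n)
  have "card (words S (Suc n)) \<le> card (S \<times> words S n)"
    using Suc unfolding words.simps by (intro card_image_le) auto
  also have "\<dots> \<le> card S * card S ^ Suc n"
    using Suc by (simp add: card_cartesian_product)
  finally show ?case using Suc by simp
qed simp

lemma words_mono:
  assumes "S \<subseteq> \<Gamma>" "disc_id \<in> S"
  shows "words S n \<subseteq> words S (Suc n)"
proof
  fix w assume w: "w \<in> words S n"
  then have "compose unit_disc disc_id w = w"
    using words_subset[OF assms(1)] compose_disc_id by blast
  then show "w \<in> words S (Suc n)"
    unfolding words.simps by (intro image_eqI[of _ _ "(disc_id, w)"]) (use assms w in auto)
qed

lemma words_mono0: "S \<subseteq> \<Gamma> \<Longrightarrow> disc_id \<in> S \<Longrightarrow> S \<subseteq> words S n"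
proof (induction n)
  case (Suc n)
  then show ?case using words_mono[of S n] by blast
qed simp

text \<open>Every descent step at least doubles \<open>eps\<close>, so \<open>n\<close> steps lift
  it from e / 2^n to e, and what remains is a letter because e^2 \<le> e. The letters are the
  elements with \<open>eps\<close> at least e^2; this set is closed under inversion, so the steps
  can be undone inside it.\<close>

lemma word_length:
  obtains S e where "finite S" "S \<subseteq> \<Gamma>" "disc_id \<in> S" "0 < e" "e \<le> 1"
    "\<And>\<gamma> n. \<gamma> \<in> \<Gamma> \<Longrightarrow> e / 2 ^ n \<le> eps \<gamma> \<Longrightarrow> \<gamma> \<in> words S n"
proof -
  obtain e where e: "0 < e" "e < 1" and d: "\<And>w. norm w < 1 \<Longrightarrow> 1 - (norm w)\<^sup>2 < e \<Longrightarrow>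
       \<exists>s\<in>\<Gamma>. e\<^sup>2 \<le> eps s \<and> 2 * (1 - (norm w)\<^sup>2) \<le> 1 - (norm (s w))\<^sup>2"
    using descent by metis
  define S where "S = {\<gamma>\<in>\<Gamma>. e\<^sup>2 \<le> eps \<gamma>}"
  have e2: "e\<^sup>2 \<le> e" using e by (simp add: power2_eq_square mult_le_cancel_left1)
  have S: "finite S" "S \<subseteq> \<Gamma>" "disc_id \<in> S"
    using finite_eps_ge[of "e\<^sup>2"] e e2 id_in by (auto simp: S_def eps_def)
  have "\<gamma> \<in> words S n" if "\<gamma> \<in> \<Gamma>" "e / 2 ^ n \<le> eps \<gamma>" for \<gamma> n
    using that
  proof (induction n arbitrary: \<gamma>)
    case 0
    then show ?case using e2 by (simp add: S_def)
  next
    case (Suc n)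
    show ?case
    proof (cases "e \<le> eps \<gamma>")
      case True
      then have "\<gamma> \<in> S" using Suc.prems e2 by (simp add: S_def)
      then show ?thesis using words_mono0[OF S(2,3)] by blast
    next
      case False
      then obtain s where s: "s \<in> \<Gamma>" "e\<^sup>2 \<le> eps s" "2 * eps \<gamma> \<le> 1 - (norm (s (\<gamma> 0)))\<^sup>2"
        using d[of "\<gamma> 0"] maps[OF Suc.prems(1), of 0] by (auto simp: eps_def)
      have "e / 2 ^ n \<le> eps (compose unit_disc s \<gamma>)"
      proof -
        have "e / 2 ^ n = 2 * (e / 2 ^ Suc n)" by simp
        then show ?thesis using Suc.prems(2) s(3) unfolding eps_def by simp
      qed
      then have "compose unit_disc s \<gamma> \<in> words S n"
        by (intro Suc.IH comp_in s Suc.prems)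
      moreover have "ginv s \<in> S" using s by (simp add: S_def ginv_in eps_ginv)
      ultimately have "compose unit_disc (ginv s) (compose unit_disc s \<gamma>) \<in> words S (Suc n)" by auto
      then show ?thesis
        using Suc.prems s by (simp add: compose_assoc_group ginv_in ginv_left compose_disc_id del: words.simps)
    qed
  qed
  with S e show ?thesis by (intro that) auto
qed

text \<open>Both the number of words and submultiplicative quantities grow at most exponentially in the word length,
  whereas \<open>eps\<close> decays exponentially.\<close>

lemma summable_eps:
  fixes P :: "(complex \<Rightarrow> complex) \<Rightarrow> real \<Rightarrow> bool"
  assumes P1: "\<And>\<gamma>. \<gamma> \<in> \<Gamma> \<Longrightarrow> \<exists>L. P \<gamma> L"
    and P2: "\<And>\<gamma> L L'. \<gamma> \<in> \<Gamma> \<Longrightarrow> P \<gamma> L \<Longrightarrow> L \<le> L' \<Longrightarrow> P \<gamma> L'"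
    and P3: "\<And>\<gamma> \<delta> L L'. \<gamma> \<in> \<Gamma> \<Longrightarrow> \<delta> \<in> \<Gamma> \<Longrightarrow> 1 \<le> L \<Longrightarrow> 1 \<le> L' \<Longrightarrow> P \<gamma> L \<Longrightarrow> P \<delta> L' \<Longrightarrow> P (compose unit_disc \<gamma> \<delta>) (L * L')"
  obtains N m0 where "\<And>\<gamma>. \<gamma> \<in> \<Gamma> \<Longrightarrow> P \<gamma> (N \<gamma>)" "\<And>\<gamma>. 1 \<le> N \<gamma>"
    "\<And>m. m0 \<le> m \<Longrightarrow> (\<lambda>\<gamma>. eps \<gamma> ^ m * N \<gamma>) summable_on \<Gamma>"
proof -
  obtain S e where S: "finite S" "S \<subseteq> \<Gamma>" "disc_id \<in> S" and e: "0 < e" "e \<le> 1" and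
    W: "\<And>\<gamma> n. \<gamma> \<in> \<Gamma> \<Longrightarrow> e / 2 ^ n \<le> eps \<gamma> \<Longrightarrow> \<gamma> \<in> words S n"
    using word_length by metis
  obtain l where l: "\<And>\<gamma>. \<gamma> \<in> \<Gamma> \<Longrightarrow> P \<gamma> (l \<gamma>)" using P1 by metis
  define L where "L = Max (insert 1 (l ` S))"
  have L: "1 \<le> L" "\<And>s. s \<in> S \<Longrightarrow> l s \<le> L" using S by (auto simp: L_def)
  have PS: "P s L" if "s \<in> S" for s using P2[OF _ l L(2)[OF that]] S that by blast
  have PW: "P w (L ^ Suc n)" if "w \<in> words S n" for w n
    using that
  proof (induction n arbitrary: w)
    case (Suc n)
    then obtain s v where "s \<in> S" "v \<in> words S n" and w: "w = compose unit_disc s v" by auto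
    then show ?case unfolding w power_Suc[of L "Suc n"]
      using S words_subset[OF S(2), of n] L PS Suc.IH[of v] by (intro P3) (auto intro!: one_le_power simp del: power_Suc)
  qed (simp add: PS)
  \<comment> \<open>An element of level n is a word of n + 1 letters, while its \<open>eps\<close>
    is at most 2 / 2^n; the 2 comes from comparing with the preceding level.\<close>
  define lev where "lev \<gamma> = (LEAST n. e / 2 ^ n \<le> eps \<gamma>)" for \<gamma>
  define N where "N \<gamma> = L ^ Suc (lev \<gamma>)" for \<gamma>
  have lev: "e / 2 ^ lev \<gamma> \<le> eps \<gamma>" if "\<gamma> \<in> \<Gamma>" for \<gamma>
  proof -
    obtain n where "1 / eps \<gamma> < 2 ^ n" using real_arch_pow[of 2 "1 / eps \<gamma>"] by auto
    then have "1 / 2 ^ n \<le> eps \<gamma>" using eps_pos[OF that] by (simp add: field_simps)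
    moreover have "e / 2 ^ n \<le> 1 / 2 ^ n" using e by (simp add: divide_right_mono)
    ultimately have "e / 2 ^ n \<le> eps \<gamma>" by linarith
    then show ?thesis unfolding lev_def by (rule LeastI)
  qed
  have lev2: "eps \<gamma> \<le> 2 / 2 ^ lev \<gamma>" for \<gamma>
  proof (cases "lev \<gamma>")
    case 0
    then show ?thesis using eps_le_1[of \<gamma>] by simp
  next
    case (Suc n)
    then have "\<not> e / 2 ^ n \<le> eps \<gamma>" unfolding lev_def by (metis lessI not_less_Least)
    then have "eps \<gamma> \<le> e / 2 ^ n" by simp
    also have "\<dots> \<le> 1 / 2 ^ n" using e by (simp add: divide_right_mono)
    finally show ?thesis using Suc by simp
  qed
  \<comment> \<open>Growth per letter of the number of words times the constant. Level n contributes
    at most 2^m c (c / 2^m)^n, and \<open>m0\<close> makes the ratio at most 1/2.\<close>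
  define c where "c = real (card S) * L"
  have "0 < card S" using S card_gt_0_iff by blast
  then have c: "1 \<le> c" using L mult_mono[of 1 "real (card S)" 1 L] by (auto simp: c_def)
  obtain m0 where m0: "2 * c < 2 ^ m0" using real_arch_pow[of 2 "2 * c"] by auto
  have sumN: "(\<lambda>\<gamma>. eps \<gamma> ^ m * N \<gamma>) summable_on \<Gamma>" if m: "m0 \<le> m" for m
  proof (rule nonneg_bdd_above_summable_on)
    show "0 \<le> eps \<gamma> ^ m * N \<gamma>" if "\<gamma> \<in> \<Gamma>" for \<gamma>
      using eps_pos[OF that] L by (simp add: N_def)
    show "bdd_above (sum (\<lambda>\<gamma>. eps \<gamma> ^ m * N \<gamma>) ` {F. F \<subseteq> \<Gamma> \<and> finite F})"
    proof (rule bdd_aboveI2)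
      fix F assume "F \<in> {F. F \<subseteq> \<Gamma> \<and> finite F}"
      then have F: "F \<subseteq> \<Gamma>" "finite F" by auto
      have two: "2 * c \<le> 2 ^ m"
        by (rule order.trans[OF less_imp_le[OF m0] power_increasing[OF m]]) simp
      have "(\<Sum>\<gamma>\<in>F. eps \<gamma> ^ m * N \<gamma>) = (\<Sum>n\<in>lev ` F. \<Sum>\<gamma>\<in>{\<gamma>\<in>F. lev \<gamma> = n}. eps \<gamma> ^ m * N \<gamma>)"
        by (rule sum.image_gen[OF F(2)])
      also have "\<dots> \<le> (\<Sum>n\<in>lev ` F. 2 ^ m * c * (1/2) ^ n)"
      proof (rule sum_mono)
        fix n
        have "{\<gamma>\<in>F. lev \<gamma> = n} \<subseteq> words S n" using W lev F by blast
        then have "card {\<gamma>\<in>F. lev \<gamma> = n} \<le> card S ^ Suc n"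
          using words_card[OF S(1), of n] card_mono[of "words S n"] order.trans by blast
        then have cd: "real (card {\<gamma>\<in>F. lev \<gamma> = n}) \<le> real (card S) ^ Suc n"
          unfolding of_nat_power[symmetric] of_nat_le_iff .
        have "(\<Sum>\<gamma>\<in>{\<gamma>\<in>F. lev \<gamma> = n}. eps \<gamma> ^ m * N \<gamma>) \<le> (\<Sum>\<gamma>\<in>{\<gamma>\<in>F. lev \<gamma> = n}. (2 / 2 ^ n) ^ m * L ^ Suc n)"
        proof (rule sum_mono)
          fix \<gamma> assume "\<gamma> \<in> {\<gamma>\<in>F. lev \<gamma> = n}"
          then have g: "\<gamma> \<in> \<Gamma>" "lev \<gamma> = n" using F by auto
          show "eps \<gamma> ^ m * N \<gamma> \<le> (2 / 2 ^ n) ^ m * L ^ Suc n"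
            using lev2[of \<gamma>] eps_pos[OF g(1)] L unfolding N_def g(2)
            by (intro mult_right_mono power_mono) auto
        qed
        also have "\<dots> = real (card {\<gamma>\<in>F. lev \<gamma> = n}) * ((2 / 2 ^ n) ^ m * L ^ Suc n)" by simp
        also have "\<dots> \<le> real (card S) ^ Suc n * ((2 / 2 ^ n) ^ m * L ^ Suc n)"
          using cd L by (intro mult_right_mono) auto
        also have "\<dots> = 2 ^ m * c * (c / 2 ^ m) ^ n"
        proof -
          have "((2::real) ^ n) ^ m = (2 ^ m) ^ n" by (metis power_mult mult.commute)
          then show ?thesis by (simp add: c_def power_mult_distrib power_divide)
        qed
        also have "\<dots> \<le> 2 ^ m * c * (1/2) ^ n"
          using two c by (intro mult_left_mono power_mono) (auto simp: field_simps)
        finally show "(\<Sum>\<gamma>\<in>{\<gamma>\<in>F. lev \<gamma> = n}. eps \<gamma> ^ m * N \<gamma>) \<le> 2 ^ m * c * (1/2) ^ n" .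
      qed
      also have "\<dots> \<le> suminf (\<lambda>n. 2 ^ m * c * (1/2) ^ n)"
        using c F by (intro sum_le_suminf summable_mult summable_geometric) auto
      finally show "(\<Sum>\<gamma>\<in>F. eps \<gamma> ^ m * N \<gamma>) \<le> suminf (\<lambda>n. 2 ^ m * c * (1/2) ^ n)" .
    qed
  qed
  show ?thesis
  proof (rule that[of N m0])
    show "P \<gamma> (N \<gamma>)" if "\<gamma> \<in> \<Gamma>" for \<gamma>
      unfolding N_def by (rule PW[OF W[OF that lev[OF that]]])
  qed (use L sumN in \<open>auto simp: N_def intro: one_le_power simp del: power_Suc\<close>)
qed

end

section \<open>Compact manifolds\<close>

lemma continuous_map_locally:
  assumes "\<And>x. x \<in> topspace X \<Longrightarrow> \<exists>U. openin X U \<and> x \<in> U \<and> continuous_map (subtopology X U) Y f"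
  shows "continuous_map X Y f"
proof -
  obtain U where U: "\<And>x. x \<in> topspace X \<Longrightarrow> openin X (U x) \<and> x \<in> U x \<and> continuous_map (subtopology X (U x)) Y f"
    using assms by metis
  show ?thesis
    by (rule pasting_lemma[of "topspace X" X U Y "\<lambda>_. f"]) (use U in auto)
qed

lemma finite_uniform_bound:
  fixes P :: "'i \<Rightarrow> real \<Rightarrow> bool"
  assumes "finite A" "\<And>a. a \<in> A \<Longrightarrow> \<exists>B. P a B" "\<And>a B B'. P a B \<Longrightarrow> B \<le> B' \<Longrightarrow> P a B'"
  shows "\<exists>B\<ge>0. \<forall>a\<in>A. P a B"
  using assms(1,2)
proof (induction A rule: finite_induct)
  case (insert a A)
  then obtain B B' where "0 \<le> B" "\<forall>a\<in>A. P a B" "P a B'" by blast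
  then have "\<forall>x\<in>insert a A. P x (max B B')" 
    using assms(3)[of _ B "max B B'"] assms(3)[of _ B' "max B B'"] by simp
  moreover have "0 \<le> max B B'" using \<open>0 \<le> B\<close> by simp
  ultimately show ?case by blast
qed auto

lemma
  fixes s :: real
  shows max_sq_has_derivative: "((\<lambda>s. (max 0 s)\<^sup>2) has_real_derivative 2 * max 0 s) (at s)"
proof -
  consider "s < 0" | "s = 0" | "s > 0" by linarith
  then show ?thesis
  proof cases
    case 1
    show ?thesis
      by (rule has_field_derivative_transform_within_open[of "\<lambda>s. 0" _ _ "{..<0}"]) (use 1 in auto)
  next
    case 2
    have "((\<lambda>h. (max 0 h)\<^sup>2 / h) \<longlongrightarrow> 0) (at (0::real))"
    proof (rule Lim_null_comparison)
      show "\<forall>\<^sub>F h in at (0::real). norm ((max 0 h)\<^sup>2 / h) \<le> \<bar>h\<bar>"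
        by (auto simp: max_def power2_eq_square intro!: always_eventually)
      show "((\<lambda>h. \<bar>h\<bar>) \<longlongrightarrow> 0) (at (0::real))" by (intro tendsto_eq_intros) auto
    qed
    then show ?thesis using 2 by (simp add: DERIV_def)
  next
    case 3
    have "((\<lambda>s. s\<^sup>2) has_real_derivative 2 * s) (at s)" by (auto intro!: derivative_eq_intros)
    then show ?thesis using 3
      by (rule_tac has_field_derivative_transform_within_open[of "\<lambda>s. s\<^sup>2" _ _ "{0<..}"]) auto
  qed
qed

text \<open>The squared positive part of 1 - |x - x0|^2 / \<rho>^2 has just the C1 regularity in
  play. Its maximum lies at \<open>x0\<close>, so its derivative vanishes there; multiplication by
  it therefore changes neither the value nor the differential of a function at
  \<open>x0\<close>.\<close>

lemma bump_function:
  fixes x0 :: "'e::finite_dim_inner"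
  assumes "0 < \<rho>"
  obtains \<beta> :: "'e \<Rightarrow> complex" where "C1 UNIV \<beta>" "\<beta> x0 = 1" "\<And>x. norm (\<beta> x) \<le> 1"
    "\<And>v. fder \<beta> x0 v = 0" "\<And>x. x \<notin> cball x0 \<rho> \<Longrightarrow> \<beta> x = 0"
proof -
  define \<beta>' :: "'e \<Rightarrow> 'e \<Rightarrow> complex" where "\<beta>' x v = of_real (- 4 * max 0 (1 - ((x - x0) \<bullet> (x - x0)) / \<rho>\<^sup>2) * ((x - x0) \<bullet> v) / \<rho>\<^sup>2 :: real)"
    for x v :: 'e
  define q where "q x = 1 - ((x - x0) \<bullet> (x - x0)) / \<rho>\<^sup>2" for x :: 'e
  define \<beta> where "\<beta> x = complex_of_real ((max 0 (q x))\<^sup>2)" for x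
  have q: "(q has_derivative (\<lambda>v. - (2 * ((x - x0) \<bullet> v) / \<rho>\<^sup>2))) (at x)" for x
    unfolding q_def using assms
    by (auto intro!: derivative_eq_intros simp: inner_commute field_simps)
  have d: "(\<beta> has_derivative \<beta>' x) (at x)" for x
  proof -
    have "((\<lambda>x. (max 0 (q x))\<^sup>2) has_derivative (\<lambda>v. (- (2 * ((x - x0) \<bullet> v) / \<rho>\<^sup>2)) * (2 * max 0 (q x)))) (at x)"
      using has_derivative_compose[OF q max_sq_has_derivative[of "q x", unfolded has_field_derivative_def]]
      by (simp add: mult.commute)
    then have "((\<lambda>x. complex_of_real ((max 0 (q x))\<^sup>2)) has_derivative
        (\<lambda>v. of_real ((- (2 * ((x - x0) \<bullet> v) / \<rho>\<^sup>2)) * (2 * max 0 (q x))))) (at x)"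
      by (rule has_derivative_of_real)
    moreover have "(- (2 * ((x - x0) \<bullet> v) / \<rho>\<^sup>2)) * (2 * max 0 (q x)) =
        - 4 * max 0 (1 - ((x - x0) \<bullet> (x - x0)) / \<rho>\<^sup>2) * ((x - x0) \<bullet> v) / \<rho>\<^sup>2" for v
      by (simp add: q_def)
    ultimately show ?thesis unfolding \<beta>_def[abs_def] \<beta>'_def[abs_def] by (simp only:)
  qed
  have "C1 UNIV \<beta>"
    by (rule C1_I[OF d]) (use assms in \<open>auto simp: \<beta>'_def intro!: continuous_intros\<close>)
  moreover have "\<beta> x0 = 1" by (simp add: \<beta>_def q_def)
  moreover have "norm (\<beta> x) \<le> 1" for x
  proof -
    have "q x \<le> 1" by (simp add: q_def)
    then have "(max 0 (q x))\<^sup>2 \<le> 1\<^sup>2" by (intro power_mono) auto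
    then show ?thesis by (simp add: \<beta>_def norm_power)
  qed
  moreover have "fder \<beta> x0 v = 0" for v using fder_eq[OF d, of x0] by (simp add: \<beta>'_def)
  moreover have "\<beta> x = 0" if "x \<notin> cball x0 \<rho>" for x
  proof -
    have "\<rho> < norm (x - x0)" using that by (simp add: dist_norm norm_minus_commute)
    then have "\<rho>\<^sup>2 < (x - x0) \<bullet> (x - x0)"
      using assms by (simp add: dot_square_norm power_strict_mono)
    then have "q x < 0" using assms by (simp add: q_def)
    then show ?thesis by (simp add: \<beta>_def)
  qed
  ultimately show ?thesis by (rule that)
qed

text \<open>The topological core alone, because it serves twice: for the manifold \<open>T\<close>
  and for the compact Riemann surface at the base.\<close>

locale compact_atlas =
  fixes T :: "'t topology" and AT :: "('t, 'e::finite_dim_inner) chart set"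
  assumes atlas: "topological_atlas T AT" and Hausdorff: "Hausdorff_space T" and cmp: "compact_space T"
begin

lemma chart_cover: "t \<in> topspace T \<Longrightarrow> \<exists>V d. (V, d) \<in> AT \<and> t \<in> V"
  using atlas unfolding topological_atlas_def by blast

context
  fixes V d assumes chart: "(V, d) \<in> AT"
begin

lemma chart_open: "openin T V" and chart_image_open: "open (d ` V)"
  and chart_homeomorphic: "homeomorphic_map (subtopology T V) (top_of_set (d ` V)) d"
  using atlas chart unfolding topological_atlas_def by blast+

lemma chart_subset: "V \<subseteq> topspace T"
  using chart_open by (rule openin_subset)

lemma chart_topspace: "topspace (subtopology T V) = V"
  using chart_subset by auto

lemma chart_inj: "inj_on d V"
  using homeomorphic_imp_injective_map[OF chart_homeomorphic] unfolding chart_topspace .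

lemma chart_inv: "x \<in> d ` V \<Longrightarrow> inv_into V d x \<in> V" "x \<in> d ` V \<Longrightarrow> d (inv_into V d x) = x"
  "t \<in> V \<Longrightarrow> inv_into V d (d t) = t"
  using chart_inj by (auto simp: inv_into_into f_inv_into_f)

lemma chart_continuous: "continuous_map (subtopology T V) euclidean d"
  using homeomorphic_imp_continuous_map[OF chart_homeomorphic]
  by (simp add: continuous_map_in_subtopology)

lemma chart_image_openin:
  assumes "openin T W"
  shows "open (d ` (V \<inter> W))"
proof -
  have "openin (subtopology T V) (V \<inter> W)"
    using assms by (metis inf_commute openin_subtopology)
  then have "openin (top_of_set (d ` V)) (d ` (V \<inter> W))"
    using homeomorphic_imp_open_map[OF chart_homeomorphic] by (simp add: open_map_def)
  then show ?thesis using chart_image_open openin_open_trans by blast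
qed

lemma chart_preimage_openin:
  assumes "open W"
  shows "openin T {t \<in> V. d t \<in> W}"
proof -
  have "openin (subtopology T V) {t \<in> topspace (subtopology T V). d t \<in> W}"
    by (rule openin_continuous_map_preimage[OF chart_continuous]) (use assms in simp)
  then show ?thesis
    using openin_trans_full[OF _ chart_open] unfolding chart_topspace by blast
qed

lemma chart_image_compact:
  assumes "compactin T C" "C \<subseteq> V"
  shows "compact (d ` C)"
proof -
  have "compactin (subtopology T V) C" using assms by (simp add: compactin_subtopology)
  from image_compactin[OF this chart_continuous] show ?thesis by simp
qed

end

lemma closed_neighbourhood:
  assumes "openin T W" "t \<in> W"
  obtains G C where "openin T G" "closedin T C" "t \<in> G" "G \<subseteq> C" "C \<subseteq> W"
proof -
  have "regular_space T" using cmp Hausdorff by (simp add: compact_Hausdorff_imp_regular_space)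
  then have "neighbourhood_base_of (closedin T) T" by (simp add: neighbourhood_base_of_closedin)
  then show ?thesis using assms that unfolding neighbourhood_base_of by metis
qed

text \<open>Extension by zero requires a set closed in all of \<open>T\<close>. Regularity supplies
  a closed neighbourhood inside the chart first, and the ball is shrunk into it.\<close>

lemma chart_ball:
  assumes c: "(V, d) \<in> AT" and t0: "t0 \<in> V" and W: "openin T W" "t0 \<in> W"
  obtains \<rho> where "0 < \<rho>" "cball (d t0) \<rho> \<subseteq> d ` V" "closedin T {t \<in> V. d t \<in> cball (d t0) \<rho>}"
    "{t \<in> V. d t \<in> cball (d t0) \<rho>} \<subseteq> W"
proof -
  have "openin T (V \<inter> W)" "t0 \<in> V \<inter> W" using W t0 chart_open[OF c] by auto
  then obtain G C where G: "openin T G" "closedin T C" "t0 \<in> G" "G \<subseteq> C" "C \<subseteq> V \<inter> W"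
    by (rule closed_neighbourhood)
  have "open (d ` (V \<inter> G))" "d t0 \<in> d ` (V \<inter> G)" using chart_image_openin[OF c G(1)] G t0 by auto
  then obtain \<rho> where \<rho>: "0 < \<rho>" "cball (d t0) \<rho> \<subseteq> d ` (V \<inter> G)"
    using open_contains_cball by blast
  define Z where "Z = {t \<in> V. d t \<in> cball (d t0) \<rho>}"
  have ZG: "t \<in> G" if tZ: "t \<in> Z" for t
  proof -
    obtain s where "s \<in> V" "s \<in> G" "d t = d s" using tZ \<rho>(2) unfolding Z_def by blast
    then show ?thesis using inj_onD[OF chart_inj[OF c], of t s] tZ by (simp add: Z_def)
  qed
  \<comment> \<open>The complement of \<open>Z\<close> is covered by two open sets: the points
    outside \<open>C\<close>, and the points of the chart outside the ball.\<close>
  have "openin T (topspace T - C)" using G(2) by blast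
  moreover have "openin T {t \<in> V. d t \<in> - cball (d t0) \<rho>}"
    by (rule chart_preimage_openin[OF c]) auto
  ultimately have "openin T ((topspace T - C) \<union> {t \<in> V. d t \<in> - cball (d t0) \<rho>})" by blast
  moreover have "(topspace T - C) \<union> {t \<in> V. d t \<in> - cball (d t0) \<rho>} = topspace T - Z"
    using ZG G chart_subset[OF c] by (auto simp: Z_def)
  ultimately have "closedin T Z" using chart_subset[OF c] by (auto simp: closedin_def Z_def)
  moreover have "Z \<subseteq> W" using ZG G by blast
  ultimately show ?thesis using that[of \<rho>] \<rho> by (auto simp: Z_def)
qed

text \<open>Differentials may blow up towards the boundary of a chart domain, so each chart is
  paired with a compact part of it, and the interiors of these parts still cover.\<close>

lemma ex_compact_cover:
  "\<exists>\<C>. finite \<C> \<and> (\<forall>(V, d, C)\<in>\<C>. (V, d) \<in> AT \<and> compactin T C \<and> C \<subseteq> V) \<and>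
     (\<forall>t\<in>topspace T. \<exists>(V, d, C)\<in>\<C>. \<exists>G. openin T G \<and> t \<in> G \<and> G \<subseteq> C)"
proof -
  have "\<exists>V d G C. (V, d) \<in> AT \<and> openin T G \<and> closedin T C \<and> t \<in> G \<and> G \<subseteq> C \<and> C \<subseteq> V" if tT: "t \<in> topspace T" for t
  proof -
    obtain V d where c: "(V, d) \<in> AT" "t \<in> V" using chart_cover[OF tT] by blast
    then show ?thesis using closed_neighbourhood[OF chart_open[OF c(1)] c(2)] by metis
  qed
  then obtain V d G C where *: "\<And>t. t \<in> topspace T \<Longrightarrow> (V t, d t) \<in> AT \<and> openin T (G t) \<and> closedin T (C t) \<and> t \<in> G t \<and> G t \<subseteq> C t \<and> C t \<subseteq> V t"
    by metis
  have "(\<forall>U\<in>G ` topspace T. openin T U) \<and> topspace T \<subseteq> \<Union>(G ` topspace T)" using * by auto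
  then have "\<exists>F. finite F \<and> F \<subseteq> G ` topspace T \<and> topspace T \<subseteq> \<Union>F"
    using cmp unfolding compact_space_alt by simp
  then obtain I where I: "finite I" "I \<subseteq> topspace T" "topspace T \<subseteq> \<Union>(G ` I)"
    by (metis finite_subset_image)
  show ?thesis
  proof (intro exI conjI)
    show "finite ((\<lambda>t. (V t, d t, C t)) ` I)" using I by simp
    show "\<forall>(V, d, C)\<in>(\<lambda>t. (V t, d t, C t)) ` I. (V, d) \<in> AT \<and> compactin T C \<and> C \<subseteq> V"
      using * I closedin_compact_space[OF cmp] by auto
    show "\<forall>t\<in>topspace T. \<exists>(V, d, C)\<in>(\<lambda>t. (V t, d t, C t)) ` I. \<exists>G. openin T G \<and> t \<in> G \<and> G \<subseteq> C"
    proof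
      fix t assume "t \<in> topspace T"
      then obtain i where "i \<in> I" "t \<in> G i" using I by auto
      then show "\<exists>(V, d, C)\<in>(\<lambda>t. (V t, d t, C t)) ` I. \<exists>G. openin T G \<and> t \<in> G \<and> G \<subseteq> C"
        using * I by (intro bexI[of _ "(V i, d i, C i)"]) auto
    qed
  qed
qed

end

section \<open>C1 functions on a compact manifold and bounds for their differentials\<close>

locale C1_manifold =
  fixes T :: "'t topology" and AT :: "('t, 'e::finite_dim_inner) chart set"
  assumes manifold: "smooth_manifold T AT" and compact_space_T: "compact_space T"

sublocale C1_manifold \<subseteq> compact_atlas
  using manifold compact_space_T by unfold_locales (simp_all add: smooth_manifold_def)

context C1_manifold
begin

abbreviation "C1self \<psi> \<equiv> Ck_map 1 T AT T AT \<psi>"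

definition C1T :: "('t \<Rightarrow> complex) \<Rightarrow> bool" where
  "C1T k \<longleftrightarrow> (\<forall>(V, d)\<in>AT. C1 (d ` V) (\<lambda>x. k (inv_into V d x)))"

lemma C1T_D: "C1T k \<Longrightarrow> (V, d) \<in> AT \<Longrightarrow> C1 (d ` V) (\<lambda>x. k (inv_into V d x))"
  by (auto simp: C1T_def)

lemma C1self_continuous: "C1self \<psi> \<Longrightarrow> continuous_map T T \<psi>"
  by (simp add: Ck_map_def)

lemma C1self_maps: "C1self \<psi> \<Longrightarrow> t \<in> topspace T \<Longrightarrow> \<psi> t \<in> topspace T"
  using C1self_continuous continuous_map_funspace by fastforce

lemma C1self_chart:
  "C1self \<psi> \<Longrightarrow> (V, d) \<in> AT \<Longrightarrow> (V', d') \<in> AT \<Longrightarrow> C1 (d ` (V \<inter> \<psi> -` V')) (\<lambda>x. d' (\<psi> (inv_into V d x)))"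
  unfolding Ck_map_def C1_def comp_def by blast

lemma C1self_open:
  assumes "C1self \<psi>" "(V, d) \<in> AT" "openin T W"
  shows "open (d ` (V \<inter> \<psi> -` W))"
proof -
  have "openin T {t \<in> topspace T. \<psi> t \<in> W}"
    using C1self_continuous[OF assms(1)] assms(3) by (rule openin_continuous_map_preimage)
  then have "open (d ` (V \<inter> {t \<in> topspace T. \<psi> t \<in> W}))" by (rule chart_image_openin[OF assms(2)])
  moreover have "V \<inter> {t \<in> topspace T. \<psi> t \<in> W} = V \<inter> \<psi> -` W"
    using chart_subset[OF assms(2)] by auto
  ultimately show ?thesis by simp
qed

text \<open>Compatibility of the charts becomes the case of the identity map, so changes of charts
  are covered by the lemmas on self-maps.\<close>

lemma C1self_id: "C1self (\<lambda>t. t)"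
proof -
  have "Ck_on 1 (c ` (U \<inter> V)) (d \<circ> inv_into U c)" if "(U, c) \<in> AT" "(V, d) \<in> AT" for U c V d
    using manifold that unfolding smooth_manifold_def smooth_on_def by blast
  then show ?thesis unfolding Ck_map_def by (auto simp: comp_def simp del: Ck_on.simps One_nat_def)
qed

lemma
  assumes \<psi>: "C1self \<psi>" and c: "(V, d) \<in> AT" "(V', d') \<in> AT"
    and k: "C1 (d' ` V') (\<lambda>x. k (inv_into V' d' x))"
  shows C1_chart_change: "C1 (d ` (V \<inter> \<psi> -` V')) (\<lambda>x. k (\<psi> (inv_into V d x)))"
    and fder_chart_change: "t \<in> V \<Longrightarrow> \<psi> t \<in> V' \<Longrightarrow> fder (\<lambda>x. k (\<psi> (inv_into V d x))) (d t) v =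
      fder (\<lambda>x. k (inv_into V' d' x)) (d' (\<psi> t)) (fder (\<lambda>x. d' (\<psi> (inv_into V d x))) (d t) v)"
proof -
  let ?S = "d ` (V \<inter> \<psi> -` V')"
  have op: "open ?S" by (rule C1self_open[OF \<psi> c(1) chart_open[OF c(2)]])
  have im: "(\<lambda>x. d' (\<psi> (inv_into V d x))) ` ?S \<subseteq> d' ` V'"
    using chart_inv(3)[OF c(1)] by auto
  have eq: "k (inv_into V' d' (d' (\<psi> (inv_into V d x)))) = k (\<psi> (inv_into V d x))" if "x \<in> ?S" for x
    using that chart_inv(3)[OF c(1)] chart_inv(3)[OF c(2)] by auto
  note C = C1self_chart[OF \<psi> c]
  show "C1 ?S (\<lambda>x. k (\<psi> (inv_into V d x)))"
    by (rule C1_cong[OF op eq C1_compose[OF k C im]])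
  assume t: "t \<in> V" "\<psi> t \<in> V'"
  then have dt: "d t \<in> ?S" by auto
  have "fder (\<lambda>x. k (\<psi> (inv_into V d x))) (d t) v = fder (\<lambda>x. k (inv_into V' d' (d' (\<psi> (inv_into V d x))))) (d t) v"
    using fder_cong[OF op dt eq] by simp
  also have "\<dots> = fder (\<lambda>x. k (inv_into V' d' x)) (d' (\<psi> (inv_into V d (d t)))) (fder (\<lambda>x. d' (\<psi> (inv_into V d x))) (d t) v)"
    by (rule fder_compose[OF k C im dt])
  finally show "fder (\<lambda>x. k (\<psi> (inv_into V d x))) (d t) v =
      fder (\<lambda>x. k (inv_into V' d' x)) (d' (\<psi> t)) (fder (\<lambda>x. d' (\<psi> (inv_into V d x))) (d t) v)"
    by (simp add: chart_inv(3)[OF c(1) t(1)])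
qed

lemma C1T_compose:
  assumes k: "C1T k" and \<psi>: "C1self \<psi>"
  shows "C1T (\<lambda>t. k (\<psi> t))"
  unfolding C1T_def
proof safe
  fix V d assume c: "(V, d) \<in> AT"
  show "C1 (d ` V) (\<lambda>x. k (\<psi> (inv_into V d x)))"
  proof (rule C1_local)
    fix x assume "x \<in> d ` V"
    then obtain t where t: "t \<in> V" "x = d t" by auto
    then have "\<psi> t \<in> topspace T" using chart_subset[OF c] C1self_maps[OF \<psi>] by auto
    then obtain V' d' where c': "(V', d') \<in> AT" "\<psi> t \<in> V'" using chart_cover by blast
    show "\<exists>N. open N \<and> x \<in> N \<and> C1 N (\<lambda>x. k (\<psi> (inv_into V d x)))"
      by (rule exI[of _ "d ` (V \<inter> \<psi> -` V')"])
        (use c' t C1_chart_change[OF \<psi> c c'(1) C1T_D[OF k c'(1)]] C1self_open[OF \<psi> c chart_open[OF c'(1)]] in auto)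
  qed
qed

text \<open>One cover is fixed for good, since bounds with respect to different covers could not be
  multiplied without loss.\<close>

definition ccover :: "('t set \<times> ('t \<Rightarrow> 'e) \<times> 't set) set" where
  "ccover = (SOME \<C>. finite \<C> \<and> (\<forall>(V, d, C)\<in>\<C>. (V, d) \<in> AT \<and> compactin T C \<and> C \<subseteq> V) \<and>
     (\<forall>t\<in>topspace T. \<exists>(V, d, C)\<in>\<C>. \<exists>G. openin T G \<and> t \<in> G \<and> G \<subseteq> C))"

lemma finite_ccover: "finite ccover"
  and ccoverD: "(V, d, C) \<in> ccover \<Longrightarrow> (V, d) \<in> AT \<and> compactin T C \<and> C \<subseteq> V"
  and ccover_cover: "t \<in> topspace T \<Longrightarrow> \<exists>V d C G. (V, d, C) \<in> ccover \<and> openin T G \<and> t \<in> G \<and> G \<subseteq> C"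
proof -
  have *: "finite ccover \<and> (\<forall>(V, d, C)\<in>ccover. (V, d) \<in> AT \<and> compactin T C \<and> C \<subseteq> V) \<and>
     (\<forall>t\<in>topspace T. \<exists>(V, d, C)\<in>ccover. \<exists>G. openin T G \<and> t \<in> G \<and> G \<subseteq> C)"
    unfolding ccover_def by (rule someI_ex[OF ex_compact_cover])
  then show "finite ccover" by blast
  show "(V, d) \<in> AT \<and> compactin T C \<and> C \<subseteq> V" if "(V, d, C) \<in> ccover" using * that by blast
  show "\<exists>V d C G. (V, d, C) \<in> ccover \<and> openin T G \<and> t \<in> G \<and> G \<subseteq> C" if "t \<in> topspace T"
    using * that by blast
qed

text \<open>A substitute for the supremum of the norm of the differential with respect to a Riemannian metric.\<close>

definition dbound :: "('t \<Rightarrow> complex) \<Rightarrow> real \<Rightarrow> bool" where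
  "dbound k b \<longleftrightarrow> (\<forall>(V, d, C)\<in>ccover. \<forall>t\<in>C. \<forall>v. norm (fder (\<lambda>x. k (inv_into V d x)) (d t) v) \<le> b * norm v)"

lemma dboundD: "dbound k b \<Longrightarrow> (V, d, C) \<in> ccover \<Longrightarrow> t \<in> C \<Longrightarrow> norm (fder (\<lambda>x. k (inv_into V d x)) (d t) v) \<le> b * norm v"
  unfolding dbound_def by blast

lemma dbound_exists:
  assumes k: "C1T k"
  shows "\<exists>b\<ge>0. dbound k b"
proof -
  define P where "P = (\<lambda>(V::'t set, d::'t \<Rightarrow> 'e, C) b. \<forall>t\<in>C. \<forall>v. norm (fder (\<lambda>x. k (inv_into V d x)) (d t) v) \<le> b * norm v)"
  have "\<exists>b\<ge>0. \<forall>c\<in>ccover. P c b"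
  proof (rule finite_uniform_bound[OF finite_ccover])
    fix c assume "c \<in> ccover"
    then obtain V d C where c: "c = (V, d, C)" "(V, d, C) \<in> ccover" by (cases c) auto
    have c': "(V, d) \<in> AT" "compactin T C" "C \<subseteq> V" using ccoverD[OF c(2)] by auto
    obtain B where "0 \<le> B" "\<And>x v. x \<in> d ` C \<Longrightarrow> norm (fder (\<lambda>x. k (inv_into V d x)) x v) \<le> B * norm v"
      using C1_bound_compact[OF C1T_D[OF k c'(1)] chart_image_compact[OF c']] c'(3) by blast
    then show "\<exists>B. P c B" unfolding c P_def by (intro exI[of _ B]) auto
  next
    fix c B B' assume "P c B" "B \<le> (B'::real)"
    then show "P c B'"
      unfolding P_def by (auto split: prod.splits) (meson mult_right_mono norm_ge_zero order.trans)
  qed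
  then obtain b where "0 \<le> b" "\<And>c. c \<in> ccover \<Longrightarrow> P c b" by blast
  then show ?thesis unfolding dbound_def by (intro exI[of _ b]) (auto simp: P_def)
qed

text \<open>\<open>L\<close> bounds the differential of \<psi> between any two members of the cover,
  on the compact set where both apply. It is independent of \<open>k\<close>, which makes these
  constants submultiplicative under composition.\<close>

lemma dbound_compose:
  assumes \<psi>: "C1self \<psi>"
  shows "\<exists>L. \<forall>k b. C1T k \<longrightarrow> 0 \<le> b \<longrightarrow> dbound k b \<longrightarrow> dbound (\<lambda>t. k (\<psi> t)) (L * b)"
proof -
  define P where "P = (\<lambda>((V::'t set, d::'t \<Rightarrow> 'e, C), (V'::'t set, d'::'t \<Rightarrow> 'e, C')) B. \<forall>t\<in>C. \<psi> t \<in> C' \<longrightarrow>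
    (\<forall>v. norm (fder (\<lambda>x. d' (\<psi> (inv_into V d x))) (d t) v) \<le> B * norm v))"
  have "\<exists>L\<ge>0. \<forall>p\<in>ccover \<times> ccover. P p L"
  proof (rule finite_uniform_bound)
    fix p assume "p \<in> ccover \<times> ccover"
    then obtain V d C V' d' C' where p: "p = ((V, d, C), (V', d', C'))"
      and c: "(V, d, C) \<in> ccover" "(V', d', C') \<in> ccover" by (cases p) auto
    have c1: "(V, d) \<in> AT" "compactin T C" "C \<subseteq> V" using ccoverD[OF c(1)] by auto
    have c2: "(V', d') \<in> AT" "compactin T C'" "C' \<subseteq> V'" using ccoverD[OF c(2)] by auto
    define K where "K = C \<inter> {t \<in> topspace T. \<psi> t \<in> C'}"
    have "closedin T {t \<in> topspace T. \<psi> t \<in> C'}"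
      using closedin_continuous_map_preimage[OF C1self_continuous[OF \<psi>] compactin_imp_closedin[OF Hausdorff c2(2)]] .
    then have "compactin T K" unfolding K_def by (rule compact_Int_closedin[OF c1(2)])
    then have "compact (d ` K)" by (rule chart_image_compact[OF c1(1)]) (use c1 in \<open>auto simp: K_def\<close>)
    moreover have "d ` K \<subseteq> d ` (V \<inter> \<psi> -` V')" using c1(3) c2(3) by (auto simp: K_def)
    ultimately obtain B where "0 \<le> B" and
      B: "\<And>x v. x \<in> d ` K \<Longrightarrow> norm (fder (\<lambda>x. d' (\<psi> (inv_into V d x))) x v) \<le> B * norm v"
      using C1_bound_compact[OF C1self_chart[OF \<psi> c1(1) c2(1)]] by blast
    have "d t \<in> d ` K" if "t \<in> C" "\<psi> t \<in> C'" for t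
      using that c1(3) chart_subset[OF c1(1)] by (auto simp: K_def)
    then show "\<exists>B. P p B" unfolding p P_def using B by (intro exI[of _ B]) auto
  next
    fix p B B' assume "P p B" "B \<le> (B'::real)"
    then show "P p B'"
      unfolding P_def by (auto split: prod.splits) (meson mult_right_mono norm_ge_zero order.trans)
  qed (simp add: finite_ccover)
  then obtain L where L: "\<And>p. p \<in> ccover \<times> ccover \<Longrightarrow> P p L" by blast
  have "dbound (\<lambda>t. k (\<psi> t)) (L * b)" if k: "C1T k" and b: "0 \<le> b" "dbound k b" for k b
    unfolding dbound_def
  proof safe
    fix V d C t v assume c: "(V, d, C) \<in> ccover" and t: "t \<in> C"
    have c1: "(V, d) \<in> AT" "C \<subseteq> V" using ccoverD[OF c] by auto
    have "\<psi> t \<in> topspace T" using chart_subset[OF c1(1)] C1self_maps[OF \<psi>] c1 t by auto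
    then obtain V' d' C' where c': "(V', d', C') \<in> ccover" and pt: "\<psi> t \<in> C'"
      using ccover_cover by (meson subsetD)
    have c2: "(V', d') \<in> AT" "C' \<subseteq> V'" using ccoverD[OF c'] by auto
    let ?w = "fder (\<lambda>x. d' (\<psi> (inv_into V d x))) (d t) v"
    have w: "norm ?w \<le> L * norm v"
      using L[of "((V, d, C), (V', d', C'))"] c c' t pt by (auto simp: P_def)
    have "fder (\<lambda>x. k (\<psi> (inv_into V d x))) (d t) v = fder (\<lambda>x. k (inv_into V' d' x)) (d' (\<psi> t)) ?w"
      by (rule fder_chart_change[OF \<psi> c1(1) c2(1) C1T_D[OF k c2(1)]]) (use t pt c1 c2 in auto)
    then have "norm (fder (\<lambda>x. k (\<psi> (inv_into V d x))) (d t) v) \<le> b * norm ?w"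
      using dboundD[OF b(2) c' pt] by simp
    also have "\<dots> \<le> b * (L * norm v)" using w b(1) by (rule mult_left_mono)
    finally show "norm (fder (\<lambda>x. k (\<psi> (inv_into V d x))) (d t) v) \<le> L * b * norm v" by (simp add: mult_ac)
  qed
  then show ?thesis by blast
qed

text \<open>\<open>dbound\<close> sees only the charts of the cover. The change of charts near one
  point transfers it to any chart of the atlas, with a factor \<open>M\<close> valid for all
  \<open>k\<close> at once.\<close>

lemma dbound_local:
  assumes c: "(V, d) \<in> AT" and x: "x \<in> d ` V"
  obtains r M where "0 < r" "0 \<le> M" "ball x r \<subseteq> d ` V"
    "\<And>k b y v. C1T k \<Longrightarrow> 0 \<le> b \<Longrightarrow> dbound k b \<Longrightarrow> y \<in> ball x r \<Longrightarrow>
       norm (fder (\<lambda>x. k (inv_into V d x)) y v) \<le> M * b * norm v"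
proof -
  obtain t where t: "t \<in> V" "x = d t" using x by auto
  then obtain V' d' C' G where c': "(V', d', C') \<in> ccover" and G: "openin T G" "t \<in> G" "G \<subseteq> C'"
    using ccover_cover chart_subset[OF c] by (meson subsetD)
  have c2: "(V', d') \<in> AT" "C' \<subseteq> V'" using ccoverD[OF c'] by auto
  note id = C1self_id
  have "C1 (d ` (V \<inter> G)) (\<lambda>x. d' (inv_into V d x))"
    by (rule C1_subset[OF C1self_chart[OF id c c2(1)]]) (use G c2 in auto)
  moreover have "open (d ` (V \<inter> G))" using chart_image_openin[OF c G(1)] .
  moreover have "x \<in> d ` (V \<inter> G)" using t G by auto
  ultimately obtain r M where r: "0 < r" "0 \<le> M" "ball x r \<subseteq> d ` (V \<inter> G)"
    and M: "\<And>y v. y \<in> ball x r \<Longrightarrow> norm (fder (\<lambda>x. d' (inv_into V d x)) y v) \<le> M * norm v"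
    using C1_bound_local by blast
  show ?thesis
  proof (rule that[OF r(1,2)])
    show "ball x r \<subseteq> d ` V" using r by auto
    fix k b y v assume k: "C1T k" and b: "0 \<le> b" "dbound k b" and y: "y \<in> ball x r"
    obtain s where s: "s \<in> V" "s \<in> G" "y = d s" using y r by auto
    let ?w = "fder (\<lambda>x. d' (inv_into V d x)) (d s) v"
    have "fder (\<lambda>x. k (inv_into V d x)) (d s) v = fder (\<lambda>x. k (inv_into V' d' x)) (d' s) ?w"
      by (rule fder_chart_change[OF id c c2(1) C1T_D[OF k c2(1)]]) (use s G c2 in auto)
    then have "norm (fder (\<lambda>x. k (inv_into V d x)) y v) \<le> b * norm ?w"
      using dboundD[OF b(2) c', of s] s G by auto
    also have "\<dots> \<le> b * (M * norm v)" using M[OF y] s b(1) by (intro mult_left_mono) auto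
    finally show "norm (fder (\<lambda>x. k (inv_into V d x)) y v) \<le> M * b * norm v" by (simp add: mult_ac)
  qed
qed

lemma C1T_bounded:
  assumes k: "C1T k"
  shows "\<exists>M\<ge>0. \<forall>t\<in>topspace T. norm (k t) \<le> M"
proof -
  define P where "P = (\<lambda>(V::'t set, d::'t \<Rightarrow> 'e, C) B. \<forall>t\<in>C. norm (k t) \<le> B)"
  have "\<exists>B\<ge>0. \<forall>c\<in>ccover. P c B"
  proof (rule finite_uniform_bound[OF finite_ccover])
    fix c assume "c \<in> ccover"
    then obtain V d C where c: "c = (V, d, C)" "(V, d, C) \<in> ccover" by (cases c) auto
    have c': "(V, d) \<in> AT" "compactin T C" "C \<subseteq> V" using ccoverD[OF c(2)] by auto
    have "continuous_on (d ` C) (\<lambda>x. k (inv_into V d x))"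
      using C1_imp_continuous_on[OF C1T_D[OF k c'(1)]] c' by (meson continuous_on_subset image_mono)
    then have "bounded ((\<lambda>x. k (inv_into V d x)) ` d ` C)"
      using chart_image_compact[OF c'] by (intro compact_imp_bounded compact_continuous_image)
    then obtain B where B: "\<And>y. y \<in> (\<lambda>x. k (inv_into V d x)) ` d ` C \<Longrightarrow> norm y \<le> B" by (auto simp: bounded_iff)
    have "norm (k t) \<le> B" if "t \<in> C" for t
      using B[of "k t"] chart_inv(3)[OF c'(1)] c'(3) that by (force simp: image_image subset_iff)
    then show "\<exists>B. P c B" unfolding c P_def by auto
  qed (auto simp: P_def intro: order.trans)
  then obtain B where B: "0 \<le> B" "\<And>c. c \<in> ccover \<Longrightarrow> P c B" by blast
  have "norm (k t) \<le> B" if tT: "t \<in> topspace T" for t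
  proof -
    obtain V d C where c: "(V, d, C) \<in> ccover" "t \<in> C" using ccover_cover[OF tT] by (meson subsetD)
    then show ?thesis using B(2)[OF c(1)] by (simp add: P_def)
  qed
  then show ?thesis using B(1) by blast
qed

text \<open>The factor \<open>p\<close> is left free: the constant 1 yields bump functions, a linear
  \<open>p\<close> yields functions with prescribed differential at \<open>t0\<close>. Extension by
  zero is C1 because the support lies in a subset of the chart that is closed in
  \<open>T\<close>.\<close>

lemma bump:
  assumes c: "(V, d) \<in> AT" and t0: "t0 \<in> V" and W: "openin T W" "t0 \<in> W"
  obtains \<beta> :: "'e \<Rightarrow> complex" where "C1 UNIV \<beta>" "\<beta> (d t0) = 1" "\<And>x. norm (\<beta> x) \<le> 1"
    "\<And>v. fder \<beta> (d t0) v = 0" "\<And>t. t \<in> V \<Longrightarrow> \<beta> (d t) \<noteq> 0 \<Longrightarrow> t \<in> W"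
    "\<And>p. C1 UNIV p \<Longrightarrow> C1T (\<lambda>t. if t \<in> V then \<beta> (d t) * p (d t) else 0)"
proof -
  obtain \<rho> where \<rho>: "0 < \<rho>" and "cball (d t0) \<rho> \<subseteq> d ` V"
    and \<rho>': "closedin T {t \<in> V. d t \<in> cball (d t0) \<rho>}" "{t \<in> V. d t \<in> cball (d t0) \<rho>} \<subseteq> W"
    by (rule chart_ball[OF c t0 W], rule that)
  obtain \<beta> :: "'e \<Rightarrow> complex" where b: "C1 UNIV \<beta>" "\<beta> (d t0) = 1" "\<And>x. norm (\<beta> x) \<le> 1"
    "\<And>v. fder \<beta> (d t0) v = 0" "\<And>x. x \<notin> cball (d t0) \<rho> \<Longrightarrow> \<beta> x = 0"
    using bump_function[OF \<rho>, of "d t0"] by blast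
  define Z where "Z = {t \<in> V. d t \<in> cball (d t0) \<rho>}"
  have Zcl: "closedin T Z" and ZW: "Z \<subseteq> W" using \<rho>' by (simp_all add: Z_def)
  show ?thesis
  proof (rule that[OF b(1-4)])
    show "t \<in> W" if "t \<in> V" "\<beta> (d t) \<noteq> 0" for t
      using b(5)[of "d t"] that ZW by (auto simp: Z_def)
    fix p :: "'e \<Rightarrow> complex" assume p: "C1 UNIV p"
    let ?k = "\<lambda>t. if t \<in> V then \<beta> (d t) * p (d t) else 0"
    show "C1T ?k"
      unfolding C1T_def
    proof safe
      fix V' d' assume c': "(V', d') \<in> AT"
      show "C1 (d' ` V') (\<lambda>x. ?k (inv_into V' d' x))"
      proof (rule C1_local)
        fix x assume "x \<in> d' ` V'"
        then obtain t where t: "t \<in> V'" "x = d' t" by auto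
        show "\<exists>N. open N \<and> x \<in> N \<and> C1 N (\<lambda>x. ?k (inv_into V' d' x))"
        proof (cases "t \<in> Z")
          case True
          then have tV: "t \<in> V" by (simp add: Z_def)
          let ?N = "d' ` (V' \<inter> V)"
          have N: "open ?N" using chart_image_openin[OF c' chart_open[OF c]] .
          have tr: "C1 ?N (\<lambda>x. d (inv_into V' d' x))" using C1self_chart[OF C1self_id c' c] by simp
          have "C1 UNIV (\<lambda>y. \<beta> y * p y)" by (rule C1_mult[OF b(1) p])
          from C1_compose[OF this tr] have "C1 ?N (\<lambda>x. \<beta> (d (inv_into V' d' x)) * p (d (inv_into V' d' x)))" by simp
          then have "C1 ?N (\<lambda>x. ?k (inv_into V' d' x))"
            by (rule C1_cong[OF N, rotated]) (use chart_inv(3)[OF c'] in auto)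
          then show ?thesis using N t tV by blast
        next
          case False
          let ?N = "d' ` (V' \<inter> (topspace T - Z))"
          have N: "open ?N" using chart_image_openin[OF c' openin_diff[OF openin_topspace Zcl]] .
          have "C1 ?N (\<lambda>x. ?k (inv_into V' d' x))"
          proof (rule C1_cong[OF N _ C1_const[of _ 0]])
            fix y assume "y \<in> ?N"
            then obtain s where "s \<in> V'" "s \<notin> Z" "y = d' s" by auto
            then show "0 = ?k (inv_into V' d' y)" using chart_inv(3)[OF c'] b(5) by (auto simp: Z_def)
          qed
          then show ?thesis using N t False chart_subset[OF c'] by blast
        qed
      qed
    qed
  qed
qed

end

section \<open>Poincare series\<close>

lemma (in C1_manifold) fder_chart_cong:
  assumes "(V, d) \<in> AT" "\<And>t. t \<in> topspace T \<Longrightarrow> k t = k' t" "x \<in> d ` V"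
  shows "fder (\<lambda>x. k (inv_into V d x)) x = fder (\<lambda>x. k' (inv_into V d x)) x"
  by (rule fder_cong[OF chart_image_open[OF assms(1)] assms(3)])
    (use assms(2) chart_inv(1)[OF assms(1)] chart_subset[OF assms(1)] in blast)

lemma (in C1_manifold) dbound_cong:
  assumes "dbound k b" "\<And>t. t \<in> topspace T \<Longrightarrow> k t = k' t"
  shows "dbound k' b"
  unfolding dbound_def
proof safe
  fix V d C t v assume c: "(V, d, C) \<in> ccover" and t: "t \<in> C"
  then have "(V, d) \<in> AT" "d t \<in> d ` V" using ccoverD[OF c] by auto
  from fder_chart_cong[of V d k k', OF this(1) assms(2) this(2)]
  show "norm (fder (\<lambda>x. k' (inv_into V d x)) (d t) v) \<le> b * norm v"
    using dboundD[OF assms(1) c t, of v] by simp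
qed

lemma (in C1_manifold) dbound_mono:
  assumes "dbound k b" "b \<le> b'"
  shows "dbound k b'"
  unfolding dbound_def
proof safe
  fix V d C t v assume c: "(V, d, C) \<in> ccover" and t: "t \<in> C"
  show "norm (fder (\<lambda>x. k (inv_into V d x)) (d t) v) \<le> b' * norm v"
    using order.trans[OF dboundD[OF assms(1) c t] mult_right_mono[OF assms(2) norm_ge_zero]] .
qed

section \<open>Growth of the action on the fibre\<close>

locale susp = disc_group \<Gamma> + C1_manifold T AT
  for \<Gamma> and T :: "'t topology" and AT :: "('t, 'e::finite_dim_inner) chart set" +
  fixes \<phi> :: "(complex \<Rightarrow> complex) \<Rightarrow> 't \<Rightarrow> 't"
  assumes phi_C1: "\<gamma> \<in> \<Gamma> \<Longrightarrow> C1self (\<phi> \<gamma>)"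
    and phi_compose: "\<gamma> \<in> \<Gamma> \<Longrightarrow> \<delta> \<in> \<Gamma> \<Longrightarrow> t \<in> topspace T \<Longrightarrow> \<phi> (compose unit_disc \<gamma> \<delta>) t = \<phi> \<gamma> (\<phi> \<delta> t)"
    and phi_id: "t \<in> topspace T \<Longrightarrow> \<phi> disc_id t = t"
begin

lemma phi_maps: "\<gamma> \<in> \<Gamma> \<Longrightarrow> t \<in> topspace T \<Longrightarrow> \<phi> \<gamma> t \<in> topspace T"
  by (rule C1self_maps[OF phi_C1])

lemma phi_ginv: "\<gamma> \<in> \<Gamma> \<Longrightarrow> t \<in> topspace T \<Longrightarrow> \<phi> (ginv \<gamma>) (\<phi> \<gamma> t) = t"
  using phi_compose[of "ginv \<gamma>" \<gamma> t] by (simp add: ginv_in ginv_left phi_id)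

text \<open>A bound for the pull-back of C1 functions by \<open>\<phi> \<gamma>\<close>. Quantifying
  over all \<open>k\<close> and \<open>b\<close> lets the bounds multiply along a word.\<close>

definition "dgrowth \<gamma> L \<longleftrightarrow> (\<forall>k b. C1T k \<longrightarrow> 0 \<le> b \<longrightarrow> dbound k b \<longrightarrow> dbound (\<lambda>t. k (\<phi> \<gamma> t)) (L * b))"

lemma dgrowth_compose:
  assumes g: "\<gamma> \<in> \<Gamma>" "\<delta> \<in> \<Gamma>" and L: "1 \<le> L" "dgrowth \<gamma> L" "dgrowth \<delta> L'"
  shows "dgrowth (compose unit_disc \<gamma> \<delta>) (L * L')"
  unfolding dgrowth_def
proof (intro allI impI)
  fix k b assume k: "C1T k" "0 \<le> b" "dbound k b"
  have 1: "C1T (\<lambda>t. k (\<phi> \<gamma> t))" "dbound (\<lambda>t. k (\<phi> \<gamma> t)) (L * b)"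
    using C1T_compose[OF k(1) phi_C1[OF g(1)]] L(2) k unfolding dgrowth_def by auto
  have "0 \<le> L * b" using L(1) k(2) by simp
  then have "dbound (\<lambda>t. k (\<phi> \<gamma> (\<phi> \<delta> t))) (L' * (L * b))" using L(3) 1 unfolding dgrowth_def by blast
  then show "dbound (\<lambda>t. k (\<phi> (compose unit_disc \<gamma> \<delta>) t)) (L * L' * b)"
    using dbound_cong[of _ "L' * (L * b)"] phi_compose[OF g] by (simp add: mult_ac)
qed

lemma ex_growth: "\<exists>N m0. (\<forall>\<gamma>\<in>\<Gamma>. dgrowth \<gamma> (N \<gamma>)) \<and> (\<forall>\<gamma>. 1 \<le> N \<gamma>) \<and>
    (\<forall>m\<ge>m0. (\<lambda>\<gamma>. eps \<gamma> ^ m * N \<gamma>) summable_on \<Gamma>)"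
proof -
  obtain N m0 where "\<And>\<gamma>. \<gamma> \<in> \<Gamma> \<Longrightarrow> dgrowth \<gamma> (N \<gamma>)" "\<And>\<gamma>. 1 \<le> N \<gamma>"
    "\<And>m. m0 \<le> m \<Longrightarrow> (\<lambda>\<gamma>. eps \<gamma> ^ m * N \<gamma>) summable_on \<Gamma>"
  proof (rule summable_eps[of dgrowth])
    show "\<exists>L. dgrowth \<gamma> L" if "\<gamma> \<in> \<Gamma>" for \<gamma>
      using dbound_compose[OF phi_C1[OF that]] unfolding dgrowth_def .
    show "dgrowth \<gamma> L'" if "dgrowth \<gamma> L" "L \<le> L'" for \<gamma> L L'
      using that dbound_mono unfolding dgrowth_def by (meson mult_right_mono)
  qed (use dgrowth_compose in blast)+
  then show ?thesis by blast
qed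

text \<open>Chosen once and for all, so that every series below can be compared with the same family
  \<open>eps \<gamma> ^ m * Ngr \<gamma>\<close>.\<close>

definition Ngr :: "(complex \<Rightarrow> complex) \<Rightarrow> real" where
  "Ngr = (SOME N. \<exists>m0. (\<forall>\<gamma>\<in>\<Gamma>. dgrowth \<gamma> (N \<gamma>)) \<and> (\<forall>\<gamma>. 1 \<le> N \<gamma>) \<and>
    (\<forall>m\<ge>m0. (\<lambda>\<gamma>. eps \<gamma> ^ m * N \<gamma>) summable_on \<Gamma>))"

definition mgr :: nat where
  "mgr = (SOME m0. \<forall>m\<ge>m0. (\<lambda>\<gamma>. eps \<gamma> ^ m * Ngr \<gamma>) summable_on \<Gamma>)"

lemma Ngr: "\<gamma> \<in> \<Gamma> \<Longrightarrow> dgrowth \<gamma> (Ngr \<gamma>)" and Ngr_ge_1: "1 \<le> Ngr \<gamma>"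
  and summable_Ngr: "mgr \<le> m \<Longrightarrow> (\<lambda>\<gamma>. eps \<gamma> ^ m * Ngr \<gamma>) summable_on \<Gamma>"
proof -
  have *: "\<exists>m0. (\<forall>\<gamma>\<in>\<Gamma>. dgrowth \<gamma> (Ngr \<gamma>)) \<and> (\<forall>\<gamma>. 1 \<le> Ngr \<gamma>) \<and>
    (\<forall>m\<ge>m0. (\<lambda>\<gamma>. eps \<gamma> ^ m * Ngr \<gamma>) summable_on \<Gamma>)"
    unfolding Ngr_def by (rule someI_ex[OF ex_growth])
  then show "\<gamma> \<in> \<Gamma> \<Longrightarrow> dgrowth \<gamma> (Ngr \<gamma>)" "1 \<le> Ngr \<gamma>" by blast+
  have "\<forall>m\<ge>mgr. (\<lambda>\<gamma>. eps \<gamma> ^ m * Ngr \<gamma>) summable_on \<Gamma>"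
    unfolding mgr_def by (rule someI_ex) (use * in blast)
  then show "mgr \<le> m \<Longrightarrow> (\<lambda>\<gamma>. eps \<gamma> ^ m * Ngr \<gamma>) summable_on \<Gamma>" by blast
qed

text \<open>The constant does not depend on the coefficients \<open>u \<gamma>\<close> or the set \<open>I\<close>, so one estimate gives both the
  convergence of the series and the smallness of its tails for large weight.\<close>

definition series_bound :: "'t set \<Rightarrow> ('t \<Rightarrow> 'e) \<Rightarrow> 'e \<Rightarrow> ('t \<Rightarrow> complex) \<Rightarrow> real \<Rightarrow> real \<Rightarrow> bool" where
  "series_bound V d x0 k r c0 \<longleftrightarrow>
    (\<forall>\<zeta>0 \<eta> I u \<beta>. 0 < \<eta> \<longrightarrow> I \<subseteq> \<Gamma> \<longrightarrow> (\<forall>\<gamma>\<in>I. u \<gamma> holomorphic_on ball \<zeta>0 \<eta>) \<longrightarrow>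
       (\<forall>\<gamma>\<in>I. \<forall>\<zeta>\<in>ball \<zeta>0 \<eta>. norm (u \<gamma> \<zeta>) \<le> \<beta> \<gamma>) \<longrightarrow>
       (\<lambda>\<gamma>. \<beta> \<gamma> * Ngr \<gamma>) summable_on I \<longrightarrow>
       C1 (ball \<zeta>0 (\<eta>/2) \<times> ball x0 r) (\<lambda>p. \<Sum>\<^sub>\<infinity>\<gamma>\<in>I. u \<gamma> (fst p) * k (\<phi> \<gamma> (inv_into V d (snd p)))) \<and>
       (\<forall>p\<in>ball \<zeta>0 (\<eta>/2) \<times> ball x0 r.
          norm (\<Sum>\<^sub>\<infinity>\<gamma>\<in>I. u \<gamma> (fst p) * k (\<phi> \<gamma> (inv_into V d (snd p)))) \<le> c0 * (1 + 1 / \<eta>) * (\<Sum>\<^sub>\<infinity>\<gamma>\<in>I. \<beta> \<gamma> * Ngr \<gamma>) \<and>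
          (\<forall>v. norm (fder (\<lambda>p. \<Sum>\<^sub>\<infinity>\<gamma>\<in>I. u \<gamma> (fst p) * k (\<phi> \<gamma> (inv_into V d (snd p)))) p v)
             \<le> c0 * (1 + 1 / \<eta>) * (\<Sum>\<^sub>\<infinity>\<gamma>\<in>I. \<beta> \<gamma> * Ngr \<gamma>) * norm v)))"

text \<open>The derivative along the disc is estimated by Cauchy's inequality on a disc of radius
  \<eta>/2, that along \<open>T\<close> by \<open>Ngr\<close>. As \<open>Ngr\<close> is at least 1,
  the one majorant \<open>\<beta> \<gamma> * Ngr \<gamma>\<close> serves for both and for the
  values.\<close>

lemma ex_series_bound:
  assumes c: "(V, d) \<in> AT" and x0: "x0 \<in> d ` V" and k: "C1T k"
  shows "\<exists>r c0. 0 < r \<and> 0 \<le> c0 \<and> ball x0 r \<subseteq> d ` V \<and> series_bound V d x0 k r c0"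
proof -
  obtain M where M: "0 \<le> M" "\<And>t. t \<in> topspace T \<Longrightarrow> norm (k t) \<le> M" using C1T_bounded[OF k] by blast
  obtain b where b: "0 \<le> b" "dbound k b" using dbound_exists[OF k] by blast
  obtain r L where r: "0 < r" "0 \<le> L" "ball x0 r \<subseteq> d ` V"
    and L: "\<And>k b y v. C1T k \<Longrightarrow> 0 \<le> b \<Longrightarrow> dbound k b \<Longrightarrow> y \<in> ball x0 r \<Longrightarrow>
       norm (fder (\<lambda>x. k (inv_into V d x)) y v) \<le> L * b * norm v"
    using dbound_local[OF c x0] by metis
  define \<kappa> where "\<kappa> \<gamma> x = k (\<phi> \<gamma> (inv_into V d x))" for \<gamma> x
  have kC1: "C1 (ball x0 r) (\<kappa> \<gamma>)" if "\<gamma> \<in> \<Gamma>" for \<gamma>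
    unfolding \<kappa>_def using C1_subset[OF C1T_D[OF C1T_compose[OF k phi_C1[OF that]] c] r(3)] .
  have kM: "norm (\<kappa> \<gamma> x) \<le> M" if "\<gamma> \<in> \<Gamma>" "x \<in> ball x0 r" for \<gamma> x
    unfolding \<kappa>_def using that r(3) chart_inv(1)[OF c] chart_subset[OF c] phi_maps M(2) by blast
  have kD: "norm (fder (\<kappa> \<gamma>) x v) \<le> L * b * Ngr \<gamma> * norm v" if g: "\<gamma> \<in> \<Gamma>" "x \<in> ball x0 r" for \<gamma> x v
  proof -
    have "dbound (\<lambda>t. k (\<phi> \<gamma> t)) (Ngr \<gamma> * b)" using Ngr[OF g(1)] k b unfolding dgrowth_def by blast
    moreover have "0 \<le> Ngr \<gamma> * b" using Ngr_ge_1[of \<gamma>] b(1) by simp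
    ultimately have "norm (fder (\<lambda>x. k (\<phi> \<gamma> (inv_into V d x))) x v) \<le> L * (Ngr \<gamma> * b) * norm v"
      using L[OF C1T_compose[OF k phi_C1[OF g(1)]] _ _ g(2)] by blast
    then show ?thesis unfolding \<kappa>_def by (simp add: mult_ac)
  qed
  \<comment> \<open>\<open>L * b\<close> comes from the differential of \<open>k\<close>, and
    2M/\<eta> from Cauchy's inequality; with the factor 1 + 1/\<eta> one constant dominates their
    sum, and \<open>M\<close> as well.\<close>
  define c0 where "c0 = L * b + 2 * M"
  have c0: "0 \<le> c0" using r(2) b(1) M(1) by (simp add: c0_def)
  have "series_bound V d x0 k r c0"
    unfolding series_bound_def
  proof (intro allI impI)
    fix \<zeta>0 :: complex and \<eta> :: real and I and u :: "_ \<Rightarrow> complex \<Rightarrow> complex" and \<beta> :: "_ \<Rightarrow> real"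
    assume eta: "0 < \<eta>" and I: "I \<subseteq> \<Gamma>" and hu0: "\<forall>\<gamma>\<in>I. u \<gamma> holomorphic_on ball \<zeta>0 \<eta>"
      and ub0: "\<forall>\<gamma>\<in>I. \<forall>\<zeta>\<in>ball \<zeta>0 \<eta>. norm (u \<gamma> \<zeta>) \<le> \<beta> \<gamma>"
      and sb: "(\<lambda>\<gamma>. \<beta> \<gamma> * Ngr \<gamma>) summable_on I"
    note hu = hu0[rule_format] and ub = ub0[rule_format]
    let ?B = "ball \<zeta>0 (\<eta>/2)" and ?R = "ball x0 r"
    let ?S = "?B \<times> ?R"
    let ?f = "\<lambda>\<gamma> p. u \<gamma> (fst p) * \<kappa> \<gamma> (snd p)"
    let ?c = "c0 * (1 + 1 / \<eta>)"
    let ?b = "\<lambda>\<gamma>. ?c * (\<beta> \<gamma> * Ngr \<gamma>)"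
    have sub: "?B \<subseteq> ball \<zeta>0 \<eta>" using eta by auto
    have be: "0 \<le> \<beta> \<gamma>" if "\<gamma> \<in> I" for \<gamma>
      using ub[OF that, of \<zeta>0] eta by (meson centre_in_ball norm_ge_zero order.trans)
    have Nb: "\<beta> \<gamma> \<le> \<beta> \<gamma> * Ngr \<gamma>" if "\<gamma> \<in> I" for \<gamma>
      using mult_left_mono[OF Ngr_ge_1[of \<gamma>] be[OF that]] by simp
    have du: "norm (deriv (u \<gamma>) \<zeta>) \<le> 2 * \<beta> \<gamma> / \<eta>" if g: "\<gamma> \<in> I" and z: "\<zeta> \<in> ?B" for \<gamma> \<zeta>
    proof -
      have cb: "cball \<zeta> (\<eta>/2) \<subseteq> ball \<zeta>0 \<eta>"
      proof
        fix w assume "w \<in> cball \<zeta> (\<eta>/2)"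
        then show "w \<in> ball \<zeta>0 \<eta>" using z dist_triangle[of \<zeta>0 w \<zeta>] by simp
      qed
      have "norm ((deriv ^^ 1) (u \<gamma>) \<zeta>) \<le> fact 1 * \<beta> \<gamma> / (\<eta>/2) ^ 1"
      proof (rule Cauchy_inequality)
        show "u \<gamma> holomorphic_on ball \<zeta> (\<eta>/2)"
          by (rule holomorphic_on_subset[OF hu[OF g]]) (use cb ball_subset_cball in blast)
        show "continuous_on (cball \<zeta> (\<eta>/2)) (u \<gamma>)"
          by (rule holomorphic_on_imp_continuous_on[OF holomorphic_on_subset[OF hu[OF g] cb]])
        show "norm (u \<gamma> w) \<le> \<beta> \<gamma>" if "norm (\<zeta> - w) = \<eta>/2" for w
          by (rule ub[OF g]) (use that cb in \<open>auto simp: dist_norm subset_iff\<close>)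
      qed (use eta in auto)
      then show ?thesis by (simp add: mult.commute)
    qed
    have uC1: "C1 ?B (u \<gamma>)" if "\<gamma> \<in> I" for \<gamma>
      by (rule C1_holomorphic[OF holomorphic_on_subset[OF hu[OF that] sub]]) auto
    have uf: "C1 ?S (\<lambda>p. u \<gamma> (fst p))" and uf': "\<And>p v. p \<in> ?S \<Longrightarrow> fder (\<lambda>p. u \<gamma> (fst p)) p v = deriv (u \<gamma>) (fst p) * fst v"
      if g: "\<gamma> \<in> I" for \<gamma>
    proof -
      have f: "C1 ?S fst" by (rule C1_bounded_linear[OF bounded_linear_fst])
      have im: "fst ` ?S \<subseteq> ?B" by auto
      show "C1 ?S (\<lambda>p. u \<gamma> (fst p))" by (rule C1_compose[OF uC1[OF g] f im])
      fix p v assume p: "p \<in> ?S"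
      have "fder (\<lambda>p. u \<gamma> (fst p)) p v = fder (u \<gamma>) (fst p) (fder fst p v)"
        by (rule fder_compose[OF uC1[OF g] f im p])
      also have "fder fst p = fst" by (rule fder_eq[OF bounded_linear_imp_has_derivative[OF bounded_linear_fst]])
      finally show "fder (\<lambda>p. u \<gamma> (fst p)) p v = deriv (u \<gamma>) (fst p) * fst v"
        using fder_holomorphic[OF holomorphic_on_subset[OF hu[OF g] sub]] p by auto
    qed
    have kf: "C1 ?S (\<lambda>p. \<kappa> \<gamma> (snd p))" and kf': "\<And>p v. p \<in> ?S \<Longrightarrow> fder (\<lambda>p. \<kappa> \<gamma> (snd p)) p v = fder (\<kappa> \<gamma>) (snd p) (snd v)"
      if g: "\<gamma> \<in> I" for \<gamma>
    proof -
      have g': "\<gamma> \<in> \<Gamma>" using g I by blast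
      have f: "C1 ?S snd" by (rule C1_bounded_linear[OF bounded_linear_snd])
      have im: "snd ` ?S \<subseteq> ?R" by auto
      show "C1 ?S (\<lambda>p. \<kappa> \<gamma> (snd p))" by (rule C1_compose[OF kC1[OF g'] f im])
      fix p v assume p: "p \<in> ?S"
      have "fder (\<lambda>p. \<kappa> \<gamma> (snd p)) p v = fder (\<kappa> \<gamma>) (snd p) (fder snd p v)"
        by (rule fder_compose[OF kC1[OF g'] f im p])
      also have "fder snd p = snd" by (rule fder_eq[OF bounded_linear_imp_has_derivative[OF bounded_linear_snd]])
      finally show "fder (\<lambda>p. \<kappa> \<gamma> (snd p)) p v = fder (\<kappa> \<gamma>) (snd p) (snd v)" .
    qed
    have S: "open ?S" "convex ?S" by (auto intro: open_Times convex_Times)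
    have f1: "C1 ?S (?f \<gamma>)" if "\<gamma> \<in> I" for \<gamma> by (rule C1_mult[OF uf[OF that] kf[OF that]])
    have f2: "norm (?f \<gamma> p) \<le> ?b \<gamma>" if g: "\<gamma> \<in> I" and p: "p \<in> ?S" for \<gamma> p
    proof -
      have "norm (?f \<gamma> p) \<le> \<beta> \<gamma> * M"
        unfolding norm_mult using ub[OF g, of "fst p"] kM[of \<gamma> "snd p"] g I p sub be[OF g] by (intro mult_mono) auto
      also have "\<dots> \<le> (\<beta> \<gamma> * Ngr \<gamma>) * ?c"
      proof (intro mult_mono Nb[OF g])
        have "M \<le> c0 * 1" using r(2) b(1) M(1) by (simp add: c0_def)
        also have "\<dots> \<le> ?c" using c0 eta by (intro mult_left_mono) auto
        finally show "M \<le> ?c" .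
      qed (use be[OF g] Ngr_ge_1[of \<gamma>] M in auto)
      finally show ?thesis by (simp add: mult_ac)
    qed
    have f3: "norm (fder (?f \<gamma>) p v) \<le> ?b \<gamma> * norm v" if g: "\<gamma> \<in> I" and p: "p \<in> ?S" for \<gamma> p v
    proof -
      have g': "\<gamma> \<in> \<Gamma>" and p': "fst p \<in> ?B" "snd p \<in> ?R" using g I p by auto
      have nv: "norm (fst v) \<le> norm v" "norm (snd v) \<le> norm v"
        using norm_fst_le[of "fst v" "snd v"] norm_snd_le[of "snd v" "fst v"] by auto
      have "fder (?f \<gamma>) p v = u \<gamma> (fst p) * fder (\<kappa> \<gamma>) (snd p) (snd v) + deriv (u \<gamma>) (fst p) * fst v * \<kappa> \<gamma> (snd p)"
        using fder_mult[OF uf[OF g] kf[OF g] p] uf'[OF g p] kf'[OF g p] by simp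
      also have "norm \<dots> \<le> \<beta> \<gamma> * (L * b * Ngr \<gamma> * norm v) + 2 * \<beta> \<gamma> / \<eta> * norm v * M"
      proof (intro norm_triangle_mono)
        have "norm (fder (\<kappa> \<gamma>) (snd p) (snd v)) \<le> L * b * Ngr \<gamma> * norm (snd v)" by (rule kD[OF g' p'(2)])
        also have "\<dots> \<le> L * b * Ngr \<gamma> * norm v"
          using nv(2) r(2) b(1) Ngr_ge_1[of \<gamma>] by (intro mult_left_mono) auto
        finally show "norm (u \<gamma> (fst p) * fder (\<kappa> \<gamma>) (snd p) (snd v)) \<le> \<beta> \<gamma> * (L * b * Ngr \<gamma> * norm v)"
          unfolding norm_mult using ub[OF g, of "fst p"] p' sub be[OF g] by (intro mult_mono) auto
        show "norm (deriv (u \<gamma>) (fst p) * fst v * \<kappa> \<gamma> (snd p)) \<le> 2 * \<beta> \<gamma> / \<eta> * norm v * M"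
          unfolding norm_mult using du[OF g p'(1)] nv(1) kM[OF g' p'(2)] be[OF g] eta
          by (intro mult_mono) auto
      qed
      also have "\<dots> \<le> (\<beta> \<gamma> * Ngr \<gamma>) * (L * b) * norm v + (\<beta> \<gamma> * Ngr \<gamma>) * (2 * M / \<eta>) * norm v"
      proof (intro add_mono)
        have "\<beta> \<gamma> * (2 * M / \<eta> * norm v) \<le> (\<beta> \<gamma> * Ngr \<gamma>) * (2 * M / \<eta> * norm v)"
          using Nb[OF g] M(1) eta by (intro mult_right_mono) auto
        then show "2 * \<beta> \<gamma> / \<eta> * norm v * M \<le> (\<beta> \<gamma> * Ngr \<gamma>) * (2 * M / \<eta>) * norm v" by (simp add: mult_ac)
      qed (simp add: mult_ac)
      also have "\<dots> = (\<beta> \<gamma> * Ngr \<gamma>) * (L * b + 2 * M / \<eta>) * norm v" by (simp add: algebra_simps)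
      also have "\<dots> \<le> (\<beta> \<gamma> * Ngr \<gamma>) * ?c * norm v"
      proof (intro mult_right_mono mult_left_mono)
        show "L * b + 2 * M / \<eta> \<le> ?c"
          using r(2) b(1) M(1) eta by (simp add: c0_def algebra_simps)
      qed (use be[OF g] Ngr_ge_1[of \<gamma>] in auto)
      finally show ?thesis by (simp add: mult_ac)
    qed
    have sb': "?b summable_on I" by (rule summable_on_cmult_right[OF sb])
    have ib: "infsum ?b I = ?c * (\<Sum>\<^sub>\<infinity>\<gamma>\<in>I. \<beta> \<gamma> * Ngr \<gamma>)" by (rule infsum_cmult_right) (use sb in auto)
    let ?G = "\<lambda>p. \<Sum>\<^sub>\<infinity>\<gamma>\<in>I. ?f \<gamma> p"
    have "C1 ?S ?G" by (rule C1_infsum[OF S f1 f2 f3 sb'])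
    moreover have "norm (?G p) \<le> ?c * (\<Sum>\<^sub>\<infinity>\<gamma>\<in>I. \<beta> \<gamma> * Ngr \<gamma>)" if p: "p \<in> ?S" for p
      using norm_infsum_dominated[OF sb' f2[OF _ p]] unfolding ib .
    moreover have "norm (fder ?G p v) \<le> ?c * (\<Sum>\<^sub>\<infinity>\<gamma>\<in>I. \<beta> \<gamma> * Ngr \<gamma>) * norm v" if p: "p \<in> ?S" for p v
    proof -
      have s2: "(\<lambda>\<gamma>. ?b \<gamma> * norm v) summable_on I" by (rule summable_on_cmult_left[OF sb'])
      have "norm (fder ?G p v) \<le> (\<Sum>\<^sub>\<infinity>\<gamma>\<in>I. norm (fder (?f \<gamma>) p v))"
        by (rule norm_fder_infsum[OF S f1 f2 f3 sb' p])
      also have "\<dots> \<le> (\<Sum>\<^sub>\<infinity>\<gamma>\<in>I. ?b \<gamma> * norm v)"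
        by (rule infsum_mono[OF dominated_norm_summable[OF s2 f3[OF _ p]] s2 f3[OF _ p]])
      also have "\<dots> = infsum ?b I * norm v" by (rule infsum_cmult_left) (use sb' in auto)
      finally show ?thesis unfolding ib .
    qed
    ultimately show "C1 ?S (\<lambda>p. \<Sum>\<^sub>\<infinity>\<gamma>\<in>I. u \<gamma> (fst p) * k (\<phi> \<gamma> (inv_into V d (snd p)))) \<and>
       (\<forall>p\<in>?S. norm (\<Sum>\<^sub>\<infinity>\<gamma>\<in>I. u \<gamma> (fst p) * k (\<phi> \<gamma> (inv_into V d (snd p)))) \<le> ?c * (\<Sum>\<^sub>\<infinity>\<gamma>\<in>I. \<beta> \<gamma> * Ngr \<gamma>) \<and>
          (\<forall>v. norm (fder (\<lambda>p. \<Sum>\<^sub>\<infinity>\<gamma>\<in>I. u \<gamma> (fst p) * k (\<phi> \<gamma> (inv_into V d (snd p)))) p v)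
             \<le> ?c * (\<Sum>\<^sub>\<infinity>\<gamma>\<in>I. \<beta> \<gamma> * Ngr \<gamma>) * norm v))"
      unfolding \<kappa>_def by blast
  qed
  with r(1,3) c0 show ?thesis by blast
qed

lemma
  assumes "series_bound V d x0 k r c0" "0 < \<eta>" "I \<subseteq> \<Gamma>" "\<And>\<gamma>. \<gamma> \<in> I \<Longrightarrow> u \<gamma> holomorphic_on ball \<zeta>0 \<eta>"
    "\<And>\<gamma> \<zeta>. \<gamma> \<in> I \<Longrightarrow> \<zeta> \<in> ball \<zeta>0 \<eta> \<Longrightarrow> norm (u \<gamma> \<zeta>) \<le> \<beta> \<gamma>" "(\<lambda>\<gamma>. \<beta> \<gamma> * Ngr \<gamma>) summable_on I"
  defines "G \<equiv> \<lambda>p. \<Sum>\<^sub>\<infinity>\<gamma>\<in>I. u \<gamma> (fst p) * k (\<phi> \<gamma> (inv_into V d (snd p)))"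
  shows series_C1: "C1 (ball \<zeta>0 (\<eta>/2) \<times> ball x0 r) G"
    and series_norm_le: "p \<in> ball \<zeta>0 (\<eta>/2) \<times> ball x0 r \<Longrightarrow>
      norm (G p) \<le> c0 * (1 + 1 / \<eta>) * (\<Sum>\<^sub>\<infinity>\<gamma>\<in>I. \<beta> \<gamma> * Ngr \<gamma>)"
    and series_fder_le: "p \<in> ball \<zeta>0 (\<eta>/2) \<times> ball x0 r \<Longrightarrow>
      norm (fder G p v) \<le> c0 * (1 + 1 / \<eta>) * (\<Sum>\<^sub>\<infinity>\<gamma>\<in>I. \<beta> \<gamma> * Ngr \<gamma>) * norm v"
  using assms(1)[unfolded series_bound_def, rule_format, of \<eta> I u \<zeta>0 \<beta>] assms(2-6) unfolding G_def by blast+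

section \<open>Poincare series and automorphic forms\<close>

definition poincare :: "nat \<Rightarrow> (complex \<Rightarrow> complex) \<Rightarrow> ('t \<Rightarrow> complex) \<Rightarrow> complex \<times> 't \<Rightarrow> complex" where
  "poincare m h k p = (\<Sum>\<^sub>\<infinity>\<gamma>\<in>\<Gamma>. h (\<gamma> (fst p)) * deriv \<gamma> (fst p) ^ m * k (\<phi> \<gamma> (snd p)))"

definition regular :: "(complex \<times> 't \<Rightarrow> complex) \<Rightarrow> bool" where
  "regular F \<longleftrightarrow> (\<forall>(V, d)\<in>AT. C1 (unit_disc \<times> d ` V) (\<lambda>p. F (fst p, inv_into V d (snd p)))) \<and>
     (\<forall>t\<in>topspace T. (\<lambda>\<zeta>. F (\<zeta>, t)) holomorphic_on unit_disc)"

text \<open>In other terms F d\<zeta>^m is invariant: forms of weight \<open>m\<close> are sections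
  of the m-th power of the holomorphic cotangent bundle of the leaves.\<close>

definition form :: "nat \<Rightarrow> (complex \<times> 't \<Rightarrow> complex) \<Rightarrow> bool" where
  "form m F \<longleftrightarrow> regular F \<and>
     (\<forall>\<gamma>\<in>\<Gamma>. \<forall>\<zeta>\<in>unit_disc. \<forall>t\<in>topspace T. F (\<gamma> \<zeta>, \<phi> \<gamma> t) * deriv \<gamma> \<zeta> ^ m = F (\<zeta>, t))"

text \<open>The chain rule merges the derivatives of \<gamma> at \<open>\<delta> \<zeta>\<close> and
  of \<delta> at \<zeta> into that of the composition, after which right translation by \<delta> is
  a change of index.\<close>

lemma poincare_automorphic:
  assumes d: "\<delta> \<in> \<Gamma>" and z: "norm \<zeta> < 1" and t: "t \<in> topspace T"
  shows "poincare m h k (\<delta> \<zeta>, \<phi> \<delta> t) * deriv \<delta> \<zeta> ^ m = poincare m h k (\<zeta>, t)"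
proof -
  let ?g = "\<lambda>\<gamma>. h (\<gamma> \<zeta>) * deriv \<gamma> \<zeta> ^ m * k (\<phi> \<gamma> t)"
  have "poincare m h k (\<delta> \<zeta>, \<phi> \<delta> t) * deriv \<delta> \<zeta> ^ m
      = (\<Sum>\<^sub>\<infinity>\<gamma>\<in>\<Gamma>. h (\<gamma> (\<delta> \<zeta>)) * deriv \<gamma> (\<delta> \<zeta>) ^ m * k (\<phi> \<gamma> (\<phi> \<delta> t)) * deriv \<delta> \<zeta> ^ m)"
    unfolding poincare_def fst_conv snd_conv by (rule infsum_cmult_left'[symmetric])
  also have "\<dots> = (\<Sum>\<^sub>\<infinity>\<gamma>\<in>\<Gamma>. ?g (compose unit_disc \<gamma> \<delta>))"
    by (rule infsum_cong) (use d z t in \<open>simp add: phi_compose deriv_compose power_mult_distrib mult_ac\<close>)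
  also have "\<dots> = infsum ?g \<Gamma>"
    by (rule infsum_reindex_bij_betw[OF bij_compose_right[OF d]])
  finally show ?thesis by (simp add: poincare_def)
qed

lemma poincare_term_bound:
  assumes g: "\<gamma> \<in> \<Gamma>" and z: "norm \<zeta> \<le> \<rho>" "\<rho> < 1" and h: "\<And>z. norm z < 1 \<Longrightarrow> norm (h z) \<le> H"
  shows "norm (h (\<gamma> \<zeta>) * deriv \<gamma> \<zeta> ^ m) \<le> H * (1 / (1 - \<rho>)\<^sup>2) ^ m * eps \<gamma> ^ m"
proof -
  have z1: "norm \<zeta> < 1" using z by simp
  have "norm (deriv \<gamma> \<zeta>) \<le> eps \<gamma> / (1 - norm \<zeta>)\<^sup>2" by (rule norm_deriv_le[OF g z1])
  also have "\<dots> \<le> eps \<gamma> / (1 - \<rho>)\<^sup>2"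
    using z eps_pos[OF g] by (intro divide_left_mono power_mono mult_pos_pos) auto
  finally have "norm (deriv \<gamma> \<zeta>) ^ m \<le> (eps \<gamma> / (1 - \<rho>)\<^sup>2) ^ m" by (intro power_mono) auto
  moreover have "norm (h (\<gamma> \<zeta>)) \<le> H" by (rule h[OF maps[OF g z1]])
  ultimately have "norm (h (\<gamma> \<zeta>) * deriv \<gamma> \<zeta> ^ m) \<le> H * (eps \<gamma> / (1 - \<rho>)\<^sup>2) ^ m"
    unfolding norm_mult norm_power using order.trans[OF norm_ge_zero h[of 0]] by (intro mult_mono) auto
  then show ?thesis by (simp add: power_divide)
qed

lemma holomorphic_poincare_term:
  assumes g: "\<gamma> \<in> \<Gamma>" and h: "h holomorphic_on unit_disc"
  shows "(\<lambda>\<zeta>. h (\<gamma> \<zeta>) * deriv \<gamma> \<zeta> ^ m) holomorphic_on unit_disc"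
proof -
  have "(h \<circ> \<gamma>) holomorphic_on unit_disc"
    by (rule holomorphic_on_compose_gen[OF hol[OF g] h]) (use maps[OF g] in auto)
  then show ?thesis using holomorphic_deriv[OF hol[OF g]] by (auto simp: comp_def intro!: holomorphic_intros)
qed

lemma poincare_term_summable:
  assumes g: "norm \<zeta> < 1" "t \<in> topspace T" and h: "\<And>z. norm z < 1 \<Longrightarrow> norm (h z) \<le> H" and k: "C1T k" and m: "mgr \<le> m"
  shows "(\<lambda>\<gamma>. h (\<gamma> \<zeta>) * deriv \<gamma> \<zeta> ^ m * k (\<phi> \<gamma> t)) summable_on \<Gamma>"
proof -
  obtain M where M: "0 \<le> M" "\<And>t. t \<in> topspace T \<Longrightarrow> norm (k t) \<le> M" using C1T_bounded[OF k] by blast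
  let ?K = "H * (1 / (1 - norm \<zeta>)\<^sup>2) ^ m"
  have H: "0 \<le> H" using order.trans[OF norm_ge_zero h[of 0]] by simp
  show ?thesis
  proof (rule dominated_summable)
    show "(\<lambda>\<gamma>. ?K * M * (eps \<gamma> ^ m * Ngr \<gamma>)) summable_on \<Gamma>"
      by (rule summable_on_cmult_right[OF summable_Ngr[OF m]])
    fix \<gamma> assume g: "\<gamma> \<in> \<Gamma>"
    have "norm (h (\<gamma> \<zeta>) * deriv \<gamma> \<zeta> ^ m * k (\<phi> \<gamma> t)) \<le> (?K * eps \<gamma> ^ m) * M"
      unfolding norm_mult[of _ "k _"] 
      using poincare_term_bound[OF g order.refl assms(1) h] M(2)[OF phi_maps[OF g assms(2)]] H eps_pos[OF g]
      by (intro mult_mono) auto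
    also have "\<dots> = ?K * M * (eps \<gamma> ^ m * 1)" by simp
    also have "\<dots> \<le> ?K * M * (eps \<gamma> ^ m * Ngr \<gamma>)"
      using H M(1) eps_pos[OF g] Ngr_ge_1[of \<gamma>] by (intro mult_left_mono) auto
    finally show "norm (h (\<gamma> \<zeta>) * deriv \<gamma> \<zeta> ^ m * k (\<phi> \<gamma> t)) \<le> ?K * M * (eps \<gamma> ^ m * Ngr \<gamma>)" .
  qed
qed

text \<open>Near each point of the disc the terms are bounded by a multiple of
  \<open>eps \<gamma> ^ m\<close>, and \<open>series_bound\<close> gives C1. Holomorphy along the
  disc is proved separately, as that of a locally uniform limit of finite partial sums with the same
  majorant.\<close>

lemma form_poincare:
  assumes h: "h holomorphic_on unit_disc" "\<And>z. norm z < 1 \<Longrightarrow> norm (h z) \<le> H" and k: "C1T k" and m: "mgr \<le> m"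
  shows "form m (poincare m h k)"
proof -
  have H: "0 \<le> H" using order.trans[OF norm_ge_zero h(2)[of 0]] by simp
  define u where "u \<gamma> \<zeta> = h (\<gamma> \<zeta>) * deriv \<gamma> \<zeta> ^ m" for \<gamma> \<zeta>
  have loc: "\<exists>\<eta> \<beta>. 0 < \<eta> \<and> ball \<zeta>0 \<eta> \<subseteq> unit_disc \<and> (\<forall>\<gamma>\<in>\<Gamma>. \<forall>\<zeta>\<in>ball \<zeta>0 \<eta>. norm (u \<gamma> \<zeta>) \<le> \<beta> \<gamma>) \<and>
      (\<lambda>\<gamma>. \<beta> \<gamma> * Ngr \<gamma>) summable_on \<Gamma>" if z: "norm \<zeta>0 < 1" for \<zeta>0
  proof -
    \<comment> \<open>The ball has half the distance of \<zeta>0 to the unit circle as its radius,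
      so it stays within radius \<rho> and one constant serves all its points.\<close>
    define \<rho> where "\<rho> = (1 + norm \<zeta>0) / 2"
    have r: "\<rho> < 1" using z by (simp add: \<rho>_def)
    have nz: "norm \<zeta> \<le> \<rho>" if "\<zeta> \<in> ball \<zeta>0 ((1 - norm \<zeta>0) / 2)" for \<zeta>
      using that norm_triangle_ineq2[of \<zeta> \<zeta>0] by (simp add: \<rho>_def dist_norm norm_minus_commute)
    let ?K = "H * (1 / (1 - \<rho>)\<^sup>2) ^ m"
    have "(\<lambda>\<gamma>. ?K * (eps \<gamma> ^ m * Ngr \<gamma>)) summable_on \<Gamma>"
      by (rule summable_on_cmult_right[OF summable_Ngr[OF m]])
    then have "(\<lambda>\<gamma>. ?K * eps \<gamma> ^ m * Ngr \<gamma>) summable_on \<Gamma>" by (simp add: mult.assoc)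
    moreover have "norm (u \<gamma> \<zeta>) \<le> ?K * eps \<gamma> ^ m" if "\<gamma> \<in> \<Gamma>" "\<zeta> \<in> ball \<zeta>0 ((1 - norm \<zeta>0) / 2)" for \<gamma> \<zeta>
      unfolding u_def using poincare_term_bound[OF that(1) nz[OF that(2)] r h(2)] .
    moreover have "ball \<zeta>0 ((1 - norm \<zeta>0) / 2) \<subseteq> unit_disc" using nz r by force
    ultimately show ?thesis using z by (intro exI[of _ "(1 - norm \<zeta>0) / 2"] exI[of _ "\<lambda>\<gamma>. ?K * eps \<gamma> ^ m"]) auto
  qed
  have hu: "u \<gamma> holomorphic_on unit_disc" if "\<gamma> \<in> \<Gamma>" for \<gamma>
    unfolding u_def by (rule holomorphic_poincare_term[OF that h(1)])
  have "C1 (unit_disc \<times> d ` V) (\<lambda>p. poincare m h k (fst p, inv_into V d (snd p)))" if c: "(V, d) \<in> AT" for V d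
  proof (rule C1_local)
    fix p assume "p \<in> unit_disc \<times> d ` V"
    then have p: "norm (fst p) < 1" "snd p \<in> d ` V" by auto
    obtain \<eta> \<beta> where e: "0 < \<eta>" "ball (fst p) \<eta> \<subseteq> unit_disc" "\<And>\<gamma> \<zeta>. \<gamma> \<in> \<Gamma> \<Longrightarrow> \<zeta> \<in> ball (fst p) \<eta> \<Longrightarrow> norm (u \<gamma> \<zeta>) \<le> \<beta> \<gamma>"
      "(\<lambda>\<gamma>. \<beta> \<gamma> * Ngr \<gamma>) summable_on \<Gamma>" using loc[OF p(1)] by blast
    obtain r c0 where r: "0 < r" and sb: "series_bound V d (snd p) k r c0"
      using ex_series_bound[OF c p(2) k] by blast
    have "C1 (ball (fst p) (\<eta>/2) \<times> ball (snd p) r) (\<lambda>p. \<Sum>\<^sub>\<infinity>\<gamma>\<in>\<Gamma>. u \<gamma> (fst p) * k (\<phi> \<gamma> (inv_into V d (snd p))))"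
      by (rule series_C1[OF sb e(1) order.refl holomorphic_on_subset[OF hu e(2)] e(3,4)])
    then show "\<exists>N. open N \<and> p \<in> N \<and> C1 N (\<lambda>p. poincare m h k (fst p, inv_into V d (snd p)))"
      unfolding poincare_def u_def fst_conv snd_conv
      using e(1) r by (intro exI[of _ "ball (fst p) (\<eta>/2) \<times> ball (snd p) r"]) (auto simp: open_Times mem_Times_iff)
  qed
  moreover have "(\<lambda>\<zeta>. poincare m h k (\<zeta>, t)) holomorphic_on unit_disc" if t: "t \<in> topspace T" for t
  proof -
    have "\<exists>S. open S \<and> \<zeta>0 \<in> S \<and> (\<lambda>\<zeta>. poincare m h k (\<zeta>, t)) holomorphic_on S" if z: "\<zeta>0 \<in> unit_disc" for \<zeta>0
    proof -
      obtain \<eta> \<beta> where e: "0 < \<eta>" "ball \<zeta>0 \<eta> \<subseteq> unit_disc" "\<And>\<gamma> \<zeta>. \<gamma> \<in> \<Gamma> \<Longrightarrow> \<zeta> \<in> ball \<zeta>0 \<eta> \<Longrightarrow> norm (u \<gamma> \<zeta>) \<le> \<beta> \<gamma>"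
        "(\<lambda>\<gamma>. \<beta> \<gamma> * Ngr \<gamma>) summable_on \<Gamma>" using loc[OF z[unfolded mem_ball_0]] by blast
      obtain M where M: "0 \<le> M" "\<And>t. t \<in> topspace T \<Longrightarrow> norm (k t) \<le> M" using C1T_bounded[OF k] by blast
      have be: "0 \<le> \<beta> \<gamma>" if "\<gamma> \<in> \<Gamma>" for \<gamma>
        using e(3)[OF that, of \<zeta>0] e(1) by (meson centre_in_ball norm_ge_zero order.trans)
      have sub: "cball \<zeta>0 (\<eta>/2) \<subseteq> ball \<zeta>0 \<eta>" using e(1) by auto
      let ?f = "\<lambda>\<gamma> \<zeta>. u \<gamma> \<zeta> * k (\<phi> \<gamma> t)"
      have ul: "uniform_limit (cball \<zeta>0 (\<eta>/2)) (\<lambda>F \<zeta>. \<Sum>\<gamma>\<in>F. ?f \<gamma> \<zeta>) (\<lambda>\<zeta>. \<Sum>\<^sub>\<infinity>\<gamma>\<in>\<Gamma>. ?f \<gamma> \<zeta>) (finite_subsets_at_top \<Gamma>)"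
      proof (rule Weierstrass_m_test_general)
        show "(\<lambda>\<gamma>. M * (\<beta> \<gamma> * Ngr \<gamma>)) summable_on \<Gamma>" by (rule summable_on_cmult_right[OF e(4)])
        fix \<gamma> \<zeta> assume g: "\<gamma> \<in> \<Gamma>" and "\<zeta> \<in> cball \<zeta>0 (\<eta>/2)"
        then have "norm (u \<gamma> \<zeta>) \<le> \<beta> \<gamma>" using e(3) sub by blast
        then have "norm (?f \<gamma> \<zeta>) \<le> \<beta> \<gamma> * M"
          unfolding norm_mult using M(2)[OF phi_maps[OF g t]] be[OF g] by (intro mult_mono) auto
        also have "\<dots> \<le> (\<beta> \<gamma> * Ngr \<gamma>) * M"
          using mult_left_mono[OF Ngr_ge_1[of \<gamma>] be[OF g]] M(1) by (intro mult_right_mono) auto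
        finally show "norm (?f \<gamma> \<zeta>) \<le> M * (\<beta> \<gamma> * Ngr \<gamma>)" by (simp add: mult_ac)
      qed
      have fh: "(\<lambda>\<zeta>. \<Sum>\<gamma>\<in>F. ?f \<gamma> \<zeta>) holomorphic_on unit_disc" if "F \<subseteq> \<Gamma>" for F
        using that hu by (intro holomorphic_intros) auto
      have cbs: "cball \<zeta>0 (\<eta>/2) \<subseteq> unit_disc" "ball \<zeta>0 (\<eta>/2) \<subseteq> unit_disc"
        using order.trans[OF sub e(2)] ball_subset_cball[of \<zeta>0 "\<eta>/2"] by blast+
      have "\<forall>\<^sub>F F in finite_subsets_at_top \<Gamma>. continuous_on (cball \<zeta>0 (\<eta>/2)) (\<lambda>\<zeta>. \<Sum>\<gamma>\<in>F. ?f \<gamma> \<zeta>) \<and>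
          (\<lambda>\<zeta>. \<Sum>\<gamma>\<in>F. ?f \<gamma> \<zeta>) holomorphic_on ball \<zeta>0 (\<eta>/2)"
        unfolding eventually_finite_subsets_at_top
        using holomorphic_on_subset[OF fh] holomorphic_on_imp_continuous_on cbs
        by (intro exI[of _ "{}"]) blast
      from holomorphic_uniform_limit[OF this ul]
      have "(\<lambda>\<zeta>. \<Sum>\<^sub>\<infinity>\<gamma>\<in>\<Gamma>. ?f \<gamma> \<zeta>) holomorphic_on ball \<zeta>0 (\<eta>/2)" by auto
      then show ?thesis using e(1) unfolding poincare_def u_def fst_conv snd_conv
        by (intro exI[of _ "ball \<zeta>0 (\<eta>/2)"]) auto
    qed
    then obtain S where S: "\<And>z. z \<in> unit_disc \<Longrightarrow> open (S z) \<and> z \<in> S z \<and> (\<lambda>\<zeta>. poincare m h k (\<zeta>, t)) holomorphic_on S z"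
      by metis
    have "(\<lambda>\<zeta>. poincare m h k (\<zeta>, t)) holomorphic_on (\<Union>z\<in>unit_disc. S z)"
      by (rule holomorphic_on_UN_open) (use S in auto)
    then show ?thesis by (rule holomorphic_on_subset) (use S in auto)
  qed
  ultimately show ?thesis
    unfolding form_def regular_def using poincare_automorphic by auto
qed

end

section \<open>Asymptotics for large weight\<close>

lemma C1_fder_near:
  fixes h :: "'a::finite_dim_inner \<Rightarrow> 'b::real_normed_vector"
  assumes h: "C1 S h" and S: "open S" "x \<in> S" and e: "0 < e"
  shows "\<exists>r>0. ball x r \<subseteq> S \<and> (\<forall>y\<in>ball x r. \<forall>v. norm (fder h y v - fder h x v) \<le> e * norm v)"
proof -
  let ?f = "\<lambda>y. \<Sum>b\<in>onb. norm (fder h y b - fder h x b)"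
  have "continuous_on S ?f"
    using C1_continuous_fder[OF h] by (intro continuous_intros)
  then have "open (S \<inter> ?f -` {..<e})"
    using S(1) by (intro continuous_open_preimage) auto
  moreover have "x \<in> S \<inter> ?f -` {..<e}" using S(2) e by auto
  ultimately obtain r where r: "0 < r" "ball x r \<subseteq> S \<inter> ?f -` {..<e}"
    by (meson open_contains_ball)
  have "norm (fder h y v - fder h x v) \<le> e * norm v" if y: "y \<in> ball x r" for y v
  proof -
    have yS: "y \<in> S" using y r by blast
    have "fder h y v - fder h x v = (\<Sum>b\<in>onb. (v \<bullet> b) *\<^sub>R (fder h y b - fder h x b))"
      unfolding fder_expansion[OF h yS, of v] fder_expansion[OF h S(2), of v]
      by (simp add: scaleR_diff_right sum_subtractf)
    also have "norm \<dots> \<le> (\<Sum>b\<in>onb. norm v * norm (fder h y b - fder h x b))"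
    proof (rule order.trans[OF norm_sum sum_mono])
      fix b :: 'a assume "b \<in> onb"
      then have "\<bar>v \<bullet> b\<bar> \<le> norm v" using Cauchy_Schwarz_ineq2[of v b] by (simp add: norm_onb)
      then show "norm ((v \<bullet> b) *\<^sub>R (fder h y b - fder h x b)) \<le> norm v * norm (fder h y b - fder h x b)"
        by (simp add: mult_right_mono)
    qed
    also have "\<dots> = norm v * ?f y" by (simp add: sum_distrib_left)
    also have "\<dots> \<le> norm v * e" using y r by (intro mult_left_mono) auto
    finally show ?thesis by (simp add: mult.commute)
  qed
  with r show ?thesis by blast
qed

text \<open>The linear maps \<open>D l\<close> are jointly bounded below by \<open>nD\<close>. A
  vector killed by maps close to them would have norm at most a fraction of itself, and the mean
  value inequality for \<open>R l - D l\<close> gives the same for \<open>p - q\<close>. Thus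
  closeness at the one point \<open>p0\<close> yields immersion and injectivity on a ball.\<close>

lemma local_immersion:
  fixes R :: "'l \<Rightarrow> 'a::finite_dim_inner \<Rightarrow> 'b::real_normed_vector"
  assumes fin: "finite \<Lambda>" and S: "open S" "p0 \<in> S" and R: "\<And>l. l \<in> \<Lambda> \<Longrightarrow> C1 S (R l)"
    and D: "\<And>l. l \<in> \<Lambda> \<Longrightarrow> bounded_linear (D l)" and nD: "\<And>v. norm v \<le> (\<Sum>l\<in>\<Lambda>. norm (D l v))"
    and RD: "\<And>l v. l \<in> \<Lambda> \<Longrightarrow> norm (fder (R l) p0 v - D l v) \<le> norm v / (4 * (real (card \<Lambda>) + 1))"
  shows "\<exists>r>0. ball p0 r \<subseteq> S \<and>
    (\<forall>p\<in>ball p0 r. \<forall>v. (\<forall>l\<in>\<Lambda>. fder (R l) p v = 0) \<longrightarrow> v = 0) \<and>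
    (\<forall>p\<in>ball p0 r. \<forall>q\<in>ball p0 r. (\<forall>l\<in>\<Lambda>. R l p = R l q) \<longrightarrow> p = q)"
proof -
  \<comment> \<open>One \<delta> is spent at \<open>p0\<close>, another on moving away from it, and
    the card \<Lambda> many errors of 2\<delta> stay below 1 in total. The added 1 covers an empty
    \<Lambda>.\<close>
  define \<delta> where "\<delta> = 1 / (4 * (real (card \<Lambda>) + 1))"
  have d: "0 < \<delta>" by (simp add: \<delta>_def)
  have "real (card \<Lambda>) * (2 * \<delta>) = (2 * real (card \<Lambda>)) / (4 * (real (card \<Lambda>) + 1))"
    by (simp add: \<delta>_def)
  also have "\<dots> < 1" by (simp add: divide_less_eq)
  finally have d1: "real (card \<Lambda>) * (2 * \<delta>) < 1" .
  obtain r where r: "\<And>l. l \<in> \<Lambda> \<Longrightarrow> r l > 0 \<and> ball p0 (r l) \<subseteq> S \<and>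
      (\<forall>y\<in>ball p0 (r l). \<forall>v. norm (fder (R l) y v - fder (R l) p0 v) \<le> \<delta> * norm v)"
    using C1_fder_near[OF R S d] by metis
  obtain r0 where r0: "0 < r0" "ball p0 r0 \<subseteq> S" using S by (meson open_contains_ball)
  define \<rho> where "\<rho> = Min (insert r0 (r ` \<Lambda>))"
  have rho: "0 < \<rho>" "\<rho> \<le> r0" "\<And>l. l \<in> \<Lambda> \<Longrightarrow> \<rho> \<le> r l" using fin r r0 by (auto simp: \<rho>_def)
  have bS: "ball p0 \<rho> \<subseteq> S" using r0 rho by (meson order.trans subset_ball)
  have near: "norm (fder (R l) y v - D l v) \<le> 2 * \<delta> * norm v" if l: "l \<in> \<Lambda>" and y: "y \<in> ball p0 \<rho>" for l y v
  proof -
    have "norm (fder (R l) y v - fder (R l) p0 v) \<le> \<delta> * norm v"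
      using r[OF l] y subset_ball[OF rho(3)[OF l]] by blast
    moreover have "norm (fder (R l) p0 v - D l v) \<le> \<delta> * norm v" using RD[OF l, of v] by (simp add: \<delta>_def)
    ultimately show ?thesis
      using norm_triangle_ineq[of "fder (R l) y v - fder (R l) p0 v" "fder (R l) p0 v - D l v"] by simp
  qed
  have small: "v = 0" if v: "\<And>l. l \<in> \<Lambda> \<Longrightarrow> norm (D l v) \<le> 2 * \<delta> * norm v" for v :: 'a
  proof -
    have "norm v \<le> (\<Sum>l\<in>\<Lambda>. 2 * \<delta> * norm v)" by (rule order.trans[OF nD sum_mono[OF v]])
    also have "\<dots> = (real (card \<Lambda>) * (2 * \<delta>)) * norm v" by simp
    finally have "norm v * (1 - real (card \<Lambda>) * (2 * \<delta>)) \<le> 0" by (simp add: algebra_simps)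
    then show ?thesis using d1 by (simp add: mult_le_0_iff)
  qed
  have "v = 0" if p: "p \<in> ball p0 \<rho>" "\<forall>l\<in>\<Lambda>. fder (R l) p v = 0" for p v
    by (rule small) (use near[OF _ p(1), of _ v] p(2) in auto)
  moreover have "p = q" if pq: "p \<in> ball p0 \<rho>" "q \<in> ball p0 \<rho>" "\<forall>l\<in>\<Lambda>. R l p = R l q" for p q
  proof -
    have "p - q = 0"
    proof (rule small)
      fix l assume l: "l \<in> \<Lambda>"
      interpret D: bounded_linear "D l" by (rule D[OF l])
      have C: "C1 (ball p0 \<rho>) (R l)" by (rule C1_subset[OF R[OF l] bS])
      have der: "((\<lambda>y. R l y - D l y) has_derivative (\<lambda>v. fder (R l) y v - D l v)) (at y)" if "y \<in> ball p0 \<rho>" for y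
        by (intro has_derivative_diff C1_D[OF C that] bounded_linear_imp_has_derivative D.bounded_linear_axioms)
      \<comment> \<open>\<open>R l - D l\<close> has derivative at most 2\<delta>. As
        \<open>R l\<close> takes the same value at \<open>p\<close> and \<open>q\<close>, its
        increment is that of \<open>- D l\<close>.\<close>
      have "norm ((R l p - D l p) - (R l q - D l q)) \<le> (2 * \<delta>) * norm (p - q)"
      proof (rule differentiable_bound[OF convex_ball _ _ pq(1,2)])
        show "((\<lambda>y. R l y - D l y) has_derivative (\<lambda>v. fder (R l) y v - D l v)) (at y within ball p0 \<rho>)"
          if "y \<in> ball p0 \<rho>" for y by (rule has_derivative_at_withinI[OF der[OF that]])
        show "onorm (\<lambda>v. fder (R l) y v - D l v) \<le> 2 * \<delta>" if "y \<in> ball p0 \<rho>" for y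
          by (rule onorm_bound) (use d near[OF l that] in auto)
      qed
      moreover have "(R l p - D l p) - (R l q - D l q) = - D l (p - q)" using pq(3) l by (simp add: D.diff)
      ultimately show "norm (D l (p - q)) \<le> 2 * \<delta> * norm (p - q)" by simp
    qed
    then show ?thesis by simp
  qed
  ultimately show ?thesis using rho(1) bS by (intro exI[of _ \<rho>] conjI ballI allI impI)
qed

lemma bump_avoiding: 
  fixes T :: "'t topology" and AT :: "('t, 'e::finite_dim_inner) chart set"
  assumes "C1_manifold T AT" and t: "t0 \<in> topspace T" "t1 \<noteq> t0"
  shows "\<exists>k. C1_manifold.C1T AT k \<and> k t0 = 1 \<and> k t1 = 0 \<and> (\<forall>t. norm (k t) \<le> 1)"
proof -
  interpret C1_manifold T AT by fact
  obtain V d where c: "(V, d) \<in> AT" "t0 \<in> V" using chart_cover[OF t(1)] by blast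
  have W: "openin T (topspace T - {t1})"
    using Hausdorff_imp_t1_space[OF Hausdorff] by (simp add: t1_space_openin_delete_alt)
  have t0W: "t0 \<in> topspace T - {t1}" using t by auto
  obtain \<beta> :: "'e \<Rightarrow> complex" where "C1 UNIV \<beta>" and b: "\<beta> (d t0) = 1" "\<And>x. norm (\<beta> x) \<le> 1"
    and "\<And>v. fder \<beta> (d t0) v = 0"
    and b': "\<And>t. t \<in> V \<Longrightarrow> \<beta> (d t) \<noteq> 0 \<Longrightarrow> t \<in> topspace T - {t1}"
    "\<And>p. C1 UNIV p \<Longrightarrow> C1T (\<lambda>t. if t \<in> V then \<beta> (d t) * p (d t) else 0)"
    by (rule bump[OF c W t0W], rule that)
  let ?k = "\<lambda>t. if t \<in> V then \<beta> (d t) * 1 else 0"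
  have "C1T ?k" by (rule b'(2)[OF C1_const])
  moreover have "?k t1 = 0" using b'(1)[of t1] by auto
  moreover have "norm (?k t) \<le> 1" for t using b(2) by simp
  ultimately show ?thesis using b(1) c(2) by (intro exI[of _ ?k]) auto
qed

text \<open>The derivative of \<open>mob a\<close> at \<open>z\<close>. Its m-th power is the peak
  function that goes into the Poincare series.\<close>

definition kern :: "complex \<Rightarrow> complex \<Rightarrow> complex" where
  "kern a z = of_real (1 - (norm a)\<^sup>2) / (1 - cnj a * z)\<^sup>2"

lemma holomorphic_on_kern: "norm a < 1 \<Longrightarrow> kern a holomorphic_on unit_disc"
  unfolding kern_def[abs_def] using mob_denominator_nz by (auto intro!: holomorphic_intros)

lemma kern_nz: "norm a < 1 \<Longrightarrow> norm z < 1 \<Longrightarrow> kern a z \<noteq> 0"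
  using one_minus_norm_sq_pos[of a] mob_denominator_nz[of a z]
  by (auto simp: kern_def simp del: of_real_diff)

lemma norm_kern: "norm a < 1 \<Longrightarrow> norm (kern a z) = (1 - (norm a)\<^sup>2) / (norm (1 - cnj a * z))\<^sup>2"
  using one_minus_norm_sq_pos[of a] by (simp add: kern_def norm_divide norm_power del: of_real_diff)

lemma norm_kern_eq: "norm a < 1 \<Longrightarrow> norm z < 1 \<Longrightarrow> norm (kern a z) * (1 - (norm z)\<^sup>2) = 1 - (norm (mob a z))\<^sup>2"
  by (simp add: norm_kern one_minus_norm_mob_sq)

lemma norm_kern_le:
  assumes "norm a < 1" "norm z < 1"
  shows "norm (kern a z) \<le> 1 / (1 - norm a)\<^sup>2"
  unfolding norm_kern[OF assms(1)]
  using mob_denominator'[OF assms] assms one_minus_norm_sq_pos[OF assms(1)]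
  by (intro frac_le power_mono) auto

text \<open>A crude comparison of pseudohyperbolic and Euclidean distance, from |1 - cnj a * z|
  \<le> 2; it turns the separation of orbit points into a gap of the weights below 1.\<close>

lemma norm_mob_ge:
  assumes "norm a < 1" "norm z < 1"
  shows "dist a z / 2 \<le> norm (mob a z)"
proof -
  have "norm (1 - cnj a * z) \<le> 1 + norm a * norm z"
    using norm_triangle_ineq4[of 1 "cnj a * z"] by (simp add: norm_mult)
  also have "\<dots> \<le> 2" using assms mult_mono[of "norm a" 1 "norm z" 1] by simp
  finally have "norm (1 - cnj a * z) \<le> 2" .
  then show ?thesis
    unfolding mob_def norm_divide dist_norm norm_minus_commute[of a z]
    using mob_denominator_nz[OF assms] by (intro divide_left_mono) auto
qed

section \<open>Peaked Poincare series\<close>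

context susp
begin

text \<open>Split w^m into w^(m - mgr), which is at most q^(m - mgr) and tends to 0, and w^mgr,
  which is dominated by the convergent series of weight \<open>mgr\<close>.\<close>

lemma tail_small:
  assumes I: "I \<subseteq> \<Gamma>" and w: "\<And>\<gamma>. \<gamma> \<in> I \<Longrightarrow> 0 \<le> w \<gamma>" "\<And>\<gamma>. \<gamma> \<in> I \<Longrightarrow> w \<gamma> \<le> C * eps \<gamma>" "\<And>\<gamma>. \<gamma> \<in> I \<Longrightarrow> w \<gamma> \<le> q"
    and q: "0 \<le> q" "q < 1" and C: "0 \<le> C" and e: "0 < e"
  shows "\<exists>m0\<ge>mgr. \<forall>m\<ge>m0. (\<lambda>\<gamma>. w \<gamma> ^ m * Ngr \<gamma>) summable_on I \<and> (\<Sum>\<^sub>\<infinity>\<gamma>\<in>I. w \<gamma> ^ m * Ngr \<gamma>) < e"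
proof -
  have sI: "(\<lambda>\<gamma>. eps \<gamma> ^ mgr * Ngr \<gamma>) summable_on I"
    by (rule summable_on_subset_banach[OF summable_Ngr[OF order.refl] I])
  define A where "A = (\<Sum>\<^sub>\<infinity>\<gamma>\<in>I. C ^ mgr * (eps \<gamma> ^ mgr * Ngr \<gamma>))"
  have "(\<lambda>n. q ^ n * A) \<longlonglongrightarrow> 0 * A"
    using q by (intro tendsto_mult_right LIMSEQ_power_zero) auto
  then have "\<forall>\<^sub>F n in sequentially. q ^ n * A < e" using e by (simp add: order_tendstoD(2))
  then obtain n0 where n0: "\<And>n. n \<ge> n0 \<Longrightarrow> q ^ n * A < e" by (auto simp: eventually_sequentially)
  have "(\<lambda>\<gamma>. w \<gamma> ^ m * Ngr \<gamma>) summable_on I \<and> (\<Sum>\<^sub>\<infinity>\<gamma>\<in>I. w \<gamma> ^ m * Ngr \<gamma>) < e" if m: "m \<ge> mgr + n0" for m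
  proof -
    let ?b = "\<lambda>\<gamma>. q ^ (m - mgr) * (C ^ mgr * (eps \<gamma> ^ mgr * Ngr \<gamma>))"
    have sb: "?b summable_on I" by (intro summable_on_cmult_right sI)
    have le: "w \<gamma> ^ m * Ngr \<gamma> \<le> ?b \<gamma>" if g: "\<gamma> \<in> I" for \<gamma>
    proof -
      have "w \<gamma> ^ m = w \<gamma> ^ (m - mgr) * w \<gamma> ^ mgr" using m by (simp flip: power_add)
      also have "\<dots> \<le> q ^ (m - mgr) * (C * eps \<gamma>) ^ mgr"
        using w[OF g] q by (intro mult_mono power_mono) auto
      finally have "w \<gamma> ^ m \<le> q ^ (m - mgr) * (C * eps \<gamma>) ^ mgr" .
      then have "w \<gamma> ^ m * Ngr \<gamma> \<le> q ^ (m - mgr) * (C * eps \<gamma>) ^ mgr * Ngr \<gamma>"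
        using Ngr_ge_1[of \<gamma>] by (intro mult_right_mono) auto
      then show ?thesis by (simp add: power_mult_distrib mult_ac)
    qed
    have nn: "norm (w \<gamma> ^ m * Ngr \<gamma>) \<le> ?b \<gamma>" if g: "\<gamma> \<in> I" for \<gamma>
      using le[OF g] w(1)[OF g] Ngr_ge_1[of \<gamma>] by (simp add: abs_mult)
    have "(\<Sum>\<^sub>\<infinity>\<gamma>\<in>I. w \<gamma> ^ m * Ngr \<gamma>) \<le> infsum ?b I"
      by (rule infsum_mono[OF dominated_summable[OF sb nn] sb le])
    also have "infsum ?b I = q ^ (m - mgr) * A" unfolding A_def
      by (rule infsum_cmult_right) (use summable_on_cmult_right[OF sI] in auto)
    also have "\<dots> < e" using m by (intro n0) auto
    finally show ?thesis using dominated_summable[OF sb nn] by blast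
  qed
  then show ?thesis by (intro exI[of _ "mgr + n0"]) auto
qed

text \<open>Schwarz-Pick for \<gamma> at \<open>z\<close> meets the same identity for
  \<open>mob a\<close> at \<open>\<gamma> z\<close>. Of the two bounds, that by
  \<open>eps \<gamma>\<close> gives summability and that by the distance gives decay in
  \<open>m\<close>.\<close>

lemma kern_weight:
  assumes a: "norm a < 1" and z: "norm z < 1" and g: "\<gamma> \<in> \<Gamma>"
  shows "norm (kern a (\<gamma> z) * deriv \<gamma> z) * (1 - (norm z)\<^sup>2) = 1 - (norm (mob a (\<gamma> z)))\<^sup>2"
    and "1 - (norm (mob a (\<gamma> z)))\<^sup>2 \<le> eps \<gamma> / ((1 - norm a)\<^sup>2 * (1 - norm z)\<^sup>2)"
    and "0 \<le> s \<Longrightarrow> s \<le> dist a (\<gamma> z) \<Longrightarrow> 1 - (norm (mob a (\<gamma> z)))\<^sup>2 \<le> 1 - s\<^sup>2 / 4"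
proof -
  have gz: "norm (\<gamma> z) < 1" by (rule maps[OF g z])
  show eq: "norm (kern a (\<gamma> z) * deriv \<gamma> z) * (1 - (norm z)\<^sup>2) = 1 - (norm (mob a (\<gamma> z)))\<^sup>2"
    using schwarz_pick[OF g z] norm_kern_eq[OF a gz] by (simp add: norm_mult mult.assoc)
  have "norm (kern a (\<gamma> z) * deriv \<gamma> z) * (1 - (norm z)\<^sup>2) \<le> (1 / (1 - norm a)\<^sup>2 * (eps \<gamma> / (1 - norm z)\<^sup>2)) * 1"
    unfolding norm_mult using norm_kern_le[OF a gz] norm_deriv_le[OF g z] eps_pos[OF g] one_minus_norm_sq_pos[OF z]
    by (intro mult_mono) auto
  then show "1 - (norm (mob a (\<gamma> z)))\<^sup>2 \<le> eps \<gamma> / ((1 - norm a)\<^sup>2 * (1 - norm z)\<^sup>2)"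
    unfolding eq by simp
  assume s: "0 \<le> s" "s \<le> dist a (\<gamma> z)"
  have "(s / 2)\<^sup>2 \<le> (norm (mob a (\<gamma> z)))\<^sup>2"
    using norm_mob_ge[OF a gz] s by (intro power_mono) auto
  then show "1 - (norm (mob a (\<gamma> z)))\<^sup>2 \<le> 1 - s\<^sup>2 / 4" by (simp add: power_divide)
qed

text \<open>The factor \<open>H\<close> leaves room for test functions along the disc: the constant
  1 prescribes values, whereas \<open>mob a\<close>, with its simple zero at the peak, prescribes a
  differential.\<close>

lemma form_poincare_kern:
  assumes a: "norm a < 1" and H: "H holomorphic_on unit_disc" "\<And>z. norm z < 1 \<Longrightarrow> norm (H z) \<le> 1"
    and k: "C1T k" and m: "mgr \<le> m"
  shows "form m (poincare m (\<lambda>z. H z * kern a z ^ m) k)"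
proof (rule form_poincare[OF _ _ k m])
  show "(\<lambda>z. H z * kern a z ^ m) holomorphic_on unit_disc"
    by (intro holomorphic_intros H holomorphic_on_kern a)
  show "norm (H z * kern a z ^ m) \<le> 1 * (1 / (1 - norm a)\<^sup>2) ^ m" if "norm z < 1" for z
    unfolding norm_mult norm_power using H(2)[OF that] norm_kern_le[OF a that]
    by (intro mult_mono power_mono) auto
qed

lemma C1T_const: "C1T (\<lambda>t. c)"
  unfolding C1T_def using C1_const by auto

text \<open>Discreteness admits at most one orbit point within \<open>r\<close> of \<open>a\<close>.
  If there is one different from \<open>a\<close>, its distance is the gap; otherwise the gap is
  \<open>r\<close>.\<close>

lemma orbit_separated:
  assumes a: "norm a < 1" and z: "norm z < 1"
  shows "\<exists>s>0. \<forall>\<gamma>\<in>\<Gamma>. \<gamma> z \<noteq> a \<longrightarrow> s \<le> dist a (\<gamma> z)"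
proof -
  obtain r where r: "r > 0" "\<And>\<gamma> w. \<gamma> \<in> \<Gamma> \<Longrightarrow> norm w < 1 \<Longrightarrow> dist a w < r \<Longrightarrow> dist a (\<gamma> w) < r \<Longrightarrow> \<gamma> = disc_id"
    using discrete[OF a] by blast
  have uniq: "\<gamma> z = \<delta> z" if "\<gamma> \<in> \<Gamma>" "\<delta> \<in> \<Gamma>" "dist a (\<gamma> z) < r" "dist a (\<delta> z) < r" for \<gamma> \<delta>
  proof -
    have gz: "norm (\<gamma> z) < 1" using maps that z by blast
    have "compose unit_disc \<delta> (ginv \<gamma>) = disc_id"
      by (rule r(2)[OF _ gz]) (use that z gz in \<open>auto simp: ginv_left_apply intro: comp_in ginv_in\<close>)
    then have "compose unit_disc \<delta> (ginv \<gamma>) (\<gamma> z) = \<gamma> z" using gz by simp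
    then show ?thesis using that z gz by (simp add: ginv_left_apply)
  qed
  show ?thesis
  proof (cases "\<exists>\<gamma>\<in>\<Gamma>. \<gamma> z \<noteq> a \<and> dist a (\<gamma> z) < r")
    case True
    then obtain \<gamma> where g: "\<gamma> \<in> \<Gamma>" "\<gamma> z \<noteq> a" "dist a (\<gamma> z) < r" by blast
    show ?thesis
    proof (intro exI[of _ "dist a (\<gamma> z)"] conjI ballI impI)
      fix \<delta> assume "\<delta> \<in> \<Gamma>" "\<delta> z \<noteq> a"
      then show "dist a (\<gamma> z) \<le> dist a (\<delta> z)" using uniq[OF g(1) _ g(3), of \<delta>] g(3) by force
    qed (use g in auto)
  next
    case False
    then show ?thesis using r(1) by (intro exI[of _ r]) force
  qed
qed

text \<open>With the weight at \<open>z\<close> normalized by \<open>(1 - |z|\<^sup>2)\<^sup>m\<close>, the terms of the series with kernel \<open>kern a\<close> have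
  modulus \<open>(1 - |mob a (\<gamma> z)|\<^sup>2)\<^sup>m\<close>, so only the terms with \<open>\<gamma> z = a\<close> survive as \<open>m\<close> grows.\<close>

lemma separate_half:
  assumes z: "norm \<zeta>0 < 1" "norm \<zeta>1 < 1" and t: "t0 \<in> topspace T" "t1 \<in> topspace T"
    and ne: "\<And>\<gamma>. \<gamma> \<in> \<Gamma> \<Longrightarrow> \<gamma> \<zeta>1 = \<zeta>0 \<Longrightarrow> \<phi> \<gamma> t1 \<noteq> t0"
  shows "\<exists>m0. \<forall>m\<ge>m0. \<exists>F. form m F \<and> 1/2 < norm (F (\<zeta>0, t0)) * (1 - (norm \<zeta>0)\<^sup>2) ^ m \<and>
    norm (F (\<zeta>1, t1)) * (1 - (norm \<zeta>1)\<^sup>2) ^ m < 1/2"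
proof -
  \<comment> \<open>By freeness at most one \<gamma> carries \<zeta>1 to \<zeta>0, so a single zero
    of \<open>k\<close> kills the only peak term at (\<zeta>1, t1).\<close>
  have "\<exists>k. C1T k \<and> k t0 = 1 \<and> (\<forall>t. norm (k t) \<le> 1) \<and> (\<forall>\<gamma>\<in>\<Gamma>. \<gamma> \<zeta>1 = \<zeta>0 \<longrightarrow> k (\<phi> \<gamma> t1) = 0)"
  proof (cases "\<exists>\<gamma>\<in>\<Gamma>. \<gamma> \<zeta>1 = \<zeta>0")
    case True
    then obtain \<gamma> where g: "\<gamma> \<in> \<Gamma>" "\<gamma> \<zeta>1 = \<zeta>0" by blast
    have "\<gamma>' = \<gamma>" if "\<gamma>' \<in> \<Gamma>" "\<gamma>' \<zeta>1 = \<zeta>0" for \<gamma>' using free2[OF that(1) g(1) z(2)] that g by simp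
    then show ?thesis using bump_avoiding[OF C1_manifold_axioms t(1) ne[OF g]] by blast
  next
    case False
    then show ?thesis by (intro exI[of _ "\<lambda>_. 1"]) (auto simp: C1T_const)
  qed
  then obtain k where k: "C1T k" "k t0 = 1" "\<And>t. norm (k t) \<le> 1" "\<And>\<gamma>. \<gamma> \<in> \<Gamma> \<Longrightarrow> \<gamma> \<zeta>1 = \<zeta>0 \<Longrightarrow> k (\<phi> \<gamma> t1) = 0"
    by blast
  \<comment> \<open>The terms away from the peak, normalized at \<open>z\<close>. Both points are
    instances of this bound.\<close>
  have gen: "\<exists>m0\<ge>mgr. \<forall>m\<ge>m0. norm (\<Sum>\<^sub>\<infinity>\<gamma>\<in>{\<gamma>\<in>\<Gamma>. \<gamma> z \<noteq> \<zeta>0}. 1 * kern \<zeta>0 (\<gamma> z) ^ m * deriv \<gamma> z ^ m * k (\<phi> \<gamma> t)) * (1 - (norm z)\<^sup>2) ^ m < 1/2"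
    if z1: "norm z < 1" and tt: "t \<in> topspace T" for z t
  proof -
    let ?I = "{\<gamma>\<in>\<Gamma>. \<gamma> z \<noteq> \<zeta>0}"
    obtain s0 where s0: "s0 > 0" "\<And>\<gamma>. \<gamma> \<in> ?I \<Longrightarrow> s0 \<le> dist \<zeta>0 (\<gamma> z)" using orbit_separated[OF z(1) z1] by blast
    \<comment> \<open>Capping \<open>s0\<close> at 1 keeps the bound 1 - s^2/4 of the weights
      nonnegative.\<close>
    define s where "s = min s0 1"
    have s: "0 < s" "s \<le> 1" "\<And>\<gamma>. \<gamma> \<in> ?I \<Longrightarrow> s \<le> dist \<zeta>0 (\<gamma> z)" using s0 by (auto simp: s_def min.coboundedI1)
    define w where "w \<gamma> = 1 - (norm (mob \<zeta>0 (\<gamma> z)))\<^sup>2" for \<gamma>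
    have w0: "0 \<le> w \<gamma>" if "\<gamma> \<in> ?I" for \<gamma>
      using one_minus_norm_sq_pos[OF norm_mob_less_1[OF z(1) maps[OF _ z1]]] that by (auto simp: w_def less_imp_le)
    have s4: "s\<^sup>2 \<le> 1" using s by (simp add: power_le_one)
    have "\<exists>m0\<ge>mgr. \<forall>m\<ge>m0. (\<lambda>\<gamma>. w \<gamma> ^ m * Ngr \<gamma>) summable_on ?I \<and> (\<Sum>\<^sub>\<infinity>\<gamma>\<in>?I. w \<gamma> ^ m * Ngr \<gamma>) < 1/2"
    proof (rule tail_small[OF _ w0])
      show "w \<gamma> \<le> 1 / ((1 - norm \<zeta>0)\<^sup>2 * (1 - norm z)\<^sup>2) * eps \<gamma>" if "\<gamma> \<in> ?I" for \<gamma>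
        using kern_weight(2)[OF z(1) z1] that by (simp add: w_def)
      show "w \<gamma> \<le> 1 - s\<^sup>2 / 4" if "\<gamma> \<in> ?I" for \<gamma>
        unfolding w_def using that s by (intro kern_weight(3)[OF z(1) z1]) auto
    qed (use s s4 z1 in auto)
    then obtain m0 where m0: "m0 \<ge> mgr" "\<And>m. m \<ge> m0 \<Longrightarrow> (\<lambda>\<gamma>. w \<gamma> ^ m * Ngr \<gamma>) summable_on ?I \<and> (\<Sum>\<^sub>\<infinity>\<gamma>\<in>?I. w \<gamma> ^ m * Ngr \<gamma>) < 1/2"
      by blast
    have "norm (\<Sum>\<^sub>\<infinity>\<gamma>\<in>?I. 1 * kern \<zeta>0 (\<gamma> z) ^ m * deriv \<gamma> z ^ m * k (\<phi> \<gamma> t)) * (1 - (norm z)\<^sup>2) ^ m < 1/2"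
      if m: "m \<ge> m0" for m
    proof -
      let ?u = "\<lambda>\<gamma>. 1 * kern \<zeta>0 (\<gamma> z) ^ m * deriv \<gamma> z ^ m * k (\<phi> \<gamma> t)"
      \<comment> \<open>The normalization enters the sum as a complex factor, so that the domination
        applies term by term.\<close>
      let ?r = "complex_of_real ((1 - (norm z)\<^sup>2) ^ m)"
      have r: "norm ?r = (1 - (norm z)\<^sup>2) ^ m"
        using one_minus_norm_sq_pos[OF z1] by (simp del: of_real_power of_real_diff)
      have "norm (?u \<gamma> * ?r) \<le> w \<gamma> ^ m * Ngr \<gamma>" if g: "\<gamma> \<in> ?I" for \<gamma>
      proof -
        have "norm (?u \<gamma> * ?r) = (norm (kern \<zeta>0 (\<gamma> z) * deriv \<gamma> z) * (1 - (norm z)\<^sup>2)) ^ m * norm (k (\<phi> \<gamma> t))"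
          unfolding norm_mult r norm_power by (simp add: power_mult_distrib mult_ac)
        also have "\<dots> = w \<gamma> ^ m * norm (k (\<phi> \<gamma> t))"
          using kern_weight(1)[OF z(1) z1] g by (simp add: w_def)
        also have "\<dots> \<le> w \<gamma> ^ m * Ngr \<gamma>"
          using w0[OF g] order.trans[OF k(3) Ngr_ge_1] by (intro mult_left_mono) auto
        finally show ?thesis .
      qed
      from norm_infsum_dominated[OF conjunct1[OF m0(2)[OF m]] this]
      have "norm (\<Sum>\<^sub>\<infinity>\<gamma>\<in>?I. ?u \<gamma> * ?r) < 1/2" using m0(2)[OF m] by auto
      then show ?thesis by (simp only: infsum_cmult_left' norm_mult r)
    qed
    then show ?thesis using m0(1) by blast
  qed
  obtain m1 where m1: "m1 \<ge> mgr" "\<And>m. m \<ge> m1 \<Longrightarrow> norm (\<Sum>\<^sub>\<infinity>\<gamma>\<in>{\<gamma>\<in>\<Gamma>. \<gamma> \<zeta>0 \<noteq> \<zeta>0}. 1 * kern \<zeta>0 (\<gamma> \<zeta>0) ^ m * deriv \<gamma> \<zeta>0 ^ m * k (\<phi> \<gamma> t0)) * (1 - (norm \<zeta>0)\<^sup>2) ^ m < 1/2"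
    using gen[OF z(1) t(1)] by blast
  obtain m2 where m2: "m2 \<ge> mgr" "\<And>m. m \<ge> m2 \<Longrightarrow> norm (\<Sum>\<^sub>\<infinity>\<gamma>\<in>{\<gamma>\<in>\<Gamma>. \<gamma> \<zeta>1 \<noteq> \<zeta>0}. 1 * kern \<zeta>0 (\<gamma> \<zeta>1) ^ m * deriv \<gamma> \<zeta>1 ^ m * k (\<phi> \<gamma> t1)) * (1 - (norm \<zeta>1)\<^sup>2) ^ m < 1/2"
    using gen[OF z(2) t(2)] by blast
  show ?thesis
  proof (intro exI[of _ "max m1 m2"] allI impI)
    fix m assume "m \<ge> max m1 m2"
    then have m: "m \<ge> m1" "m \<ge> m2" by auto
    then have mg: "mgr \<le> m" using m1(1) by simp
    let ?F = "poincare m (\<lambda>z. 1 * kern \<zeta>0 z ^ m) k"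
    let ?u = "\<lambda>z t \<gamma>. 1 * kern \<zeta>0 (\<gamma> z) ^ m * deriv \<gamma> z ^ m * k (\<phi> \<gamma> t)"
    have F: "form m ?F" by (rule form_poincare_kern[OF z(1) _ _ k(1) mg]) auto
    \<comment> \<open>At \<zeta>0 only the identity reaches the peak; its normalized term has
      modulus 1, and the rest takes away less than 1/2.\<close>
    have id_only: "{\<gamma>\<in>\<Gamma>. \<gamma> \<zeta>0 \<noteq> \<zeta>0} = \<Gamma> - {disc_id}" using free[OF _ z(1)] z(1) by auto
    have sm: "?u \<zeta>0 t0 summable_on \<Gamma>"
      by (rule poincare_term_summable[OF z(1) t(1) _ k(1) mg, where H = "1 * (1 / (1 - norm \<zeta>0)\<^sup>2) ^ m"])
        (use norm_kern_le[OF z(1)] in \<open>auto simp: norm_power norm_mult power_mono simp flip: power_one_over\<close>)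
    have "infsum (?u \<zeta>0 t0) \<Gamma> = ?u \<zeta>0 t0 disc_id + infsum (?u \<zeta>0 t0) (\<Gamma> - {disc_id})"
      using infsum_Un_disjoint[of "?u \<zeta>0 t0" "{disc_id}" "\<Gamma> - {disc_id}"] summable_on_subset_banach[OF sm, of "\<Gamma> - {disc_id}"] id_in
      by (simp add: insert_absorb)
    also have "?u \<zeta>0 t0 disc_id = kern \<zeta>0 \<zeta>0 ^ m"
      using z(1) t(1) by (simp add: deriv_disc_id phi_id k(2))
    finally have "?F (\<zeta>0, t0) = kern \<zeta>0 \<zeta>0 ^ m + infsum (?u \<zeta>0 t0) {\<gamma>\<in>\<Gamma>. \<gamma> \<zeta>0 \<noteq> \<zeta>0}"
      unfolding poincare_def id_only by simp
    then have "norm (kern \<zeta>0 \<zeta>0 ^ m) \<le> norm (?F (\<zeta>0, t0)) + norm (infsum (?u \<zeta>0 t0) {\<gamma>\<in>\<Gamma>. \<gamma> \<zeta>0 \<noteq> \<zeta>0})"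
      using norm_diff_ineq[of "kern \<zeta>0 \<zeta>0 ^ m" "infsum (?u \<zeta>0 t0) {\<gamma>\<in>\<Gamma>. \<gamma> \<zeta>0 \<noteq> \<zeta>0}"] by simp
    then have "norm (kern \<zeta>0 \<zeta>0 ^ m) * (1 - (norm \<zeta>0)\<^sup>2) ^ m \<le> norm (?F (\<zeta>0, t0)) * (1 - (norm \<zeta>0)\<^sup>2) ^ m
        + norm (infsum (?u \<zeta>0 t0) {\<gamma>\<in>\<Gamma>. \<gamma> \<zeta>0 \<noteq> \<zeta>0}) * (1 - (norm \<zeta>0)\<^sup>2) ^ m"
      using one_minus_norm_sq_pos[OF z(1)] by (simp add: mult_right_mono flip: distrib_right)
    moreover have "norm (kern \<zeta>0 \<zeta>0 ^ m) * (1 - (norm \<zeta>0)\<^sup>2) ^ m = 1"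
      using norm_kern_eq[OF z(1,1)] by (simp add: norm_power flip: power_mult_distrib)
    ultimately have 1: "1/2 < norm (?F (\<zeta>0, t0)) * (1 - (norm \<zeta>0)\<^sup>2) ^ m" using m1(2)[OF m(1)] by linarith
    have "?F (\<zeta>1, t1) = infsum (?u \<zeta>1 t1) {\<gamma>\<in>\<Gamma>. \<gamma> \<zeta>1 \<noteq> \<zeta>0}"
      unfolding poincare_def fst_conv snd_conv by (rule infsum_cong_neutral) (use k(4) in auto)
    then have "norm (?F (\<zeta>1, t1)) * (1 - (norm \<zeta>1)\<^sup>2) ^ m < 1/2" using m2(2)[OF m(2)] by simp
    with F 1 show "\<exists>F. form m F \<and> 1/2 < norm (F (\<zeta>0, t0)) * (1 - (norm \<zeta>0)\<^sup>2) ^ m \<and>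
      norm (F (\<zeta>1, t1)) * (1 - (norm \<zeta>1)\<^sup>2) ^ m < 1/2" by blast
  qed
qed

text \<open>Near \<zeta>0 the normalization is by the holomorphic \<open>kern \<zeta>0\<close>,
  since the quotient is to be differentiated. Compared with 1 / (1 - |\<zeta>|^2) this costs a
  factor 1 - x on a small ball, which the gap of the other terms can afford.\<close>

lemma kern_ratio_bound:
  assumes z0: "norm \<zeta>0 < 1"
  obtains \<eta> q C where "0 < \<eta>" "ball \<zeta>0 \<eta> \<subseteq> unit_disc" "0 \<le> q" "q < 1" "0 \<le> C"
    "\<And>\<gamma> \<zeta>. \<gamma> \<in> \<Gamma> - {disc_id} \<Longrightarrow> \<zeta> \<in> ball \<zeta>0 \<eta> \<Longrightarrow>
       norm (kern \<zeta>0 (\<gamma> \<zeta>) * deriv \<gamma> \<zeta> / kern \<zeta>0 \<zeta>) \<le> min q (C * eps \<gamma>)"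
proof -
  obtain r where r: "r > 0" "\<And>\<gamma> w. \<gamma> \<in> \<Gamma> \<Longrightarrow> norm w < 1 \<Longrightarrow> dist \<zeta>0 w < r \<Longrightarrow> dist \<zeta>0 (\<gamma> w) < r \<Longrightarrow> \<gamma> = disc_id"
    using discrete[OF z0] by blast
  define s where "s = min r 1"
  \<comment> \<open>The gap of the terms other than the identity is s^2/4 = 2x, and (1 - 2x) / (1 -
    x) \<le> 1 - x.\<close>
  define x where "x = s\<^sup>2 / 8"
  define \<rho> where "\<rho> = (1 + norm \<zeta>0) / 2"
  have s: "0 < s" "s \<le> 1" "s \<le> r" using r(1) by (auto simp: s_def)
  have x: "0 < x" "x \<le> 1/8" using s by (auto simp: x_def power_le_one)
  have rho: "\<rho> < 1" using z0 by (simp add: \<rho>_def)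
  have "continuous_on unit_disc (mob \<zeta>0)"
    by (rule holomorphic_on_imp_continuous_on[OF holomorphic_on_mob[OF z0]])
  then obtain \<eta>1 where e1: "0 < \<eta>1" "\<And>\<zeta>. norm \<zeta> < 1 \<Longrightarrow> dist \<zeta> \<zeta>0 < \<eta>1 \<Longrightarrow> dist (mob \<zeta>0 \<zeta>) (mob \<zeta>0 \<zeta>0) < sqrt x"
    using z0 x unfolding continuous_on_iff by (metis mem_ball_0 real_sqrt_gt_zero)
  define \<eta> where "\<eta> = min \<eta>1 (min s ((1 - norm \<zeta>0) / 2))"
  have eta: "0 < \<eta>" "\<eta> \<le> \<eta>1" "\<eta> \<le> s" using e1(1) s z0 by (auto simp: \<eta>_def)
  have eta4: "\<eta> \<le> (1 - norm \<zeta>0) / 2" unfolding \<eta>_def by (rule order.trans[OF min.cobounded2 min.cobounded2])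
  have nz: "norm \<zeta> \<le> \<rho>" if "\<zeta> \<in> ball \<zeta>0 \<eta>" for \<zeta>
    using that eta4 norm_triangle_ineq2[of \<zeta> \<zeta>0] by (simp add: \<rho>_def dist_norm norm_minus_commute field_simps)
  define C where "C = 2 / ((1 - norm \<zeta>0)\<^sup>2 * (1 - \<rho>)\<^sup>2)"
  show ?thesis
  proof (rule that[of \<eta> "1 - x" C])
    show "ball \<zeta>0 \<eta> \<subseteq> unit_disc" using nz rho by force
    show "0 \<le> C" using z0 rho by (simp add: C_def)
    fix \<gamma> \<zeta> assume g: "\<gamma> \<in> \<Gamma> - {disc_id}" and z: "\<zeta> \<in> ball \<zeta>0 \<eta>"
    then have g': "\<gamma> \<in> \<Gamma>" and z1: "norm \<zeta> < 1" using nz[OF z] rho by auto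
    have "s \<le> dist \<zeta>0 (\<gamma> \<zeta>)"
      using r(2)[OF g' z1] z g eta s by force
    then have A2: "1 - (norm (mob \<zeta>0 (\<gamma> \<zeta>)))\<^sup>2 \<le> 1 - 2 * x"
      using kern_weight(3)[OF z0 z1 g', of s] s by (simp add: x_def)
    have "norm (mob \<zeta>0 \<zeta>) \<le> sqrt x" using e1(2)[OF z1] z eta by (simp add: dist_commute)
    then have "(norm (mob \<zeta>0 \<zeta>))\<^sup>2 \<le> x" using x by (metis norm_ge_zero power_mono real_sqrt_pow2 less_imp_le)
    then have B: "1 - x \<le> norm (kern \<zeta>0 \<zeta>) * (1 - (norm \<zeta>)\<^sup>2)" using norm_kern_eq[OF z0 z1] by simp
    have p: "0 < 1 - (norm \<zeta>)\<^sup>2" "0 < norm (kern \<zeta>0 \<zeta>)" using one_minus_norm_sq_pos[OF z1] kern_nz[OF z0 z1] by auto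
    have "norm (kern \<zeta>0 (\<gamma> \<zeta>) * deriv \<gamma> \<zeta> / kern \<zeta>0 \<zeta>)
        = (norm (kern \<zeta>0 (\<gamma> \<zeta>) * deriv \<gamma> \<zeta>) * (1 - (norm \<zeta>)\<^sup>2)) / (norm (kern \<zeta>0 \<zeta>) * (1 - (norm \<zeta>)\<^sup>2))"
      using p by (simp add: norm_divide)
    also have "\<dots> \<le> (1 - (norm (mob \<zeta>0 (\<gamma> \<zeta>)))\<^sup>2) / (1 - x)"
      unfolding kern_weight(1)[OF z0 z1 g']
      using B x one_minus_norm_sq_pos[OF norm_mob_less_1[OF z0 maps[OF g' z1]]] by (intro frac_le) auto
    finally have le: "norm (kern \<zeta>0 (\<gamma> \<zeta>) * deriv \<gamma> \<zeta> / kern \<zeta>0 \<zeta>) \<le> (1 - (norm (mob \<zeta>0 (\<gamma> \<zeta>)))\<^sup>2) / (1 - x)" .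
    have "(1 - (norm (mob \<zeta>0 (\<gamma> \<zeta>)))\<^sup>2) / (1 - x) \<le> (1 - 2 * x) / (1 - x)"
      using A2 x by (intro divide_right_mono) auto
    also have "\<dots> \<le> 1 - x" using x by (simp add: divide_le_eq) (simp add: algebra_simps)
    finally have 1: "(1 - (norm (mob \<zeta>0 (\<gamma> \<zeta>)))\<^sup>2) / (1 - x) \<le> 1 - x" .
    have "(1 - (norm (mob \<zeta>0 (\<gamma> \<zeta>)))\<^sup>2) / (1 - x) \<le> (eps \<gamma> / ((1 - norm \<zeta>0)\<^sup>2 * (1 - norm \<zeta>)\<^sup>2)) / (1/2)"
      using kern_weight(2)[OF z0 z1 g'] x eps_pos[OF g'] by (intro frac_le) auto
    also have "\<dots> \<le> (eps \<gamma> / ((1 - norm \<zeta>0)\<^sup>2 * (1 - \<rho>)\<^sup>2)) / (1/2)"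
      using nz[OF z] rho z0 z1 eps_pos[OF g']
      by (intro divide_right_mono divide_left_mono mult_left_mono power_mono mult_pos_pos) auto
    also have "\<dots> = C * eps \<gamma>" by (simp add: C_def)
    finally have 2: "(1 - (norm (mob \<zeta>0 (\<gamma> \<zeta>)))\<^sup>2) / (1 - x) \<le> C * eps \<gamma>" .
    show "norm (kern \<zeta>0 (\<gamma> \<zeta>) * deriv \<gamma> \<zeta> / kern \<zeta>0 \<zeta>) \<le> min (1 - x) (C * eps \<gamma>)"
      using le 1 2 by simp
  qed (use x eta in auto)
qed

abbreviation "chm V d p \<equiv> (fst p, inv_into V d (snd p))"

lemma regular_C1: "regular F \<Longrightarrow> (V, d) \<in> AT \<Longrightarrow> C1 (unit_disc \<times> d ` V) (\<lambda>p. F (chm V d p))"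
  unfolding regular_def by blast

lemma C1_fst_holomorphic:
  assumes "u holomorphic_on unit_disc"
  shows "C1 (unit_disc \<times> R) (\<lambda>p. u (fst p))"
  by (rule C1_compose[OF C1_holomorphic[OF assms open_ball] C1_bounded_linear[OF bounded_linear_fst]]) auto

lemma C1_snd_chart:
  assumes "C1T k" "(V, d) \<in> AT"
  shows "C1 (S \<times> d ` V) (\<lambda>p. k (inv_into V d (snd p)))"
  by (rule C1_compose[OF C1T_D[OF assms] C1_bounded_linear[OF bounded_linear_snd]]) auto

lemma normalized_poincare_C1:
  assumes c: "(V, d) \<in> AT" and z0: "norm \<zeta>0 < 1"
    and H: "H holomorphic_on unit_disc" "\<And>z. norm z < 1 \<Longrightarrow> norm (H z) \<le> 1" and k: "C1T k" and m: "mgr \<le> m"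
  shows "C1 (unit_disc \<times> d ` V) (\<lambda>p. poincare m (\<lambda>z. H z * kern \<zeta>0 z ^ m) k (chm V d p) / kern \<zeta>0 (fst p) ^ m)"
proof (rule C1_divide)
  show "C1 (unit_disc \<times> d ` V) (\<lambda>p. poincare m (\<lambda>z. H z * kern \<zeta>0 z ^ m) k (chm V d p))"
    using form_poincare_kern[OF z0 H k m] by (intro regular_C1 c) (simp_all add: form_def)
  show "C1 (unit_disc \<times> d ` V) (\<lambda>p. kern \<zeta>0 (fst p) ^ m)"
    by (rule C1_fst_holomorphic) (intro holomorphic_intros holomorphic_on_kern z0)
qed (use kern_nz[OF z0] in auto)

text \<open>After division by the power of the kernel the identity term is exactly \<open>M\<close>.
  The other terms form a series to which \<open>series_bound\<close> applies with a constant
  independent of \<open>m\<close>, so its value and differential tend to 0 by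
  \<open>tail_small\<close>.\<close>

lemma normalized_poincare_limit:
  assumes c: "(V, d) \<in> AT" and t0: "t0 \<in> V" and z0: "norm \<zeta>0 < 1"
    and H: "H holomorphic_on unit_disc" "\<And>z. norm z < 1 \<Longrightarrow> norm (H z) \<le> 1" and k: "C1T k" and e: "0 < e"
  defines "G \<equiv> \<lambda>m p. poincare m (\<lambda>z. H z * kern \<zeta>0 z ^ m) k (chm V d p) / kern \<zeta>0 (fst p) ^ m"
    and "M \<equiv> \<lambda>p. H (fst p) * k (inv_into V d (snd p))"
  shows "\<forall>\<^sub>F m in sequentially. norm (G m (\<zeta>0, d t0) - M (\<zeta>0, d t0)) \<le> e \<and>
    (\<forall>v. norm (fder (G m) (\<zeta>0, d t0) v - fder M (\<zeta>0, d t0) v) \<le> e * norm v)"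
proof -
  obtain \<eta> q C where eta: "0 < \<eta>" "ball \<zeta>0 \<eta> \<subseteq> unit_disc" and q: "0 \<le> q" "q < 1" "0 \<le> C" and
    ratio: "\<And>\<gamma> \<zeta>. \<gamma> \<in> \<Gamma> - {disc_id} \<Longrightarrow> \<zeta> \<in> ball \<zeta>0 \<eta> \<Longrightarrow>
       norm (kern \<zeta>0 (\<gamma> \<zeta>) * deriv \<gamma> \<zeta> / kern \<zeta>0 \<zeta>) \<le> min q (C * eps \<gamma>)"
    by (rule kern_ratio_bound[OF z0], rule that)
  have x0: "d t0 \<in> d ` V" using t0 by simp
  obtain r c0 where r: "0 < r" "0 \<le> c0" "ball (d t0) r \<subseteq> d ` V" and sb: "series_bound V d (d t0) k r c0"
    using ex_series_bound[OF c x0 k] by blast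
  let ?I = "\<Gamma> - {disc_id}"
  define w where "w \<gamma> = min q (C * eps \<gamma>)" for \<gamma>
  define A where "A = c0 * (1 + 1 / \<eta>)"
  have A: "0 \<le> A" using r(2) eta(1) by (simp add: A_def)
  \<comment> \<open>\<open>A + 1\<close> instead of \<open>A\<close>, which may be 0.\<close>
  have "\<exists>m0\<ge>mgr. \<forall>m\<ge>m0. (\<lambda>\<gamma>. w \<gamma> ^ m * Ngr \<gamma>) summable_on ?I \<and> (\<Sum>\<^sub>\<infinity>\<gamma>\<in>?I. w \<gamma> ^ m * Ngr \<gamma>) < e / (A + 1)"
    by (rule tail_small[of _ w C q]) (use q e A eps_pos in \<open>auto simp: w_def less_imp_le\<close>)
  then obtain m0 where m0: "m0 \<ge> mgr" "\<And>m. m \<ge> m0 \<Longrightarrow> (\<lambda>\<gamma>. w \<gamma> ^ m * Ngr \<gamma>) summable_on ?I"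
    "\<And>m. m \<ge> m0 \<Longrightarrow> (\<Sum>\<^sub>\<infinity>\<gamma>\<in>?I. w \<gamma> ^ m * Ngr \<gamma>) < e / (A + 1)" by blast
  let ?p0 = "(\<zeta>0, d t0)"
  let ?S = "ball \<zeta>0 (\<eta>/2) \<times> ball (d t0) r"
  have S: "open ?S" "?p0 \<in> ?S" using eta r by (auto simp: open_Times)
  have sub: "?S \<subseteq> unit_disc \<times> d ` V"
    using eta(2) r(3) subset_ball[of "\<eta>/2" \<eta> \<zeta>0] eta(1) by (intro Sigma_mono) auto
  have "norm (G m ?p0 - M ?p0) \<le> e \<and> (\<forall>v. norm (fder (G m) ?p0 v - fder M ?p0 v) \<le> e * norm v)" if m: "m \<ge> m0" for m
  proof -
    have mg: "mgr \<le> m" using m m0(1) by simp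
    define u where "u \<gamma> \<zeta> = H (\<gamma> \<zeta>) * (kern \<zeta>0 (\<gamma> \<zeta>) * deriv \<gamma> \<zeta> / kern \<zeta>0 \<zeta>) ^ m" for \<gamma> \<zeta>
    have hu: "u \<gamma> holomorphic_on ball \<zeta>0 \<eta>" if "\<gamma> \<in> ?I" for \<gamma>
    proof -
      have g: "\<gamma> \<in> \<Gamma>" using that by simp
      have 1: "(\<lambda>\<zeta>. H (\<gamma> \<zeta>)) holomorphic_on unit_disc" and 2: "(\<lambda>\<zeta>. kern \<zeta>0 (\<gamma> \<zeta>)) holomorphic_on unit_disc"
        using holomorphic_poincare_term[OF g H(1), of 0] holomorphic_poincare_term[OF g holomorphic_on_kern[OF z0], of 0] by auto
      have "u \<gamma> holomorphic_on unit_disc"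
        unfolding u_def
        by (rule holomorphic_on_mult[OF 1 holomorphic_on_power[OF holomorphic_on_divide[OF
          holomorphic_on_mult[OF 2 holomorphic_deriv[OF hol[OF g] open_ball]] holomorphic_on_kern[OF z0]]]])
          (use kern_nz[OF z0] in auto)
      then show ?thesis using eta(2) holomorphic_on_subset by blast
    qed
    have bu: "norm (u \<gamma> \<zeta>) \<le> w \<gamma> ^ m" if g: "\<gamma> \<in> ?I" and z: "\<zeta> \<in> ball \<zeta>0 \<eta>" for \<gamma> \<zeta>
    proof -
      have "norm (\<gamma> \<zeta>) < 1" using maps g z eta(2) by (metis DiffD1 mem_ball_0 subsetD)
      then have h: "norm (H (\<gamma> \<zeta>)) \<le> 1" by (rule H(2))
      have "norm (u \<gamma> \<zeta>) = norm (H (\<gamma> \<zeta>)) * norm (kern \<zeta>0 (\<gamma> \<zeta>) * deriv \<gamma> \<zeta> / kern \<zeta>0 \<zeta>) ^ m"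
        unfolding u_def by (subst norm_mult, subst norm_power) (rule refl)
      also have "\<dots> \<le> 1 * w \<gamma> ^ m"
        unfolding w_def by (rule mult_mono[OF h power_mono[OF ratio[OF g z] norm_ge_zero]]) auto
      finally have "norm (u \<gamma> \<zeta>) \<le> 1 * w \<gamma> ^ m" .
      then show ?thesis by simp
    qed
    define E where "E = (\<lambda>p. \<Sum>\<^sub>\<infinity>\<gamma>\<in>?I. u \<gamma> (fst p) * k (\<phi> \<gamma> (inv_into V d (snd p))))"
    have I: "?I \<subseteq> \<Gamma>" by auto
    note ser = sb eta(1) I hu bu m0(2)[OF m]
    have EC: "C1 ?S E" unfolding E_def by (rule series_C1[OF ser])
    have tail: "A * (\<Sum>\<^sub>\<infinity>\<gamma>\<in>?I. w \<gamma> ^ m * Ngr \<gamma>) \<le> e"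
    proof -
      have "A * (\<Sum>\<^sub>\<infinity>\<gamma>\<in>?I. w \<gamma> ^ m * Ngr \<gamma>) \<le> A * (e / (A + 1))"
        using m0(3)[OF m] A by (intro mult_left_mono) auto
      also have "\<dots> \<le> e" using A e by (simp add: field_simps)
      finally show ?thesis .
    qed
    have EN: "norm (E ?p0) \<le> e"
      using series_norm_le[OF ser S(2)] tail unfolding E_def A_def by linarith
    have ED: "norm (fder E ?p0 v) \<le> e * norm v" for v
    proof -
      have "norm (fder E ?p0 v) \<le> (A * (\<Sum>\<^sub>\<infinity>\<gamma>\<in>?I. w \<gamma> ^ m * Ngr \<gamma>)) * norm v"
        using series_fder_le[OF ser S(2)] unfolding E_def A_def .
      also have "\<dots> \<le> e * norm v" using tail by (rule mult_right_mono) simp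
      finally show ?thesis .
    qed
    have eq: "G m p = M p + E p" if p: "p \<in> ?S" for p
    proof -
      have "p \<in> unit_disc \<times> d ` V" using p sub by blast
      then have z: "norm (fst p) < 1" and "snd p \<in> d ` V" by auto
      then have x: "inv_into V d (snd p) \<in> topspace T" using chart_inv(1)[OF c] chart_subset[OF c] by blast
      have kz: "kern \<zeta>0 (fst p) \<noteq> 0" by (rule kern_nz[OF z0 z])
      let ?f = "\<lambda>\<gamma>. H (\<gamma> (fst p)) * kern \<zeta>0 (\<gamma> (fst p)) ^ m * deriv \<gamma> (fst p) ^ m * k (\<phi> \<gamma> (inv_into V d (snd p)))"
      have sm: "?f summable_on \<Gamma>"
      proof (rule poincare_term_summable[OF z x _ k mg, where h = "\<lambda>z. H z * kern \<zeta>0 z ^ m"])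
        show "norm (H z * kern \<zeta>0 z ^ m) \<le> 1 * (1 / (1 - norm \<zeta>0)\<^sup>2) ^ m" if "norm z < 1" for z
          unfolding norm_mult norm_power using H(2)[OF that] norm_kern_le[OF z0 that]
          by (intro mult_mono power_mono) auto
      qed
      have "infsum ?f \<Gamma> = ?f disc_id + infsum ?f ?I"
        using infsum_Un_disjoint[of ?f "{disc_id}" ?I] summable_on_subset_banach[OF sm, of ?I] id_in
        by (simp add: insert_absorb)
      also have "?f disc_id = M p * kern \<zeta>0 (fst p) ^ m"
        using z x by (simp add: deriv_disc_id phi_id M_def)
      also have "infsum ?f ?I = infsum (\<lambda>\<gamma>. u \<gamma> (fst p) * k (\<phi> \<gamma> (inv_into V d (snd p))) * kern \<zeta>0 (fst p) ^ m) ?I"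
        by (rule infsum_cong) (use kz in \<open>simp add: u_def power_mult_distrib power_divide\<close>)
      also have "\<dots> = E p * kern \<zeta>0 (fst p) ^ m" unfolding E_def by (rule infsum_cmult_left')
      finally show ?thesis using kz by (simp add: G_def poincare_def distrib_right[symmetric])
    qed
    have MC: "C1 ?S M" unfolding M_def
      by (rule C1_subset[OF C1_mult[OF C1_fst_holomorphic[OF H(1)] C1_snd_chart[OF k c]] sub])
    have "(G m has_derivative (\<lambda>v. fder M ?p0 v + fder E ?p0 v)) (at ?p0)"
      by (rule has_derivative_transform_within_open[OF has_derivative_add[OF C1_D[OF MC S(2)] C1_D[OF EC S(2)]] S])
        (simp add: eq)
    then have "fder (G m) ?p0 = (\<lambda>v. fder M ?p0 v + fder E ?p0 v)" by (rule fder_eq)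
    then show ?thesis using EN ED eq[OF S(2)] by simp
  qed
  then show ?thesis unfolding eventually_sequentially by blast
qed

text \<open>The quotient rule at a point where the numerator is near 0 and the denominator is near 1
  with small derivative \<open>b\<close>: only the derivative \<open>a\<close> of the numerator
  survives, and it is close to \<open>D\<close>.\<close>

lemma ratio_derivative_estimate:
  fixes a b D g0 gl :: complex
  assumes e: "0 < e" "e \<le> 1/2" and n: "0 \<le> n" and K: "0 \<le> K" "norm D \<le> K * n"
    and a: "norm (a - D) \<le> e * n" and b: "norm b \<le> e * n" and g0: "norm (g0 - 1) \<le> e" and gl: "norm gl \<le> e"
  shows "g0 \<noteq> 0" "norm ((a * g0 - gl * b) / (g0 * g0) - D) \<le> e * (4 + 2 * K) * n"
proof -
  have g: "1/2 \<le> norm g0"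
    using norm_triangle_ineq2[of 1 "1 - g0"] g0 e by (simp add: norm_minus_commute)
  then show g00: "g0 \<noteq> 0" by auto
  have inv: "1 / norm g0 \<le> 2" using g by (simp add: divide_le_eq)
  have "(a * g0 - gl * b) / (g0 * g0) - D = ((a - D) + D * (1 - g0)) / g0 - gl * b / (g0 * g0)"
    using g00 by (simp add: field_simps)
  also have "norm \<dots> \<le> (norm (a - D) + norm D * norm (1 - g0)) * (1 / norm g0) + norm gl * norm b * ((1 / norm g0) * (1 / norm g0))"
    using norm_triangle_ineq[of "a - D" "D * (1 - g0)"]
    by (intro order.trans[OF norm_triangle_ineq4] add_mono) (auto simp: norm_divide norm_mult divide_right_mono)
  also have "\<dots> \<le> (e * n + (K * n) * e) * 2 + e * (e * n) * (2 * 2)"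
    using a b gl K n e inv g0 by (intro add_mono mult_mono) (auto simp: norm_minus_commute)
  also have "\<dots> = e * n * (2 + 2 * K) + e * n * (4 * e)" by (simp add: algebra_simps)
  also have "\<dots> \<le> e * n * (2 + 2 * K) + e * n * 2"
    using e n by (intro add_left_mono mult_left_mono) auto
  also have "\<dots> = e * (4 + 2 * K) * n" by (simp add: algebra_simps)
  finally show "norm ((a * g0 - gl * b) / (g0 * g0) - D) \<le> e * (4 + 2 * K) * n" .
qed

text \<open>The limits of the normalized series can be prescribed: \<open>mob \<zeta>0\<close> for
  the direction of the disc, a cut-off linear function for each basis vector of the chart, and the
  constant 1 for the denominator. The former vanish at \<open>?p0\<close> and their differentials
  are coordinates, so \<open>local_immersion\<close> applies to the quotients for one large
  \<open>m\<close>.\<close>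

lemma ex_local_immersion:
  assumes c: "(V, d) \<in> AT" and t0: "t0 \<in> V" and z0: "norm \<zeta>0 < 1"
  shows "\<exists>m F0 Fs r. 1 \<le> m \<and> finite Fs \<and> form m F0 \<and> (\<forall>F\<in>Fs. form m F) \<and> 0 < r \<and>
    ball (\<zeta>0, d t0) r \<subseteq> unit_disc \<times> d ` V \<and> (\<forall>p\<in>ball (\<zeta>0, d t0) r. F0 (chm V d p) \<noteq> 0) \<and>
    (\<forall>p\<in>ball (\<zeta>0, d t0) r. \<forall>v. (\<forall>F\<in>Fs. fder (\<lambda>p. F (chm V d p) / F0 (chm V d p)) p v = 0) \<longrightarrow> v = 0) \<and>
    (\<forall>p\<in>ball (\<zeta>0, d t0) r. \<forall>q\<in>ball (\<zeta>0, d t0) r.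
       (\<forall>F\<in>Fs. F (chm V d p) / F0 (chm V d p) = F (chm V d q) / F0 (chm V d q)) \<longrightarrow> p = q)"
proof -
  let ?p0 = "(\<zeta>0, d t0)"
  let ?S = "unit_disc \<times> d ` V"
  obtain \<beta> :: "'e \<Rightarrow> complex" where b1: "C1 UNIV \<beta>" and b2: "\<beta> (d t0) = 1"
    and "\<And>x. norm (\<beta> x) \<le> 1" and b3: "\<And>v. fder \<beta> (d t0) v = 0"
    and "\<And>t. t \<in> V \<Longrightarrow> \<beta> (d t) \<noteq> 0 \<Longrightarrow> t \<in> V"
    and b4: "\<And>p. C1 UNIV p \<Longrightarrow> C1T (\<lambda>t. if t \<in> V then \<beta> (d t) * p (d t) else 0)"
    by (rule bump[OF c t0 chart_open[OF c] t0], rule that)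
  define lin where "lin b x = complex_of_real ((x - d t0) \<bullet> b)" for b x :: 'e
  have lind: "(lin b has_derivative (\<lambda>v. of_real (v \<bullet> b))) (at x)" for b x
    unfolding lin_def[abs_def] by (auto intro!: derivative_eq_intros)
  have linC: "C1 UNIV (lin b)" for b by (rule C1_I[OF lind]) (auto intro: continuous_intros)
  \<comment> \<open>\<open>None\<close> is the direction of the disc, \<open>Some b\<close> a
    direction of the chart.\<close>
  define \<Lambda> :: "'e option set" where "\<Lambda> = insert None (Some ` onb)"
  have fin: "finite \<Lambda>" by (simp add: \<Lambda>_def finite_onb)
  define H where "H l = (case l of None \<Rightarrow> mob \<zeta>0 | Some b \<Rightarrow> (\<lambda>_. 1))" for l :: "'e option"
  define K where "K l = (case l of None \<Rightarrow> (\<lambda>_. 1) | Some b \<Rightarrow> (\<lambda>t. if t \<in> V then \<beta> (d t) * lin b (d t) else 0))" for l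
  define D where "D l v = (case l of None \<Rightarrow> fst v * kern \<zeta>0 \<zeta>0 | Some b \<Rightarrow> of_real (snd v \<bullet> b))" for l and v :: "complex \<times> 'e"
  have Hh: "H l holomorphic_on unit_disc" and Hb: "norm z < 1 \<Longrightarrow> norm (H l z) \<le> 1" for l z
    using holomorphic_on_mob[OF z0] norm_mob_less_1[OF z0] by (auto simp: H_def less_imp_le split: option.splits)
  have KC: "C1T (K l)" for l using b4[OF linC] C1T_const by (auto simp: K_def split: option.splits)
  have Dl: "bounded_linear (D l)" for l
    by (cases l) (auto simp: D_def[abs_def] intro!: bounded_linear_intros
      bounded_linear_compose[OF bounded_linear_of_real bounded_linear_compose[OF bounded_linear_inner_left bounded_linear_snd]])
  have kz: "norm (kern \<zeta>0 \<zeta>0) * (1 - (norm \<zeta>0)\<^sup>2) = 1" using norm_kern_eq[OF z0 z0] by simp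
  \<comment> \<open>The differential of \<open>mob \<zeta>0\<close> at \<zeta>0 does not contract,
    its modulus being 1 / (1 - |\<zeta>0|^2); this is the disc part of \<open>nD\<close>.\<close>
  have k1: "1 \<le> norm (kern \<zeta>0 \<zeta>0)"
  proof -
    have "norm (kern \<zeta>0 \<zeta>0) * (1 - (norm \<zeta>0)\<^sup>2) \<le> norm (kern \<zeta>0 \<zeta>0) * 1" by (intro mult_left_mono) auto
    then show ?thesis using kz by simp
  qed
  have nD: "norm v \<le> (\<Sum>l\<in>\<Lambda>. norm (D l v))" for v
  proof -
    have "norm v \<le> norm (fst v) + norm (snd v)"
      using norm_triangle_ineq[of "(fst v, 0)" "(0, snd v)"] by (simp add: norm_Pair)
    also have "norm (fst v) \<le> norm (fst v) * norm (kern \<zeta>0 \<zeta>0)" using k1 by (simp add: mult_le_cancel_left1)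
    also have "norm (snd v) \<le> (\<Sum>b\<in>onb. \<bar>snd v \<bullet> b\<bar>)" by (rule norm_le_sum_onb)
    finally have "norm v \<le> norm (fst v) * norm (kern \<zeta>0 \<zeta>0) + (\<Sum>b\<in>onb. \<bar>snd v \<bullet> b\<bar>)" by simp
    also have "\<dots> = (\<Sum>l\<in>\<Lambda>. norm (D l v))"
      unfolding \<Lambda>_def using finite_onb by (subst sum.insert) (auto simp: D_def norm_mult sum.reindex)
    finally show ?thesis .
  qed
  define B where "B = norm (kern \<zeta>0 \<zeta>0) + 1"
  have B: "0 \<le> B" "norm (D l v) \<le> B * norm v" if "l \<in> \<Lambda>" for l v
  proof -
    show "0 \<le> B" by (simp add: B_def)
    have nv: "norm (fst v) \<le> norm v" "norm (snd v) \<le> norm v"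
      using norm_fst_le[of "fst v" "snd v"] norm_snd_le[of "snd v" "fst v"] by auto
    show "norm (D l v) \<le> B * norm v"
    proof (cases l)
      case None
      have "norm (fst v) * norm (kern \<zeta>0 \<zeta>0) \<le> norm v * B" using nv by (intro mult_mono) (auto simp: B_def)
      then show ?thesis using None by (simp add: D_def norm_mult mult.commute)
    next
      case (Some b)
      then have "norm b = 1" using that by (auto simp: \<Lambda>_def norm_onb)
      then have "\<bar>snd v \<bullet> b\<bar> \<le> norm (snd v)" using Cauchy_Schwarz_ineq2[of "snd v" b] by simp
      also have "\<dots> \<le> 1 * norm v" using nv by simp
      also have "\<dots> \<le> B * norm v" by (intro mult_right_mono) (auto simp: B_def)
      finally show ?thesis using Some by (simp add: D_def)
    qed
  qed
  define M where "M l p = H l (fst p) * K l (inv_into V d (snd p))" for l p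
  have p0: "?p0 \<in> ?S" and oS: "open ?S" using z0 t0 chart_image_open[OF c] by (auto simp: open_Times)
  have dK: "K (Some b) (inv_into V d x) = \<beta> x * lin b x" if "x \<in> d ` V" for b x
    using chart_inv(1,2)[OF c that] by (simp add: K_def)
  have M0: "M l ?p0 = 0" for l
    using t0 chart_inv(3)[OF c t0] by (auto simp: M_def H_def K_def lin_def split: option.splits)
  have MD: "fder (M l) ?p0 = D l" for l
  proof (cases l)
    case None
    have "(mob \<zeta>0 has_derivative (*) (kern \<zeta>0 \<zeta>0)) (at \<zeta>0)"
      using mob_derivative[OF z0 z0] unfolding has_field_derivative_def kern_def .
    then have "((\<lambda>p. mob \<zeta>0 (fst p)) has_derivative (\<lambda>v. kern \<zeta>0 \<zeta>0 * fst v)) (at ?p0)"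
      using has_derivative_compose[OF bounded_linear_imp_has_derivative[OF bounded_linear_fst], of "mob \<zeta>0" _ ?p0] by simp
    moreover have "M l = (\<lambda>p. mob \<zeta>0 (fst p))" using None by (simp add: M_def[abs_def] H_def K_def)
    ultimately show ?thesis using fder_eq None by (simp add: D_def[abs_def] mult.commute)
  next
    case (Some b)
    have "(\<beta> has_derivative (\<lambda>v. 0)) (at (d t0))"
    proof -
      have "fder \<beta> (d t0) = (\<lambda>v. 0)" by (rule HOL.ext) (rule b3)
      then show ?thesis using C1_D[OF b1, of "d t0"] by simp
    qed
    from has_derivative_mult[OF this lind[of b "d t0"]]
    have "((\<lambda>x. \<beta> x * lin b x) has_derivative (\<lambda>v. of_real (v \<bullet> b))) (at (d t0))" by (simp add: b2)
    then have "((\<lambda>p. \<beta> (snd p) * lin b (snd p)) has_derivative (\<lambda>v. of_real (snd v \<bullet> b))) (at ?p0)"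
      using has_derivative_compose[OF bounded_linear_imp_has_derivative[OF bounded_linear_snd], of "\<lambda>x. \<beta> x * lin b x" _ ?p0] by simp
    then have "(M l has_derivative (\<lambda>v. of_real (snd v \<bullet> b))) (at ?p0)"
      by (rule has_derivative_transform_within_open[OF _ oS p0]) (use Some dK in \<open>auto simp: M_def H_def\<close>)
    then show ?thesis using fder_eq Some by (simp add: D_def[abs_def])
  qed
  \<comment> \<open>The bound 1/2 keeps the denominator in \<open>ratio_derivative_estimate\<close>
    away from 0; the other one brings the resulting error e (4 + 2B) within the tolerance of
    \<open>local_immersion\<close>.\<close>
  define e where "e = min (1/2) (1 / ((4 + 2 * B) * (4 * (real (card \<Lambda>) + 1))))"
  have B0: "0 \<le> B" by (simp add: B_def)
  have e: "0 < e" "e \<le> 1/2" using B0 by (auto simp: e_def)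
  have e2: "e * (4 + 2 * B) \<le> 1 / (4 * (real (card \<Lambda>) + 1))"
  proof -
    have "e * (4 + 2 * B) \<le> 1 / ((4 + 2 * B) * (4 * (real (card \<Lambda>) + 1))) * (4 + 2 * B)"
      using B0 by (intro mult_right_mono) (auto simp: e_def)
    also have "\<dots> = 1 / (4 * (real (card \<Lambda>) + 1))" using B0 by (simp add: divide_simps)
    finally show ?thesis .
  qed
  define F where "F m l = poincare m (\<lambda>z. H l z * kern \<zeta>0 z ^ m) (K l)" for m l
  define F0 where "F0 m = poincare m (\<lambda>z. 1 * kern \<zeta>0 z ^ m) (\<lambda>_. 1)" for m
  define G where "G m l p = F m l (chm V d p) / kern \<zeta>0 (fst p) ^ m" for m l p
  define G0 where "G0 m p = F0 m (chm V d p) / kern \<zeta>0 (fst p) ^ m" for m p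
  have ev1: "\<forall>\<^sub>F m in sequentially. \<forall>l\<in>\<Lambda>. norm (G m l ?p0 - M l ?p0) \<le> e \<and>
      (\<forall>v. norm (fder (G m l) ?p0 v - fder (M l) ?p0 v) \<le> e * norm v)"
  proof (rule eventually_ball_finite[OF fin], intro ballI)
    fix l show "\<forall>\<^sub>F m in sequentially. norm (G m l ?p0 - M l ?p0) \<le> e \<and>
      (\<forall>v. norm (fder (G m l) ?p0 v - fder (M l) ?p0 v) \<le> e * norm v)"
      using normalized_poincare_limit[OF c t0 z0 Hh Hb KC e(1), of l l]
      unfolding G_def[abs_def] F_def M_def[abs_def] .
  qed
  have ev2: "\<forall>\<^sub>F m in sequentially. norm (G0 m ?p0 - 1 * 1) \<le> e \<and>
      (\<forall>v. norm (fder (G0 m) ?p0 v - fder (\<lambda>p. 1 * 1) ?p0 v) \<le> e * norm v)"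
    using normalized_poincare_limit[OF c t0 z0 _ _ C1T_const[of 1] e(1), of "\<lambda>_. 1"]
    unfolding G0_def[abs_def] F0_def by simp
  have ev3: "\<forall>\<^sub>F m in sequentially. max mgr 1 \<le> m" by (rule eventually_ge_at_top)
  obtain m where *: "(\<forall>l\<in>\<Lambda>. norm (G m l ?p0 - M l ?p0) \<le> e \<and>
      (\<forall>v. norm (fder (G m l) ?p0 v - fder (M l) ?p0 v) \<le> e * norm v)) \<and> (norm (G0 m ?p0 - 1 * 1) \<le> e \<and>
      (\<forall>v. norm (fder (G0 m) ?p0 v - fder (\<lambda>p. 1 * 1) ?p0 v) \<le> e * norm v)) \<and> max mgr 1 \<le> m"
    using eventually_happens'[OF sequentially_bot eventually_conj[OF ev1 eventually_conj[OF ev2 ev3]]] ..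
  have m: "norm (G m l ?p0 - M l ?p0) \<le> e" "norm (fder (G m l) ?p0 v - fder (M l) ?p0 v) \<le> e * norm v"
    if "l \<in> \<Lambda>" for l v using * that by blast+
  have m': "norm (G0 m ?p0 - 1 * 1) \<le> e" "norm (fder (G0 m) ?p0 v - fder (\<lambda>p. 1 * 1 :: complex) ?p0 v) \<le> e * norm v" for v
    using * by blast+
  have mg: "mgr \<le> m" "1 \<le> m" using * by auto
  have d1: "fder (\<lambda>p. 1 * 1 :: complex) ?p0 v = 0" for v by (simp add: frechet_derivative_const)
  have GC: "C1 ?S (G m l)" for l unfolding G_def[abs_def] F_def
    by (rule normalized_poincare_C1[OF c z0 Hh Hb KC mg(1)])
  have G0C: "C1 ?S (G0 m)" unfolding G0_def[abs_def] F0_def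
    by (rule normalized_poincare_C1[OF c z0 _ _ C1T_const mg(1)]) auto
  have Ff: "form m (F m l)" for l unfolding F_def by (rule form_poincare_kern[OF z0 Hh Hb KC mg(1)])
  have F0f: "form m (F0 m)" unfolding F0_def by (rule form_poincare_kern[OF z0 _ _ C1T_const mg(1)]) auto
  have est: "G0 m ?p0 \<noteq> 0" "norm ((fder (G m l) ?p0 v * G0 m ?p0 - G m l ?p0 * fder (G0 m) ?p0 v) / (G0 m ?p0 * G0 m ?p0) - D l v)
      \<le> e * (4 + 2 * B) * norm v" if l: "l \<in> \<Lambda>" for l v
    using ratio_derivative_estimate[OF e norm_ge_zero[of v] B0 B(2)[OF l, of v], of "fder (G m l) ?p0 v" "fder (G0 m) ?p0 v" "G0 m ?p0" "G m l ?p0"]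
      m(1)[OF l] m(2)[OF l, of v] m'(1) m'(2)[of v] unfolding M0 MD d1 by auto
  have g00: "G0 m ?p0 \<noteq> 0" using est(1)[of None] by (simp add: \<Lambda>_def)
  define S' where "S' = ?S \<inter> G0 m -` (- {0})"
  have S': "open S'" unfolding S'_def by (rule continuous_open_preimage[OF C1_imp_continuous_on[OF G0C] oS]) auto
  have p0S: "?p0 \<in> S'" using p0 g00 by (simp add: S'_def)
  have sub: "S' \<subseteq> ?S" and nz: "\<And>p. p \<in> S' \<Longrightarrow> G0 m p \<noteq> 0" by (auto simp: S'_def)
  define R where "R l p = G m l p / G0 m p" for l p
  have RC: "C1 S' (R l)" for l unfolding R_def[abs_def]
    by (rule C1_divide[OF C1_subset[OF GC sub] C1_subset[OF G0C sub] nz])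
  have "\<exists>r>0. ball ?p0 r \<subseteq> S' \<and>
    (\<forall>p\<in>ball ?p0 r. \<forall>v. (\<forall>l\<in>\<Lambda>. fder (R l) p v = 0) \<longrightarrow> v = 0) \<and>
    (\<forall>p\<in>ball ?p0 r. \<forall>q\<in>ball ?p0 r. (\<forall>l\<in>\<Lambda>. R l p = R l q) \<longrightarrow> p = q)"
  proof (rule local_immersion[OF fin S' p0S RC Dl nD])
    fix l v assume l: "l \<in> \<Lambda>"
    have "fder (R l) ?p0 v = (fder (G m l) ?p0 v * G0 m ?p0 - G m l ?p0 * fder (G0 m) ?p0 v) / (G0 m ?p0 * G0 m ?p0)"
      unfolding R_def[abs_def] by (rule fder_divide[OF C1_subset[OF GC sub] C1_subset[OF G0C sub] nz p0S])
    then have "norm (fder (R l) ?p0 v - D l v) \<le> e * (4 + 2 * B) * norm v" using est(2)[OF l, of v] by simp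
    also have "\<dots> \<le> 1 / (4 * (real (card \<Lambda>) + 1)) * norm v" using e2 by (rule mult_right_mono) simp
    finally show "norm (fder (R l) ?p0 v - D l v) \<le> norm v / (4 * (real (card \<Lambda>) + 1))" by simp
  qed
  then obtain r where r: "0 < r" "ball ?p0 r \<subseteq> S'"
    and r23: "\<forall>p\<in>ball ?p0 r. \<forall>v. (\<forall>l\<in>\<Lambda>. fder (R l) p v = 0) \<longrightarrow> v = 0"
      "\<forall>p\<in>ball ?p0 r. \<forall>q\<in>ball ?p0 r. (\<forall>l\<in>\<Lambda>. R l p = R l q) \<longrightarrow> p = q"
    by (elim exE conjE)
  note r2 = r23(1)[rule_format] and r3 = r23(2)[rule_format]
  \<comment> \<open>The power of the kernel cancels in the quotient, so the normalized functions and
    the forms have the same ratios.\<close>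
  have FR: "F m l (chm V d p) / F0 m (chm V d p) = R l p" and F0nz: "F0 m (chm V d p) \<noteq> 0" if p: "p \<in> S'" for l p
  proof -
    have "kern \<zeta>0 (fst p) \<noteq> 0" using p by (intro kern_nz[OF z0]) (auto simp: S'_def)
    then show "F m l (chm V d p) / F0 m (chm V d p) = R l p" "F0 m (chm V d p) \<noteq> 0"
      using nz[OF p] by (auto simp: R_def G_def G0_def)
  qed
  have fR: "fder (\<lambda>p. F m l (chm V d p) / F0 m (chm V d p)) p = fder (R l) p" if "p \<in> S'" for l p
    by (rule fder_cong[OF S' that FR])
  show ?thesis
  proof (rule exI[of _ m], rule exI[of _ "F0 m"], rule exI[of _ "F m ` \<Lambda>"], rule exI[of _ r], intro conjI)
    show "\<forall>p\<in>ball ?p0 r. \<forall>v. (\<forall>F\<in>F m ` \<Lambda>. fder (\<lambda>p. F (chm V d p) / F0 m (chm V d p)) p v = 0) \<longrightarrow> v = 0"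
    proof (intro ballI allI impI)
      fix p v assume p: "p \<in> ball ?p0 r" and *: "\<forall>F\<in>F m ` \<Lambda>. fder (\<lambda>p. F (chm V d p) / F0 m (chm V d p)) p v = 0"
      have "p \<in> S'" using p r(2) by blast
      then show "v = 0" using r2[OF p] * fR by auto
    qed
    show "\<forall>p\<in>ball ?p0 r. \<forall>q\<in>ball ?p0 r.
       (\<forall>F\<in>F m ` \<Lambda>. F (chm V d p) / F0 m (chm V d p) = F (chm V d q) / F0 m (chm V d q)) \<longrightarrow> p = q"
    proof (intro ballI impI)
      fix p q assume pq: "p \<in> ball ?p0 r" "q \<in> ball ?p0 r"
        and *: "\<forall>F\<in>F m ` \<Lambda>. F (chm V d p) / F0 m (chm V d p) = F (chm V d q) / F0 m (chm V d q)"
      have "p \<in> S'" "q \<in> S'" using pq r(2) by auto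
      then show "p = q" using r3[OF pq] * FR by auto
    qed
  qed (use mg fin F0f Ff r sub F0nz in auto)
qed

end

section \<open>From local to global separation\<close>

lemma C1_Pair:
  assumes f: "C1 S f" and g: "C1 S g"
  shows "C1 S (\<lambda>x. (f x, g x))"
proof (rule C1_I)
  show "((\<lambda>x. (f x, g x)) has_derivative (\<lambda>v. (fder f x v, fder g x v))) (at x)" if "x \<in> S" for x
    by (rule has_derivative_Pair[OF C1_D[OF f that] C1_D[OF g that]])
qed (auto intro!: continuous_intros C1_continuous_fder[OF f] C1_continuous_fder[OF g])

context susp
begin

section \<open>The diagonal action and the passage to a common weight\<close>

abbreviation "PT \<equiv> prod_topology (top_of_set unit_disc) T"

lemma topspace_PT: "topspace PT = unit_disc \<times> topspace T"
  by simp

definition act :: "(complex \<Rightarrow> complex) \<Rightarrow> complex \<times> 't \<Rightarrow> complex \<times> 't" where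
  "act \<gamma> p = (\<gamma> (fst p), \<phi> \<gamma> (snd p))"

lemma act_maps: "\<gamma> \<in> \<Gamma> \<Longrightarrow> p \<in> topspace PT \<Longrightarrow> act \<gamma> p \<in> topspace PT"
  unfolding topspace_PT using maps phi_maps by (auto simp: act_def)

lemma act_compose: "\<gamma> \<in> \<Gamma> \<Longrightarrow> \<delta> \<in> \<Gamma> \<Longrightarrow> p \<in> topspace PT \<Longrightarrow> act \<gamma> (act \<delta> p) = act (compose unit_disc \<gamma> \<delta>) p"
  unfolding topspace_PT by (auto simp: act_def phi_compose)

lemma act_id: "p \<in> topspace PT \<Longrightarrow> act disc_id p = p"
  unfolding topspace_PT by (auto simp: act_def phi_id)

lemma act_ginv: "\<gamma> \<in> \<Gamma> \<Longrightarrow> p \<in> topspace PT \<Longrightarrow> act (ginv \<gamma>) (act \<gamma> p) = p"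
  "\<gamma> \<in> \<Gamma> \<Longrightarrow> p \<in> topspace PT \<Longrightarrow> act \<gamma> (act (ginv \<gamma>) p) = p"
  by (simp_all add: act_compose ginv_in ginv_left ginv_right act_id del: topspace_prod_topology)

lemma act_continuous:
  assumes g: "\<gamma> \<in> \<Gamma>"
  shows "continuous_map PT PT (act \<gamma>)"
proof -
  have "continuous_map (top_of_set unit_disc) (top_of_set unit_disc) \<gamma>"
    using holomorphic_on_imp_continuous_on[OF hol[OF g]] maps[OF g]
    by (auto simp: continuous_map_in_subtopology)
  then have "continuous_map PT (top_of_set unit_disc) (\<gamma> \<circ> fst)"
    by (rule continuous_map_compose[OF continuous_map_fst])
  moreover have "continuous_map PT T (\<phi> \<gamma> \<circ> snd)"
    by (rule continuous_map_compose[OF continuous_map_snd C1self_continuous[OF phi_C1[OF g]]])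
  ultimately show ?thesis
    unfolding act_def[abs_def] comp_def by (rule continuous_map_pairedI)
qed

lemma form_automorphic: "form m F \<Longrightarrow> \<gamma> \<in> \<Gamma> \<Longrightarrow> p \<in> topspace PT \<Longrightarrow> F (act \<gamma> p) * deriv \<gamma> (fst p) ^ m = F p"
  unfolding topspace_PT form_def act_def by (cases p) auto

lemma form_mult:
  assumes F: "form m F" and G: "form n G"
  shows "form (m + n) (\<lambda>p. F p * G p)"
proof -
  have "F (\<gamma> \<zeta>, \<phi> \<gamma> t) * G (\<gamma> \<zeta>, \<phi> \<gamma> t) * deriv \<gamma> \<zeta> ^ (m + n) = F (\<zeta>, t) * G (\<zeta>, t)"
    if "\<gamma> \<in> \<Gamma>" "\<zeta> \<in> unit_disc" "t \<in> topspace T" for \<gamma> \<zeta> t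
  proof -
    have "F (\<zeta>, t) = F (\<gamma> \<zeta>, \<phi> \<gamma> t) * deriv \<gamma> \<zeta> ^ m" "G (\<zeta>, t) = G (\<gamma> \<zeta>, \<phi> \<gamma> t) * deriv \<gamma> \<zeta> ^ n"
      using F G that unfolding form_def by auto
    then show ?thesis by (simp add: power_add)
  qed
  moreover have "C1 (unit_disc \<times> d ` V) (\<lambda>p. F (chm V d p) * G (chm V d p))" if "(V, d) \<in> AT" for V d
    using F G by (intro C1_mult regular_C1 that) (auto simp: form_def)
  moreover have "(\<lambda>\<zeta>. F (\<zeta>, t) * G (\<zeta>, t)) holomorphic_on unit_disc" if "t \<in> topspace T" for t
    using F G that unfolding form_def regular_def by (intro holomorphic_on_mult) auto
  ultimately show ?thesis unfolding form_def regular_def by auto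
qed

lemma form_one: "form 0 (\<lambda>p. 1)"
  unfolding form_def regular_def using C1_const by auto

lemma form_zero: "form m (\<lambda>p. 0)"
  unfolding form_def regular_def using C1_const by auto

lemma form_power: "form m F \<Longrightarrow> form (k * m) (\<lambda>p. F p ^ k)"
  by (induction k) (use form_one form_mult in auto)

lemma chart_continuous_map:
  assumes c: "(V, d) \<in> AT"
  shows "continuous_map (subtopology PT (unit_disc \<times> V)) (top_of_set (unit_disc \<times> d ` V)) (\<lambda>p. (fst p, d (snd p)))"
proof -
  have e: "subtopology PT (unit_disc \<times> V) = prod_topology (top_of_set unit_disc) (subtopology T V)"
    by (simp add: subtopology_Times subtopology_subtopology)
  have "continuous_map (prod_topology (top_of_set unit_disc) (subtopology T V)) (top_of_set unit_disc) fst"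
    by (rule continuous_map_fst)
  moreover have "continuous_map (subtopology T V) (top_of_set (d ` V)) d"
    by (rule homeomorphic_imp_continuous_map[OF chart_homeomorphic[OF c]])
  then have "continuous_map (prod_topology (top_of_set unit_disc) (subtopology T V)) (top_of_set (d ` V)) (d \<circ> snd)"
    by (rule continuous_map_compose[OF continuous_map_snd])
  ultimately have "continuous_map (prod_topology (top_of_set unit_disc) (subtopology T V))
      (prod_topology (top_of_set unit_disc) (top_of_set (d ` V))) (\<lambda>p. (fst p, (d \<circ> snd) p))"
    by (rule continuous_map_pairedI)
  then show ?thesis unfolding e by simp
qed

lemma chart_box_open: "(V, d) \<in> AT \<Longrightarrow> openin PT (unit_disc \<times> V)"
  using chart_open by (simp add: openin_prod_Times_iff)

lemma chart_preimage_openin_PT: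
  assumes c: "(V, d) \<in> AT" and O: "open U"
  shows "openin PT {p \<in> unit_disc \<times> V. (fst p, d (snd p)) \<in> U}"
proof -
  have t: "topspace (subtopology PT (unit_disc \<times> V)) = unit_disc \<times> V" using chart_subset[OF c] by auto
  have "continuous_map (subtopology PT (unit_disc \<times> V)) euclidean (\<lambda>p. (fst p, d (snd p)))"
    using chart_continuous_map[OF c] by (simp add: continuous_map_in_subtopology)
  then have "openin (subtopology PT (unit_disc \<times> V)) {p \<in> unit_disc \<times> V. (fst p, d (snd p)) \<in> U}"
    using openin_continuous_map_preimage[of _ euclidean _ U] O t by fastforce
  then show ?thesis using openin_trans_full[OF _ chart_box_open[OF c]] by blast
qed

lemma form_continuous:
  assumes F: "form m F"
  shows "continuous_map PT euclidean F"
proof (rule continuous_map_locally)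
  fix p assume "p \<in> topspace PT"
  then have p: "fst p \<in> unit_disc" "snd p \<in> topspace T" by auto
  then obtain V d where c: "(V, d) \<in> AT" "snd p \<in> V" using chart_cover by blast
  have "C1 (unit_disc \<times> d ` V) (\<lambda>p. F (chm V d p))" using F c(1) by (intro regular_C1) (auto simp: form_def)
  then have "continuous_map (top_of_set (unit_disc \<times> d ` V)) euclidean (\<lambda>p. F (chm V d p))"
    by (simp add: C1_imp_continuous_on)
  from continuous_map_compose[OF chart_continuous_map[OF c(1)] this]
  have "continuous_map (subtopology PT (unit_disc \<times> V)) euclidean F"
    by (rule continuous_map_eq) (use chart_inv(3)[OF c(1)] in auto)
  then show "\<exists>U. openin PT U \<and> p \<in> U \<and> continuous_map (subtopology PT U) euclidean F"
    using chart_box_open[OF c(1)] p c(2) by (intro exI[of _ "unit_disc \<times> V"]) (auto simp: mem_Times_iff)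
qed

text \<open>Different points come with different weights, hence the demand for a family in every
  multiple of the local weight: the product of the weights over a finite subcover is a multiple of
  each. The factor \<open>k\<close> stays free so that two results of this kind can again be brought
  to one weight. \<open>mono\<close> allows the union of the families.\<close>

lemma compact_forms:
  assumes Z: "compactin X Z" and mono: "\<And>A B z. R A z \<Longrightarrow> A \<subseteq> B \<Longrightarrow> R B z"
    and loc: "\<And>z. z \<in> Z \<Longrightarrow> \<exists>m U. 1 \<le> m \<and> openin X U \<and> z \<in> U \<and>
      (\<forall>k\<ge>1. \<exists>A. finite A \<and> (\<forall>F\<in>A. form (k * m) F) \<and> (\<forall>z'\<in>U. R A z'))"
  shows "\<exists>m\<ge>1. \<forall>k\<ge>1. \<exists>A. finite A \<and> (\<forall>F\<in>A. form (k * m) F) \<and> (\<forall>z\<in>Z. R A z)"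
proof -
  obtain m U where *: "\<And>z. z \<in> Z \<Longrightarrow> 1 \<le> m z \<and> openin X (U z) \<and> z \<in> U z \<and>
      (\<forall>k\<ge>1. \<exists>A. finite A \<and> (\<forall>F\<in>A. form (k * m z) F) \<and> (\<forall>z'\<in>U z. R A z'))"
    using loc by metis
  have "\<exists>\<F>. finite \<F> \<and> \<F> \<subseteq> U ` Z \<and> Z \<subseteq> \<Union>\<F>"
    by (rule compactinD[OF Z]) (use * in auto)
  then obtain I where I: "finite I" "I \<subseteq> Z" "Z \<subseteq> \<Union>(U ` I)" by (metis finite_subset_image)
  define M where "M = (\<Prod>i\<in>I. m i)"
  have "1 \<le> M" unfolding M_def using I * by (intro prod_ge_1) auto
  moreover have "\<exists>A. finite A \<and> (\<forall>F\<in>A. form (k * M) F) \<and> (\<forall>z\<in>Z. R A z)" if k: "1 \<le> k" for k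
  proof -
    have "\<exists>A. finite A \<and> (\<forall>F\<in>A. form (k * M) F) \<and> (\<forall>z'\<in>U i. R A z')" if i: "i \<in> I" for i
    proof -
      have "M = (\<Prod>j\<in>I - {i}. m j) * m i" unfolding M_def using I(1) i by (simp add: prod.remove mult.commute)
      then have eq: "k * M = (k * (\<Prod>j\<in>I - {i}. m j)) * m i" by simp
      have "1 \<le> (\<Prod>j\<in>I - {i}. m j)" using I * by (intro prod_ge_1) auto
      then have "1 \<le> k * (\<Prod>j\<in>I - {i}. m j)" using k by simp
      moreover have "i \<in> Z" using i I by blast
      ultimately show ?thesis unfolding eq using *[of i] by blast
    qed
    then obtain A where A: "\<And>i. i \<in> I \<Longrightarrow> finite (A i) \<and> (\<forall>F\<in>A i. form (k * M) F) \<and> (\<forall>z'\<in>U i. R (A i) z')"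
      by metis
    have "R (\<Union>(A ` I)) z" if z: "z \<in> Z" for z
    proof -
      obtain i where i: "i \<in> I" "z \<in> U i" using I(3) z by blast
      then show ?thesis using A[OF i(1)] mono[of "A i" z "\<Union>(A ` I)"] by blast
    qed
    then show ?thesis using A I(1) by (intro exI[of _ "\<Union>(A ` I)"]) auto
  qed
  ultimately show ?thesis by blast
qed

text \<open>Injectivity in homogeneous coordinates: at a point of the suspension the values of the
  forms are determined only up to a common nonzero factor.\<close>

definition separated :: "(complex \<times> 't \<Rightarrow> complex) set \<Rightarrow> (complex \<times> 't) \<times> (complex \<times> 't) \<Rightarrow> bool" where
  "separated A z \<longleftrightarrow> (\<forall>a. a \<noteq> 0 \<longrightarrow> (\<forall>F\<in>A. F (fst z) = a * F (snd z)) \<longrightarrow> (\<exists>\<gamma>\<in>\<Gamma>. act \<gamma> (fst z) = snd z))"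

text \<open>A differential proportional to the vector of values itself is zero in projective space;
  excluding it for nonzero \<open>v\<close> is the immersion condition in homogeneous
  coordinates.\<close>

definition immersed :: "(complex \<times> 't \<Rightarrow> complex) set \<Rightarrow> 't set \<Rightarrow> ('t \<Rightarrow> 'e) \<Rightarrow> complex \<times> 't \<Rightarrow> bool" where
  "immersed A V d p \<longleftrightarrow> (\<forall>v l. (\<forall>F\<in>A. fder (\<lambda>x. F (chm V d x)) (fst p, d (snd p)) v = l * F p) \<longrightarrow> v = 0)"

definition immersed_all :: "(complex \<times> 't \<Rightarrow> complex) set \<Rightarrow> complex \<times> 't \<Rightarrow> bool" where
  "immersed_all A p \<longleftrightarrow> (\<exists>F\<in>A. F p \<noteq> 0) \<and> (\<forall>(V, d)\<in>AT. snd p \<in> V \<longrightarrow> immersed A V d p)"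

text \<open>The automorphy factor contributes only a multiple of \<open>F\<close>, which shifts
  \<open>l\<close>. The lemma serves for translation by \<gamma> and, with the identity, for a
  change of charts.\<close>

lemma immersed_transfer:
  assumes A: "\<And>F. F \<in> A \<Longrightarrow> form m F" and g: "\<gamma> \<in> \<Gamma>" and c: "(V, d) \<in> AT" "(V', d') \<in> AT"
    and p: "norm (fst p) < 1" "snd p \<in> V" "\<phi> \<gamma> (snd p) \<in> V'" and im: "immersed A V' d' (act \<gamma> p)"
  shows "immersed A V d p"
  unfolding immersed_def
proof (intro allI impI)
  fix v l assume v: "\<forall>F\<in>A. fder (\<lambda>x. F (chm V d x)) (fst p, d (snd p)) v = l * F p"
  let ?g' = "ginv \<gamma>"
  have g': "?g' \<in> \<Gamma>" by (rule ginv_in[OF g])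
  define N where "N = unit_disc \<times> d ` (V \<inter> \<phi> \<gamma> -` V')"
  define N' where "N' = unit_disc \<times> d' ` (V' \<inter> \<phi> ?g' -` V)"
  define x where "x = (fst p, d (snd p))"
  have oN: "open N" unfolding N_def
    by (intro open_Times open_ball C1self_open[OF phi_C1[OF g] c(1) chart_open[OF c(2)]])
  have xN: "x \<in> N" using p by (auto simp: N_def x_def)
  \<comment> \<open>The translation by \<gamma> in coordinates. \<open>\<Xi>\<close> is its inverse
    and recovers \<open>v\<close> from the image \<open>w\<close>.\<close>
  define \<Theta> where "\<Theta> y = (\<gamma> (fst y), d' (\<phi> \<gamma> (inv_into V d (snd y))))" for y
  define \<Xi> where "\<Xi> y = (?g' (fst y), d (\<phi> ?g' (inv_into V' d' (snd y))))" for y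
  have C: "C1 (unit_disc \<times> d ` (V \<inter> \<phi> \<gamma> -` V')) (\<lambda>y. (\<gamma> (fst y), d' (\<phi> \<gamma> (inv_into V d (snd y)))))"
    if g: "\<gamma> \<in> \<Gamma>" and c: "(V, d) \<in> AT" "(V', d') \<in> AT" for \<gamma> V d V' d'
  proof (rule C1_Pair[OF C1_fst_holomorphic[OF hol[OF g]]])
    show "C1 (unit_disc \<times> d ` (V \<inter> \<phi> \<gamma> -` V')) (\<lambda>y. d' (\<phi> \<gamma> (inv_into V d (snd y))))"
      by (rule C1_compose[OF C1self_chart[OF phi_C1[OF g] c] C1_bounded_linear[OF bounded_linear_snd]]) auto
  qed
  have TC: "C1 N \<Theta>" unfolding N_def \<Theta>_def[abs_def] by (rule C[OF g c])
  have XC: "C1 N' \<Xi>" unfolding N'_def \<Xi>_def[abs_def] by (rule C[OF g' c(2,1)])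
  have pt: "y1 \<in> topspace T" if "y1 \<in> V" for y1 using chart_subset[OF c(1)] that by blast
  have TN: "\<Theta> ` N \<subseteq> N'"
    using maps[OF g] chart_inv(3)[OF c(1)] phi_ginv[OF g pt] by (auto simp: N_def N'_def \<Theta>_def)
  have XT: "\<Xi> (\<Theta> y) = y" if y: "y \<in> N" for y
  proof -
    obtain s where s: "s \<in> V" "\<phi> \<gamma> s \<in> V'" "snd y = d s" and y1: "norm (fst y) < 1" using y by (auto simp: N_def)
    then show ?thesis using chart_inv(3)[OF c(1) s(1)] chart_inv(3)[OF c(2) s(2)] phi_ginv[OF g pt[OF s(1)]] ginv_left_apply[OF g y1]
      by (simp add: \<Theta>_def \<Xi>_def prod_eq_iff)
  qed
  define w where "w = fder \<Theta> x v"
  have "fder \<Xi> (\<Theta> x) w = fder (\<lambda>y. \<Xi> (\<Theta> y)) x v"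
    unfolding w_def by (rule fder_compose[OF XC TC TN xN, symmetric])
  also have "\<dots> = fder (\<lambda>y. y) x v" by (simp add: fder_cong[OF oN xN XT])
  also have "\<dots> = v" by simp
  finally have Xw: "fder \<Xi> (\<Theta> x) w = v" .
  define J where "J y = deriv \<gamma> (fst y) ^ m" for y :: "complex \<times> 'e"
  have JC: "C1 N J" unfolding J_def[abs_def] N_def
    by (rule C1_fst_holomorphic[OF holomorphic_on_power[OF holomorphic_deriv[OF hol[OF g] open_ball]]])
  have Jx: "J x \<noteq> 0" using deriv_nz[OF g p(1)] by (simp add: J_def x_def)
  have Tx: "\<Theta> x = (fst (act \<gamma> p), d' (snd (act \<gamma> p)))"
    using chart_inv(3)[OF c(1) p(2)] by (simp add: \<Theta>_def x_def act_def)
  have im_sub: "\<Theta> ` N \<subseteq> unit_disc \<times> d' ` V'" using TN by (auto simp: N'_def)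
  \<comment> \<open>By the product rule for the form in the new chart times \<open>J\<close>, the
    logarithmic derivative of \<open>J\<close> is subtracted from \<open>l\<close>.\<close>
  have "fder (\<lambda>x. F (chm V' d' x)) (\<Theta> x) w = (l - fder J x v / J x) * F (act \<gamma> p)" if F: "F \<in> A" for F
  proof -
    let ?F' = "\<lambda>x. F (chm V' d' x)"
    have FC: "C1 (unit_disc \<times> d' ` V') ?F'" using A[OF F] c(2) by (intro regular_C1) (auto simp: form_def)
    have eq: "F (chm V d y) = ?F' (\<Theta> y) * J y" if y: "y \<in> N" for y
    proof -
      obtain s where s: "s \<in> V" "\<phi> \<gamma> s \<in> V'" "snd y = d s" and y1: "norm (fst y) < 1" using y by (auto simp: N_def)
      have "F (act \<gamma> (fst y, s)) * deriv \<gamma> (fst y) ^ m = F (fst y, s)"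
        using form_automorphic[OF A[OF F] g, of "(fst y, s)"] y1 pt[OF s(1)] by simp
      then show ?thesis using chart_inv(3)[OF c(1) s(1)] chart_inv(3)[OF c(2) s(2)] s(3)
        by (simp add: \<Theta>_def J_def act_def)
    qed
    have F'C: "C1 N (\<lambda>y. ?F' (\<Theta> y))" by (rule C1_compose[OF FC TC im_sub])
    have "fder (\<lambda>y. F (chm V d y)) x v = fder (\<lambda>y. ?F' (\<Theta> y) * J y) x v" by (simp add: fder_cong[OF oN xN eq])
    also have "\<dots> = ?F' (\<Theta> x) * fder J x v + fder (\<lambda>y. ?F' (\<Theta> y)) x v * J x" by (rule fder_mult[OF F'C JC xN])
    also have "fder (\<lambda>y. ?F' (\<Theta> y)) x v = fder ?F' (\<Theta> x) w" unfolding w_def by (rule fder_compose[OF FC TC im_sub xN])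
    finally have 1: "fder (\<lambda>y. F (chm V d y)) x v = ?F' (\<Theta> x) * fder J x v + fder ?F' (\<Theta> x) w * J x" .
    have F'x: "?F' (\<Theta> x) = F (act \<gamma> p)" using chart_inv(3)[OF c(2) p(3)] by (simp add: Tx act_def)
    have "fder (\<lambda>y. F (chm V d y)) x v = l * F p" using v F by (simp add: x_def)
    also have "F p = F (act \<gamma> p) * J x"
      using eq[OF xN] chart_inv(3)[OF c(1) p(2)] F'x by (simp add: x_def)
    finally have "fder ?F' (\<Theta> x) w * J x = (l * J x - fder J x v) * F (act \<gamma> p)"
      using 1 F'x by (simp add: algebra_simps)
    then show ?thesis using Jx by (simp add: field_simps)
  qed
  then have "w = 0" using im unfolding immersed_def Tx by blast
  moreover have "linear (fder \<Xi> (\<Theta> x))"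
    using fder_linear[OF XC, of "\<Theta> x"] TN xN by (blast intro: bounded_linear.linear)
  ultimately show "v = 0" using Xw linear_0 by metis
qed

lemma immersed_all_act:
  assumes A: "\<And>F. F \<in> A \<Longrightarrow> form m F" and g: "\<gamma> \<in> \<Gamma>" and p: "p \<in> topspace PT" and im: "immersed_all A (act \<gamma> p)"
  shows "immersed_all A p"
  unfolding immersed_all_def
proof (intro conjI)
  have p': "norm (fst p) < 1" "snd p \<in> topspace T" using p by auto
  obtain F where F: "F \<in> A" "F (act \<gamma> p) \<noteq> 0" using im by (auto simp: immersed_all_def)
  then show "\<exists>F\<in>A. F p \<noteq> 0"
    using form_automorphic[OF A[OF F(1)] g p] deriv_nz[OF g p'(1)] by (metis mult_eq_0_iff power_not_zero)
  show "\<forall>(V, d)\<in>AT. snd p \<in> V \<longrightarrow> immersed A V d p"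
  proof (clarify)
    fix V d assume c: "(V, d) \<in> AT" and t: "snd p \<in> V"
    obtain V' d' where c': "(V', d') \<in> AT" "\<phi> \<gamma> (snd p) \<in> V'" using chart_cover[OF phi_maps[OF g p'(2)]] by blast
    show "immersed A V d p"
      by (rule immersed_transfer[OF A g c c'(1) p'(1) t c'(2)])
        (use im c' in \<open>auto simp: immersed_all_def act_def\<close>)
  qed
qed

text \<open>Only the quotients by \<open>F0\<close> matter for immersion and injectivity. With
  \<open>F0 ^ k\<close> as the denominator and each \<open>F\<close> multiplied by
  \<open>F0 ^ (k - 1)\<close>, they are the same in every weight \<open>k * m\<close>.\<close>

lemma immersion_nbhd:
  assumes p: "p \<in> topspace PT"
  obtains m U where "1 \<le> m" "openin PT U" "p \<in> U"
    "\<And>k. 1 \<le> k \<Longrightarrow> \<exists>A. finite A \<and> (\<forall>F\<in>A. form (k * m) F) \<and> (\<forall>p'\<in>U. immersed_all A p') \<and>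
       (\<forall>p'\<in>U. \<forall>q'\<in>U. \<forall>a. a \<noteq> 0 \<longrightarrow> (\<forall>F\<in>A. F p' = a * F q') \<longrightarrow> p' = q')"
proof -
  have p': "norm (fst p) < 1" "snd p \<in> topspace T" using p by auto
  obtain V d where c: "(V, d) \<in> AT" "snd p \<in> V" using chart_cover[OF p'(2)] by blast
  let ?x = "(fst p, d (snd p))"
  obtain m F0 Fs r where m: "1 \<le> m" and fin: "finite Fs" and F0: "form m F0" and Fs: "\<And>F. F \<in> Fs \<Longrightarrow> form m F" and r: "0 < r"
    "ball ?x r \<subseteq> unit_disc \<times> d ` V" and nz: "\<forall>y\<in>ball ?x r. F0 (chm V d y) \<noteq> 0"
    and im: "\<forall>y\<in>ball ?x r. \<forall>v. (\<forall>F\<in>Fs. fder (\<lambda>y. F (chm V d y) / F0 (chm V d y)) y v = 0) \<longrightarrow> v = 0"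
    and inj: "\<forall>y\<in>ball ?x r. \<forall>z\<in>ball ?x r.
       (\<forall>F\<in>Fs. F (chm V d y) / F0 (chm V d y) = F (chm V d z) / F0 (chm V d z)) \<longrightarrow> y = z"
    using ex_local_immersion[OF c p'(1)] by (elim exE conjE) blast
  define U where "U = {p \<in> unit_disc \<times> V. (fst p, d (snd p)) \<in> ball ?x r}"
  have U: "openin PT U" unfolding U_def by (rule chart_preimage_openin_PT[OF c(1)]) auto
  have pU: "p \<in> U" using p' c(2) r by (auto simp: U_def mem_Times_iff)
  have ch: "chm V d (fst p', d (snd p')) = p'" if "p' \<in> U" for p'
    using that chart_inv(3)[OF c(1)] by (auto simp: U_def)
  show ?thesis
  proof (rule that[OF m U pU])
    fix k :: nat assume k: "1 \<le> k"
    define A where "A = insert (\<lambda>p. F0 p ^ k) ((\<lambda>F p. F0 p ^ (k - 1) * F p) ` Fs)"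
    have kk: "k * m = (k - 1) * m + m" using k by (cases k) auto
    have Af: "\<forall>F\<in>A. form (k * m) F"
      using form_power[OF F0, of k] form_mult[OF form_power[OF F0, of "k - 1"] Fs] by (auto simp: A_def kk)
    have pw: "F0 p ^ k = F0 p ^ (k - 1) * F0 p" for p using k by (cases k) auto
    have F0U: "F0 p' \<noteq> 0" if "p' \<in> U" for p'
      using nz[rule_format, of "(fst p', d (snd p'))"] that ch[OF that] by (auto simp: U_def)
    have imU: "immersed A V d p'" if pU': "p' \<in> U" for p'
      unfolding immersed_def
    proof (intro allI impI)
      fix v l assume v: "\<forall>F\<in>A. fder (\<lambda>x. F (chm V d x)) (fst p', d (snd p')) v = l * F p'"
      let ?y = "(fst p', d (snd p'))"
      have y: "?y \<in> ball ?x r" using pU' by (simp add: U_def)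
      have yS: "?y \<in> unit_disc \<times> d ` V" using y r(2) by blast
      note C = regular_C1[OF conjunct1[OF Af[rule_format, unfolded form_def]] c(1)]
      have "fder (\<lambda>y. F (chm V d y) / F0 (chm V d y)) ?y v = 0" if F: "F \<in> Fs" for F
      proof -
        let ?G = "\<lambda>y. F0 (chm V d y) ^ (k - 1) * F (chm V d y)" and ?H = "\<lambda>y. F0 (chm V d y) ^ k"
        have GA: "(\<lambda>p. F0 p ^ (k - 1) * F p) \<in> A" and HA: "(\<lambda>p. F0 p ^ k) \<in> A" using F by (auto simp: A_def)
        have GC: "C1 (ball ?x r) ?G" by (rule C1_subset[OF C[OF GA] r(2)])
        have HC: "C1 (ball ?x r) ?H" by (rule C1_subset[OF C[OF HA] r(2)])
        have "fder (\<lambda>y. F (chm V d y) / F0 (chm V d y)) ?y v = fder (\<lambda>y. ?G y / ?H y) ?y v"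
        proof -
          have "F (chm V d z) / F0 (chm V d z) = ?G z / ?H z" if "z \<in> ball ?x r" for z
            using nz that unfolding pw by simp
          from fder_cong[OF open_ball y this] show ?thesis by simp
        qed
        also have "\<dots> = (fder ?G ?y v * ?H ?y - ?G ?y * fder ?H ?y v) / (?H ?y * ?H ?y)"
          by (rule fder_divide[OF GC HC _ y]) (use nz in auto)
        also have "fder ?G ?y v = l * ?G ?y" using v[rule_format, OF GA] ch[OF pU'] by simp
        also have "fder ?H ?y v = l * ?H ?y" using v[rule_format, OF HA] ch[OF pU'] by simp
        finally show ?thesis by simp
      qed
      then show "v = 0" using im y by blast
    qed
    have "immersed_all A p'" if pU': "p' \<in> U" for p'
      unfolding immersed_all_def
    proof (intro conjI)
      show "\<exists>F\<in>A. F p' \<noteq> 0" using F0U[OF pU'] by (auto simp: A_def)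
      show "\<forall>(V, d)\<in>AT. snd p' \<in> V \<longrightarrow> immersed A V d p'"
      proof clarify
        fix V' d' assume c': "(V', d') \<in> AT" and t: "snd p' \<in> V'"
        have pp: "norm (fst p') < 1" "snd p' \<in> V" "snd p' \<in> topspace T" using pU' chart_subset[OF c(1)] by (auto simp: U_def)
        \<comment> \<open>Immersion is known in the chart (V, d); translation by the identity
          carries it to every other chart.\<close>
        have "act disc_id p' = p'" by (rule act_id) (use pp in \<open>auto simp: mem_Times_iff\<close>)
        then show "immersed A V' d' p'"
          using imU[OF pU'] Af pp t by (intro immersed_transfer[OF _ id_in c' c(1), of A "k * m"]) (auto simp: phi_id)
      qed
    qed
    moreover have "p' = q'" if pq: "p' \<in> U" "q' \<in> U" "a \<noteq> 0" "\<forall>F\<in>A. F p' = a * F q'" for p' q' a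
    proof -
      let ?y = "(fst p', d (snd p'))" and ?z = "(fst q', d (snd q'))"
      have yz: "?y \<in> ball ?x r" "?z \<in> ball ?x r" using pq by (auto simp: U_def)
      have "F p' / F0 p' = F q' / F0 q'" if F: "F \<in> Fs" for F
      proof -
        have 1: "F0 p' ^ (k - 1) * F p' = a * (F0 q' ^ (k - 1) * F q')"
          using pq(4) F by (auto simp: A_def)
        have 2: "F0 p' ^ (k - 1) * F0 p' = a * (F0 q' ^ (k - 1) * F0 q')"
          using pq(4) unfolding A_def pw by auto
        have "F p' / F0 p' = (F0 p' ^ (k - 1) * F p') / (F0 p' ^ (k - 1) * F0 p')"
          using F0U[OF pq(1)] by simp
        also have "\<dots> = F q' / F0 q'" unfolding 1 2 using F0U[OF pq(2)] pq(3) by simp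
        finally show ?thesis .
      qed
      note eq = this
      have "?y = ?z"
      proof (rule inj[rule_format, OF yz])
        fix F assume "F \<in> Fs"
        then show "F (chm V d ?y) / F0 (chm V d ?y) = F (chm V d ?z) / F0 (chm V d ?z)"
          unfolding ch[OF pq(1)] ch[OF pq(2)] by (rule eq)
      qed
      then show "p' = q'" using ch[OF pq(1)] ch[OF pq(2)] by metis
    qed
    ultimately show "\<exists>A. finite A \<and> (\<forall>F\<in>A. form (k * m) F) \<and> (\<forall>p'\<in>U. immersed_all A p') \<and>
       (\<forall>p'\<in>U. \<forall>q'\<in>U. \<forall>a. a \<noteq> 0 \<longrightarrow> (\<forall>F\<in>A. F p' = a * F q') \<longrightarrow> p' = q')"
      using Af fin by (intro exI[of _ A]) (auto simp: A_def)
  qed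
qed

lemma form_norm_less_open:
  assumes "form m F" "form m G"
  shows "openin PT {p \<in> topspace PT. norm (F p) < norm (G p)}"
proof -
  have "continuous_map PT euclideanreal (\<lambda>p. norm (G p) - norm (F p))"
    using form_continuous[OF assms(1)] form_continuous[OF assms(2)] by (intro continuous_intros) auto
  then have "openin PT {p \<in> topspace PT. norm (G p) - norm (F p) \<in> {0<..}}"
    by (rule openin_continuous_map_preimage) auto
  then show ?thesis by simp
qed

text \<open>For equivalent points, injectivity near \<open>p\<close> is used after moving the second
  point back by \<gamma>. Otherwise one form dominates another at \<open>p\<close> and is dominated
  by it at \<open>q\<close>; these inequalities are open, exclude proportional values, and survive
  the passage to powers.\<close>

lemma separation_nbhd:
  assumes p: "p \<in> topspace PT" and q: "q \<in> topspace PT"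
  shows "\<exists>m U. 1 \<le> m \<and> openin (prod_topology PT PT) U \<and> (p, q) \<in> U \<and>
      (\<forall>k\<ge>1. \<exists>A. finite A \<and> (\<forall>F\<in>A. form (k * m) F) \<and> (\<forall>z\<in>U. separated A z))"
proof (cases "\<exists>\<gamma>\<in>\<Gamma>. act \<gamma> p = q")
  case True
  then obtain \<gamma> where g: "\<gamma> \<in> \<Gamma>" "act \<gamma> p = q" by blast
  obtain m U where m: "1 \<le> m" and U: "openin PT U" "p \<in> U" and
    *: "\<And>k. 1 \<le> k \<Longrightarrow> \<exists>A. finite A \<and> (\<forall>F\<in>A. form (k * m) F) \<and> (\<forall>p'\<in>U. immersed_all A p') \<and>
       (\<forall>p'\<in>U. \<forall>q'\<in>U. \<forall>a. a \<noteq> 0 \<longrightarrow> (\<forall>F\<in>A. F p' = a * F q') \<longrightarrow> p' = q')"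
    by (rule immersion_nbhd[OF p], rule that)
  let ?U' = "{q' \<in> topspace PT. act (ginv \<gamma>) q' \<in> U}"
  have U': "openin PT ?U'" by (rule openin_continuous_map_preimage[OF act_continuous[OF ginv_in[OF g(1)]] U(1)])
  have Us: "U \<subseteq> topspace PT" by (rule openin_subset[OF U(1)])
  show ?thesis
  proof (rule exI[of _ m], rule exI[of _ "U \<times> ?U'"], intro conjI allI impI)
    show "(p, q) \<in> U \<times> ?U'" using U q act_ginv(1)[OF g(1) p] g(2) by auto
    fix k :: nat assume "1 \<le> k"
    from *[OF this] obtain A where A0: "finite A" "\<forall>F\<in>A. form (k * m) F" "\<forall>p'\<in>U. immersed_all A p'"
      "\<forall>p'\<in>U. \<forall>q'\<in>U. \<forall>a. a \<noteq> 0 \<longrightarrow> (\<forall>F\<in>A. F p' = a * F q') \<longrightarrow> p' = q'" by (elim exE conjE)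
    note A = A0(1) A0(2)[rule_format] A0(4)[rule_format]
    have "separated A (p', q')" if z: "p' \<in> U" "q' \<in> ?U'" for p' q'
      unfolding separated_def fst_conv snd_conv
    proof (intro allI impI)
      fix a :: complex assume a: "a \<noteq> 0" "\<forall>F\<in>A. F p' = a * F q'"
      let ?q = "act (ginv \<gamma>) q'"
      have q': "q' \<in> topspace PT" "?q \<in> U" using z by auto
      \<comment> \<open>Moving \<open>q'\<close> back multiplies all values by one automorphy
        factor, which is absorbed in the scalar.\<close>
      let ?j = "deriv (ginv \<gamma>) (fst q') ^ (k * m)"
      have j: "?j \<noteq> 0" using deriv_nz[OF ginv_in[OF g(1)]] q'(1) by auto
      have "p' = ?q"
      proof (rule A(3)[OF z(1) q'(2)])
        show "a * ?j \<noteq> 0" using a j by simp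
        show "F p' = a * ?j * F ?q" if "F \<in> A" for F
          using that a(2) form_automorphic[OF A(2) ginv_in[OF g(1)] q'(1)] by (metis mult.assoc mult.commute)
      qed
      then have "act \<gamma> p' = q'" using act_ginv(2)[OF g(1) q'(1)] by simp
      then show "\<exists>\<gamma>\<in>\<Gamma>. act \<gamma> p' = q'" using g(1) by blast
    qed
    then show "\<exists>A. finite A \<and> (\<forall>F\<in>A. form (k * m) F) \<and> (\<forall>z\<in>U \<times> ?U'. separated A z)"
      using A by (intro exI[of _ A]) auto
  qed (use m U U' in \<open>auto simp: openin_prod_Times_iff\<close>)
next
  case False
  obtain \<zeta>0 t0 \<zeta>1 t1 where pq: "p = (\<zeta>0, t0)" "q = (\<zeta>1, t1)" by (cases p, cases q)
  have z: "norm \<zeta>0 < 1" "norm \<zeta>1 < 1" and t: "t0 \<in> topspace T" "t1 \<in> topspace T" using p q pq by auto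
  have ne: "\<phi> \<gamma> t0 \<noteq> t1" if "\<gamma> \<in> \<Gamma>" "\<gamma> \<zeta>0 = \<zeta>1" for \<gamma> using False that by (auto simp: pq act_def)
  have ne': "\<phi> \<gamma> t1 \<noteq> t0" if g: "\<gamma> \<in> \<Gamma>" "\<gamma> \<zeta>1 = \<zeta>0" for \<gamma>
    using ne[OF ginv_in[OF g(1)]] ginv_left_apply[OF g(1) z(2)] phi_ginv[OF g(1) t(2)] g(2) by auto
  obtain m1 where m1: "\<And>m. m \<ge> m1 \<Longrightarrow> \<exists>F. form m F \<and> 1/2 < norm (F (\<zeta>0, t0)) * (1 - (norm \<zeta>0)\<^sup>2) ^ m \<and>
    norm (F (\<zeta>1, t1)) * (1 - (norm \<zeta>1)\<^sup>2) ^ m < 1/2" using separate_half[OF z t ne'] by blast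
  obtain m2 where m2: "\<And>m. m \<ge> m2 \<Longrightarrow> \<exists>F. form m F \<and> 1/2 < norm (F (\<zeta>1, t1)) * (1 - (norm \<zeta>1)\<^sup>2) ^ m \<and>
    norm (F (\<zeta>0, t0)) * (1 - (norm \<zeta>0)\<^sup>2) ^ m < 1/2" using separate_half[OF z(2,1) t(2,1) ne] by blast
  define m where "m = max 1 (max m1 m2)"
  have mm: "m1 \<le> m" "m2 \<le> m" by (auto simp: m_def)
  obtain F where F: "form m F" "1/2 < norm (F p) * (1 - (norm \<zeta>0)\<^sup>2) ^ m" "norm (F q) * (1 - (norm \<zeta>1)\<^sup>2) ^ m < 1/2"
    using m1[OF mm(1)] unfolding pq by blast
  obtain G where G: "form m G" "1/2 < norm (G q) * (1 - (norm \<zeta>1)\<^sup>2) ^ m" "norm (G p) * (1 - (norm \<zeta>0)\<^sup>2) ^ m < 1/2"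
    using m2[OF mm(2)] unfolding pq by blast
  have w: "0 < (1 - (norm \<zeta>0)\<^sup>2) ^ m" "0 < (1 - (norm \<zeta>1)\<^sup>2) ^ m" using one_minus_norm_sq_pos z by auto
  have "norm (G p) * (1 - (norm \<zeta>0)\<^sup>2) ^ m < norm (F p) * (1 - (norm \<zeta>0)\<^sup>2) ^ m" using F G by linarith
  then have FGp: "norm (G p) < norm (F p)" using w by (simp add: mult_less_cancel_right)
  have "norm (F q) * (1 - (norm \<zeta>1)\<^sup>2) ^ m < norm (G q) * (1 - (norm \<zeta>1)\<^sup>2) ^ m" using F G by linarith
  then have FGq: "norm (F q) < norm (G q)" using w by (simp add: mult_less_cancel_right)
  let ?U = "{p \<in> topspace PT. norm (G p) < norm (F p)} \<times> {p \<in> topspace PT. norm (F p) < norm (G p)}"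
  show ?thesis
  proof (rule exI[of _ m], rule exI[of _ ?U], intro conjI allI impI)
    show "openin (prod_topology PT PT) ?U"
      using form_norm_less_open[OF F(1) G(1)] form_norm_less_open[OF G(1) F(1)] by (simp add: openin_prod_Times_iff)
    fix k :: nat assume k: "1 \<le> k"
    let ?A = "{\<lambda>p. F p ^ k, \<lambda>p. G p ^ k}"
    have "separated ?A (p', q')" if pq': "norm (G p') < norm (F p')" "norm (F q') < norm (G q')" for p' q'
      unfolding separated_def fst_conv snd_conv
    proof (intro allI impI)
      fix a :: complex assume a: "a \<noteq> 0" "\<forall>F\<in>?A. F p' = a * F q'"
      then have eq: "norm (F p') ^ k = norm a * norm (F q') ^ k" "norm (G p') ^ k = norm a * norm (G q') ^ k"
        by (metis insertI1 insertI2 norm_mult norm_power)+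
      have "norm (G p') ^ k < norm (F p') ^ k" "norm (F q') ^ k < norm (G q') ^ k"
        using pq' k by (intro power_strict_mono; simp)+
      then have "norm a * norm (F q') ^ k < norm a * norm (G q') ^ k" using a(1) by simp
      then show "\<exists>\<gamma>\<in>\<Gamma>. act \<gamma> p' = q'" using eq \<open>norm (G p') ^ k < norm (F p') ^ k\<close> by linarith
    qed
    then show "\<exists>A. finite A \<and> (\<forall>F\<in>A. form (k * m) F) \<and> (\<forall>z\<in>?U. separated A z)"
      using form_power[OF F(1), of k] form_power[OF G(1), of k] by (intro exI[of _ ?A]) auto
  qed (use FGp FGq p q in \<open>auto simp: m_def\<close>)
qed

text \<open>A compact set meeting all orbits suffices, because translation changes the values only
  by automorphy factors, which both properties tolerate. Separation concerns pairs, hence the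
  compactness of \<open>K \<times> K\<close>.\<close>

theorem embedding_forms:
  obtains m A where "finite A" "\<And>F. F \<in> A \<Longrightarrow> form m F"
    "\<And>p. p \<in> topspace PT \<Longrightarrow> immersed_all A p"
    "\<And>p q. p \<in> topspace PT \<Longrightarrow> q \<in> topspace PT \<Longrightarrow> separated A (p, q)"
    and "\<exists>K. compactin PT K \<and> (\<forall>p\<in>topspace PT. \<exists>\<gamma>\<in>\<Gamma>. act \<gamma> p \<in> K)"
proof -
  obtain k0 where k0: "k0 < 1" "\<And>z. norm z < 1 \<Longrightarrow> \<exists>\<gamma>\<in>\<Gamma>. norm (\<gamma> z) \<le> k0" using cocompact by blast
  define K where "K = cball (0::complex) k0 \<times> topspace T"
  have "compactin (top_of_set unit_disc) (cball 0 k0)" using k0(1) by (auto simp: compactin_subtopology)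
  then have Kc: "compactin PT K" unfolding K_def using cmp by (simp add: compactin_Times compact_space_def)
  then have KP: "K \<subseteq> topspace PT" by (rule compactin_subset_topspace)
  have KG: "\<exists>\<gamma>\<in>\<Gamma>. act \<gamma> p \<in> K" if "p \<in> topspace PT" for p
  proof -
    have "norm (fst p) < 1" "snd p \<in> topspace T" using that by auto
    then show ?thesis using k0(2) phi_maps by (fastforce simp: K_def act_def)
  qed
  have "\<exists>m\<ge>1. \<forall>k\<ge>1. \<exists>A. finite A \<and> (\<forall>F\<in>A. form (k * m) F) \<and> (\<forall>z\<in>K \<times> K. separated A z)"
  proof (rule compact_forms[of "prod_topology PT PT"])
    show "compactin (prod_topology PT PT) (K \<times> K)" using Kc by (simp add: compactin_Times)
    show "separated B z" if "separated A z" "A \<subseteq> B" for A B z using that unfolding separated_def by blast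
    fix z assume "z \<in> K \<times> K"
    then show "\<exists>m U. 1 \<le> m \<and> openin (prod_topology PT PT) U \<and> z \<in> U \<and>
      (\<forall>k\<ge>1. \<exists>A. finite A \<and> (\<forall>F\<in>A. form (k * m) F) \<and> (\<forall>z\<in>U. separated A z))"
      using separation_nbhd KP by (cases z) blast
  qed
  then obtain m1 where m1: "1 \<le> m1" "\<And>k. 1 \<le> k \<Longrightarrow> \<exists>A. finite A \<and> (\<forall>F\<in>A. form (k * m1) F) \<and> (\<forall>z\<in>K \<times> K. separated A z)"
    by blast
  have imono: "immersed_all B z" if AB: "immersed_all A z" "A \<subseteq> B" for A B z
  proof -
    have "immersed B V d z" if "immersed A V d z" for V d
      unfolding immersed_def
    proof (intro allI impI)
      fix v l assume "\<forall>F\<in>B. fder (\<lambda>x. F (chm V d x)) (fst z, d (snd z)) v = l * F z"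
      then have "\<forall>F\<in>A. fder (\<lambda>x. F (chm V d x)) (fst z, d (snd z)) v = l * F z" using AB(2) by blast
      then show "v = 0" using that[unfolded immersed_def, rule_format, of v l] by blast
    qed
    then show ?thesis using AB unfolding immersed_all_def by fast
  qed
  have "\<exists>m\<ge>1. \<forall>k\<ge>1. \<exists>A. finite A \<and> (\<forall>F\<in>A. form (k * m) F) \<and> (\<forall>z\<in>K. immersed_all A z)"
  proof (rule compact_forms[OF Kc imono])
    fix p assume "p \<in> K"
    then have p: "p \<in> topspace PT" using KP by blast
    obtain m U where "1 \<le> m" "openin PT U" "p \<in> U"
      "\<And>k. 1 \<le> k \<Longrightarrow> \<exists>A. finite A \<and> (\<forall>F\<in>A. form (k * m) F) \<and> (\<forall>p'\<in>U. immersed_all A p') \<and>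
       (\<forall>p'\<in>U. \<forall>q'\<in>U. \<forall>a. a \<noteq> 0 \<longrightarrow> (\<forall>F\<in>A. F p' = a * F q') \<longrightarrow> p' = q')"
      by (rule immersion_nbhd[OF p], rule that)
    note * = this
    show "\<exists>m U. 1 \<le> m \<and> openin PT U \<and> p \<in> U \<and>
      (\<forall>k\<ge>1. \<exists>A. finite A \<and> (\<forall>F\<in>A. form (k * m) F) \<and> (\<forall>z'\<in>U. immersed_all A z'))"
    proof (rule exI[of _ m], rule exI[of _ U], intro conjI allI impI *(1-3))
      fix k :: nat assume "1 \<le> k"
      from *(4)[OF this] obtain A where "finite A" "\<forall>F\<in>A. form (k * m) F" "\<forall>p'\<in>U. immersed_all A p'"
        "\<forall>p'\<in>U. \<forall>q'\<in>U. \<forall>a. a \<noteq> 0 \<longrightarrow> (\<forall>F\<in>A. F p' = a * F q') \<longrightarrow> p' = q'" by (elim exE conjE)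
      then show "\<exists>A. finite A \<and> (\<forall>F\<in>A. form (k * m) F) \<and> (\<forall>z'\<in>U. immersed_all A z')"
        by (intro exI[of _ A] conjI)
    qed
  qed
  then obtain m2 where m2: "1 \<le> m2" "\<And>k. 1 \<le> k \<Longrightarrow> \<exists>A. finite A \<and> (\<forall>F\<in>A. form (k * m2) F) \<and> (\<forall>z\<in>K. immersed_all A z)"
    by blast
  \<comment> \<open>Each family is taken in the multiple given by the weight of the other, so that
    both have weight \<open>m1 * m2\<close>.\<close>
  obtain A1 where A1: "finite A1" "\<And>F. F \<in> A1 \<Longrightarrow> form (m2 * m1) F" "\<And>z. z \<in> K \<times> K \<Longrightarrow> separated A1 z"
    using m1(2)[OF m2(1)] by blast
  obtain A2 where A2: "finite A2" "\<And>F. F \<in> A2 \<Longrightarrow> form (m1 * m2) F" "\<And>z. z \<in> K \<Longrightarrow> immersed_all A2 z"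
    using m2(2)[OF m1(1)] by blast
  define A where "A = A1 \<union> A2"
  define m where "m = m1 * m2"
  have fA: "form m F" if "F \<in> A" for F using that A1(2) A2(2) by (auto simp: A_def m_def mult.commute)
  show ?thesis
  proof (rule that[of A m])
    show "immersed_all A p" if p: "p \<in> topspace PT" for p
    proof -
      obtain \<gamma> where g: "\<gamma> \<in> \<Gamma>" "act \<gamma> p \<in> K" using KG[OF p] by blast
      show ?thesis by (rule immersed_all_act[OF fA g(1) p imono[OF A2(3)[OF g(2)]]]) (auto simp: A_def)
    qed
    show "separated A (p, q)" if p: "p \<in> topspace PT" and q: "q \<in> topspace PT" for p q
      unfolding separated_def fst_conv snd_conv
    proof (intro allI impI)
      fix a :: complex assume a: "a \<noteq> 0" "\<forall>F\<in>A. F p = a * F q"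
      obtain \<gamma> where g: "\<gamma> \<in> \<Gamma>" "act \<gamma> p \<in> K" using KG[OF p] by blast
      obtain \<delta> where d: "\<delta> \<in> \<Gamma>" "act \<delta> q \<in> K" using KG[OF q] by blast
      let ?i = "deriv \<gamma> (fst p) ^ m" and ?j = "deriv \<delta> (fst q) ^ m"
      have ij: "?i \<noteq> 0" "?j \<noteq> 0" using deriv_nz[OF g(1)] deriv_nz[OF d(1)] p q by auto
      have "F (act \<gamma> p) = (a * ?j / ?i) * F (act \<delta> q)" if F: "F \<in> A1" for F
      proof -
        have FA: "F \<in> A" using F by (simp add: A_def)
        have "F (act \<gamma> p) * ?i = F p" "F (act \<delta> q) * ?j = F q"
          using form_automorphic[OF fA[OF FA] g(1) p] form_automorphic[OF fA[OF FA] d(1) q] by auto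
        then have "F (act \<gamma> p) * ?i = a * (F (act \<delta> q) * ?j)" using a(2) FA by simp
        then show ?thesis using ij by (simp add: field_simps)
      qed
      moreover have "a * ?j / ?i \<noteq> 0" using a ij by simp
      moreover have "separated A1 (act \<gamma> p, act \<delta> q)" by (rule A1(3)) (use g d in auto)
      ultimately obtain \<beta> where b: "\<beta> \<in> \<Gamma>" "act \<beta> (act \<gamma> p) = act \<delta> q"
        unfolding separated_def fst_conv snd_conv by blast
      have "act (ginv \<delta>) (act \<beta> (act \<gamma> p)) = q" using b(2) act_ginv(1)[OF d(1) q] by simp
      then have "act (compose unit_disc (ginv \<delta>) (compose unit_disc \<beta> \<gamma>)) p = q"
        using act_compose[OF b(1) g(1) p] act_compose[OF ginv_in[OF d(1)] comp_in[OF b(1) g(1)] p] by simp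
      moreover have "compose unit_disc (ginv \<delta>) (compose unit_disc \<beta> \<gamma>) \<in> \<Gamma>"
        by (intro comp_in ginv_in b d g)
      ultimately show "\<exists>\<gamma>\<in>\<Gamma>. act \<gamma> p = q" by blast
    qed
    show "\<exists>K. compactin PT K \<and> (\<forall>p\<in>topspace PT. \<exists>\<gamma>\<in>\<Gamma>. act \<gamma> p \<in> K)" using Kc KG by blast
  qed (use A1 A2 fA in \<open>auto simp: A_def\<close>)
qed

end

section \<open>The deck group of a disc covering\<close>

text \<open>The lifting theorems of the library require a normed space as the base of a covering, so the
  base is first embedded into one.\<close>

lemma (in compact_atlas) finite_separating:
  "\<exists>H. finite H \<and> (\<forall>h\<in>H. continuous_map T euclideanreal h) \<and>
     (\<forall>x\<in>topspace T. \<forall>y\<in>topspace T. (\<forall>h\<in>H. h x = h y) \<longrightarrow> x = y)"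
proof -
  have "\<exists>G H. openin T G \<and> t0 \<in> G \<and> finite H \<and> (\<forall>h\<in>H. continuous_map T euclideanreal h) \<and>
      (\<forall>x\<in>G. \<forall>y\<in>topspace T. (\<forall>h\<in>H. h x = h y) \<longrightarrow> x = y)" if t0T: "t0 \<in> topspace T" for t0
  proof -
    obtain V d where c: "(V, d) \<in> AT" and t0: "t0 \<in> V" using chart_cover[OF t0T] by blast
    obtain \<rho> where \<rho>: "0 < \<rho>" and "cball (d t0) \<rho> \<subseteq> d ` V"
      and Z: "closedin T {t \<in> V. d t \<in> cball (d t0) \<rho>}" and "{t \<in> V. d t \<in> cball (d t0) \<rho>} \<subseteq> V"
      by (rule chart_ball[OF c t0 chart_open[OF c] t0], rule that)
    define b where "b x = max 0 (\<rho> - dist (d t0) x)" for x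
    define ext where "ext u t = (if t \<in> V then b (d t) * u (d t) else 0)" for u :: "'e \<Rightarrow> real" and t
    have cont: "continuous_map T euclideanreal (ext u)" if u: "continuous_on UNIV u" for u
    proof (rule continuous_map_locally)
      fix t assume t: "t \<in> topspace T"
      show "\<exists>U. openin T U \<and> t \<in> U \<and> continuous_map (subtopology T U) euclideanreal (ext u)"
      proof (cases "t \<in> V")
        case True
        have "continuous_on UNIV (\<lambda>x. b x * u x)" unfolding b_def using u by (intro continuous_intros)
        then have "continuous_map (subtopology T V) euclideanreal ((\<lambda>x. b x * u x) \<circ> d)"
          by (intro continuous_map_compose[OF chart_continuous[OF c]]) simp
        then have "continuous_map (subtopology T V) euclideanreal (ext u)"
          by (rule continuous_map_eq) (auto simp: ext_def)
        then show ?thesis using True chart_open[OF c] by blast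
      next
        case False
        let ?U = "topspace T - {t \<in> V. d t \<in> cball (d t0) \<rho>}"
        have "continuous_map (subtopology T ?U) euclideanreal (\<lambda>_. 0)" by simp
        then have "continuous_map (subtopology T ?U) euclideanreal (ext u)"
          by (rule continuous_map_eq) (auto simp: ext_def b_def)
        then show ?thesis using False t Z by (intro exI[of _ ?U]) auto
      qed
    qed
    \<comment> \<open>The first function is \<open>b\<close>, positive exactly on the coordinate
      ball; the others are \<open>b\<close> times the coordinates, so that division recovers the
      point. Thus points of the ball are separated from all points of the space.\<close>
    let ?H = "insert (ext (\<lambda>_. 1)) ((\<lambda>e. ext (\<lambda>x. x \<bullet> e)) ` onb)"
    let ?G = "{t \<in> V. d t \<in> ball (d t0) \<rho>}"
    have "x = y" if x: "x \<in> ?G" and eq: "\<forall>h\<in>?H. h x = h y" for x y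
    proof -
      have bx: "0 < b (d x)" using x by (simp add: b_def)
      have "ext (\<lambda>_. 1) x = ext (\<lambda>_. 1) y" using eq by blast
      then have y: "y \<in> V" "b (d y) = b (d x)" using x bx by (auto simp: ext_def split: if_splits)
      have "d x \<bullet> e = d y \<bullet> e" if "e \<in> onb" for e
      proof -
        have "ext (\<lambda>x. x \<bullet> e) x = ext (\<lambda>x. x \<bullet> e) y" using eq that by blast
        then show ?thesis using x y bx by (simp add: ext_def)
      qed
      then have "(\<Sum>e\<in>onb. (d x \<bullet> e) *\<^sub>R e) = (\<Sum>e\<in>onb. (d y \<bullet> e) *\<^sub>R e)" by simp
      then have "d x = d y" by (simp only: onb_expansion[symmetric])
      then show ?thesis using inj_onD[OF chart_inj[OF c]] x y by blast
    qed
    moreover have "openin T ?G" by (rule chart_preimage_openin[OF c]) auto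
    moreover have "continuous_map T euclideanreal (ext (\<lambda>_. 1))" by (rule cont) simp
    moreover have "continuous_map T euclideanreal (ext (\<lambda>x. x \<bullet> e))" for e by (rule cont) (intro continuous_intros)
    ultimately show ?thesis using t0 \<rho> finite_onb
      by (intro exI[of _ ?G] exI[of _ ?H] conjI) auto
  qed
  then obtain G H where GH: "\<And>t. t \<in> topspace T \<Longrightarrow> openin T (G t) \<and> t \<in> G t \<and> finite (H t) \<and>
      (\<forall>h\<in>H t. continuous_map T euclideanreal h) \<and>
      (\<forall>x\<in>G t. \<forall>y\<in>topspace T. (\<forall>h\<in>H t. h x = h y) \<longrightarrow> x = y)" by metis
  have "(\<forall>U\<in>G ` topspace T. openin T U) \<and> topspace T \<subseteq> \<Union>(G ` topspace T)" using GH by auto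
  then have "\<exists>F. finite F \<and> F \<subseteq> G ` topspace T \<and> topspace T \<subseteq> \<Union>F"
    using cmp unfolding compact_space_alt by simp
  then obtain I where I: "finite I" "I \<subseteq> topspace T" "topspace T \<subseteq> \<Union>(G ` I)" by (metis finite_subset_image)
  show ?thesis
  proof (intro exI[of _ "\<Union>(H ` I)"] conjI ballI impI)
    show "finite (\<Union>(H ` I))" using I GH by auto
    show "continuous_map T euclideanreal h" if "h \<in> \<Union>(H ` I)" for h using that I GH by blast
    fix x y assume xy: "x \<in> topspace T" "y \<in> topspace T" "\<forall>h\<in>\<Union>(H ` I). h x = h y"
    then obtain i where "i \<in> I" "x \<in> G i" using I by blast
    then show "x = y" using GH[of i] I xy by blast
  qed
qed

text \<open>The number of functions is not fixed by a type, so an infinite-dimensional space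
  receives them: each function gets its own index, and evaluation there recovers it.\<close>

lemma embed_in_normed_space:
  fixes H :: "('x::topological_space \<Rightarrow> real) set"
  assumes H: "finite H" "\<And>h. h \<in> H \<Longrightarrow> continuous_on X h"
    and sep: "\<And>x y. x \<in> X \<Longrightarrow> y \<in> X \<Longrightarrow> \<forall>h\<in>H. h x = h y \<Longrightarrow> x = y"
  shows "\<exists>e :: 'x \<Rightarrow> nat \<Rightarrow>\<^sub>C real. continuous_on X e \<and> inj_on e X"
proof -
  obtain idx :: "('x \<Rightarrow> real) \<Rightarrow> nat" where idx: "inj_on idx H"
    using finite_imp_inj_to_nat_seg[OF H(1)] by blast
  define E :: "nat \<Rightarrow> nat \<Rightarrow>\<^sub>C real" where "E n = Bcontfun (\<lambda>k. if k = n then 1 else 0)" for n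
  have "(\<lambda>k. if k = n then 1 else 0 :: real) \<in> bcontfun" for n :: nat
    by (auto simp: bcontfun_def bounded_iff intro: exI[of _ 1])
  then have E: "apply_bcontfun (E n) k = (if k = n then 1 else 0)" for n k
    by (simp add: E_def Bcontfun_inverse)
  define e where "e x = (\<Sum>h\<in>H. h x *\<^sub>R E (idx h))" for x
  have app: "apply_bcontfun (\<Sum>h\<in>A. h x *\<^sub>R E (idx h)) k = (\<Sum>h\<in>A. h x * (if k = idx h then 1 else 0))"
    if "finite A" for A x k
    using that by (induction A rule: finite_induct) (auto simp: E plus_bcontfun.rep_eq scaleR_bcontfun.rep_eq zero_bcontfun.rep_eq)
  have e: "apply_bcontfun (e x) (idx h) = h x" if h: "h \<in> H" for x h
  proof -
    have "apply_bcontfun (e x) (idx h) = (\<Sum>h'\<in>H. h' x * (if idx h = idx h' then 1 else 0))"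
      unfolding e_def by (rule app[OF H(1)])
    also have "\<dots> = (\<Sum>h'\<in>{h}. h' x * (if idx h = idx h' then 1 else 0))"
      using H(1) h inj_onD[OF idx] by (intro sum.mono_neutral_right) auto
    finally show ?thesis by simp
  qed
  have "continuous_on X e" unfolding e_def[abs_def] using H(2) by (intro continuous_intros)
  moreover have "inj_on e X"
  proof (rule inj_onI)
    fix x y assume "x \<in> X" "y \<in> X" "e x = e y"
    then show "x = y" using e by (intro sep) metis+
  qed
  ultimately show ?thesis by blast
qed

lemma covering_space_homeomorphic_base:
  assumes cov: "covering_space C f X" and e: "homeomorphism X Y e e'"
  shows "covering_space C (e \<circ> f) Y"
proof
  have fX: "f ` C = X" by (rule covering_space_imp_surjective[OF cov])
  have eX: "e ` X = Y" and ce: "continuous_on X e" and inv: "\<And>x. x \<in> X \<Longrightarrow> e' (e x) = x"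
    using e by (auto simp: homeomorphism_def)
  show "continuous_on C (e \<circ> f)"
    by (rule continuous_on_compose[OF covering_space_imp_continuous[OF cov]]) (simp add: fX ce)
  show "(e \<circ> f) ` C = Y" using fX eX by (metis image_comp)
  fix y assume "y \<in> Y"
  then obtain x where x: "x \<in> X" "y = e x" using eX by blast
  have "\<forall>x\<in>X. \<exists>U. x \<in> U \<and> openin (top_of_set X) U \<and> (\<exists>v. \<Union>v = C \<inter> f -` U \<and> (\<forall>u\<in>v. openin (top_of_set C) u) \<and>
      pairwise disjnt v \<and> (\<forall>u\<in>v. \<exists>q. homeomorphism u U f q))"
    using cov unfolding covering_space_def by (elim conjE)
  from bspec[OF this x(1)] obtain U v where U: "x \<in> U" "openin (top_of_set X) U"
    and v: "\<Union>v = C \<inter> f -` U" "\<forall>u\<in>v. openin (top_of_set C) u"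
    "pairwise disjnt v" "\<forall>u\<in>v. \<exists>q. homeomorphism u U f q"
    by (elim exE conjE)
  have UX: "U \<subseteq> X" using U(2) openin_imp_subset by blast
  have 1: "C \<inter> (e \<circ> f) -` (e ` U) = C \<inter> f -` U"
  proof -
    have "f z \<in> U" if z: "z \<in> C" "e (f z) = e u" "u \<in> U" for z u
    proof -
      have "f z \<in> X" "u \<in> X" using z fX UX by auto
      then have "f z = u" using inv z(2) by metis
      then show ?thesis using z(3) by simp
    qed
    then show ?thesis by auto
  qed
  have 2: "\<exists>q. homeomorphism u (e ` U) (e \<circ> f) q" if "u \<in> v" for u
  proof -
    obtain q where q: "homeomorphism u U f q" using v(4) \<open>u \<in> v\<close> by blast
    have "homeomorphism U (e ` U) e e'"
      by (rule homeomorphism_of_subsets[OF e UX]) auto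
    from homeomorphism_compose[OF q this] show ?thesis by blast
  qed
  have 3: "openin (top_of_set Y) (e ` U)"
    by (rule homeomorphism_imp_open_map[OF e U(2)])
  show "\<exists>T. y \<in> T \<and> openin (top_of_set Y) T \<and>
      (\<exists>v. \<Union>v = C \<inter> (e \<circ> f) -` T \<and> (\<forall>u\<in>v. openin (top_of_set C) u) \<and> pairwise disjnt v \<and>
        (\<forall>u\<in>v. \<exists>q. homeomorphism u T (e \<circ> f) q))"
  proof (rule exI[of _ "e ` U"], intro conjI)
    show "y \<in> e ` U" using U(1) x(2) by blast
    show "\<exists>v. \<Union>v = C \<inter> (e \<circ> f) -` (e ` U) \<and> (\<forall>u\<in>v. openin (top_of_set C) u) \<and> pairwise disjnt v \<and>
        (\<forall>u\<in>v. \<exists>q. homeomorphism u (e ` U) (e \<circ> f) q)"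
      unfolding 1 using v(1-3) 2 by (intro exI[of _ v] conjI ballI) auto
  qed (rule 3)
qed

lemma riemann_surface_embedding:
  assumes X: "riemann_surface (top_of_set X) AX" and cX: "compact_space (top_of_set X)"
  shows "\<exists>(e :: 'x::topological_space \<Rightarrow> nat \<Rightarrow>\<^sub>C real) e'. homeomorphism X (e ` X) e e'"
proof -
  interpret compact_atlas "top_of_set X" AX
    using X cX by unfold_locales (auto simp: riemann_surface_def)
  obtain H where H: "finite H" "\<forall>h\<in>H. continuous_map (top_of_set X) euclideanreal h"
     "\<forall>x\<in>topspace (top_of_set X). \<forall>y\<in>topspace (top_of_set X). (\<forall>h\<in>H. h x = h y) \<longrightarrow> x = y"
    using finite_separating by blast
  have "compact X" using cX by (simp add: compact_space_def compactin_subtopology)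
  moreover obtain e :: "'x \<Rightarrow> nat \<Rightarrow>\<^sub>C real" where "continuous_on X e" "inj_on e X"
    using embed_in_normed_space[of H X] H by auto
  ultimately show ?thesis using homeomorphism_compact by blast
qed

section \<open>Deck transformations over a base in a normed space\<close>

locale disc_covering =
  fixes f :: "complex \<Rightarrow> 'x::real_normed_vector" and X :: "'x set"
  assumes cov: "covering_space unit_disc f X" and compact_X: "compact X"
begin

definition "\<Gamma> = {\<gamma> \<in> Bij unit_disc. homeomorphic_map (top_of_set unit_disc) (top_of_set unit_disc) \<gamma> \<and>
  (\<forall>\<zeta>\<in>unit_disc. f (\<gamma> \<zeta>) = f \<zeta>)}"

lemma f_cont: "continuous_on unit_disc f"
  by (rule covering_space_imp_continuous[OF cov])

lemma f_image: "f ` unit_disc = X"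
  by (rule covering_space_imp_surjective[OF cov])

lemma lift_unique:
  assumes "continuous_on unit_disc g" "continuous_on unit_disc h" "\<And>z. z \<in> unit_disc \<Longrightarrow> g z \<in> unit_disc"
    "\<And>z. z \<in> unit_disc \<Longrightarrow> h z \<in> unit_disc"
    "\<And>z. z \<in> unit_disc \<Longrightarrow> f (g z) = f z" "\<And>z. z \<in> unit_disc \<Longrightarrow> f (h z) = f z"
    "a \<in> unit_disc" "g a = h a" "z \<in> unit_disc"
  shows "g z = h z"
  by (rule covering_space_lift_unique[where c = unit_disc and p = f and S = X and ?g1.0 = g and ?g2.0 = h
      and a = a and T = unit_disc and f = f and x = z])
    (use assms cov f_cont f_image in \<open>auto intro: connected_ball\<close>)

text \<open>The disc is simply connected and locally path connected, so \<open>f\<close> lifts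
  through itself with any prescribed point over \<open>f z\<close>.\<close>

lemma lift_exists:
  assumes "z \<in> unit_disc" "w \<in> unit_disc" "f z = f w"
  shows "\<exists>g. continuous_on unit_disc g \<and> (\<forall>z\<in>unit_disc. g z \<in> unit_disc \<and> f (g z) = f z) \<and> g z = w"
proof -
  have sc: "simply_connected unit_disc" by (rule convex_imp_simply_connected) auto
  have lp: "locally path_connected unit_disc" by (rule convex_imp_locally_path_connected) auto
  have fim: "f \<in> unit_disc \<rightarrow> X" using f_image by auto
  obtain g where "continuous_on unit_disc g" "g \<in> unit_disc \<rightarrow> unit_disc" "g z = w"
    "\<And>y. y \<in> unit_disc \<Longrightarrow> f (g y) = f y"
    by (rule covering_space_lift_strong[OF cov assms(2,1) sc lp f_cont fim assms(3)], rule that)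
  then show ?thesis by blast
qed

text \<open>A continuous self-map over the base is automatically invertible: there is a lift in the
  opposite direction, and both compositions agree with the identity at one point, hence
  everywhere.\<close>

lemma Gamma_iff: "\<gamma> \<in> \<Gamma> \<longleftrightarrow> \<gamma> \<in> extensional unit_disc \<and> continuous_on unit_disc \<gamma> \<and>
    (\<forall>z\<in>unit_disc. \<gamma> z \<in> unit_disc \<and> f (\<gamma> z) = f z)"
proof
  assume g: "\<gamma> \<in> \<Gamma>"
  then have "continuous_map (top_of_set unit_disc) (top_of_set unit_disc) \<gamma>"
    unfolding \<Gamma>_def by (intro homeomorphic_imp_continuous_map) simp
  then have "continuous_on unit_disc \<gamma>" by (simp only: continuous_map_subtopology_eu)
  moreover have "\<gamma> \<in> extensional unit_disc" "bij_betw \<gamma> unit_disc unit_disc" "\<forall>z\<in>unit_disc. f (\<gamma> z) = f z"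
    using g unfolding \<Gamma>_def Bij_def by auto
  ultimately show "\<gamma> \<in> extensional unit_disc \<and> continuous_on unit_disc \<gamma> \<and>
    (\<forall>z\<in>unit_disc. \<gamma> z \<in> unit_disc \<and> f (\<gamma> z) = f z)"
    using bij_betw_apply[of \<gamma> unit_disc unit_disc] by (intro conjI ballI) simp_all
next
  assume g: "\<gamma> \<in> extensional unit_disc \<and> continuous_on unit_disc \<gamma> \<and>
    (\<forall>z\<in>unit_disc. \<gamma> z \<in> unit_disc \<and> f (\<gamma> z) = f z)"
  have 0: "(0::complex) \<in> unit_disc" by simp
  have g0: "\<gamma> 0 \<in> unit_disc" "f (\<gamma> 0) = f 0" using g 0 by blast+
  obtain h where h: "continuous_on unit_disc h" "\<forall>z\<in>unit_disc. h z \<in> unit_disc \<and> f (h z) = f z" "h (\<gamma> 0) = 0"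
    using lift_exists[OF g0(1) 0 g0(2)] by blast
  have hg: "h (\<gamma> z) = z" if "z \<in> unit_disc" for z
  proof (rule lift_unique[of "\<lambda>z. h (\<gamma> z)" "\<lambda>z. z" 0])
    show "continuous_on unit_disc (\<lambda>z. h (\<gamma> z))"
      by (rule continuous_on_compose2[OF h(1)]) (use g in auto)
  qed (use g h that in auto)
  have gh: "\<gamma> (h z) = z" if "z \<in> unit_disc" for z
  proof (rule lift_unique[of "\<lambda>z. \<gamma> (h z)" "\<lambda>z. z" "\<gamma> 0"])
    show "continuous_on unit_disc (\<lambda>z. \<gamma> (h z))"
      by (rule continuous_on_compose2[of unit_disc \<gamma>]) (use g h in auto)
  qed (use g h that g0 in auto)
  have "bij_betw \<gamma> unit_disc unit_disc"
    by (rule bij_betw_byWitness[where f' = h]) (use g h hg gh in auto)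
  moreover have "homeomorphic_maps (top_of_set unit_disc) (top_of_set unit_disc) \<gamma> h"
    unfolding homeomorphic_maps_def using g h hg gh by (auto simp: continuous_map_in_subtopology)
  then have "homeomorphic_map (top_of_set unit_disc) (top_of_set unit_disc) \<gamma>"
    using homeomorphic_map_maps by blast
  ultimately show "\<gamma> \<in> \<Gamma>" using g by (simp add: \<Gamma>_def Bij_def)
qed

lemma Gamma_unique:
  assumes "\<gamma> \<in> \<Gamma>" "\<delta> \<in> \<Gamma>" "a \<in> unit_disc" "\<gamma> a = \<delta> a"
  shows "\<gamma> = \<delta>"
proof (rule extensionalityI)
  show "\<gamma> z = \<delta> z" if "z \<in> unit_disc" for z
    by (rule lift_unique[of \<gamma> \<delta> a z]) (use assms that in \<open>auto simp: Gamma_iff\<close>)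
qed (use assms in \<open>auto simp: Gamma_iff\<close>)

lemma id_in_Gamma: "disc_id \<in> \<Gamma>"
proof -
  have "continuous_on unit_disc disc_id"
    by (rule continuous_on_eq[OF continuous_on_id]) auto
  then show ?thesis by (auto simp: Gamma_iff disc_id_def)
qed

lemma compose_in_Gamma:
  assumes "\<gamma> \<in> \<Gamma>" "\<delta> \<in> \<Gamma>"
  shows "compose unit_disc \<gamma> \<delta> \<in> \<Gamma>"
proof -
  have "continuous_on unit_disc (\<lambda>z. \<gamma> (\<delta> z))"
    by (rule continuous_on_compose2[of unit_disc \<gamma>]) (use assms in \<open>auto simp: Gamma_iff\<close>)
  then have "continuous_on unit_disc (compose unit_disc \<gamma> \<delta>)"
    by (rule continuous_on_eq) (auto simp: compose_def)
  then show ?thesis using assms by (auto simp: Gamma_iff compose_def)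
qed

lemma transitive:
  assumes "z \<in> unit_disc" "w \<in> unit_disc" "f z = f w"
  shows "\<exists>\<gamma>\<in>\<Gamma>. \<gamma> z = w"
proof -
  obtain g where g: "continuous_on unit_disc g" "\<forall>z\<in>unit_disc. g z \<in> unit_disc \<and> f (g z) = f z" "g z = w"
    using lift_exists[OF assms] by blast
  have "continuous_on unit_disc (restrict g unit_disc)"
    by (rule continuous_on_eq[OF g(1)]) auto
  then have "restrict g unit_disc \<in> \<Gamma>" using g by (auto simp: Gamma_iff)
  then show ?thesis using g(3) assms(1) by (intro bexI[of _ "restrict g unit_disc"]) auto
qed

lemma locally_injective:
  assumes "z \<in> unit_disc"
  shows "\<exists>r>0. ball z r \<subseteq> unit_disc \<and> inj_on f (ball z r)"
proof -
  obtain W U q where W: "z \<in> W" "openin (top_of_set unit_disc) W" "homeomorphism W U f q"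
    using covering_space_local_homeomorphism[OF cov assms] by metis
  have "open W" using W(2) by (simp add: openin_open_eq)
  then obtain r where "0 < r" "ball z r \<subseteq> W" using W(1) by (meson open_contains_ball)
  moreover have "inj_on f W" using W(3) by (auto simp: homeomorphism_def intro: inj_on_inverseI)
  moreover have "W \<subseteq> unit_disc" using W(2) openin_imp_subset by blast
  ultimately show ?thesis by (meson inj_on_subset order.trans)
qed

lemma inverse_in_Gamma:
  assumes g: "\<gamma> \<in> \<Gamma>"
  shows "\<exists>\<delta>\<in>\<Gamma>. compose unit_disc \<delta> \<gamma> = disc_id \<and> compose unit_disc \<gamma> \<delta> = disc_id"
proof -
  have g0: "\<gamma> 0 \<in> unit_disc" "f (\<gamma> 0) = f 0" using g by (auto simp: Gamma_iff)
  obtain \<delta> where d: "\<delta> \<in> \<Gamma>" "\<delta> (\<gamma> 0) = 0" using transitive[OF g0(1) _ g0(2)] by auto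
  have "compose unit_disc \<delta> \<gamma> = disc_id"
    by (rule Gamma_unique[OF compose_in_Gamma[OF d(1) g] id_in_Gamma, of 0]) (use d in \<open>auto simp: compose_def\<close>)
  moreover have "compose unit_disc \<gamma> \<delta> = disc_id"
    by (rule Gamma_unique[OF compose_in_Gamma[OF g d(1)] id_in_Gamma, of "\<gamma> 0"])
      (use d g0 in \<open>auto simp: compose_def\<close>)
  ultimately show ?thesis using d(1) by blast
qed

text \<open>The images of the discs of radius below 1 about 0 are open and cover the compact base.
  The largest disc of a finite subcover meets every fibre, and fibres are orbits.\<close>

lemma cocompact_Gamma: "\<exists>k<1. \<forall>z. norm z < 1 \<longrightarrow> (\<exists>\<gamma>\<in>\<Gamma>. norm (\<gamma> z) \<le> k)"
proof -
  let ?\<C> = "(\<lambda>k. f ` ball 0 k) ` {0<..<1}"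
  have op: "openin (top_of_set X) (f ` ball 0 k)" if "k < 1" for k
    by (rule covering_space_open_map[OF cov]) (use that in \<open>auto simp: openin_open_eq intro: subset_ball\<close>)
  have cover: "X \<subseteq> \<Union>?\<C>"
  proof
    fix x assume "x \<in> X"
    then obtain z where z: "norm z < 1" "x = f z" using f_image by auto
    obtain k where k: "norm z < k" "k < 1" using dense[OF z(1)] by blast
    then have "k \<in> {0<..<1}" using order.strict_trans1[OF norm_ge_zero k(1)] by simp
    moreover have "x \<in> f ` ball 0 k" using z k by auto
    ultimately show "x \<in> \<Union>?\<C>" by blast
  qed
  have cX: "compactin (top_of_set X) X" using compact_X by (simp add: compactin_subtopology)
  have "\<exists>F. finite F \<and> F \<subseteq> ?\<C> \<and> X \<subseteq> \<Union>F"
    by (rule compactinD[OF cX _ cover]) (use op in auto)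
  then obtain F where F: "finite F" "F \<subseteq> ?\<C>" "X \<subseteq> \<Union>F" by blast
  then obtain S where S: "finite S" "S \<subseteq> {0<..<1}" "F = (\<lambda>k. f ` ball 0 k) ` S" by (metis finite_subset_image)
  define k where "k = Max (insert 0 S)"
  have k: "k < 1" "\<And>s. s \<in> S \<Longrightarrow> s \<le> k" using S by (auto simp: k_def)
  have "\<exists>\<gamma>\<in>\<Gamma>. norm (\<gamma> z) \<le> k" if z: "norm z < 1" for z
  proof -
    have "f z \<in> X" using z f_image by auto
    then obtain s w where s: "s \<in> S" "norm w < s" "f z = f w" using F(3) S(3) by auto
    then have w: "norm w < 1" "norm w \<le> k" using k S by force+
    obtain \<gamma> where "\<gamma> \<in> \<Gamma>" "\<gamma> z = w" using transitive[of z w] z w(1) s(3) by auto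
    then show ?thesis using w by blast
  qed
  then show ?thesis using k(1) by blast
qed

text \<open>For \<open>discrete\<close>: \<open>w\<close> and \<open>\<gamma> w\<close> lie in one
  fibre, and a ball on which \<open>f\<close> is injective contains at most one point of it.\<close>

lemma disc_group_Gamma:
  assumes hol: "\<And>\<gamma>. \<gamma> \<in> \<Gamma> \<Longrightarrow> \<gamma> holomorphic_on unit_disc"
  shows "disc_group \<Gamma>"
proof
  fix z :: complex assume z: "norm z < 1"
  obtain r where r: "0 < r" "ball z r \<subseteq> unit_disc" "inj_on f (ball z r)" using locally_injective[of z] z by auto
  have "\<gamma> = disc_id" if "\<gamma> \<in> \<Gamma>" "norm w < 1" "dist z w < r" "dist z (\<gamma> w) < r" for \<gamma> w
  proof (rule Gamma_unique[OF that(1) id_in_Gamma, of w])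
    have "f (\<gamma> w) = f w" using that by (auto simp: Gamma_iff)
    then show "\<gamma> w = disc_id w" using inj_onD[OF r(3)] that by auto
  qed (use that in auto)
  then show "\<exists>r>0. \<forall>\<gamma>\<in>\<Gamma>. \<forall>w. norm w < 1 \<longrightarrow> dist z w < r \<longrightarrow> dist z (\<gamma> w) < r \<longrightarrow> \<gamma> = disc_id"
    using r(1) by blast
qed (use hol id_in_Gamma compose_in_Gamma inverse_in_Gamma cocompact_Gamma in \<open>auto simp: Gamma_iff\<close>)

end

text \<open>Locally \<gamma> is the composition of \<open>c \<circ> f\<close> with the holomorphic
  branch of its inverse near \<open>\<gamma> z\<close>. Continuity of \<gamma> keeps its values in
  the domain of that branch.\<close>

lemma deck_transformation_holomorphic:
  fixes f :: "complex \<Rightarrow> 'x::topological_space"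
  assumes atlas: "topological_atlas (top_of_set X) AX" and f: "continuous_on unit_disc f" "f ` unit_disc \<subseteq> X"
    and hol: "\<And>U c. (U, c) \<in> AX \<Longrightarrow> (c \<circ> f) holomorphic_on (unit_disc \<inter> f -` U)"
    and inj: "\<And>z. z \<in> unit_disc \<Longrightarrow> \<exists>r>0. ball z r \<subseteq> unit_disc \<and> inj_on f (ball z r)"
    and g: "continuous_on unit_disc \<gamma>" "\<And>z. z \<in> unit_disc \<Longrightarrow> \<gamma> z \<in> unit_disc" "\<And>z. z \<in> unit_disc \<Longrightarrow> f (\<gamma> z) = f z"
  shows "\<gamma> holomorphic_on unit_disc"
proof -
  have "\<exists>M. open M \<and> z \<in> M \<and> \<gamma> holomorphic_on M" if z: "z \<in> unit_disc" for z
  proof -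
    have "(\<Union>(U, c)\<in>AX. U) = X" using atlas unfolding topological_atlas_def by simp
    then have "f z \<in> (\<Union>(U, c)\<in>AX. U)" using f(2) z by blast
    then obtain U c where c: "(U, c) \<in> AX" "f z \<in> U" by auto
    have U: "openin (top_of_set X) U" and ch: "homeomorphic_map (subtopology (top_of_set X) U) (top_of_set (c ` U)) c"
      using atlas c(1) unfolding topological_atlas_def by auto
    have UX: "U \<subseteq> X" using openin_imp_subset[OF U] .
    have "inj_on c (topspace (subtopology (top_of_set X) U))" by (rule homeomorphic_imp_injective_map[OF ch])
    then have cinj: "inj_on c U" using UX by (simp add: Int_absorb1)
    let ?W = "unit_disc \<inter> f -` U"
    have "openin (top_of_set unit_disc) ?W"
      by (rule continuous_openin_preimage[OF f(1) _ U]) (use f(2) in auto)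
    then have oW: "open ?W" by (simp add: openin_open_eq)
    have gz: "\<gamma> z \<in> unit_disc" by (rule g(2)[OF z])
    obtain r where r: "0 < r" "inj_on f (ball (\<gamma> z) r)" using inj[OF gz] by blast
    define N where "N = ?W \<inter> ball (\<gamma> z) r"
    have N: "open N" "\<gamma> z \<in> N" using oW r gz g(3)[OF z] c(2) by (auto simp: N_def)
    have inN: "inj_on (c \<circ> f) N"
    proof (rule comp_inj_on)
      show "inj_on f N" by (rule inj_on_subset[OF r(2)]) (auto simp: N_def)
      show "inj_on c (f ` N)" by (rule inj_on_subset[OF cinj]) (auto simp: N_def)
    qed
    have hN: "(c \<circ> f) holomorphic_on N" by (rule holomorphic_on_subset[OF hol[OF c(1)]]) (auto simp: N_def)
    obtain h where h: "h holomorphic_on (c \<circ> f) ` N" and "\<And>y. y \<in> N \<Longrightarrow> deriv (c \<circ> f) y * deriv h ((c \<circ> f) y) = 1"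
      and hinv: "\<And>y. y \<in> N \<Longrightarrow> h ((c \<circ> f) y) = y"
      by (rule holomorphic_has_inverse[OF hN N(1) inN], rule that)
    define M where "M = ?W \<inter> (unit_disc \<inter> \<gamma> -` N)"
    have "open (unit_disc \<inter> \<gamma> -` N)" by (rule continuous_open_preimage[OF g(1) open_ball N(1)])
    then have M: "open M" "z \<in> M" using oW z c(2) N(2) by (auto simp: M_def)
    have eq: "(c \<circ> f) (\<gamma> y) = (c \<circ> f) y" if "y \<in> M" for y using that g(3) by (auto simp: M_def)
    have "(h \<circ> (c \<circ> f)) holomorphic_on M"
    proof (rule holomorphic_on_compose_gen[OF _ h])
      show "(c \<circ> f) holomorphic_on M" by (rule holomorphic_on_subset[OF hol[OF c(1)]]) (auto simp: M_def)
      show "(c \<circ> f) ` M \<subseteq> (c \<circ> f) ` N"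
      proof (rule image_subsetI)
        fix y assume y: "y \<in> M"
        then have "\<gamma> y \<in> N" by (auto simp: M_def)
        then show "(c \<circ> f) y \<in> (c \<circ> f) ` N" using eq[OF y] by (metis imageI)
      qed
    qed
    then have "\<gamma> holomorphic_on M"
    proof (rule holomorphic_transform)
      fix y assume y: "y \<in> M"
      then have "\<gamma> y \<in> N" by (auto simp: M_def)
      then show "(h \<circ> (c \<circ> f)) y = \<gamma> y" using hinv eq[OF y] by (metis comp_apply)
    qed
    then show ?thesis using M by blast
  qed
  then obtain S where S: "\<And>z. z \<in> unit_disc \<Longrightarrow> open (S z) \<and> z \<in> S z \<and> \<gamma> holomorphic_on S z" by metis
  have "\<gamma> holomorphic_on (\<Union>z\<in>unit_disc. S z)" by (rule holomorphic_on_UN_open) (use S in auto)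
  then show ?thesis by (rule holomorphic_on_subset) (use S in auto)
qed

text \<open>Composing \<open>f\<close> with the injective \<open>e\<close> preserves the fibres and
  therefore the deck group. Holomorphy is still proved with the original covering and its
  charts.\<close>

lemma disc_group_deck_group:
  fixes f :: "complex \<Rightarrow> 'x::topological_space"
  assumes X: "riemann_surface (top_of_set X) AX" "compact_space (top_of_set X)" and f: "disc_universal_covering X AX f"
  shows "disc_group (carrier (deck_group f))"
proof -
  obtain e :: "'x \<Rightarrow> nat \<Rightarrow>\<^sub>C real" and e' where e: "homeomorphism X (e ` X) e e'"
    using riemann_surface_embedding[OF X] by blast
  have cf: "covering_space unit_disc f X" using f by (simp add: disc_universal_covering_def)
  have fX: "f ` unit_disc = X" by (rule covering_space_imp_surjective[OF cf])
  interpret disc_covering "e \<circ> f" "e ` X"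
  proof
    show "covering_space unit_disc (e \<circ> f) (e ` X)" by (rule covering_space_homeomorphic_base[OF cf e])
    have "compact X" using X(2) by (simp add: compact_space_def compactin_subtopology)
    then show "compact (e ` X)" using e by (intro compact_continuous_image) (auto simp: homeomorphism_def)
  qed
  have einj: "e x = e y \<longleftrightarrow> x = y" if "x \<in> X" "y \<in> X" for x y
    using e that by (metis homeomorphism_apply1)
  have eq: "\<Gamma> = carrier (deck_group f)"
  proof -
    have "e (f (\<gamma> z)) = e (f z) \<longleftrightarrow> f (\<gamma> z) = f z" if "\<gamma> \<in> Bij unit_disc" "z \<in> unit_disc" for \<gamma> z
    proof -
      have "\<gamma> z \<in> unit_disc" using that by (auto simp: Bij_def bij_betw_def)
      then show ?thesis using that(2) fX einj by blast
    qed
    then show ?thesis unfolding \<Gamma>_def deck_group_def by auto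
  qed
  have "disc_group \<Gamma>"
  proof (rule disc_group_Gamma)
    fix \<gamma> assume g: "\<gamma> \<in> \<Gamma>"
    show "\<gamma> holomorphic_on unit_disc"
    proof (rule deck_transformation_holomorphic)
      show "topological_atlas (top_of_set X) AX" using X(1) by (simp add: riemann_surface_def)
      show "continuous_on unit_disc f" by (rule covering_space_imp_continuous[OF cf])
      show "(c \<circ> f) holomorphic_on (unit_disc \<inter> f -` U)" if "(U, c) \<in> AX" for U c
        using f that unfolding disc_universal_covering_def by blast
      show "\<exists>r>0. ball z r \<subseteq> unit_disc \<and> inj_on f (ball z r)" if "z \<in> unit_disc" for z
        using locally_injective[OF that] inj_on_imageI2 by blast
      show "f (\<gamma> z) = f z" if "z \<in> unit_disc" for z
        using g that unfolding eq deck_group_def by simp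
    qed (use g fX in \<open>auto simp: Gamma_iff\<close>)
  qed
  then show ?thesis unfolding eq .
qed

lemma susp_deck_group:
  fixes f :: "complex \<Rightarrow> 'x::topological_space" and AT :: "('t, 'e::finite_dim_inner) chart set"
  assumes X: "riemann_surface (top_of_set X) AX" "compact_space (top_of_set X)" and f: "disc_universal_covering X AX f"
    and T: "smooth_manifold T AT" "compact_space T" and \<phi>: "\<phi> \<in> hom (deck_group f) (diff1_group T AT)"
  shows "susp (carrier (deck_group f)) T AT \<phi>"
proof -
  interpret disc_group "carrier (deck_group f)" by (rule disc_group_deck_group[OF X f])
  have car: "\<phi> \<gamma> \<in> Bij (topspace T) \<and> Ck_map 1 T AT T AT (\<phi> \<gamma>)" if "\<gamma> \<in> carrier (deck_group f)" for \<gamma>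
  proof -
    have "\<phi> \<gamma> \<in> carrier (diff1_group T AT)" using \<phi> that by (auto simp: hom_def)
    then show ?thesis unfolding diff1_group_def by simp
  qed
  have comp: "\<phi> (compose unit_disc \<gamma> \<delta>) t = \<phi> \<gamma> (\<phi> \<delta> t)"
    if g: "\<gamma> \<in> carrier (deck_group f)" "\<delta> \<in> carrier (deck_group f)" and t: "t \<in> topspace T" for \<gamma> \<delta> t
  proof -
    have B: "\<gamma> \<in> Bij unit_disc" "\<delta> \<in> Bij unit_disc" using g by (auto simp: deck_group_def)
    have "\<phi> (\<gamma> \<otimes>\<^bsub>deck_group f\<^esub> \<delta>) = \<phi> \<gamma> \<otimes>\<^bsub>diff1_group T AT\<^esub> \<phi> \<delta>" using \<phi> g by (simp add: hom_def)
    moreover have "\<gamma> \<otimes>\<^bsub>deck_group f\<^esub> \<delta> = compose unit_disc \<gamma> \<delta>"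
      using B by (simp add: deck_group_def BijGroup_def)
    moreover have "\<phi> \<gamma> \<otimes>\<^bsub>diff1_group T AT\<^esub> \<phi> \<delta> = compose (topspace T) (\<phi> \<gamma>) (\<phi> \<delta>)"
      using car[OF g(1)] car[OF g(2)] by (simp add: diff1_group_def BijGroup_def)
    ultimately show ?thesis using t by (simp add: FuncSet.compose_def)
  qed
  show ?thesis
  proof
    show "smooth_manifold T AT" "compact_space T" by (fact T)+
    show "Ck_map 1 T AT T AT (\<phi> \<gamma>)" if "\<gamma> \<in> carrier (deck_group f)" for \<gamma> using car[OF that] by simp
    show "\<phi> (compose unit_disc \<gamma> \<delta>) t = \<phi> \<gamma> (\<phi> \<delta> t)"
      if "\<gamma> \<in> carrier (deck_group f)" "\<delta> \<in> carrier (deck_group f)" "t \<in> topspace T" for \<gamma> \<delta> t using comp[OF that] .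
    fix t assume t: "t \<in> topspace T"
    \<comment> \<open>\<open>\<phi> disc_id\<close> is idempotent and injective, hence the
      identity.\<close>
    have "\<phi> disc_id (\<phi> disc_id t) = \<phi> disc_id t"
      using comp[OF id_in id_in t] compose_disc_id[OF id_in] by simp
    moreover have "bij_betw (\<phi> disc_id) (topspace T) (topspace T)" using car[OF id_in] by (simp add: Bij_def)
    ultimately show "\<phi> disc_id t = t" using t by (metis bij_betw_apply bij_betw_imp_inj_on inj_onD)
  qed
qed

section \<open>The embedding into projective space\<close>

lemma continuous_map_euclidean_iff:
  "continuous_map X euclidean f \<longleftrightarrow> (\<forall>x\<in>topspace X. (f \<longlongrightarrow> f x) (atin X x))"
  by (simp add: continuous_map_atin limitin_canonical_iff)

abbreviation "vec_space N \<equiv> subtopology (product_topology (\<lambda>_. euclidean) {..N}) (nonzero_vectors N)"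

lemma topspace_vec_space: "topspace (vec_space N) = nonzero_vectors N"
  by (auto simp: nonzero_vectors_def PiE_def)

lemma quotient_map_proj_class: "quotient_map (vec_space N) (proj_space N) (proj_class N)"
  unfolding proj_space_def by (rule quotient_map_quotient_topology)

lemma topspace_proj_space: "topspace (proj_space N) = proj_class N ` nonzero_vectors N"
  unfolding proj_space_def topspace_quotient_topology topspace_vec_space ..

lemma proj_class_eqD:
  assumes z: "z \<in> nonzero_vectors N" and eq: "proj_class N z = proj_class N w"
  shows "\<exists>a. a \<noteq> 0 \<and> (\<forall>i\<le>N. z i = a * w i)"
proof -
  have "z = (\<lambda>i\<in>{..N}. 1 * z i)"
    using z by (auto simp: nonzero_vectors_def extensional_def fun_eq_iff)
  then have "z \<in> proj_class N z" unfolding proj_class_def using one_neq_zero by blast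
  then have "z \<in> {(\<lambda>i\<in>{..N}. a * w i) | a. a \<noteq> 0}" unfolding eq unfolding proj_class_def .
  then obtain a where "a \<noteq> 0" "z = (\<lambda>i\<in>{..N}. a * w i)" by (elim CollectE exE conjE)
  then show ?thesis by (intro exI[of _ a]) auto
qed

lemma proj_class_eqI:
  assumes a: "a \<noteq> 0" and eq: "\<And>i. i \<le> N \<Longrightarrow> z i = a * w i"
  shows "proj_class N z = proj_class N w"
proof -
  have zw: "(\<lambda>i\<in>{..N}. b * z i) = (\<lambda>i\<in>{..N}. (b * a) * w i)" for b using eq by (auto simp: fun_eq_iff)
  have wz: "(\<lambda>i\<in>{..N}. b * w i) = (\<lambda>i\<in>{..N}. (b / a) * z i)" for b using eq a by (auto simp: fun_eq_iff)
  show ?thesis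
    unfolding proj_class_def
  proof (intro subset_antisym subsetI; elim CollectE exE conjE)
    fix x b assume "x = (\<lambda>i\<in>{..N}. b * z i)" "b \<noteq> 0"
    then show "x \<in> {(\<lambda>i\<in>{..N}. b * w i) | b. b \<noteq> 0}"
      unfolding zw using a by (intro CollectI exI[of _ "b * a"] conjI) simp_all
  next
    fix x b assume "x = (\<lambda>i\<in>{..N}. b * w i)" "b \<noteq> 0"
    then show "x \<in> {(\<lambda>i\<in>{..N}. b * z i) | b. b \<noteq> 0}"
      unfolding wz using a by (intro CollectI exI[of _ "b / a"] conjI) simp_all
  qed
qed

text \<open>The matrix of the orthogonal projection onto the line, with entries z_i cnj z_j / |z|^2,
  depends continuously on the class and determines it. This is a continuous injection into a product
  of copies of the plane.\<close>

lemma Hausdorff_proj_space: "Hausdorff_space (proj_space N)"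
proof -
  define s where "s z = (\<Sum>k\<le>N. (norm (z k))\<^sup>2)" for z :: "nat \<Rightarrow> complex"
  define G where "G z = (\<lambda>p\<in>{..N} \<times> {..N}. z (fst p) * cnj (z (snd p)) / of_real (s z))" for z :: "nat \<Rightarrow> complex"
  let ?Z = "product_topology (\<lambda>_. euclidean :: complex topology) ({..N} \<times> {..N})"
  have s: "0 < s z" if z: "z \<in> nonzero_vectors N" for z
  proof -
    obtain i where i: "i \<le> N" "z i \<noteq> 0" using z by (auto simp: nonzero_vectors_def)
    have "(norm (z i))\<^sup>2 \<le> s z" unfolding s_def by (rule member_le_sum) (use i in auto)
    moreover have "0 < (norm (z i))\<^sup>2" using i by simp
    ultimately show ?thesis by linarith
  qed
  have coord: "continuous_map (vec_space N) euclidean (\<lambda>z. z i)" if "i \<le> N" for i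
    by (rule continuous_map_from_subtopology[OF continuous_map_product_projection]) (use that in auto)
  have tc: "((\<lambda>z. z i) \<longlongrightarrow> z0 i) (atin (vec_space N) z0)" if "i \<le> N" "z0 \<in> nonzero_vectors N" for i z0
    using coord[OF that(1)] that(2) unfolding continuous_map_euclidean_iff topspace_vec_space by blast
  have "continuous_map (vec_space N) ?Z G"
    unfolding continuous_map_componentwise
  proof (intro conjI ballI)
    show "G ` topspace (vec_space N) \<subseteq> extensional ({..N} \<times> {..N})" by (auto simp: G_def)
    fix p assume p: "p \<in> {..N} \<times> {..N}"
    then have "continuous_map (vec_space N) euclidean (\<lambda>z. z (fst p) * cnj (z (snd p)) / of_real (s z))"
      unfolding continuous_map_euclidean_iff topspace_vec_space s_def
    proof (intro ballI tendsto_intros tc)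
      fix z assume "z \<in> nonzero_vectors N"
      then show "complex_of_real (\<Sum>k\<le>N. (norm (z k))\<^sup>2) \<noteq> 0" using s[of z] unfolding s_def of_real_eq_0_iff by linarith
    qed auto
    then show "continuous_map (vec_space N) euclidean (\<lambda>z. G z p)" using p by (simp add: G_def)
  qed
  moreover have "G z = G w" if zw: "z \<in> topspace (vec_space N)" "w \<in> topspace (vec_space N)" "proj_class N z = proj_class N w" for z w
  proof -
    obtain a where a: "a \<noteq> 0" "\<And>i. i \<le> N \<Longrightarrow> z i = a * w i"
      using proj_class_eqD[OF zw(1)[unfolded topspace_vec_space] zw(3)] by (elim exE conjE) blast
    have sz: "s z = (norm a)\<^sup>2 * s w" unfolding s_def using a(2) by (simp add: norm_mult power_mult_distrib sum_distrib_left)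
    have "z i * cnj (z j) / of_real (s z) = w i * cnj (w j) / of_real (s w)" if "i \<le> N" "j \<le> N" for i j
    proof -
      have "z i * cnj (z j) = (a * cnj a) * (w i * cnj (w j))" using a(2) that by simp
      also have "a * cnj a = of_real ((norm a)\<^sup>2)" by (rule complex_norm_square[symmetric])
      finally show ?thesis unfolding sz of_real_mult using a(1) by simp
    qed
    then show ?thesis by (auto simp: G_def fun_eq_iff)
  qed
  ultimately obtain P where P: "continuous_map (proj_space N) ?Z P" "\<And>z. z \<in> nonzero_vectors N \<Longrightarrow> P (proj_class N z) = G z"
    using quotient_map_lift_exists[OF quotient_map_proj_class, of N ?Z G] unfolding topspace_vec_space by metis
  have inj: "inj_on P (topspace (proj_space N))"
    unfolding topspace_proj_space
  proof (rule inj_onI, clarify)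
    fix z w assume z: "z \<in> nonzero_vectors N" and w: "w \<in> nonzero_vectors N" and "P (proj_class N z) = P (proj_class N w)"
    then have "G z = G w" using P(2) by simp
    then have eq: "z i * cnj (z j) / of_real (s z) = w i * cnj (w j) / of_real (s w)" if "i \<le> N" "j \<le> N" for i j
      using that by (auto simp: G_def dest!: fun_cong[of _ _ "(i, j)"])
    obtain j where j: "j \<le> N" "z j \<noteq> 0" using z by (auto simp: nonzero_vectors_def)
    have sz: "s z \<noteq> 0" "s w \<noteq> 0" using s[OF z] s[OF w] by auto
    have wj: "w j \<noteq> 0" using eq[OF j(1) j(1)] j(2) sz by auto
    show "proj_class N z = proj_class N w"
    proof (rule proj_class_eqI)
      \<comment> \<open>Column \<open>j\<close> of each matrix is a multiple of the vector; the
        quotient of the two multiples is the required scalar.\<close>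
      show "(cnj (w j) / of_real (s w)) / (cnj (z j) / of_real (s z)) \<noteq> 0" using wj j sz by simp
      show "z i = (cnj (w j) / of_real (s w)) / (cnj (z j) / of_real (s z)) * w i" if "i \<le> N" for i
        using eq[OF that j(1)] j(2) sz by (simp add: field_simps)
    qed
  qed
  show ?thesis
    by (rule Hausdorff_space_injective_preimage[OF _ P(1) inj]) (simp add: Hausdorff_space_product_topology)
qed

lemma
  assumes z: "z \<in> nonzero_vectors N" and j: "j \<le> N"
  shows proj_class_in_proj_dom: "proj_class N z \<in> proj_dom N j \<longleftrightarrow> z j \<noteq> 0"
    and proj_coord_proj_class: "i \<le> N \<Longrightarrow> z j \<noteq> 0 \<Longrightarrow> proj_coord j i (proj_class N z) = z i / z j"
proof -
  have zc: "(\<lambda>i\<in>{..N}. 1 * z i) \<in> proj_class N z" unfolding proj_class_def using one_neq_zero by blast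
  show "proj_class N z \<in> proj_dom N j \<longleftrightarrow> z j \<noteq> 0"
  proof
    assume "proj_class N z \<in> proj_dom N j"
    then have "(\<lambda>i\<in>{..N}. 1 * z i) j \<noteq> 0" using zc unfolding proj_dom_def by blast
    then show "z j \<noteq> 0" using j by simp
  next
    assume "z j \<noteq> 0"
    then show "proj_class N z \<in> proj_dom N j"
      using z j unfolding proj_dom_def topspace_proj_space by (auto simp: proj_class_def)
  qed
  assume i: "i \<le> N" and zj: "z j \<noteq> 0"
  show "proj_coord j i (proj_class N z) = z i / z j"
    unfolding proj_coord_def
  proof (rule the_equality)
    show "\<forall>w\<in>proj_class N z. z i / z j = w i / w j" using i j by (auto simp: proj_class_def)
    show "w = z i / z j" if "\<forall>v\<in>proj_class N z. w = v i / v j" for w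
      using bspec[OF that zc] i j by simp
  qed
qed

text \<open>The values of the forms are homogeneous coordinates, and the automorphy factor by which
  they change along an orbit disappears in projective space. A continuous injection of a compact
  space into a Hausdorff space is an embedding, and the quotient rule translates
  \<open>immersed\<close> into the immersion condition in affine charts.\<close>

lemma susp_projective:
  fixes f :: "complex \<Rightarrow> 'x" and AT :: "('t, 'e::finite_dim_inner) chart set"
  assumes "susp (carrier (deck_group f)) T AT \<phi>"
  shows "projective_lamination (suspension f T \<phi>) (suspension_atlas f AT \<phi>)"
proof -
  interpret susp "carrier (deck_group f)" T AT \<phi> by fact
  let ?\<Gamma> = "carrier (deck_group f)" and ?Y = "suspension f T \<phi>" and ?\<pi> = "susp_pi f \<phi>"
  have pi_act: "?\<pi> p = (\<lambda>\<gamma>. act \<gamma> p) ` ?\<Gamma>" for p unfolding susp_pi_def act_def ..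
  have pi_eq: "?\<pi> p = ?\<pi> q \<longleftrightarrow> (\<exists>\<gamma>\<in>?\<Gamma>. act \<gamma> p = q)" if p: "p \<in> topspace PT" and q: "q \<in> topspace PT" for p q
  proof
    assume eq: "?\<pi> p = ?\<pi> q"
    have "q \<in> ?\<pi> q" unfolding pi_act by (rule image_eqI[OF _ id_in]) (simp only: act_id[OF q])
    then have "q \<in> (\<lambda>\<gamma>. act \<gamma> p) ` ?\<Gamma>" unfolding eq[symmetric] unfolding pi_act .
    then show "\<exists>\<gamma>\<in>?\<Gamma>. act \<gamma> p = q" by (elim imageE) auto
  next
    assume "\<exists>\<gamma>\<in>?\<Gamma>. act \<gamma> p = q"
    then obtain \<gamma> where g: "\<gamma> \<in> ?\<Gamma>" "q = act \<gamma> p" by blast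
    have "act \<delta> q \<in> ?\<pi> p" if "\<delta> \<in> ?\<Gamma>" for \<delta>
      unfolding pi_act g(2) act_compose[OF that g(1) p] using comp_in[OF that g(1)] by blast
    moreover have "act \<delta> p \<in> ?\<pi> q" if d: "\<delta> \<in> ?\<Gamma>" for \<delta>
    proof -
      have "act \<delta> p = act (compose unit_disc \<delta> (ginv \<gamma>)) q"
        using act_compose[OF d ginv_in[OF g(1)] q] act_ginv(1)[OF g(1) p] g(2) by simp
      then show ?thesis unfolding pi_act using comp_in[OF d ginv_in[OF g(1)]] by blast
    qed
    ultimately show "?\<pi> p = ?\<pi> q" unfolding pi_act[of p] pi_act[of q] by (intro subset_antisym) (auto simp: pi_act)
  qed
  have qm: "quotient_map PT ?Y ?\<pi>" unfolding suspension_def by (rule quotient_map_quotient_topology)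
  have Ytop: "topspace ?Y = ?\<pi> ` topspace PT" unfolding suspension_def topspace_quotient_topology ..
  obtain m A where A: "finite A" "\<And>F. F \<in> A \<Longrightarrow> form m F"
    and im: "\<And>p. p \<in> topspace PT \<Longrightarrow> immersed_all A p"
    and sep: "\<And>p q. p \<in> topspace PT \<Longrightarrow> q \<in> topspace PT \<Longrightarrow> separated A (p, q)"
    and K: "\<exists>K. compactin PT K \<and> (\<forall>p\<in>topspace PT. \<exists>\<gamma>\<in>?\<Gamma>. act \<gamma> p \<in> K)"
    by (rule embedding_forms, rule that)
  \<comment> \<open>The zero form, which has every weight, makes the list of coordinates nonempty
    even if \<open>A\<close> is empty.\<close>
  obtain n :: nat and Fs where Fs: "insert (\<lambda>_. 0) A = Fs ` {i. i < n}"
    using finite_imp_nat_seg_image_inj_on[of "insert (\<lambda>_. 0) A"] A(1) by auto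
  have "n \<noteq> 0"
  proof
    assume "n = 0"
    then show False using Fs by auto
  qed
  define N where "N = n - 1"
  have Fs: "insert (\<lambda>_. 0) A = Fs ` {..N}"
    using Fs \<open>n \<noteq> 0\<close> by (auto simp: N_def set_eq_iff image_iff) (metis Suc_pred less_Suc_eq_le not_gr_zero)+
  have Ff: "form m (Fs i)" if "i \<le> N" for i
  proof -
    have "Fs i \<in> insert (\<lambda>_. 0) A" unfolding Fs using that by auto
    then show ?thesis using A(2) form_zero by auto
  qed
  define vc where "vc p = (\<lambda>i\<in>{..N}. Fs i p)" for p
  have vc: "vc p \<in> nonzero_vectors N" if p: "p \<in> topspace PT" for p
  proof -
    obtain F where "F \<in> A" "F p \<noteq> 0" using im[OF p] unfolding immersed_all_def by blast
    moreover from this obtain i where "i \<le> N" "F = Fs i" using Fs by auto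
    ultimately show ?thesis by (auto simp: vc_def nonzero_vectors_def)
  qed
  have vc_cont: "continuous_map PT (vec_space N) vc"
    unfolding continuous_map_in_subtopology continuous_map_componentwise
  proof (intro conjI ballI)
    show "vc ` topspace PT \<subseteq> extensional {..N}" by (auto simp: vc_def)
    show "continuous_map PT euclidean (\<lambda>p. vc p i)" if "i \<in> {..N}" for i
      using form_continuous[OF Ff] that by (simp add: vc_def)
    show "vc \<in> topspace PT \<rightarrow> nonzero_vectors N" using vc by blast
  qed
  have cont0: "continuous_map PT (proj_space N) (proj_class N \<circ> vc)"
    by (rule continuous_map_compose[OF vc_cont quotient_imp_continuous_map[OF quotient_map_proj_class]])
  have inv0: "(proj_class N \<circ> vc) p = (proj_class N \<circ> vc) q"
    if p: "p \<in> topspace PT" and q: "q \<in> topspace PT" and eq: "?\<pi> p = ?\<pi> q" for p q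
  proof -
    obtain \<gamma> where g: "\<gamma> \<in> ?\<Gamma>" "act \<gamma> p = q" using eq pi_eq[OF p q] by blast
    have "deriv \<gamma> (fst p) ^ m \<noteq> 0" using deriv_nz[OF g(1)] p by auto
    moreover have "vc p i = deriv \<gamma> (fst p) ^ m * vc q i" if "i \<le> N" for i
      using form_automorphic[OF Ff[OF that] g(1) p] that unfolding g(2) by (simp add: vc_def mult.commute)
    ultimately show ?thesis unfolding comp_def by (rule proj_class_eqI)
  qed
  obtain \<Psi> where Pc: "continuous_map ?Y (proj_space N) \<Psi>"
    and "\<Psi> ` topspace ?Y = (proj_class N \<circ> vc) ` topspace PT"
    and Pe0: "\<And>p. p \<in> topspace PT \<Longrightarrow> \<Psi> (?\<pi> p) = (proj_class N \<circ> vc) p"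
    by (rule quotient_map_lift_exists[OF qm cont0 inv0], assumption, assumption, assumption, rule that)
  have Pe: "\<Psi> (?\<pi> p) = proj_class N (vc p)" if "p \<in> topspace PT" for p using Pe0[OF that] by simp
  have "inj_on \<Psi> (topspace ?Y)"
    unfolding Ytop
  proof (rule inj_onI, elim imageE)
    fix y y' p q assume p: "p \<in> topspace PT" "y = ?\<pi> p" and q: "q \<in> topspace PT" "y' = ?\<pi> q" and "\<Psi> y = \<Psi> y'"
    then have "proj_class N (vc p) = proj_class N (vc q)" using Pe by simp
    then obtain a where a: "a \<noteq> 0" "\<forall>i\<le>N. vc p i = a * vc q i" using proj_class_eqD[OF vc[OF p(1)]] by blast
    have "F p = a * F q" if F: "F \<in> A" for F
    proof -
      have "F \<in> Fs ` {..N}" unfolding Fs[symmetric] using F by blast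
      then obtain i where "i \<le> N" "F = Fs i" by auto
      then show ?thesis using a(2) by (auto simp: vc_def)
    qed
    then have "\<exists>\<gamma>\<in>?\<Gamma>. act \<gamma> p = q" using sep[OF p(1) q(1)] a(1) unfolding separated_def by auto
    then show "y = y'" using pi_eq[OF p(1) q(1)] p q by blast
  qed
  moreover have "compact_space ?Y"
  proof -
    obtain K where K: "compactin PT K" "\<And>p. p \<in> topspace PT \<Longrightarrow> \<exists>\<gamma>\<in>?\<Gamma>. act \<gamma> p \<in> K" using K by blast
    have "?\<pi> ` K = topspace ?Y"
    proof
      show "?\<pi> ` K \<subseteq> topspace ?Y" unfolding Ytop using compactin_subset_topspace[OF K(1)] by (rule image_mono)
      show "topspace ?Y \<subseteq> ?\<pi> ` K"
      proof
        fix y assume "y \<in> topspace ?Y"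
        then obtain p where p: "p \<in> topspace PT" "y = ?\<pi> p" unfolding Ytop by (elim imageE) simp
        obtain \<gamma> where g: "\<gamma> \<in> ?\<Gamma>" "act \<gamma> p \<in> K" using K(2)[OF p(1)] by blast
        have "?\<pi> p = ?\<pi> (act \<gamma> p)" using pi_eq[OF p(1) act_maps[OF g(1) p(1)]] g(1) by blast
        then show "y \<in> ?\<pi> ` K" using p(2) g(2) by blast
      qed
    qed
    then show ?thesis unfolding compact_space_def
      using image_compactin[OF K(1) quotient_imp_continuous_map[OF qm]] by simp
  qed
  ultimately have emb: "embedding_map ?Y (proj_space N) \<Psi>"
    by (intro continuous_imp_embedding_map Pc Hausdorff_proj_space)
  define Q where "Q V d j = {x \<in> unit_disc \<times> d ` V. Fs j (chm V d x) \<noteq> 0}" for V and d :: "'t \<Rightarrow> 'e" and j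
  have Fc: "C1 (unit_disc \<times> d ` V) (\<lambda>x. Fs i (chm V d x))" if "(V, d) \<in> AT" "i \<le> N" for V d i
    using Ff[OF that(2)] that(1) by (intro regular_C1) (auto simp: form_def)
  have Qo: "open (Q V d j)" if c: "(V, d) \<in> AT" and j: "j \<le> N" for V d j
  proof -
    have "open (unit_disc \<times> d ` V)" using chart_image_open[OF c] by (simp add: open_Times)
    then have "open (unit_disc \<times> d ` V \<inter> (\<lambda>x. Fs j (chm V d x)) -` (- {0}))"
      by (intro continuous_open_preimage C1_imp_continuous_on Fc c j) auto
    moreover have "unit_disc \<times> d ` V \<inter> (\<lambda>x. Fs j (chm V d x)) -` (- {0}) = Q V d j" by (auto simp: Q_def)
    ultimately show ?thesis by simp
  qed
  \<comment> \<open>In a flow box the affine coordinates of \<Psi> are quotients of forms in the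
    coordinates of \<open>chm\<close>, on the part where the j-th form does not vanish. All three
    local properties are read off from this.\<close>
  have box: "\<exists>U V d. open U \<and> U \<subseteq> unit_disc \<and> (V, d) \<in> AT \<and>
      (\<forall>j\<le>N. c ` (W \<inter> \<Psi> -` proj_dom N j) = Q V d j \<inter> (U \<times> d ` V)) \<and>
      (\<forall>j\<le>N. \<forall>i\<le>N. \<forall>x\<in>Q V d j \<inter> (U \<times> d ` V). proj_coord j i (\<Psi> (inv_into W c x)) = Fs i (chm V d x) / Fs j (chm V d x))"
    if Wc: "(W, c) \<in> suspension_atlas f AT \<phi>" for W c
  proof -
    obtain U V d where W: "W = ?\<pi> ` (U \<times> V)" and c: "c = (\<lambda>y. map_prod id d (inv_into (U \<times> V) ?\<pi> y))"
      and U: "open U" "U \<subseteq> unit_disc" and Vd: "(V, d) \<in> AT" and inj: "inj_on ?\<pi> (U \<times> V)"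
      using Wc unfolding suspension_atlas_def by blast
    have UV: "U \<times> V \<subseteq> topspace PT" using U(2) chart_subset[OF Vd] by auto
    have c_pi: "c (?\<pi> p) = (fst p, d (snd p))" if "p \<in> U \<times> V" for p
      using inv_into_f_f[OF inj that] by (simp add: c map_prod_def split_beta)
    have c_inj: "inj_on c W" unfolding W
    proof (rule inj_onI, elim imageE)
      fix y y' p q assume pq: "p \<in> U \<times> V" "q \<in> U \<times> V" "y = ?\<pi> p" "y' = ?\<pi> q" "c y = c y'"
      then have 1: "fst p = fst q" "d (snd p) = d (snd q)" using c_pi by auto
      have "snd p \<in> V" "snd q \<in> V" using pq by auto
      then have "snd p = snd q" by (rule inj_onD[OF chart_inj[OF Vd] 1(2)])
      then have "p = q" by (rule prod_eqI[OF 1(1)])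
      then show "y = y'" unfolding pq by simp
    qed
    \<comment> \<open>The flow-box chart is inverse to the quotient map after
      \<open>chm\<close>.\<close>
    have inv: "inv_into W c x = ?\<pi> (chm V d x)" and chmUV: "chm V d x \<in> U \<times> V" if x: "x \<in> U \<times> d ` V" for x
    proof -
      show p: "chm V d x \<in> U \<times> V" using x chart_inv(1)[OF Vd] by auto
      have "c (?\<pi> (chm V d x)) = x" unfolding c_pi[OF p] using x chart_inv(2)[OF Vd] by (auto simp: prod_eq_iff)
      moreover have "?\<pi> (chm V d x) \<in> W" unfolding W using p by blast
      ultimately show "inv_into W c x = ?\<pi> (chm V d x)" using inv_into_f_f[OF c_inj] by metis
    qed
    have dom: "\<Psi> (?\<pi> p) \<in> proj_dom N j \<longleftrightarrow> Fs j p \<noteq> 0" if "p \<in> U \<times> V" "j \<le> N" for p j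
      using proj_class_in_proj_dom[OF vc that(2), of p] Pe[of p] UV that by (auto simp: vc_def)
    have dm: "c ` (W \<inter> \<Psi> -` proj_dom N j) = Q V d j \<inter> (U \<times> d ` V)" if j: "j \<le> N" for j
    proof (intro subset_antisym subsetI)
      fix x assume "x \<in> c ` (W \<inter> \<Psi> -` proj_dom N j)"
      then obtain p where p: "p \<in> U \<times> V" "\<Psi> (?\<pi> p) \<in> proj_dom N j" "x = c (?\<pi> p)" unfolding W by blast
      have x: "x = (fst p, d (snd p))" using p(3) c_pi[OF p(1)] by simp
      have "chm V d x = p" using x p(1) chart_inv(3)[OF Vd] by (auto simp: prod_eq_iff)
      moreover have "x \<in> U \<times> d ` V" unfolding x using p(1) by auto
      moreover from this have "x \<in> unit_disc \<times> d ` V" using U(2) by blast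
      moreover have "Fs j p \<noteq> 0" using dom[OF p(1) j] p(2) by blast
      ultimately show "x \<in> Q V d j \<inter> (U \<times> d ` V)" unfolding Q_def by blast
    next
      fix x assume x: "x \<in> Q V d j \<inter> (U \<times> d ` V)"
      then have p: "chm V d x \<in> U \<times> V" using chmUV by blast
      have "x = c (?\<pi> (chm V d x))" unfolding c_pi[OF p] using x chart_inv(2)[OF Vd] by (auto simp: prod_eq_iff)
      moreover have "?\<pi> (chm V d x) \<in> W \<inter> \<Psi> -` proj_dom N j" using dom[OF p j] x p by (auto simp: W Q_def)
      ultimately show "x \<in> c ` (W \<inter> \<Psi> -` proj_dom N j)" by blast
    qed
    have co: "proj_coord j i (\<Psi> (inv_into W c x)) = Fs i (chm V d x) / Fs j (chm V d x)"
      if ji: "j \<le> N" "i \<le> N" and x: "x \<in> Q V d j \<inter> (U \<times> d ` V)" for j i x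
    proof -
      have x': "x \<in> U \<times> d ` V" using x by blast
      have p: "chm V d x \<in> topspace PT" using chmUV[OF x'] UV by blast
      have "vc (chm V d x) j \<noteq> 0" using x ji by (simp add: Q_def vc_def)
      then show ?thesis
        using proj_coord_proj_class[OF vc[OF p] ji] Pe[OF p] ji unfolding inv[OF x'] by (simp add: vc_def)
    qed
    show ?thesis
      by (intro exI[of _ U] exI[of _ V] exI[of _ d] conjI U Vd allI impI ballI dm co)
  qed
  have ratio: "C1 S (\<lambda>x. Fs i (chm V d x) / Fs j (chm V d x))"
    if "(V, d) \<in> AT" "i \<le> N" "j \<le> N" "S \<subseteq> Q V d j" for V d i j S
  proof (rule C1_divide)
    show "C1 S (\<lambda>x. Fs i (chm V d x))" "C1 S (\<lambda>x. Fs j (chm V d x))"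
      by (rule C1_subset[OF Fc]; use that in \<open>auto simp: Q_def\<close>)+
  qed (use that in \<open>auto simp: Q_def\<close>)
  have "C1_proj_map ?Y (suspension_atlas f AT \<phi>) N \<Psi>"
    unfolding C1_proj_map_def
  proof (intro conjI Pc ballI, clarify)
    fix W c j i assume Wc: "(W, c) \<in> suspension_atlas f AT \<phi>" and ji: "j \<le> N" "i \<le> N"
    obtain U V d where U: "open U" "U \<subseteq> unit_disc" and Vd: "(V, d) \<in> AT"
      and dom: "\<forall>j\<le>N. c ` (W \<inter> \<Psi> -` proj_dom N j) = Q V d j \<inter> (U \<times> d ` V)"
      and co: "\<forall>j\<le>N. \<forall>i\<le>N. \<forall>x\<in>Q V d j \<inter> (U \<times> d ` V). proj_coord j i (\<Psi> (inv_into W c x)) = Fs i (chm V d x) / Fs j (chm V d x)"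
      using box[OF Wc] by (elim exE conjE) blast
    let ?S = "Q V d j \<inter> (U \<times> d ` V)"
    have S: "open ?S" using Qo[OF Vd ji(1)] U(1) chart_image_open[OF Vd] by (intro open_Int open_Times)
    have "C1 ?S (proj_coord j i \<circ> \<Psi> \<circ> inv_into W c)"
      by (rule C1_cong[OF S _ ratio[OF Vd ji(2,1)]]) (use co ji in auto)
    then show "Ck_on 1 (c ` (W \<inter> \<Psi> -` proj_dom N j)) (proj_coord j i \<circ> \<Psi> \<circ> inv_into W c)"
      using dom ji(1) unfolding C1_def by metis
  qed
  moreover have "v = 0" if Wc: "(W, c) \<in> suspension_atlas f AT \<phi>" and j: "j \<le> N" and x: "x \<in> c ` (W \<inter> \<Psi> -` proj_dom N j)"
    and v: "\<forall>i\<le>N. fder (proj_coord j i \<circ> \<Psi> \<circ> inv_into W c) x v = 0" for W c j x v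
  proof -
    obtain U V d where U: "open U" "U \<subseteq> unit_disc" and Vd: "(V, d) \<in> AT"
      and dom: "\<forall>j\<le>N. c ` (W \<inter> \<Psi> -` proj_dom N j) = Q V d j \<inter> (U \<times> d ` V)"
      and co: "\<forall>j\<le>N. \<forall>i\<le>N. \<forall>x\<in>Q V d j \<inter> (U \<times> d ` V). proj_coord j i (\<Psi> (inv_into W c x)) = Fs i (chm V d x) / Fs j (chm V d x)"
      using box[OF Wc] by (elim exE conjE) blast
    let ?S = "Q V d j \<inter> (U \<times> d ` V)"
    have S: "open ?S" using Qo[OF Vd j] U(1) chart_image_open[OF Vd] by (intro open_Int open_Times)
    have xS: "x \<in> ?S" using x dom j by blast
    define p where "p = chm V d x"
    have x1: "norm (fst x) < 1" "snd x \<in> d ` V" using xS U(2) by auto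
    have p: "p \<in> topspace PT" "snd p \<in> V" and px: "(fst p, d (snd p)) = x"
      using x1 chart_inv(1,2)[OF Vd] chart_subset[OF Vd] by (auto simp: p_def prod_eq_iff)
    have Fj: "Fs j p \<noteq> 0" using xS by (simp add: Q_def p_def)
    \<comment> \<open>The logarithmic derivative of the denominator: if all quotients by
      \<open>Fs j\<close> have derivative 0, then every form has derivative \<open>l\<close> times
      its value, as \<open>immersed\<close> forbids for nonzero \<open>v\<close>.\<close>
    define l where "l = fder (\<lambda>x. Fs j (chm V d x)) x v / Fs j p"
    have "fder (\<lambda>x. F (chm V d x)) x v = l * F p" if F: "F \<in> A" for F
    proof -
      obtain i where i: "i \<le> N" "F = Fs i" using Fs F by auto
      have sub: "?S \<subseteq> unit_disc \<times> d ` V" by (auto simp: Q_def)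
      have "0 = fder (proj_coord j i \<circ> \<Psi> \<circ> inv_into W c) x v" using v i(1) by simp
      also have "\<dots> = fder (\<lambda>x. Fs i (chm V d x) / Fs j (chm V d x)) x v"
      proof -
        have "(proj_coord j i \<circ> \<Psi> \<circ> inv_into W c) y = Fs i (chm V d y) / Fs j (chm V d y)" if "y \<in> ?S" for y
          using co j i(1) that by simp
        then show ?thesis
          by (intro fun_cong[OF fder_cong[of ?S x "proj_coord j i \<circ> \<Psi> \<circ> inv_into W c" "\<lambda>x. Fs i (chm V d x) / Fs j (chm V d x)", OF S xS]])
      qed
      also have "\<dots> = (fder (\<lambda>x. Fs i (chm V d x)) x v * Fs j (chm V d x) - Fs i (chm V d x) * fder (\<lambda>x. Fs j (chm V d x)) x v)
          / (Fs j (chm V d x) * Fs j (chm V d x))"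
        by (rule fder_divide[OF C1_subset[OF Fc[OF Vd i(1)] sub] C1_subset[OF Fc[OF Vd j] sub] _ xS]) (auto simp: Q_def)
      finally have "fder (\<lambda>x. Fs i (chm V d x)) x v * Fs j p = Fs i p * fder (\<lambda>x. Fs j (chm V d x)) x v"
        using Fj by (simp add: p_def)
      then show ?thesis using Fj unfolding i(2) l_def by (simp add: field_simps)
    qed
    moreover have "immersed A V d p" using im[OF p(1)] Vd p(2) unfolding immersed_all_def by blast
    ultimately show "v = 0" unfolding immersed_def px by blast
  qed
  ultimately have "proj_immersion ?Y (suspension_atlas f AT \<phi>) N \<Psi>" unfolding proj_immersion_def by blast
  then have "C1_proj_embedding ?Y (suspension_atlas f AT \<phi>) N \<Psi>" using emb unfolding C1_proj_embedding_def by blast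
  moreover have "leafwise_holomorphic (suspension_atlas f AT \<phi>) N \<Psi>"
    unfolding leafwise_holomorphic_def
  proof (intro ballI, clarify)
    fix W c j i s assume Wc: "(W, c) \<in> suspension_atlas f AT \<phi>" and ji: "j \<le> N" "i \<le> N"
    obtain U V d where U: "open U" "U \<subseteq> unit_disc" and Vd: "(V, d) \<in> AT"
      and dom: "\<forall>j\<le>N. c ` (W \<inter> \<Psi> -` proj_dom N j) = Q V d j \<inter> (U \<times> d ` V)"
      and co: "\<forall>j\<le>N. \<forall>i\<le>N. \<forall>x\<in>Q V d j \<inter> (U \<times> d ` V). proj_coord j i (\<Psi> (inv_into W c x)) = Fs i (chm V d x) / Fs j (chm V d x)"
      using box[OF Wc] by (elim exE conjE) blast
    let ?D = "{\<zeta>. (\<zeta>, s) \<in> Q V d j \<inter> (U \<times> d ` V)}"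
    show "(\<lambda>\<zeta>. proj_coord j i (\<Psi> (inv_into W c (\<zeta>, s)))) holomorphic_on {\<zeta>. (\<zeta>, s) \<in> c ` (W \<inter> \<Psi> -` proj_dom N j)}"
    proof (cases "s \<in> d ` V")
      case False
      then have "{\<zeta>. (\<zeta>, s) \<in> c ` (W \<inter> \<Psi> -` proj_dom N j)} = {}" using dom ji(1) by auto
      then show ?thesis by (simp only: holomorphic_on_empty)
    next
      case True
      let ?t = "inv_into V d s"
      have t: "?t \<in> topspace T" using chart_inv(1)[OF Vd True] chart_subset[OF Vd] by blast
      have h: "(\<lambda>\<zeta>. Fs k (\<zeta>, ?t)) holomorphic_on ?D" if "k \<le> N" for k
      proof (rule holomorphic_on_subset)
        show "(\<lambda>\<zeta>. Fs k (\<zeta>, ?t)) holomorphic_on unit_disc" using Ff[OF that] t unfolding form_def regular_def by blast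
        show "?D \<subseteq> unit_disc" using U(2) by auto
      qed
      have "(\<lambda>\<zeta>. Fs i (\<zeta>, ?t) / Fs j (\<zeta>, ?t)) holomorphic_on ?D"
        by (rule holomorphic_on_divide[OF h[OF ji(2)] h[OF ji(1)]]) (auto simp: Q_def)
      then have "(\<lambda>\<zeta>. proj_coord j i (\<Psi> (inv_into W c (\<zeta>, s)))) holomorphic_on ?D"
        by (rule holomorphic_transform) (use co ji in auto)
      then show ?thesis using dom ji(1) by metis
    qed
  qed
  ultimately show ?thesis unfolding projective_lamination_def by blast
qed

theorem theorem6p1:
  fixes X :: "'x::topological_space set" and AX :: "('x, complex) chart set" and gX :: nat
    and f :: "complex \<Rightarrow> 'x"
    and T :: "'t topology" and AT :: "('t, 'e::finite_dim_inner) chart set"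
    and \<phi> :: "(complex \<Rightarrow> complex) \<Rightarrow> ('t \<Rightarrow> 't)"
    and g :: "(complex \<times> 't) set \<Rightarrow> 'x"
  assumes "riemann_surface (top_of_set X) AX" and "compact_space (top_of_set X)"
    and "has_genus (top_of_set X) gX" and "gX \<ge> 2"
    and "disc_universal_covering X AX f"
    and "smooth_manifold T AT" and "compact_space T"
    and "\<phi> \<in> hom (deck_group f) (diff1_group T AT)"
    and "\<And>\<zeta> t. \<zeta> \<in> unit_disc \<Longrightarrow> t \<in> topspace T \<Longrightarrow> g (susp_pi f \<phi> (\<zeta>, t)) = f \<zeta>"
  shows "projective_lamination (suspension f T \<phi>) (suspension_atlas f AT \<phi>)"
  by (rule susp_projective[OF susp_deck_group[OF assms(1,2,5,6,7,8)]])

end
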